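(* Let $n\ge 1$, $T>0$, $t_0\in[0,T]$, and let $(a_{ij}(t))_{i,j=1}^n$, $t\in[0,T]$, be a real symmetric matrix of functions. Set $$a(t,\xi):=\sum_{i,j=1}^n a_{ij}(t)\,\xi_i\xi_j/|\xi|^2,\qquad (t,\xi)\in[0,T]\times(\mathbb R^n\setminus\{0\}).$$ Assume that $a(\cdot,\xi)\in L^1(0,T)$ for all $\xi\in\mathbb R^n\setminus\{0\}$, and that there is a constant $\lambda_0>0$ with $a(t,\xi)\ge\lambda_0$ for all $(t,\xi)\in[0,T]\times(\mathbb R^n\setminus\{0\})$. Let $1\le q\le+\infty$ and $p\ge 0$, and assume that for all $\xi\in\mathbb R^n\setminus\{0\}$: (i) $a(\cdot,\xi)\in\bigcap_{\varepsilon>0}W^{1,1}\big(]0,t_0-\varepsilon[\,\cup\,]t_0+\varepsilon,T[\big)$; (ii) $|t_0-\cdot|^p\,a'(\cdot,\xi)\in L^q(0,T)$, where $'$ denotes differentiation with respect to $t$. Assume that $p+1/q\le 1$. Then the Cauchy problem $$u_{tt}-\sum_{i,j=1}^n a_{ij}(t)u_{x_ix_j}=0\ \text{ in }[0,T]\times\mathbb R^n,\qquad u(0,x)=u_0(x),\quad u_t(0,x)=u_1(x)\ \text{ in }\mathbb R^n,$$ is $C^\infty$-well-posed.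
   Context: Conventions: $1/q=0$ if $q=+\infty$. In (i), the intervals are understood as empty when their left endpoint is not smaller than their right endpoint; $a'(\cdot,\xi)$ is the weak derivative on $]0,T[\,\setminus\{t_0\}$. Well-posedness: the Cauchy problem is $C^\infty$-well-posed if for all $u_0,u_1\in C^\infty(\mathbb R^n)$ there is a unique solution $u\in W^{2,1}([0,T],C^\infty(\mathbb R^n))$, the equation being satisfied for a.e. $t$. Here $u\in W^{2,1}([0,T],C^\infty(\mathbb R^n))$ means that for every compact $K\subset\mathbb R^n$ and every integer $k\ge0$, $u$, restricted to $K$ in $x$, belongs to $W^{2,1}$ on $[0,T]$ with values in $C^k(K)$. *)

theory Defs
  imports "HOL-Analysis.Analysis"
begin

text \<open>Partial derivatives are taken along the standard basis, so that the same definitions serve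
  for functions on \<^typ>\<open>real\<close> and on \<^typ>\<open>real ^ 'n\<close>. A multi-index of order \<open>m\<close> is encoded as a list of
  \<open>m\<close> basis vectors.\<close>

definition partial :: "'a::euclidean_space \<Rightarrow> ('a \<Rightarrow> 'b::real_normed_vector) \<Rightarrow> 'a \<Rightarrow> 'b" where
  "partial b f = (\<lambda>x. frechet_derivative f (at x) b)"

definition partials :: "'a::euclidean_space list \<Rightarrow> ('a \<Rightarrow> 'b::real_normed_vector) \<Rightarrow> 'a \<Rightarrow> 'b" where
  "partials bs f = foldr partial bs f"

definition multi_indices :: "nat \<Rightarrow> 'a::euclidean_space list set" where
  "multi_indices k = {bs \<in> lists Basis. length bs \<le> k}"

text \<open>The differentiability clause excludes the unspecified values of \<^const>\<open>frechet_derivative\<close>.\<close>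

definition Ck :: "nat \<Rightarrow> ('a::euclidean_space \<Rightarrow> 'b::real_normed_vector) \<Rightarrow> bool" where
  "Ck k f \<longleftrightarrow>
    (\<forall>bs \<in> multi_indices k. continuous_on UNIV (partials bs f) \<and>
       (length bs < k \<longrightarrow> (\<forall>x. partials bs f differentiable (at x))))"

definition smooth :: "('a::euclidean_space \<Rightarrow> 'b::real_normed_vector) \<Rightarrow> bool" where
  "smooth f \<longleftrightarrow> (\<forall>k. Ck k f)"

text \<open>The norm of \<open>C\<^sup>k(K)\<close>, as an extended nonnegative number (hence \<open>0\<close> for empty \<open>K\<close>).\<close>

definition Ck_norm :: "nat \<Rightarrow> 'a::euclidean_space set \<Rightarrow> ('a \<Rightarrow> 'b::real_normed_vector) \<Rightarrow> ennreal" where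
  "Ck_norm k K f = (SUP bs\<in>multi_indices k. SUP x\<in>K. ennreal (norm (partials bs f x)))"

definition in_Lq :: "ereal \<Rightarrow> real set \<Rightarrow> (real \<Rightarrow> real) \<Rightarrow> bool" where
  "in_Lq q S f \<longleftrightarrow> f \<in> borel_measurable (lebesgue_on S) \<and>
    (if q = \<infinity> then \<exists>C. AE t in lebesgue_on S. \<bar>f t\<bar> \<le> C
     else integrable (lebesgue_on S) (\<lambda>t. \<bar>f t\<bar> powr real_of_ereal q))"

definition locally_integrable_on :: "(real \<Rightarrow> 'b::euclidean_space) \<Rightarrow> real set \<Rightarrow> bool" where
  "locally_integrable_on f U \<longleftrightarrow> (\<forall>K. compact K \<and> K \<subseteq> U \<longrightarrow> f absolutely_integrable_on K)"

definition test_function :: "real set \<Rightarrow> (real \<Rightarrow> real) \<Rightarrow> bool" where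
  "test_function U \<phi> \<longleftrightarrow> smooth \<phi> \<and> (\<exists>K. compact K \<and> K \<subseteq> U \<and> (\<forall>t. t \<notin> K \<longrightarrow> \<phi> t = 0))"

definition has_weak_derivative_on ::
  "(real \<Rightarrow> 'b::euclidean_space) \<Rightarrow> (real \<Rightarrow> 'b) \<Rightarrow> real set \<Rightarrow> bool" where
  "has_weak_derivative_on f g U \<longleftrightarrow>
    locally_integrable_on f U \<and> locally_integrable_on g U \<and>
    (\<forall>\<phi>. test_function U \<phi> \<longrightarrow>
       (LINT t:U|lebesgue. deriv \<phi> t *\<^sub>R f t) = - (LINT t:U|lebesgue. \<phi> t *\<^sub>R g t))"

definition in_W11 :: "real set \<Rightarrow> (real \<Rightarrow> real) \<Rightarrow> bool" where
  "in_W11 U f \<longleftrightarrow> f absolutely_integrable_on U \<and>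
    (\<exists>g. g absolutely_integrable_on U \<and> has_weak_derivative_on f g U)"

text \<open>\<open>C\<^sup>k(K)\<close> does not form a type, so the Bochner space \<open>L\<^sup>1(S; C\<^sup>k(K))\<close> is written out: strong
  measurability, i.e. almost everywhere approximation by simple functions with values in \<open>C\<^sup>k\<close>,
  and integrability of the norm (which is then Lebesgue measurable).\<close>

definition strongly_measurable_Ck ::
  "nat \<Rightarrow> 'a::euclidean_space set \<Rightarrow> real set \<Rightarrow> (real \<Rightarrow> 'a \<Rightarrow> 'b::real_normed_vector) \<Rightarrow> bool" where
  "strongly_measurable_Ck k K S v \<longleftrightarrow>
    (\<exists>s :: nat \<Rightarrow> real \<Rightarrow> 'a \<Rightarrow> 'b.
       (\<forall>i. simple_function (lebesgue_on S) (s i) \<and> (\<forall>t\<in>S. Ck k (s i t))) \<and>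
       (AE t in lebesgue_on S. (\<lambda>i. Ck_norm k K (\<lambda>x. s i t x - v t x)) \<longlonglongrightarrow> 0))"

definition in_L1_Ck ::
  "nat \<Rightarrow> 'a::euclidean_space set \<Rightarrow> real set \<Rightarrow> (real \<Rightarrow> 'a \<Rightarrow> 'b::real_normed_vector) \<Rightarrow> bool" where
  "in_L1_Ck k K S v \<longleftrightarrow> (\<forall>t\<in>S. Ck k (v t)) \<and> strongly_measurable_Ck k K S v \<and>
    (\<integral>\<^sup>+ t. Ck_norm k K (v t) \<partial>lebesgue_on S) < \<infinity>"

text \<open>The weak derivative of a \<open>C\<^sup>k(K)\<close>-valued function. The defining identity between Bochner
  integrals in \<open>C\<^sup>k(K)\<close> is an equality of functions on \<open>K\<close> together with their derivatives up
  to order \<open>k\<close>; since \<open>f \<mapsto> \<partial>\<^sup>\<alpha>f(x)\<close> is continuous on \<open>C\<^sup>k(K)\<close>, it passes under the integral.\<close>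

definition has_weak_derivative_Ck ::
  "nat \<Rightarrow> 'a::euclidean_space set \<Rightarrow> real set \<Rightarrow>
   (real \<Rightarrow> 'a \<Rightarrow> 'b::euclidean_space) \<Rightarrow> (real \<Rightarrow> 'a \<Rightarrow> 'b) \<Rightarrow> bool" where
  "has_weak_derivative_Ck k K U u v \<longleftrightarrow>
    (\<forall>bs \<in> multi_indices k. \<forall>x\<in>K.
       has_weak_derivative_on (\<lambda>t. partials bs (u t) x) (\<lambda>t. partials bs (v t) x) U)"

definition continuous_on_Ck ::
  "nat \<Rightarrow> 'a::euclidean_space set \<Rightarrow> real set \<Rightarrow> (real \<Rightarrow> 'a \<Rightarrow> 'b::real_normed_vector) \<Rightarrow> bool" where
  "continuous_on_Ck k K S v \<longleftrightarrow>
    (\<forall>t\<in>S. ((\<lambda>s. Ck_norm k K (\<lambda>x. v s x - v t x)) \<longlongrightarrow> 0) (at t within S))"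

text \<open>\<open>u \<in> W\<^sup>2\<^sup>,\<^sup>1([0,T], C\<^sup>k(K))\<close> with \<open>u\<^sub>t = v\<close> and \<open>u\<^sub>t\<^sub>t = w\<close>. For \<open>u\<close> and \<open>u\<^sub>t\<close> the
  continuous representatives are taken, so that their values at \<open>t = 0\<close> make sense; \<open>w\<close> is
  determined up to a null set of times.\<close>

definition W21_Ck ::
  "nat \<Rightarrow> 'a::euclidean_space set \<Rightarrow> real \<Rightarrow>
   (real \<Rightarrow> 'a \<Rightarrow> 'b::euclidean_space) \<Rightarrow> (real \<Rightarrow> 'a \<Rightarrow> 'b) \<Rightarrow> (real \<Rightarrow> 'a \<Rightarrow> 'b) \<Rightarrow> bool" where
  "W21_Ck k K T u v w \<longleftrightarrow>
    in_L1_Ck k K {0<..<T} u \<and> in_L1_Ck k K {0<..<T} v \<and> in_L1_Ck k K {0<..<T} w \<and>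
    has_weak_derivative_Ck k K {0<..<T} u v \<and> has_weak_derivative_Ck k K {0<..<T} v w \<and>
    continuous_on_Ck k K {0..T} u \<and> continuous_on_Ck k K {0..T} v"

definition W21_smooth ::
  "real \<Rightarrow> (real \<Rightarrow> 'a::euclidean_space \<Rightarrow> 'b::euclidean_space) \<Rightarrow>
   (real \<Rightarrow> 'a \<Rightarrow> 'b) \<Rightarrow> (real \<Rightarrow> 'a \<Rightarrow> 'b) \<Rightarrow> bool" where
  "W21_smooth T u v w \<longleftrightarrow>
    (\<forall>t\<in>{0..T}. smooth (u t) \<and> smooth (v t) \<and> smooth (w t)) \<and>
    (\<forall>k K. compact K \<longrightarrow> W21_Ck k K T u v w)"

definition symbol :: "(real \<Rightarrow> real ^ 'n ^ 'n) \<Rightarrow> real \<Rightarrow> real ^ 'n \<Rightarrow> real" where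
  "symbol A t \<xi> = (\<Sum>i\<in>UNIV. \<Sum>j\<in>UNIV. A t $ i $ j * (\<xi> $ i) * (\<xi> $ j) / (norm \<xi>)\<^sup>2)"

definition is_solution ::
  "real \<Rightarrow> (real \<Rightarrow> real ^ 'n ^ 'n) \<Rightarrow> (real ^ 'n \<Rightarrow> complex) \<Rightarrow> (real ^ 'n \<Rightarrow> complex) \<Rightarrow>
   (real \<Rightarrow> real ^ 'n \<Rightarrow> complex) \<Rightarrow> bool" where
  "is_solution T A u0 u1 u \<longleftrightarrow>
    (\<exists>ut utt. W21_smooth T u ut utt \<and>
       (AE t in lebesgue_on {0..T}. \<forall>x.
          utt t x - (\<Sum>i\<in>UNIV. \<Sum>j\<in>UNIV.
             (A t $ i $ j) *\<^sub>R partial (axis j 1) (partial (axis i 1) (u t)) x) = 0) \<and>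
       (\<forall>x. u 0 x = u0 x) \<and> (\<forall>x. ut 0 x = u1 x))"

text \<open>Solutions are functions on \<open>[0,T] \<times> \<real>\<^sup>n\<close>, so uniqueness disregards other times.\<close>

definition Cinfinity_well_posed :: "real \<Rightarrow> (real \<Rightarrow> real ^ 'n ^ 'n) \<Rightarrow> bool" where
  "Cinfinity_well_posed T A \<longleftrightarrow>
    (\<forall>u0 u1. smooth u0 \<and> smooth u1 \<longrightarrow>
       (\<exists>u. is_solution T A u0 u1 u) \<and>
       (\<forall>u v. is_solution T A u0 u1 u \<and> is_solution T A u0 u1 v \<longrightarrow>
          (\<forall>t\<in>{0..T}. \<forall>x. u t x = v t x)))"

end

theory Submission imports Defs begin

text \<open>The condition \<open>p + 1/q \<le> 1\<close> bounds the variation of the coefficients by that of \<open>C log \<bar>t - t0\<bar>\<close> plus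
  that of a continuous function. Hence the energy of a mode \<open>y'' = - a(t, \<xi>) \<bar>\<xi>\<bar>\<^sup>2 y\<close> grows at most by a power of
  \<open>\<bar>\<xi>\<bar>\<close>: for \<open>\<bar>t - t0\<bar> \<ge> 1/\<bar>\<xi>\<bar>\<close> Gronwall's inequality gives a factor \<open>exp (C log \<bar>\<xi>\<bar>)\<close>, and for
  \<open>\<bar>t - t0\<bar> \<le> 1/\<bar>\<xi>\<bar>\<close> the integral of \<open>a\<close> is at most \<open>C log \<bar>\<xi>\<bar> / \<bar>\<xi>\<bar>\<close>. Smooth data are rapidly convergent sums of
  plane waves on every ball, which gives solutions with the right data on balls. They fit together by
  finite speed of propagation, the speed being integrable. That and uniqueness come from an energy in
  a cone. Beyond \<open>t0\<close> the energy estimate, started at \<open>s\<close>, loses a factor \<open>(s - t0)\<^sup>-\<^sup>N\<close>; a solution with vanishing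
  data at \<open>t0\<close> vanishes there to infinite order, which compensates for this as \<open>s\<close> tends to \<open>t0\<close>. Since the
  coefficients are not differentiable in \<open>t\<close>, energies are estimated by differences.\<close>

text \<open>Weak derivatives matter only for choosing the representative \<open>b\<close> of the
  coefficients and for translating between two notions of solution. All estimates concern
  \<open>classical_solution\<close>: every spatial derivative is continuous up to and across
  \<open>t0\<close>, and the equation holds at each \<open>t \<noteq> t0\<close>. The cut at
  distance \<open>1/n\<close>, with \<open>n = 1 + norm \<xi>\<close>, balances two energies. The
  one with the true coefficient costs a factor with logarithm of order
  \<open>ln (1/\<epsilon>)\<close> outside the zone of width \<open>\<epsilon>\<close>; the one with
  the constant \<open>n^2\<close> costs about \<open>n \<epsilon> (1 + ln (1/\<epsilon>))\<close>
  inside. For \<open>\<epsilon> = 1/n\<close> both are of order \<open>ln n\<close>. Uniqueness has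
  to be proved in physical space, since a solution may grow arbitrarily in \<open>x\<close>, and
  there is no frequency to cut at. Before \<open>t0\<close> this does no harm: zero energy stays
  zero on every closed interval that ends before \<open>t0\<close>, and continuity reaches
  \<open>t0\<close> itself. Beyond \<open>t0\<close> the constant of the energy estimate is already
  infinite at the start, whence the detour through infinite order of vanishing.\<close>

lemma partials_Nil [simp]: "partials [] f = f"
  by (simp add: partials_def)

lemma partials_Cons: "partials (b # bs) f = partial b (partials bs f)"
  by (simp add: partials_def)

lemma partials_append: "partials (as @ bs) f = partials as (partials bs f)"
  by (simp add: partials_def)

lemma has_derivative_partial: "(f has_derivative f') (at x) ==> partial b f x = f' b"
  unfolding partial_def using frechet_derivative_at by metis

lemma differentiable_has_derivative_partials:
  assumes "f differentiable (at x)"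
  shows "(f has_derivative (\<lambda>v. \<Sum>e\<in>Basis. (v \<bullet> e) *\<^sub>R partial e f x)) (at x)"
proof -
  obtain D where D: "(f has_derivative D) (at x)"
    using assms by (auto simp: differentiable_def)
  then have lin: "linear D"
    using has_derivative_linear by blast
  have "D v = (\<Sum>e\<in>Basis. (v \<bullet> e) *\<^sub>R partial e f x)" for v
  proof -
    have "D v = D (\<Sum>e\<in>Basis. (v \<bullet> e) *\<^sub>R e)"
      by (simp add: euclidean_representation)
    also have "\<dots> = (\<Sum>e\<in>Basis. (v \<bullet> e) *\<^sub>R D e)"
      by (simp add: linear_sum[OF lin] linear_scale[OF lin] o_def)
    also have "\<dots> = (\<Sum>e\<in>Basis. (v \<bullet> e) *\<^sub>R partial e f x)"
      using has_derivative_partial[OF D] by simp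
    finally show ?thesis .
  qed
  then have "D = (\<lambda>v. \<Sum>e\<in>Basis. (v \<bullet> e) *\<^sub>R partial e f x)" ..
  with D show ?thesis by simp
qed

lemma has_derivative_cong_open:
  assumes "open S" "x \<in> S" "\<And>y. y \<in> S ==> f y = g y"
  shows "(f has_derivative D) (at x) \<longleftrightarrow> (g has_derivative D) (at x)"
  using assms has_derivative_transform_within_open[of f D x UNIV S g]
    has_derivative_transform_within_open[of g D x UNIV S f] by auto

lemma partials_cong_open:
  assumes "open S" "\<And>y. y \<in> S ==> f y = g y" "x \<in> S"
  shows "partials bs f x = partials bs g x"
  using assms(3)
proof (induction bs arbitrary: x)
  case (Cons b bs)
  \<comment> \<open>The equivalence for every \<open>D\<close> makes the choice inside
    \<open>frechet_derivative\<close> the same for both functions, so the step also covers points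
    where neither is differentiable.\<close>
  have "(partials bs f has_derivative D) (at x) \<longleftrightarrow> (partials bs g has_derivative D) (at x)" for D
    by (rule has_derivative_cong_open[OF assms(1) Cons.prems]) (use Cons.IH in auto)
  then show ?case
    by (simp add: partials_Cons partial_def frechet_derivative_def)
qed (use assms in auto)

text \<open>Once all orders are present, differentiability at each order supplies the continuity
  clauses of \<open>Ck\<close>, and the bookkeeping of orders disappears.\<close>

lemma smooth_altdef: "smooth f \<longleftrightarrow> (\<forall>bs\<in>lists Basis. \<forall>x. partials bs f differentiable (at x))"
proof
  assume sm: "smooth f"
  show "\<forall>bs\<in>lists Basis. \<forall>x. partials bs f differentiable (at x)"
  proof (intro ballI allI)
    fix bs :: "'a list" and x assume "bs \<in> lists Basis"
    then have "bs \<in> multi_indices (Suc (length bs))" by (auto simp: multi_indices_def)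
    then show "partials bs f differentiable (at x)"
      using sm unfolding smooth_def Ck_def by blast
  qed
next
  assume d: "\<forall>bs\<in>lists Basis. \<forall>x. partials bs f differentiable (at x)"
  then have "continuous_on UNIV (partials bs f)" if "bs \<in> lists Basis" for bs
    using that differentiable_imp_continuous_within by (blast intro: continuous_at_imp_continuous_on)
  with d show "smooth f"
    by (auto simp: smooth_def Ck_def multi_indices_def)
qed

text \<open>\<open>partials\<close> adds derivatives at the outside, at the head of the list.
  Splitting off the last entry instead peels off the innermost derivative, which is the form needed
  for closure properties.\<close>

lemma smooth_iff: "smooth f \<longleftrightarrow> (\<forall>x. f differentiable (at x)) \<and> (\<forall>b\<in>Basis. smooth (partial b f))"
proof
  assume sm: "smooth f"
  have "partials bs (partial b f) differentiable (at x)" if "bs \<in> lists Basis" "b \<in> Basis" for bs b x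
    using sm[unfolded smooth_altdef, rule_format, of "bs @ [b]" x] that
    by (simp add: partials_append partials_Cons)
  moreover have "f differentiable (at x)" for x
    using sm[unfolded smooth_altdef, rule_format, of "[]" x] by simp
  ultimately show "(\<forall>x. f differentiable (at x)) \<and> (\<forall>b\<in>Basis. smooth (partial b f))"
    by (auto simp: smooth_altdef)
next
  assume a: "(\<forall>x. f differentiable (at x)) \<and> (\<forall>b\<in>Basis. smooth (partial b f))"
  show "smooth f"
    unfolding smooth_altdef
  proof (intro ballI allI)
    fix bs :: "'a list" and x assume "bs \<in> lists Basis"
    then show "partials bs f differentiable (at x)"
      using a by (cases bs rule: rev_cases) (auto simp: partials_append partials_Cons smooth_altdef)
  qed
qed

lemma smooth_differentiable: "smooth f ==> f differentiable (at x)"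
  by (simp add: smooth_iff[of f])

lemma smooth_continuous_on: "smooth f ==> continuous_on S f"
  by (meson continuous_at_imp_continuous_on differentiable_imp_continuous_within smooth_differentiable)

lemma smooth_partial: "smooth f ==> b \<in> Basis ==> smooth (partial b f)"
  using smooth_iff by blast

lemma smooth_partials: "smooth f ==> bs \<in> lists Basis ==> smooth (partials bs f)"
  by (induction bs) (auto simp: partials_Cons smooth_partial)

text \<open>Differentiating a product or a composite leaves the class of such functions but yields a
  finite sum of its members. Closing under sums here keeps the classes used for coinduction
  simple.\<close>

inductive sum_closure :: "(('a => 'b::real_vector) => bool) => ('a => 'b) => bool"
  for S where
  base: "S f ==> sum_closure S f"
| add: "sum_closure S f ==> sum_closure S g ==> sum_closure S (\<lambda>x. f x + g x)"

lemma sum_closure_sum: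
  assumes "finite I" "I \<noteq> {}" "\<And>i. i \<in> I ==> S (f i)"
  shows "sum_closure S (\<lambda>x. \<Sum>i\<in>I. f i x)"
  using assms
proof (induction rule: finite_ne_induct)
  case (singleton i)
  then show ?case using sum_closure.base[of S "f i"] by simp
next
  case (insert i I)
  then show ?case using sum_closure.add[OF sum_closure.base[of S "f i"]] by simp
qed

lemma partial_add:
  assumes "f differentiable (at x)" "g differentiable (at x)"
  shows "partial b (\<lambda>x. f x + g x) x = partial b f x + partial b g x"
proof -
  obtain F G where "(f has_derivative F) (at x)" "(g has_derivative G) (at x)"
    using assms by (auto simp: differentiable_def)
  then show ?thesis
    using has_derivative_partial has_derivative_add by metis
qed

text \<open>Coinduction up to sums: by linearity the sum closure of \<open>S\<close> is again stable
  under partial derivatives, so it contains every iterated partial of \<open>f\<close>, and all its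
  members are differentiable.\<close>

lemma smooth_coinduct:
  assumes "S f"
    and step: "\<And>f. S f ==> (\<forall>x. f differentiable (at x)) \<and> (\<forall>b\<in>Basis. sum_closure S (partial b f))"
  shows "smooth f"
proof -
  have cl: "(\<forall>x. f differentiable (at x)) \<and> (\<forall>b\<in>Basis. sum_closure S (partial b f))"
    if "sum_closure S f" for f
    using that
  proof induction
    case (add f g)
    have "partial b (\<lambda>x. f x + g x) = (\<lambda>x. partial b f x + partial b g x)" for b
      using add.IH by (auto intro!: partial_add)
    then show ?case using add.IH by (auto intro!: sum_closure.add)
  qed (rule step)
  have "sum_closure S (partials bs f)" if "bs \<in> lists Basis" for bs
    using that by (induction bs) (auto simp: partials_Cons cl sum_closure.base assms(1))
  then show ?thesis using cl by (simp add: smooth_altdef)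
qed

lemma smooth_has_real_derivative:
  fixes f g :: "real => real"
  assumes "\<And>x. (f has_real_derivative g x) (at x)" "smooth g"
  shows "smooth f"
proof -
  have d: "(f has_derivative (\<lambda>h. g x * h)) (at x)" for x
    using assms(1) by (simp add: has_field_derivative_def)
  have "partial b f = g" if "b \<in> Basis" for b
    using has_derivative_partial[OF d, of b] that by auto
  then show ?thesis
    using d assms(2) by (auto simp: smooth_iff[of f] differentiable_def)
qed

lemma smooth_real_derivative:
  fixes f :: "real => real"
  assumes "smooth f"
  shows "(f has_real_derivative deriv f x) (at x)" "smooth (deriv f)"
proof -
  have d: "(f has_real_derivative deriv f x) (at x)" for x
    using smooth_differentiable[OF assms] by (simp add: DERIV_deriv_iff_real_differentiable)
  then show "(f has_real_derivative deriv f x) (at x)" .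
  have "partial 1 f = deriv f"
    using has_derivative_partial[OF d[unfolded has_field_derivative_def], of 1] by auto
  then show "smooth (deriv f)"
    using smooth_partial[OF assms, of 1] by simp
qed

lemma partial_const: "partial b (\<lambda>x. c) = (\<lambda>x. 0)"
  by (simp add: partial_def)

lemma smooth_const: "smooth (\<lambda>x. c)"
  by (rule smooth_coinduct[where S = "\<lambda>f. \<exists>c. f = (\<lambda>x. c)"])
    (auto simp: partial_const intro!: sum_closure.base)

lemma smooth_bilinear:
  assumes "bounded_bilinear pr" and "smooth f" "smooth g"
  shows "smooth (\<lambda>x. pr (f x) (g x))"
proof (rule smooth_coinduct[where S = "\<lambda>h. \<exists>f g. smooth f \<and> smooth g \<and> h = (\<lambda>x. pr (f x) (g x))"])
  interpret bounded_bilinear pr by fact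
  fix h assume "\<exists>f g. smooth f \<and> smooth g \<and> h = (\<lambda>x. pr (f x) (g x))"
  then obtain f g where fg: "smooth f" "smooth g" and h: "h = (\<lambda>x. pr (f x) (g x))" by blast
  let ?S = "\<lambda>h. \<exists>f g. smooth f \<and> smooth g \<and> h = (\<lambda>x. pr (f x) (g x))"
  have d: "(h has_derivative (\<lambda>v. pr (f x) (frechet_derivative g (at x) v) + pr (frechet_derivative f (at x) v) (g x))) (at x)" for x
    unfolding h by (rule FDERIV) (use fg smooth_differentiable frechet_derivative_works in \<open>metis+\<close>)
  have "sum_closure ?S (partial b h)" if "b \<in> Basis" for b
  proof -
    have "partial b h = (\<lambda>x. pr (f x) (partial b g x) + pr (partial b f x) (g x))"
      using has_derivative_partial[OF d] by (auto simp: partial_def)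
    moreover have "?S (\<lambda>x. pr (f x) (partial b g x))" "?S (\<lambda>x. pr (partial b f x) (g x))"
      using fg smooth_partial[OF _ that] by blast+
    ultimately show ?thesis by (simp add: sum_closure.intros)
  qed
  then show "(\<forall>x. h differentiable (at x)) \<and> (\<forall>b\<in>Basis. sum_closure ?S (partial b h))"
    using d by (auto simp: differentiable_def)
qed (use assms in blast)

lemmas smooth_scaleR = smooth_bilinear[OF bounded_bilinear_scaleR]
lemmas smooth_mult = smooth_bilinear[OF bounded_bilinear_mult]

lemma smooth_add:
  assumes "smooth f" "smooth g"
  shows "smooth (\<lambda>x. f x + g x)"
proof (rule smooth_coinduct[where S = "\<lambda>h. \<exists>f g. smooth f \<and> smooth g \<and> h = (\<lambda>x. f x + g x)"])
  fix h assume "\<exists>f g. smooth f \<and> smooth g \<and> h = (\<lambda>x. f x + g x)"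
  then obtain f g where fg: "smooth f" "smooth g" and h: "h = (\<lambda>x. f x + g x)" by blast
  let ?S = "\<lambda>h. \<exists>f g. smooth f \<and> smooth g \<and> h = (\<lambda>x. f x + g x)"
  have "partial b h = (\<lambda>x. partial b f x + partial b g x)" for b
    unfolding h using fg smooth_differentiable by (auto intro!: partial_add)
  moreover have "h differentiable (at x)" for x
    unfolding h using fg smooth_differentiable by (auto intro!: differentiable_add)
  ultimately show "(\<forall>x. h differentiable (at x)) \<and> (\<forall>b\<in>Basis. sum_closure ?S (partial b h))"
    using fg by (auto intro!: sum_closure.base smooth_partial)
qed (use assms in blast)

lemma smooth_sum: "(\<And>i. i \<in> I ==> smooth (f i)) ==> smooth (\<lambda>x. \<Sum>i\<in>I. f i x)"
  by (induction I rule: infinite_finite_induct) (auto simp: smooth_const intro!: smooth_add)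

lemma smooth_prod:
  fixes f :: "'i => 'a::euclidean_space => real"
  shows "(\<And>i. i \<in> I ==> smooth (f i)) ==> smooth (\<lambda>x. \<Prod>i\<in>I. f i x)"
  by (induction I rule: infinite_finite_induct) (auto simp: smooth_const intro!: smooth_mult)

lemma smooth_cscaleR: "smooth f ==> smooth (\<lambda>x. c *\<^sub>R f x)"
  using smooth_scaleR[OF smooth_const] .

lemma smooth_diff: "smooth f ==> smooth g ==> smooth (\<lambda>x. f x - g x)"
  using smooth_add[of f "\<lambda>x. (-1) *\<^sub>R g x"] smooth_cscaleR[of g "-1"] by simp

text \<open>The chain rule expresses a partial derivative of the composite by the partials of
  \<open>f\<close> with coefficients \<open>L b \<bullet> e\<close>; this forces the scalar factor
  in the coinduction class.\<close>

lemma smooth_affine: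
  fixes f :: "'b::euclidean_space => 'c::real_normed_vector" and L :: "'a::euclidean_space => 'b"
  assumes "bounded_linear L" "smooth f"
  shows "smooth (\<lambda>x. f (L x + d))"
proof (rule smooth_coinduct[where S = "\<lambda>h. \<exists>(f::'b => 'c) c. smooth f \<and> h = (\<lambda>x. c *\<^sub>R f (L x + d))"])
  let ?S = "\<lambda>h. \<exists>(f::'b => 'c) c. smooth f \<and> h = (\<lambda>x. c *\<^sub>R f (L x + d))"
  fix h assume "?S h"
  then obtain f :: "'b => 'c" and c where f: "smooth f" and h: "h = (\<lambda>x. c *\<^sub>R f (L x + d))" by blast
  have d: "(h has_derivative (\<lambda>v. c *\<^sub>R (\<Sum>e\<in>Basis. (L v \<bullet> e) *\<^sub>R partial e f (L x + d)))) (at x)" for x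
  proof -
    have "((\<lambda>x. L x + d) has_derivative L) (at x)"
      using assms(1) by (auto intro!: derivative_eq_intros bounded_linear_imp_has_derivative)
    from has_derivative_compose[OF this differentiable_has_derivative_partials[OF smooth_differentiable[OF f]]]
    show ?thesis unfolding h by (rule has_derivative_scaleR_right)
  qed
  have "sum_closure ?S (partial b h)" if "b \<in> Basis" for b
  proof -
    have "partial b h = (\<lambda>x. \<Sum>e\<in>Basis. (c * (L b \<bullet> e)) *\<^sub>R partial e f (L x + d))"
      using has_derivative_partial[OF d] by (auto simp: scaleR_sum_right)
    moreover have "sum_closure ?S (\<lambda>x. \<Sum>e\<in>Basis. (c * (L b \<bullet> e)) *\<^sub>R partial e f (L x + d))"
      by (rule sum_closure_sum) (use f smooth_partial in auto)
    ultimately show ?thesis by simp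
  qed
  then show "(\<forall>x. h differentiable (at x)) \<and> (\<forall>b\<in>Basis. sum_closure ?S (partial b h))"
    using d by (auto simp: differentiable_def)
qed (use assms(2) scaleR_one in metis)

lemma partials_add:
  assumes "smooth f" "smooth g" "bs \<in> lists Basis"
  shows "partials bs (\<lambda>x. f x + g x) x = partials bs f x + partials bs g x"
  using assms(3)
proof (induction bs arbitrary: x)
  case (Cons b bs)
  then have "partials bs (\<lambda>x. f x + g x) = (\<lambda>x. partials bs f x + partials bs g x)" by auto
  moreover have "partials bs f differentiable (at x)" "partials bs g differentiable (at x)" for x
    using Cons.hyps assms(1,2) by (auto intro!: smooth_differentiable smooth_partials)
  ultimately show ?case
    by (simp add: partials_Cons partial_add)
qed simp

lemma partial_bounded_linear:
  assumes "bounded_linear L" "f differentiable (at x)"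
  shows "partial b (\<lambda>x. L (f x)) x = L (partial b f x)"
proof -
  obtain F where "(f has_derivative F) (at x)"
    using assms by (auto simp: differentiable_def)
  then show ?thesis
    using has_derivative_partial bounded_linear.has_derivative[OF assms(1)] by metis
qed

lemma partials_bounded_linear:
  assumes "bounded_linear L" "smooth f" "bs \<in> lists Basis"
  shows "partials bs (\<lambda>x. L (f x)) x = L (partials bs f x)"
  using assms(3)
proof (induction bs arbitrary: x)
  case (Cons b bs)
  then have "partials bs (\<lambda>x. L (f x)) = (\<lambda>x. L (partials bs f x))" by auto
  moreover have "partials bs f differentiable (at x)" for x
    using Cons.hyps assms(2) by (auto intro!: smooth_differentiable smooth_partials)
  ultimately show ?case
    by (simp add: partials_Cons partial_bounded_linear[OF assms(1)])
qed simp

lemma partials_cscaleR: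
  "smooth f ==> bs \<in> lists Basis ==> partials bs (\<lambda>x. c *\<^sub>R f x) x = c *\<^sub>R partials bs f x"
  by (rule partials_bounded_linear[OF bounded_linear_scaleR_right])

lemma partials_diff:
  assumes "smooth f" "smooth g" "bs \<in> lists Basis"
  shows "partials bs (\<lambda>x. f x - g x) x = partials bs f x - partials bs g x"
  using partials_add[OF assms(1) smooth_cscaleR[OF assms(2), of "-1"] assms(3)]
    partials_cscaleR[OF assms(2,3), of "-1"] by simp

lemma partials_const_zero: "partials bs (\<lambda>x. 0) = (\<lambda>x. 0)"
  by (induction bs) (auto simp: partials_Cons partial_const)

lemma partials_sum:
  assumes "\<And>i. i \<in> I ==> smooth (f i)" "bs \<in> lists Basis"
  shows "partials bs (\<lambda>x. \<Sum>i\<in>I. f i x) x = (\<Sum>i\<in>I. partials bs (f i) x)"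
  using assms(1)
proof (induction I rule: infinite_finite_induct)
  case (insert i I)
  then have "smooth (\<lambda>x. \<Sum>i\<in>I. f i x)" by (intro smooth_sum) auto
  with insert show ?case by (simp add: partials_add assms(2))
qed (auto simp: partials_const_zero)

subsection \<open>Smooth step functions\<close>

text \<open>The function \<open>exp (- 1/x)\<close>, extended by 0 to the left, together with the
  factors \<open>c / x^k\<close> that differentiation produces. With both parameters free the family
  is stable under derivatives up to sums.\<close>

definition flat_exp :: "nat => real => real => real" where
  "flat_exp k c x = (if x > 0 then c * (inverse x) ^ k * exp (- inverse x) else 0)"

lemma power_exp_bound:
  fixes y :: real
  assumes "y \<ge> 0"
  shows "y ^ n * exp (- y) \<le> fact n"
proof -
  have "y ^ n / fact n \<le> exp y"
    using exp_ge_add_one_self summable_exp_generic[of y]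
      sum_le_suminf[OF summable_exp_generic[of y], of "{n}"] assms
    by (simp add: exp_def divide_inverse mult.commute)
  then show ?thesis
    by (simp add: exp_minus field_simps)
qed

lemma flat_exp_derivative:
  "(flat_exp k c has_real_derivative (flat_exp (k + 2) c x + flat_exp (k + 1) (- c * k) x)) (at x)"
proof (cases x "0::real" rule: linorder_cases)
  case greater
  have e: "real k * inverse x ^ (k - Suc 0) = real k * inverse x ^ k * x"
    using greater by (cases k) auto
  have "((\<lambda>x. c * (inverse x) ^ k * exp (- inverse x)) has_real_derivative
     (c * ((real k * inverse x ^ (k - Suc 0)) * (- (inverse x * inverse x))) * exp (- inverse x)
       + c * inverse x ^ k * (exp (- inverse x) * (inverse x * inverse x)))) (at x)"
    using greater by (auto intro!: derivative_eq_intros)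
  also have "(c * ((real k * inverse x ^ (k - Suc 0)) * (- (inverse x * inverse x))) * exp (- inverse x)
       + c * inverse x ^ k * (exp (- inverse x) * (inverse x * inverse x)))
     = flat_exp (k + 2) c x + flat_exp (k + 1) (- c * k) x"
    unfolding e using greater by (simp add: flat_exp_def field_simps)
  finally show ?thesis
    by (rule has_field_derivative_transform_within_open[where S = "{0<..}"])
      (use greater in \<open>auto simp: flat_exp_def\<close>)
next
  case less
  have "((\<lambda>x. 0) has_real_derivative (flat_exp (k + 2) c x + flat_exp (k + 1) (- c * k) x)) (at x)"
    using less by (simp add: flat_exp_def)
  then show ?thesis
    by (rule has_field_derivative_transform_within_open[where S = "{..<0}"])
      (use less in \<open>auto simp: flat_exp_def\<close>)
next
  case equal
  \<comment> \<open>Bounding \<open>y^(k+2) exp (-y)\<close> for \<open>y = 1/h\<close>, two powers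
    more than occur, shows that the function is \<open>O(h^2)\<close> at 0; so its derivative there
    is 0.\<close>
  have bd: "\<bar>flat_exp k c h\<bar> \<le> \<bar>c\<bar> * fact (k + 2) * \<bar>h\<bar> * \<bar>h\<bar>" for h
  proof (cases "h > 0")
    case True
    have "inverse h ^ (k + 2) * exp (- inverse h) \<le> fact (k + 2)"
      by (rule power_exp_bound) (use True in simp)
    then have "\<bar>c\<bar> * (inverse h ^ (k + 2) * exp (- inverse h)) * (h * h) \<le> \<bar>c\<bar> * fact (k + 2) * (h * h)"
      by (intro mult_mono) (use True in auto)
    moreover have "\<bar>c\<bar> * (inverse h ^ (k + 2) * exp (- inverse h)) * (h * h) = \<bar>flat_exp k c h\<bar>"
      using True by (simp add: flat_exp_def abs_mult power_add field_simps power2_eq_square)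
    ultimately show ?thesis using True by (simp add: mult.assoc)
  qed (simp add: flat_exp_def mult.assoc)
  have "((\<lambda>h. flat_exp k c h / h) \<longlongrightarrow> 0) (at 0)"
  proof (rule Lim_null_comparison[where g = "\<lambda>h. \<bar>c\<bar> * fact (k + 2) * \<bar>h\<bar>"])
    have "norm (flat_exp k c h / h) \<le> \<bar>c\<bar> * fact (k + 2) * \<bar>h\<bar>" if "h \<noteq> 0" for h
      using bd[of h] that by (simp add: field_simps)
    then show "\<forall>\<^sub>F h in at 0. norm (flat_exp k c h / h) \<le> \<bar>c\<bar> * fact (k + 2) * \<bar>h\<bar>"
      by (auto simp: eventually_at_filter)
    show "((\<lambda>h. \<bar>c\<bar> * fact (k + 2) * \<bar>h\<bar>) \<longlongrightarrow> 0) (at 0)"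
      by (auto intro!: tendsto_eq_intros)
  qed
  then show ?thesis
    using equal by (simp add: DERIV_def flat_exp_def)
qed

lemma smooth_flat_exp: "smooth (flat_exp k c)"
proof (rule smooth_coinduct[where S = "\<lambda>f. \<exists>k c. f = flat_exp k c"])
  fix f assume "\<exists>k c. f = flat_exp k c"
  then obtain k c where f: "f = flat_exp k c" by blast
  have d: "(f has_derivative (\<lambda>h. (flat_exp (k + 2) c x + flat_exp (k + 1) (- c * k) x) * h)) (at x)" for x
    using flat_exp_derivative f by (simp add: has_field_derivative_def)
  have "partial b f = (\<lambda>x. flat_exp (k + 2) c x + flat_exp (k + 1) (- c * k) x)" if "b \<in> Basis" for b
    using has_derivative_partial[OF d, of b] that by auto
  note pb = this
  have "sum_closure (\<lambda>f. \<exists>k c. f = flat_exp k c) (partial b f)" if "b \<in> Basis" for b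
    unfolding pb[OF that] by (blast intro: sum_closure.add sum_closure.base)
  then show "(\<forall>x. f differentiable at x) \<and> (\<forall>b\<in>Basis. sum_closure (\<lambda>f. \<exists>k c. f = flat_exp k c) (partial b f))"
    using d by (auto simp: differentiable_def)
qed auto

text \<open>The base point \<open>-1\<close> lies where \<open>r\<close> vanishes, so this primitive
  is 0 on the whole left half-line. For \<open>x < -1\<close> the interval is empty and its integral
  0, in agreement.\<close>

lemma primitive_vanishing_left:
  fixes r :: "real => real"
  assumes "continuous_on UNIV r" "\<And>x. x \<le> 0 ==> r x = 0"
  shows "((\<lambda>x. integral {-1..x} r) has_real_derivative r x) (at x)" "x \<le> 0 ==> integral {-1..x} r = 0"
proof -
  show z: "integral {-1..x} r = 0" if "x \<le> 0" for x
    by (rule integral_unique, rule has_integral_is_0) (use assms that in auto)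
  show "((\<lambda>x. integral {-1..x} r) has_real_derivative r x) (at x)"
  proof (cases "x < 0")
    case True
    have "((\<lambda>x. 0) has_real_derivative r x) (at x)" using True assms by simp
    then show ?thesis
      by (rule has_field_derivative_transform_within_open[where S = "{..<0}"]) (use True z in auto)
  next
    case False
    have "((\<lambda>u. integral {-1..u} r) has_real_derivative r x) (at x within {-1..x+1})"
      by (rule integral_has_real_derivative) (use False continuous_on_subset[OF assms(1)] in auto)
    then have "((\<lambda>u. integral {-1..u} r) has_real_derivative r x) (at x within {-1<..<x+1})"
      by (rule DERIV_subset) auto
    moreover have "at x within {-1<..<x+1} = at x"
      by (rule at_within_open) (use False in auto)
    ultimately show ?thesis by simp
  qed
qed

text \<open>\<open>H\<close> is the normalised primitive of a bump supported in the unit interval,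
  and \<open>J\<close> is the primitive of \<open>H\<close>. Rescaled, \<open>H\<close> approximates
  the Heaviside function and \<open>J\<close> the positive part, up to an additive constant to the
  right of 1; \<open>J\<close> rounds the corners of piecewise linear test functions.\<close>

lemma smooth_step_exists:
  obtains H J :: "real => real" where
    "smooth H" "smooth J" "\<And>x. (J has_real_derivative H x) (at x)"
    "\<And>x. 0 \<le> H x" "\<And>x. H x \<le> 1" "\<And>x. x \<le> 0 ==> H x = 0" "\<And>x. x \<ge> 1 ==> H x = 1"
    "\<And>x. x \<le> 0 ==> J x = 0"
proof -
  define r where "r x = flat_exp 0 1 x * flat_exp 0 1 (1 - x)" for x
  have smr: "smooth r"
    unfolding r_def
    using smooth_mult[OF smooth_flat_exp[of 0 1] smooth_affine[where L = "\<lambda>x. - x" and d = 1, OF _ smooth_flat_exp[of 0 1]]]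
    by (simp add: bounded_linear_minus bounded_linear_ident)
  have r0: "r x = 0" if "x \<le> 0" for x using that by (simp add: r_def flat_exp_def)
  have r1: "r x = 0" if "x \<ge> 1" for x using that by (simp add: r_def flat_exp_def)
  have rp: "r x \<ge> 0" for x by (simp add: r_def flat_exp_def)
  define P where "P x = integral {-1..x} r" for x
  have P: "(P has_real_derivative r x) (at x)" for x
    unfolding P_def using primitive_vanishing_left(1)[OF smooth_continuous_on[OF smr] r0] by blast
  have P0: "P x = 0" if "x \<le> 0" for x
    unfolding P_def using primitive_vanishing_left(2)[OF smooth_continuous_on[OF smr] r0] that by blast
  have Pmono: "P x \<le> P y" if "x \<le> y" for x y
    by (rule DERIV_nonneg_imp_nondecreasing[OF that]) (use P rp in blast)
  have P1: "P x = P 1" if "x \<ge> 1" for x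
  proof (cases "x = 1")
    case False
    have "\<exists>z>1. z < x \<and> P x - P 1 = (x - 1) * r z"
      by (rule MVT2) (use False that P in auto)
    then show ?thesis using r1 by auto
  qed auto
  have "P 1 > 0"
  proof -
    have "\<exists>z>0. z < 1 \<and> P 1 - P 0 = (1 - 0) * r z"
      by (rule MVT2) (use P in auto)
    then obtain z where "z > 0" "z < 1" "P 1 = r z" using P0 by auto
    then show ?thesis by (simp add: r_def flat_exp_def)
  qed
  define H where "H x = P x / P 1" for x
  have smP: "smooth P" using P smr by (rule smooth_has_real_derivative)
  have smH: "smooth H"
    using smooth_cscaleR[OF smP, of "inverse (P 1)"] by (simp add: H_def[abs_def] divide_inverse mult.commute)
  have H0: "H x = 0" if "x \<le> 0" for x using P0[OF that] by (simp add: H_def)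
  define J where "J x = integral {-1..x} H" for x
  have J: "(J has_real_derivative H x) (at x)" for x
    unfolding J_def using primitive_vanishing_left(1)[OF smooth_continuous_on[OF smH] H0] by blast
  have J0: "J x = 0" if "x \<le> 0" for x
    unfolding J_def using primitive_vanishing_left(2)[OF smooth_continuous_on[OF smH] H0] that by blast
  have H1: "H x = 1" if "x \<ge> 1" for x using P1[OF that] \<open>P 1 > 0\<close> by (simp add: H_def)
  have Hp: "0 \<le> H x" for x
    using Pmono[of 0 x] P0[of 0] P0[of x] \<open>P 1 > 0\<close> by (cases "x \<ge> 0") (auto simp: H_def)
  have Hl: "H x \<le> 1" for x
    using Pmono[of x 1] P1[of x] \<open>P 1 > 0\<close> by (cases "x \<ge> 1") (auto simp: H_def)
  show thesis
    by (rule that[OF smH smooth_has_real_derivative[OF J smH] J Hp Hl H0 H1 J0])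
qed

subsection \<open>Weak derivatives on the line\<close>

lemma absolutely_integrable_continuous_scaleR:
  fixes f :: "real => 'b::euclidean_space" and c :: "real => real"
  assumes "continuous_on {a..b} c" "f absolutely_integrable_on {a..b}"
  shows "(\<lambda>r. c r *\<^sub>R f r) absolutely_integrable_on {a..b}"
proof (rule absolutely_integrable_bounded_measurable_product[where h = "(*\<^sub>R)"])
  show "bilinear ((*\<^sub>R) :: real => 'b => 'b)"
    by (simp add: bilinear_conv_bounded_bilinear bounded_bilinear_scaleR)
  show "bounded (c ` {a..b})"
    using assms(1) compact_continuous_image compact_imp_bounded by blast
  show "c \<in> borel_measurable (lebesgue_on {a..b})"
    by (rule continuous_imp_measurable_on_sets_lebesgue) (use assms(1) in auto)
qed (use assms in auto)

lemma sigma_finite_lebesgue: "sigma_finite_measure (lebesgue :: real measure)"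
proof
  show "\<exists>A. countable A \<and> A \<subseteq> sets lebesgue \<and> \<Union> A = space (lebesgue :: real measure) \<and> (\<forall>a\<in>A. emeasure lebesgue a \<noteq> \<infinity>)"
  proof (intro exI[of _ "range (\<lambda>n. {- real n..real n})"] conjI)
    have "\<exists>n. - real n \<le> x \<and> x \<le> real n" for x
    proof -
      obtain n where "\<bar>x\<bar> \<le> real n" using real_arch_simple by blast
      then show ?thesis by (intro exI[of _ n]) linarith
    qed
    then show "\<Union> (range (\<lambda>n. {- real n..real n})) = space (lebesgue :: real measure)" by auto
  qed auto
qed

text \<open>Half-lines generate the Borel sets and are stable under intersection, so the vanishing
  of the indefinite integral spreads to all Borel sets, and from there to Lebesgue sets, which
  differ from Borel sets by null sets. An integrable function with zero integral over every
  measurable set is 0 almost everywhere.\<close>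

lemma integral_initial_segments_zero_imp_AE:
  fixes k :: "real => 'b::euclidean_space"
  assumes k: "k absolutely_integrable_on {a..b}"
    and z: "\<And>t. t \<in> {a..b} ==> integral {a..t} k = 0"
  shows "AE t in lebesgue. t \<in> {a..b} --> k t = 0"
proof -
  define kk where "kk x = indicat_real {a..b} x *\<^sub>R k x" for x
  have int: "integrable lebesgue kk"
    using k by (simp add: set_integrable_def kk_def[abs_def])
  have intA: "set_integrable lebesgue A kk" if "A \<in> sets lebesgue" for A
    unfolding set_integrable_def by (rule integrable_mult_indicator[OF that int])
  have basic: "(LINT x:{..t}|lebesgue. kk x) = 0" for t
  proof (cases "t < a")
    case True
    then have "(\<lambda>x. indicat_real {..t} x *\<^sub>R kk x) = (\<lambda>x. 0)"
      by (auto simp: kk_def indicator_def)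
    then show ?thesis by (simp add: set_lebesgue_integral_def)
  next
    case False
    show ?thesis
    proof (cases "a \<le> b")
      case True
      have "(\<lambda>x. indicat_real {..t} x *\<^sub>R kk x) = (\<lambda>x. indicat_real {a..min b t} x *\<^sub>R k x)"
        by (auto simp: kk_def indicator_def)
      then have "(LINT x:{..t}|lebesgue. kk x) = (LINT x:{a..min b t}|lebesgue. k x)"
        by (simp add: set_lebesgue_integral_def)
      also have "\<dots> = integral {a..min b t} k"
        by (intro set_lebesgue_integral_eq_integral(2) absolutely_integrable_on_subinterval[OF k]) auto
      also have "\<dots> = 0" using z True False by simp
      finally show ?thesis .
    next
      case F: False
      then show ?thesis by (simp add: set_lebesgue_integral_def kk_def)
    qed
  qed
  have tot: "(LINT x|lebesgue. kk x) = 0"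
  proof -
    have "(\<lambda>x. indicat_real {..b} x *\<^sub>R kk x) = kk" by (auto simp: kk_def indicator_def)
    then show ?thesis using basic[of b] by (simp add: set_lebesgue_integral_def)
  qed
  have bor: "(LINT x:A|lebesgue. kk x) = 0" if "A \<in> sets borel" for A :: "real set"
  proof -
    have sg1: "A \<in> sigma_sets UNIV (range (\<lambda>a. {..a::real}))"
      using that by (simp add: borel_eq_atMost)
    have sg2: "Int_stable (range (\<lambda>a. {..a::real}))" "range (\<lambda>a. {..a::real}) \<subseteq> Pow UNIV"
      by (auto simp: Int_stable_def)
    show ?thesis
      using sg2 sg1
    proof (induction A rule: sigma_sets_induct_disjoint)
      case (basic A) then show ?case using \<open>\<And>t. (LINT x:{..t}|lebesgue. kk x) = 0\<close> by auto
    next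
      case empty show ?case by (simp add: set_lebesgue_integral_def)
    next
      case (compl A)
      then have "A \<in> sets (borel :: real measure)" by (simp add: borel_eq_atMost)
      then have A: "A \<in> sets lebesgue" by (simp add: sets_completionI_sets)
      have "(\<lambda>x. indicat_real (UNIV - A) x *\<^sub>R kk x) = (\<lambda>x. kk x - indicat_real A x *\<^sub>R kk x)"
        by (auto simp: indicator_def)
      then show ?case
        using compl tot int intA[OF A] by (simp add: set_lebesgue_integral_def set_integrable_def)
    next
      case (union A)
      have A: "A i \<in> sets lebesgue" for i
      proof -
        have "A i \<in> sets (borel :: real measure)" using union by (auto simp: borel_eq_atMost)
        then show ?thesis by (simp add: sets_completionI_sets)
      qed
      have "(LINT x:(\<Union>i. A i)|lebesgue. kk x) = (\<Sum>i. (LINT x:(A i)|lebesgue. kk x))"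
        by (rule lebesgue_integral_countable_add) (use A union intA in \<open>auto simp: disjoint_family_on_def\<close>)
      then show ?case using union by simp
    qed
  qed
  have "(LINT x:A|lebesgue. kk x) = 0" if Al: "A \<in> sets lebesgue" for A :: "real set"
  proof -
    obtain S N N' where S: "A = S \<union> N" "N \<subseteq> N'" "N' \<in> null_sets lborel" "S \<in> sets lborel"
      by (rule sets_completionE[OF Al])
    have "AE x in lebesgue. x \<notin> N'"
      using S(3) AE_completion AE_not_in by blast
    then have ae: "AE x in lebesgue. indicat_real A x *\<^sub>R kk x = indicat_real S x *\<^sub>R kk x"
      by eventually_elim (use S in \<open>auto simp: indicator_def\<close>)
    have "(LINT x|lebesgue. indicat_real A x *\<^sub>R kk x) = (LINT x|lebesgue. indicat_real S x *\<^sub>R kk x)"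
    proof (rule integral_cong_AE)
      show "(\<lambda>x. indicat_real A x *\<^sub>R kk x) \<in> borel_measurable lebesgue"
        using intA[OF that] by (simp add: set_integrable_def)
      show "(\<lambda>x. indicat_real S x *\<^sub>R kk x) \<in> borel_measurable lebesgue"
        using intA[of S] S(4) by (simp add: set_integrable_def)
    qed (rule ae)
    then show ?thesis using bor[of S] S(4) by (simp add: set_lebesgue_integral_def)
  qed
  from sigma_finite_measure.density_zero[OF sigma_finite_lebesgue int this]
  have "AE x in lebesgue. kk x = 0" by simp
  then show ?thesis
    by eventually_elim (auto simp: kk_def)
qed

text \<open>For \<open>s + h \<le> t\<close> it climbs from 0 to 1 on \<open>{s..s+h}\<close> and
  descends on \<open>{t..t+h}\<close>. Its derivative is the difference of the normalised indicators
  of these two intervals, so testing with it produces averages.\<close>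

definition trapezoid :: "real => real => real => real => real" where
  "trapezoid s t h r = (max 0 (r - s) - max 0 (r - s - h) - max 0 (r - t) + max 0 (r - t - h)) / h"

lemma continuous_on_trapezoid: "continuous_on S (trapezoid s t h)"
  unfolding trapezoid_def[abs_def] divide_inverse by (intro continuous_intros)

lemma set_lebesgue_integral_support:
  fixes X :: "real => 'b::euclidean_space"
  assumes "K \<subseteq> U" "\<And>r. r \<notin> K ==> X r = 0" "X absolutely_integrable_on K"
  shows "(LINT r:U|lebesgue. X r) = integral K X"
proof -
  have "(\<lambda>x. indicat_real U x *\<^sub>R X x) = (\<lambda>x. indicat_real K x *\<^sub>R X x)"
  proof
    fix x show "indicat_real U x *\<^sub>R X x = indicat_real K x *\<^sub>R X x"
      using assms(1,2) by (cases "x \<in> K") auto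
  qed
  then have "(LINT r:U|lebesgue. X r) = (LINT r:K|lebesgue. X r)"
    by (simp add: set_lebesgue_integral_def)
  also have "\<dots> = integral K X"
    by (rule set_lebesgue_integral_eq_integral(2)[OF assms(3)])
  finally show ?thesis .
qed

lemma integral_greaterThanAtMost:
  fixes f :: "real => 'b::banach"
  assumes "c \<le> d"
  shows "integral {c<..d} f = integral {c..d} f"
proof (rule Henstock_Kurzweil_Integration.integral_subset_negligible)
  have "{c..d} - {c<..d} \<subseteq> {c}" by auto
  then show "negligible ({c..d} - {c<..d})"
    using negligible_subset negligible_sing by blast
qed auto

text \<open>Tested against smooth approximations of a trapezoid, the weak derivative compares the averages
  of \<open>f\<close> over two intervals of equal length.\<close>

lemma weak_derivative_trapezoid:
  fixes f g :: "real => 'b::euclidean_space"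
  assumes W: "has_weak_derivative_on f g U"
    and st: "s \<le> t" and h: "h > 0" and \<eta>: "\<eta> > 0" and KU: "{s..t+h+\<eta>} \<subseteq> U"
  shows "(1 / h) *\<^sub>R (integral {s..s+h} f - integral {t..t+h} f)
    = - integral {s..t+h} (\<lambda>r. trapezoid s t h r *\<^sub>R g r)"
proof -
  define K where "K = {s..t+h+\<eta>}"
  define L where "L = t + h + \<eta> - s"
  obtain H J :: "real => real" where
    smH: "smooth H" and smJ: "smooth J" and JH: "\<And>x. (J has_real_derivative H x) (at x)"
    and Hp: "\<And>x. 0 \<le> H x" and Hl: "\<And>x. H x \<le> 1" and H0: "\<And>x. x \<le> 0 ==> H x = 0"
    and H1: "\<And>x. x \<ge> 1 ==> H x = 1" and J0: "\<And>x. x \<le> 0 ==> J x = 0"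
    using smooth_step_exists by metis
  have J1: "J x = J 1 + (x - 1)" if "x \<ge> 1" for x
  proof (cases "x = 1")
    case False
    have "\<exists>z>1. z < x \<and> J x - J 1 = (x - 1) * H z"
      by (rule MVT2) (use False that JH in auto)
    then show ?thesis using H1 by auto
  qed simp
  have Jp: "0 \<le> J x" for x
  proof (cases "x \<le> 0")
    case False
    then have "J 0 \<le> J x" by (intro DERIV_nonneg_imp_nondecreasing[of 0 x J]) (use JH Hp in \<open>auto\<close>)
    then show ?thesis using J0[of 0] by simp
  qed (use J0 in simp)
  have Jl: "J x \<le> max 0 x" for x
  proof (cases "x \<le> 0")
    case False
    then have "\<exists>z>0. z < x \<and> J x - J 0 = (x - 0) * H z"
      by (intro MVT2) (use JH in auto)
    then obtain z where "J x = x * H z" using J0[of 0] by auto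
    then show ?thesis using False mult_left_le[of "H z" x] Hl by auto
  qed (use J0 in simp)
  have Jg: "max 0 x - 1 \<le> J x" for x
    using Jp[of x] J1[of x] Jp[of 1] by (cases "x \<ge> 1") auto
  \<comment> \<open>Each corner is rounded on the scale \<open>\<delta> n\<close>, and only to its
    right because \<open>J\<close> vanishes on the left half-line. Hence the extra room
    \<open>\<eta>\<close> beyond \<open>t + h\<close>.\<close>
  define \<delta> where "\<delta> n = \<eta> / real (Suc n)" for n
  have \<delta>p: "\<delta> n > 0" for n using \<eta> by (simp add: \<delta>_def)
  have \<delta>l: "\<delta> n \<le> \<eta>" for n using \<eta> by (simp add: \<delta>_def field_simps)
  have \<delta>0: "\<delta> \<longlonglongrightarrow> 0"
    unfolding \<delta>_def by (intro lim_const_over_n[THEN LIMSEQ_Suc])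
  define B where "B n c r = \<delta> n * J ((r - c) / \<delta> n)" for n c r
  have Bd: "(B n c has_real_derivative H ((r - c) / \<delta> n)) (at r)" for n c r
    unfolding B_def[abs_def] using \<delta>p[of n]
    by (auto intro!: derivative_eq_intros DERIV_chain2[OF JH])
  have smB: "smooth (B n c)" for n c
  proof -
    have "bounded_linear (\<lambda>x::real. x / \<delta> n)" by (simp add: bounded_linear_divide)
    from smooth_cscaleR[OF smooth_affine[OF this smJ, of "- c / \<delta> n"], of "\<delta> n"]
    show ?thesis by (simp add: B_def[abs_def] diff_divide_distrib)
  qed
  have Blim: "(\<lambda>n. B n c r) \<longlonglongrightarrow> max 0 (r - c)" for c r
  proof (rule LIM_zero_cancel, rule Lim_null_comparison[where g = \<delta>])
    have "norm (B n c r - max 0 (r - c)) \<le> \<delta> n" for n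
    proof -
      have m: "max 0 (r - c) = \<delta> n * max 0 ((r - c) / \<delta> n)"
        using \<delta>p[of n] by (auto simp: max_def field_simps zero_le_divide_iff)
      show ?thesis
        unfolding m B_def using Jl[of "(r - c) / \<delta> n"] Jg[of "(r - c) / \<delta> n"] \<delta>p[of n]
          mult_left_mono[of "max 0 ((r - c) / \<delta> n) - J ((r - c) / \<delta> n)" 1 "\<delta> n"]
        by (auto simp: abs_le_iff algebra_simps mult_left_mono)
    qed
    then show "\<forall>\<^sub>F n in sequentially. norm (B n c r - max 0 (r - c)) \<le> \<delta> n"
      by (auto intro!: always_eventually)
  qed (rule \<delta>0)
  have Bb: "0 \<le> B n c r \<and> B n c r \<le> max 0 (r - c)" for n c r
  proof -
    have "\<delta> n * J ((r - c) / \<delta> n) \<le> \<delta> n * max 0 ((r - c) / \<delta> n)"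
      using Jl \<delta>p[of n] by (intro mult_left_mono) auto
    also have "\<dots> = max 0 (r - c)"
      using \<delta>p[of n] by (auto simp: max_def field_simps zero_le_divide_iff)
    finally show ?thesis using Jp \<delta>p[of n] by (simp add: B_def)
  qed
  have B0: "B n c r = 0" if "r \<le> c" for n c r
    using that \<delta>p[of n] by (simp add: B_def J0 divide_nonpos_pos)
  \<comment> \<open>The offset \<open>\<delta> n * (J 1 - 1)\<close> is the same at all four corners
    and cancels in the alternating sum \<open>\<phi>\<close>, so that \<open>\<phi>\<close> really
    vanishes beyond the last corner.\<close>
  have B1: "B n c r = \<delta> n * (J 1 - 1) + (r - c)" if "r \<ge> c + \<eta>" for n c r
  proof -
    have "(r - c) / \<delta> n \<ge> 1" using that \<delta>p[of n] \<delta>l[of n] by (simp add: field_simps)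
    then show ?thesis unfolding B_def J1[OF \<open>1 \<le> (r - c) / \<delta> n\<close>] using \<delta>p[of n] by (simp add: field_simps)
  qed
  have Hlim: "(\<lambda>n. H ((r - c) / \<delta> n)) \<longlonglongrightarrow> (if r > c then 1 else 0)" for c r
  proof (cases "r > c")
    case True
    have "\<forall>\<^sub>F n in sequentially. \<delta> n < r - c"
      using order_tendstoD(2)[OF \<delta>0, of "r - c"] True by simp
    then have "\<forall>\<^sub>F n in sequentially. H ((r - c) / \<delta> n) = 1"
      by eventually_elim (use \<delta>p H1 in \<open>auto simp: field_simps\<close>)
    then show ?thesis using True by (simp add: tendsto_eventually)
  next
    case False
    then have "H ((r - c) / \<delta> n) = 0" for n using \<delta>p[of n] by (simp add: H0 divide_nonpos_pos)
    then show ?thesis using False by simp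
  qed
  define \<phi> where "\<phi> n r = (1 / h) * (B n s r - B n (s + h) r - B n t r + B n (t + h) r)" for n r
  define \<psi> where "\<psi> n r = (1 / h) * (H ((r - s) / \<delta> n) - H ((r - (s + h)) / \<delta> n)
    - H ((r - t) / \<delta> n) + H ((r - (t + h)) / \<delta> n))" for n r
  have \<phi>d: "(\<phi> n has_real_derivative \<psi> n r) (at r)" for n r
    unfolding \<phi>_def[abs_def] \<psi>_def by (rule DERIV_cmult) (intro DERIV_add DERIV_diff Bd)
  have sm\<phi>: "smooth (\<phi> n)" for n
    unfolding \<phi>_def[abs_def]
    using smooth_cscaleR[OF smooth_add[OF smooth_diff[OF smooth_diff[OF smB[of n s] smB[of n "s+h"]] smB[of n t]] smB[of n "t+h"]], of "1 / h"]
    by simp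
  have \<phi>0: "\<phi> n r = 0" "\<psi> n r = 0" if "r \<notin> K" for n r
  proof -
    consider "r < s" | "r > t + h + \<eta>" using \<open>r \<notin> K\<close> by (force simp: K_def)
    then have "\<phi> n r = 0 \<and> \<psi> n r = 0"
    proof cases
      case 1
      then show ?thesis using st h \<delta>p[of n] by (simp add: \<phi>_def \<psi>_def B0 H0 divide_nonpos_pos)
    next
      case 2
      have "(r - c) / \<delta> n \<ge> 1" if "r \<ge> c + \<eta>" for c using that \<delta>p[of n] \<delta>l[of n] by (simp add: field_simps)
      then show ?thesis using 2 st h by (simp add: \<phi>_def \<psi>_def B1 H1)
    qed
    then show "\<phi> n r = 0" "\<psi> n r = 0" by auto
  qed
  have fK: "f absolutely_integrable_on K" and gK: "g absolutely_integrable_on K"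
    using W KU by (auto simp: has_weak_derivative_on_def locally_integrable_on_def K_def)
  have tf: "test_function U (\<phi> n)" for n
    unfolding test_function_def using sm\<phi> \<phi>0(1) KU by (auto simp: K_def intro!: exI[of _ K])
  have der: "deriv (\<phi> n) = \<psi> n" for n using DERIV_imp_deriv[OF \<phi>d] by auto
  have ia: "(\<lambda>r. \<psi> n r *\<^sub>R f r) absolutely_integrable_on K" for n
    unfolding K_def
  proof (rule absolutely_integrable_continuous_scaleR[OF _ fK[unfolded K_def]])
    show "continuous_on {s..t + h + \<eta>} (\<psi> n)"
      unfolding \<psi>_def[abs_def] using \<delta>p[of n] h
      by (auto intro!: continuous_intros continuous_on_compose2[OF smooth_continuous_on[OF smH, of UNIV]])
  qed
  have ib: "(\<lambda>r. \<phi> n r *\<^sub>R g r) absolutely_integrable_on K" for n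
    unfolding K_def
    by (rule absolutely_integrable_continuous_scaleR[OF smooth_continuous_on[OF sm\<phi>] gK[unfolded K_def]])
  have weak: "integral K (\<lambda>r. \<psi> n r *\<^sub>R f r) = - integral K (\<lambda>r. \<phi> n r *\<^sub>R g r)" for n
  proof -
    have "(LINT r:U|lebesgue. deriv (\<phi> n) r *\<^sub>R f r) = - (LINT r:U|lebesgue. \<phi> n r *\<^sub>R g r)"
      using W tf[of n] unfolding has_weak_derivative_on_def by blast
    moreover have "(LINT r:U|lebesgue. deriv (\<phi> n) r *\<^sub>R f r) = integral K (\<lambda>r. \<psi> n r *\<^sub>R f r)"
      unfolding der by (rule set_lebesgue_integral_support) (use KU ia \<phi>0 in \<open>auto simp: K_def\<close>)
    moreover have "(LINT r:U|lebesgue. \<phi> n r *\<^sub>R g r) = integral K (\<lambda>r. \<phi> n r *\<^sub>R g r)"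
      by (rule set_lebesgue_integral_support) (use KU ib \<phi>0 in \<open>auto simp: K_def\<close>)
    ultimately show ?thesis by simp
  qed
  have i2: "(\<lambda>r. c * norm (f r)) integrable_on K" "(\<lambda>r. c * norm (g r)) integrable_on K" for c
    using fK gK by (auto simp: absolutely_integrable_on_def intro!: integrable_on_mult_right)
  \<comment> \<open>The pointwise limit of \<open>\<psi> n\<close>. At a corner the value
    \<open>H 0 = 0\<close> decides, whence the half-open intervals below.\<close>
  define ch where "ch r = (1 / h) * ((if r > s then 1 else 0) - (if r > s + h then 1 else 0)
    - (if r > t then 1 else 0) + (if r > t + h then 1 else (0::real)))" for r
  have l1: "(\<lambda>n. integral K (\<lambda>r. \<psi> n r *\<^sub>R f r)) \<longlonglongrightarrow> integral K (\<lambda>r. ch r *\<^sub>R f r)"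
  proof (rule dominated_convergence(2)[where h = "\<lambda>r. (4 / h) * norm (f r)"])
    fix n r assume "r \<in> K"
    have "\<bar>\<psi> n r\<bar> \<le> (1 / h) * 4"
      unfolding \<psi>_def abs_mult using h
      using Hp[of "(r - s) / \<delta> n"] Hl[of "(r - s) / \<delta> n"] Hp[of "(r - (s + h)) / \<delta> n"] Hl[of "(r - (s + h)) / \<delta> n"]
        Hp[of "(r - t) / \<delta> n"] Hl[of "(r - t) / \<delta> n"] Hp[of "(r - (t + h)) / \<delta> n"] Hl[of "(r - (t + h)) / \<delta> n"]
      by (intro mult_mono) (auto simp: abs_le_iff)
    from mult_right_mono[OF this norm_ge_zero[of "f r"]]
    show "norm (\<psi> n r *\<^sub>R f r) \<le> (4 / h) * norm (f r)" by simp
    show "(\<lambda>n. \<psi> n r *\<^sub>R f r) \<longlonglongrightarrow> ch r *\<^sub>R f r"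
      unfolding \<psi>_def ch_def by (intro tendsto_intros Hlim)
  next
    show "(\<lambda>r. (4 / h) * norm (f r)) integrable_on K" by (rule i2(1))
  qed (use ia in \<open>auto simp: absolutely_integrable_on_def\<close>)
  have l2: "(\<lambda>n. integral K (\<lambda>r. \<phi> n r *\<^sub>R g r)) \<longlonglongrightarrow> integral K (\<lambda>r. trapezoid s t h r *\<^sub>R g r)"
  proof (rule dominated_convergence(2)[where h = "\<lambda>r. ((1 / h) * (4 * L)) * norm (g r)"])
    fix n r assume r: "r \<in> K"
    have "\<bar>\<phi> n r\<bar> \<le> (1 / h) * (4 * L)"
      unfolding \<phi>_def abs_mult using h \<eta> st r
      using Bb[of n s r] Bb[of n "s + h" r] Bb[of n t r] Bb[of n "t + h" r]
      by (intro mult_mono) (auto simp: abs_le_iff L_def K_def max_def split: if_splits)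
    from mult_right_mono[OF this norm_ge_zero[of "g r"]]
    show "norm (\<phi> n r *\<^sub>R g r) \<le> ((1 / h) * (4 * L)) * norm (g r)" by simp
    have "(\<lambda>n. \<phi> n r) \<longlonglongrightarrow> trapezoid s t h r"
      unfolding \<phi>_def trapezoid_def
      using tendsto_mult_left[OF tendsto_add[OF tendsto_diff[OF tendsto_diff[OF Blim[of s r] Blim[of "s+h" r]] Blim[of t r]] Blim[of "t+h" r]], of "1/h"]
      by (simp add: diff_diff_eq)
    then show "(\<lambda>n. \<phi> n r *\<^sub>R g r) \<longlonglongrightarrow> trapezoid s t h r *\<^sub>R g r"
      by (intro tendsto_intros)
  next
    show "(\<lambda>r. ((1 / h) * (4 * L)) * norm (g r)) integrable_on K" by (rule i2(2))
  qed (use ib in \<open>auto simp: absolutely_integrable_on_def\<close>)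
  have "(\<lambda>n. integral K (\<lambda>r. \<psi> n r *\<^sub>R f r)) \<longlonglongrightarrow> - integral K (\<lambda>r. trapezoid s t h r *\<^sub>R g r)"
    unfolding weak by (intro tendsto_intros l2)
  with l1 have main: "integral K (\<lambda>r. ch r *\<^sub>R f r) = - integral K (\<lambda>r. trapezoid s t h r *\<^sub>R g r)"
    using LIMSEQ_unique by blast
  have "trapezoid s t h r *\<^sub>R g r = (if r \<in> {s..t+h} then trapezoid s t h r *\<^sub>R g r else 0)" if "r \<in> K" for r
    using that h st by (auto simp: trapezoid_def K_def)
  then have "integral K (\<lambda>r. trapezoid s t h r *\<^sub>R g r)
      = integral K (\<lambda>r. if r \<in> {s..t+h} then trapezoid s t h r *\<^sub>R g r else 0)"
    by (intro integral_cong) auto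
  also have "\<dots> = integral ({s..t+h} \<inter> K) (\<lambda>r. trapezoid s t h r *\<^sub>R g r)"
    by (rule Henstock_Kurzweil_Integration.integral_restrict_Int)
  also have "{s..t+h} \<inter> K = {s..t+h}" using \<eta> by (auto simp: K_def)
  finally have rhs: "integral K (\<lambda>r. trapezoid s t h r *\<^sub>R g r) = integral {s..t+h} (\<lambda>r. trapezoid s t h r *\<^sub>R g r)" .
  have sub: "{s<..s+h} \<inter> K = {s<..s+h}" "{t<..t+h} \<inter> K = {t<..t+h}"
    using st h \<eta> by (auto simp: K_def)
  have if1: "(\<lambda>r. if r \<in> {c<..c+h} then f r else 0) integrable_on K" if "{c..c+h} \<subseteq> K" for c
  proof -
    have "f integrable_on {c..c+h}"
      using absolutely_integrable_on_subinterval[OF fK that] absolutely_integrable_on_def by blast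
    then have "f integrable_on {c<..c+h}"
    proof (rule integrable_spike_set)
      show "negligible {x \<in> {c..c+h} - {c<..c+h}. f x \<noteq> 0}"
        by (rule negligible_subset[OF negligible_sing[of c]]) auto
      show "negligible {x \<in> {c<..c+h} - {c..c+h}. f x \<noteq> 0}"
        by (rule negligible_subset[OF negligible_sing[of c]]) auto
    qed
    moreover have "{c<..c+h} \<inter> K = {c<..c+h}" using that by force
    ultimately show ?thesis using Henstock_Kurzweil_Integration.integrable_restrict_Int[of "{c<..c+h}" f K] by simp
  qed
  have sK: "{s..s+h} \<subseteq> K" "{t..t+h} \<subseteq> K" using st h \<eta> by (auto simp: K_def)
  have "ch r *\<^sub>R f r = (1 / h) *\<^sub>R ((if r \<in> {s<..s+h} then f r else 0) - (if r \<in> {t<..t+h} then f r else 0))" for r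
    using h by (auto simp: ch_def algebra_simps)
  then have "integral K (\<lambda>r. ch r *\<^sub>R f r)
     = (1 / h) *\<^sub>R (integral K (\<lambda>r. if r \<in> {s<..s+h} then f r else 0) - integral K (\<lambda>r. if r \<in> {t<..t+h} then f r else 0))"
    using if1[OF sK(1)] if1[OF sK(2)] by (simp add: integral_cmul[symmetric] Henstock_Kurzweil_Integration.integral_diff)
  also have "\<dots> = (1 / h) *\<^sub>R (integral {s..s+h} f - integral {t..t+h} f)"
    unfolding Henstock_Kurzweil_Integration.integral_restrict_Int sub using h
    by (simp add: integral_greaterThanAtMost)
  finally show ?thesis using main rhs by simp
qed

text \<open>The trapezoid and the indicator of \<open>{s..t}\<close> differ only on the two ramps,
  and pointwise by no more than the sum of the indicators of the ramps.\<close>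

lemma integral_trapezoid_error:
  fixes g :: "real => 'b::euclidean_space"
  assumes st: "s \<le> t" and h: "h > 0" and g: "g absolutely_integrable_on {s..t+h}"
  shows "norm (integral {s..t+h} (\<lambda>r. trapezoid s t h r *\<^sub>R g r) - integral {s..t} g)
    \<le> integral {s..s+h} (\<lambda>r. norm (g r)) + integral {t..t+h} (\<lambda>r. norm (g r))"
proof -
  let ?K = "{s..t+h}"
  have gi: "g integrable_on ?K" and ng: "(\<lambda>r. norm (g r)) integrable_on ?K"
    using g by (auto simp: absolutely_integrable_on_def)
  have tg: "(\<lambda>r. trapezoid s t h r *\<^sub>R g r) integrable_on ?K"
    using absolutely_integrable_continuous_scaleR[OF continuous_on_trapezoid g]
    by (simp add: absolutely_integrable_on_def)
  have sub: "g integrable_on {c..d}" "(\<lambda>r. norm (g r)) integrable_on {c..d}" if "{c..d} \<subseteq> ?K" for c d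
    using integrable_on_subinterval[OF gi that] integrable_on_subinterval[OF ng that] by auto
  have restr: "integral ?K (\<lambda>r. if r \<in> {c..d} then F r else 0) = integral {c..d} F"
    if "{c..d} \<subseteq> ?K" for c d and F :: "real => 'c::banach"
    unfolding Henstock_Kurzweil_Integration.integral_restrict_Int using that by (simp only: Int_absorb2)
  have ri: "(\<lambda>r. if r \<in> {c..d} then F r else 0) integrable_on ?K"
    if "{c..d} \<subseteq> ?K" "F integrable_on {c..d}" for c d and F :: "real => 'c::banach"
    using that by (simp only: Henstock_Kurzweil_Integration.integrable_restrict_Int Int_absorb2)
  have S: "{s..t} \<subseteq> ?K" "{s..s+h} \<subseteq> ?K" "{t..t+h} \<subseteq> ?K" using st h by auto
  have eq: "integral ?K (\<lambda>r. trapezoid s t h r *\<^sub>R g r) - integral {s..t} g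
      = integral ?K (\<lambda>r. trapezoid s t h r *\<^sub>R g r - (if r \<in> {s..t} then g r else 0))"
    by (subst Henstock_Kurzweil_Integration.integral_diff[OF tg ri[OF S(1) sub(1)[OF S(1)]]])
      (simp only: restr[OF S(1)])
  have "norm (integral ?K (\<lambda>r. trapezoid s t h r *\<^sub>R g r - (if r \<in> {s..t} then g r else 0)))
    \<le> integral ?K (\<lambda>r. (if r \<in> {s..s+h} then norm (g r) else 0) + (if r \<in> {t..t+h} then norm (g r) else 0))"
  proof (rule Henstock_Kurzweil_Integration.integral_norm_bound_integral)
    fix r assume "r \<in> ?K"
    then have "\<bar>trapezoid s t h r - (if r \<in> {s..t} then 1 else 0)\<bar>
        \<le> (if r \<in> {s..s+h} then 1 else 0) + (if r \<in> {t..t+h} then 1 else 0)"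
      using h st by (auto simp: trapezoid_def max_def field_simps abs_le_iff)
    from mult_right_mono[OF this norm_ge_zero[of "g r"]]
    show "norm (trapezoid s t h r *\<^sub>R g r - (if r \<in> {s..t} then g r else 0))
       \<le> (if r \<in> {s..s+h} then norm (g r) else 0) + (if r \<in> {t..t+h} then norm (g r) else 0)"
      by (auto simp flip: norm_scaleR simp: scaleR_left_diff_distrib split: if_splits)
  qed (intro Henstock_Kurzweil_Integration.integrable_diff Henstock_Kurzweil_Integration.integrable_add ri sub S tg)+
  also have "\<dots> = integral {s..s+h} (\<lambda>r. norm (g r)) + integral {t..t+h} (\<lambda>r. norm (g r))"
    using ri[OF S(2) sub(2)[OF S(2)]] ri[OF S(3) sub(2)[OF S(3)]]
    by (subst Henstock_Kurzweil_Integration.integral_add) (simp_all only: restr[OF S(2)] restr[OF S(3)])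
  finally show ?thesis unfolding eq .
qed

text \<open>The mass of \<open>norm g\<close> on a ramp of length \<open>h\<close> is small
  uniformly in its position, because the indefinite integral of \<open>norm g\<close> is uniformly
  continuous. The room between \<open>b\<close> and \<open>b'\<close> holds the right ramp and its
  rounding.\<close>

lemma weak_derivative_averages:
  fixes f g :: "real => 'b::euclidean_space"
  assumes W: "has_weak_derivative_on f g U" and U: "{a..b'} \<subseteq> U" and ab: "a \<le> b" "b < b'" and e: "e > 0"
  obtains d where "d > 0" "\<And>s t h. a \<le> s ==> s \<le> t ==> t \<le> b ==> 0 < h ==> h < d ==>
    norm ((1 / h) *\<^sub>R (integral {t..t+h} f - integral {s..s+h} f) - integral {s..t} g) \<le> e"
proof -
  have g: "g absolutely_integrable_on {a..b'}"
    using W U by (auto simp: has_weak_derivative_on_def locally_integrable_on_def)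
  then have ng: "(\<lambda>r. norm (g r)) integrable_on {a..b'}"
    by (simp add: absolutely_integrable_on_def)
  define N where "N x = integral {a..x} (\<lambda>r. norm (g r))" for x
  have "uniformly_continuous_on {a..b'} N"
    unfolding N_def by (intro compact_uniformly_continuous indefinite_integral_continuous_1 ng) auto
  then obtain d where d: "d > 0" "\<And>x y. x \<in> {a..b'} ==> y \<in> {a..b'} ==> dist x y < d ==> dist (N x) (N y) < e / 2"
    unfolding uniformly_continuous_on_def using e by (metis half_gt_zero)
  show thesis
  proof (rule that[of "min d ((b' - b) / 2)"])
    show "0 < min d ((b' - b) / 2)" using d ab by simp
    fix s t h assume st: "a \<le> s" "s \<le> t" "t \<le> b" and h: "0 < h" "h < min d ((b' - b) / 2)"
    have sm: "integral {c..c+h} (\<lambda>r. norm (g r)) \<le> e / 2" if "a \<le> c" "c \<le> b" for c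
    proof -
      have "{a..c+h} \<subseteq> {a..b'}" using that h ab by auto
      then have "integral {a..c} (\<lambda>r. norm (g r)) + integral {c..c+h} (\<lambda>r. norm (g r)) = N (c + h)"
        unfolding N_def using that h
        by (intro Henstock_Kurzweil_Integration.integral_combine integrable_on_subinterval[OF ng]) auto
      moreover have "dist (N (c + h)) (N c) < e / 2"
        using d(2)[of "c + h" c] that h ab by (auto simp: dist_real_def)
      ultimately show ?thesis unfolding N_def dist_real_def by linarith
    qed
    have gs: "g absolutely_integrable_on {s..t+h}"
      by (rule absolutely_integrable_on_subinterval[OF g]) (use st h ab in auto)
    have "(1 / h) *\<^sub>R (integral {s..s+h} f - integral {t..t+h} f) = - integral {s..t+h} (\<lambda>r. trapezoid s t h r *\<^sub>R g r)"
      proof (rule weak_derivative_trapezoid[OF W st(2) h(1), of "(b' - b) / 2"])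
      have "{s..t + h + (b' - b) / 2} \<subseteq> {a..b'}" using st h ab by (auto simp: field_simps)
      then show "{s..t + h + (b' - b) / 2} \<subseteq> U" using U by blast
    qed (use ab in auto)
    then have "(1 / h) *\<^sub>R (integral {t..t+h} f - integral {s..s+h} f) = integral {s..t+h} (\<lambda>r. trapezoid s t h r *\<^sub>R g r)"
      using minus_equation_iff[of "(1 / h) *\<^sub>R (integral {t..t+h} f - integral {s..s+h} f)"]
        scaleR_minus_right[of "1 / h" "integral {t..t+h} f - integral {s..s+h} f"] by simp
    then have "norm ((1 / h) *\<^sub>R (integral {t..t+h} f - integral {s..s+h} f) - integral {s..t} g)
      \<le> integral {s..s+h} (\<lambda>r. norm (g r)) + integral {t..t+h} (\<lambda>r. norm (g r))"
      using integral_trapezoid_error[OF st(2) h(1) gs] by simp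
    also have "\<dots> \<le> e" using sm[of s] sm[of t] st by auto
    finally show "norm ((1 / h) *\<^sub>R (integral {t..t+h} f - integral {s..s+h} f) - integral {s..t} g) \<le> e" .
  qed
qed

lemma integral_near_constant:
  fixes f :: "real => 'b::euclidean_space"
  assumes "continuous_on {c..c+h} f" "h > 0" "\<And>r. r \<in> {c..c+h} ==> norm (f r - f c) \<le> e"
  shows "norm (integral {c..c+h} f - h *\<^sub>R f c) \<le> e * h"
proof -
  have i: "f integrable_on {c..c+h}" using assms(1) by (rule integrable_continuous_real)
  have "integral {c..c+h} f - h *\<^sub>R f c = integral {c..c+h} (\<lambda>r. f r - f c)"
    using i \<open>h > 0\<close> by (subst Henstock_Kurzweil_Integration.integral_diff) auto
  also have "norm \<dots> \<le> integral {c..c+h} (\<lambda>r. e)"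
    by (rule Henstock_Kurzweil_Integration.integral_norm_bound_integral)
      (use i assms(3) in \<open>auto intro!: Henstock_Kurzweil_Integration.integrable_diff\<close>)
  finally show ?thesis using \<open>h > 0\<close> by (simp add: mult.commute)
qed

text \<open>For continuous \<open>f\<close> the averages over \<open>{c..c+h}\<close> tend to
  \<open>f c\<close>, which turns the comparison of averages into the fundamental theorem of
  calculus.\<close>

lemma weak_derivative_continuous:
  fixes f g :: "real => 'b::euclidean_space"
  assumes W: "has_weak_derivative_on f g U" and U: "{s..t'} \<subseteq> U" and st: "s \<le> t" "t < t'"
    and f: "continuous_on {s..t'} f"
  shows "f t - f s = integral {s..t} g"
proof -
  have "norm (f t - f s - integral {s..t} g) \<le> 0 + e" if "e > 0" for e
  proof -
    obtain d where d: "d > 0" "\<And>h. 0 < h ==> h < d ==>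
        norm ((1 / h) *\<^sub>R (integral {t..t+h} f - integral {s..s+h} f) - integral {s..t} g) \<le> e / 3"
      using weak_derivative_averages[OF W U st, of "e / 3"] \<open>e > 0\<close> st by (metis divide_pos_pos order_refl zero_less_numeral)
    have "uniformly_continuous_on {s..t'} f"
      using f by (intro compact_uniformly_continuous) auto
    then obtain d2 where d2: "d2 > 0" "\<And>x y. x \<in> {s..t'} ==> y \<in> {s..t'} ==> dist x y < d2 ==> dist (f x) (f y) < e / 3"
      unfolding uniformly_continuous_on_def using \<open>e > 0\<close> by (metis divide_pos_pos zero_less_numeral)
    define h where "h = min (min d d2) (t' - t) / 2"
    have h: "h > 0" "h < d" "h < d2" "t + h \<le> t'" using d(1) d2(1) st by (auto simp: h_def min_def field_simps)
    have near: "norm ((1 / h) *\<^sub>R integral {c..c+h} f - f c) \<le> e / 3" if "s \<le> c" "c \<le> t" for c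
    proof -
      have "norm (integral {c..c+h} f - h *\<^sub>R f c) \<le> e / 3 * h"
      proof (rule integral_near_constant)
        show "continuous_on {c..c+h} f" by (rule continuous_on_subset[OF f]) (use that h in auto)
        show "norm (f r - f c) \<le> e / 3" if "r \<in> {c..c+h}" for r
          using d2(2)[of r c] that h \<open>s \<le> c\<close> \<open>c \<le> t\<close> by (auto simp: dist_norm)
      qed (rule h)
      moreover have "integral {c..c+h} f - h *\<^sub>R f c = h *\<^sub>R ((1 / h) *\<^sub>R integral {c..c+h} f - f c)"
        using h by (simp add: scaleR_diff_right)
      ultimately have "h * norm ((1 / h) *\<^sub>R integral {c..c+h} f - f c) \<le> h * (e / 3)"
        using h(1) by (simp only: norm_scaleR) (simp add: mult.commute)
      then show ?thesis using h(1) by (rule mult_left_le_imp_le)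
    qed
    have "f t - f s - integral {s..t} g =
        ((1 / h) *\<^sub>R (integral {t..t+h} f - integral {s..s+h} f) - integral {s..t} g)
        - ((1 / h) *\<^sub>R integral {t..t+h} f - f t) + ((1 / h) *\<^sub>R integral {s..s+h} f - f s)"
      by (simp add: algebra_simps)
    also have "norm \<dots> \<le> e / 3 + e / 3 + e / 3"
      by (intro norm_triangle_le[OF add_mono] norm_triangle_le_diff[OF add_mono] near d(2) h) (use st in auto)
    finally show ?thesis by simp
  qed
  then have "norm (f t - f s - integral {s..t} g) \<le> 0" by (rule field_le_epsilon)
  then show ?thesis by simp
qed

text \<open>On a fine equidistant grid all increments of \<open>P\<close> agree up to
  \<open>e h\<close>. Their mean is 0 since \<open>P\<close> vanishes at both ends, so each
  increment is at most \<open>e h\<close> and \<open>P\<close> is at most \<open>e (b - a)\<close>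
  on the grid.\<close>

lemma equal_increments_imp_zero:
  fixes P :: "real => 'b::real_normed_vector"
  assumes ab: "a < b" and cont: "continuous_on {a..b} P" and ends: "P a = 0" "P b = 0"
    and inc: "\<And>e. e > 0 ==> \<exists>d>0. \<forall>s t h. a \<le> s --> s \<le> t --> t + h \<le> b --> 0 < h --> h < d -->
      norm ((P (t + h) - P t) - (P (s + h) - P s)) \<le> e * h"
    and t: "t \<in> {a..b}"
  shows "P t = 0"
proof -
  have "norm (P t) \<le> 0 + e" if "e > 0" for e
  proof -
    define e1 where "e1 = (e / 2) / (b - a)"
    have e1: "e1 > 0" using ab \<open>e > 0\<close> by (simp add: e1_def)
    obtain d where d: "d > 0" "\<And>s t h. a \<le> s ==> s \<le> t ==> t + h \<le> b ==> 0 < h ==> h < d ==>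
        norm ((P (t + h) - P t) - (P (s + h) - P s)) \<le> e1 * h"
      using inc[OF e1] by blast
    have "uniformly_continuous_on {a..b} P"
      using cont by (intro compact_uniformly_continuous) auto
    then obtain d2 where d2: "d2 > 0" "\<And>x y. x \<in> {a..b} ==> y \<in> {a..b} ==> dist x y < d2 ==> dist (P x) (P y) < e / 2"
      unfolding uniformly_continuous_on_def using \<open>e > 0\<close> by (metis half_gt_zero)
    obtain n :: nat where n: "(b - a) / d + (b - a) / d2 < real n" using reals_Archimedean2 by blast
    have q: "0 < (b - a) / d" "0 < (b - a) / d2" using ab d(1) d2(1) by auto
    then have np: "n > 0" using n by (cases "n = 0") auto
    have n1: "(b - a) / d < real n" "(b - a) / d2 < real n" using n q by linarith+
    define h where "h = (b - a) / n"
    have h: "h > 0" "h < d" "h < d2" "n * h = b - a"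
      using n1 np ab d(1) d2(1) by (auto simp: h_def field_simps)
    define x where "x i = a + real i * h" for i
    have xs: "x (Suc i) = x i + h" for i by (simp add: x_def algebra_simps)
    have xb: "x i \<le> b" if "i \<le> n" for i
      using mult_right_mono[of "real i" "real n" h] that h by (simp add: x_def)
    define D where "D i = P (x (Suc i)) - P (x i)" for i
    have xa: "a \<le> x i" for i using h by (simp add: x_def)
    have mono: "x i \<le> x j" if "i \<le> j" for i j
      using mult_right_mono[of "real i" "real j" h] that h by (simp add: x_def)
    have DD: "norm (D j - D i) \<le> e1 * h" if "i < n" "j < n" for i j
    proof (cases "i \<le> j")
      case True
      show ?thesis unfolding D_def xs
        by (rule d(2)) (use xa mono[OF True] h xb[of "Suc j"] that xs in auto)
    next
      case False
      have "norm (D i - D j) \<le> e1 * h" unfolding D_def xs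
        by (rule d(2)) (use xa mono[of j i] False h xb[of "Suc i"] that xs in auto)
      then show ?thesis by (simp add: norm_minus_commute)
    qed
    have sumD: "(\<Sum>i<m. D i) = P (x m)" for m
      unfolding D_def using sum_lessThan_telescope[of "\<lambda>i. P (x i)" m] by (simp add: x_def ends)
    have "norm (D j) \<le> e1 * h" if "j < n" for j
    proof -
      have "(\<Sum>i<n. D i) = 0" using sumD[of n] h(4) ends by (simp add: x_def)
      then have "real n *\<^sub>R D j = (\<Sum>i<n. D j - D i)"
        by (simp add: sum_subtractf sum_constant_scaleR)
      moreover have "norm (\<Sum>i<n. D j - D i) \<le> (\<Sum>i<n. e1 * h)"
        by (rule sum_norm_le) (use DD that in auto)
      ultimately have "norm (real n *\<^sub>R D j) \<le> (\<Sum>i<n. e1 * h)" by simp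
      then show ?thesis using np by simp
    qed
    then have Px: "norm (P (x m)) \<le> e / 2" if "m \<le> n" for m
    proof -
      have "norm (P (x m)) \<le> (\<Sum>i<m. e1 * h)"
        unfolding sumD[symmetric] using that \<open>\<And>j. j < n ==> norm (D j) \<le> e1 * h\<close> by (intro sum_norm_le) auto
      also have "\<dots> \<le> e1 * (n * h)" using mult_right_mono[of "real m" "real n" h] that h e1 by (simp add: mult.left_commute mult_left_mono)
      also have "\<dots> = e / 2" using ab e1_def nonzero_eq_divide_eq[of "b - a" e1 "e / 2"] unfolding h(4) by simp
      finally show ?thesis .
    qed
    define m where "m = nat \<lfloor>(t - a) / h\<rfloor>"
    have tp: "(t - a) / h \<ge> 0" using t h by simp
    have m1: "real m \<le> (t - a) / h" "(t - a) / h < real m + 1"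
      using tp by (auto simp: m_def)
    then have m2: "x m \<le> t" "t < x m + h"
      using h by (auto simp: x_def field_simps)
    have "real m * h \<le> n * h" using m2(1) t h(4) by (simp add: x_def)
    then have "real m \<le> real n" using h(1) by (rule mult_right_le_imp_le)
    then have mn: "m \<le> n" by simp
    have "dist (P t) (P (x m)) < e / 2"
      by (rule d2(2)) (use t xa xb[OF mn] m2 h in \<open>auto simp: dist_real_def\<close>)
    then show ?thesis using Px[OF mn] norm_triangle_sub[of "P t" "P (x m)"] by (simp add: dist_norm)
  qed
  then have "norm (P t) \<le> 0" by (rule field_le_epsilon)
  then show ?thesis by simp
qed

text \<open>With \<open>G\<close> the primitive of \<open>g\<close> and \<open>c\<close> the mean of
  \<open>f - G\<close>, let \<open>P\<close> be the primitive of \<open>f - G - c\<close>. The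
  comparison of averages says that increments of \<open>P\<close> over steps of equal length
  \<open>h\<close> agree up to a small multiple of \<open>h\<close>; hence \<open>P\<close>
  vanishes, and so does \<open>f - G - c\<close> almost everywhere.\<close>

lemma weak_derivative_AE:
  fixes f g :: "real => 'b::euclidean_space"
  assumes W: "has_weak_derivative_on f g U" and U: "{a..b'} \<subseteq> U" and ab: "a < b" "b < b'"
  obtains c where "AE t in lebesgue. t \<in> {a..b} --> f t = c + integral {a..t} g"
proof -
  have g: "g absolutely_integrable_on {a..b'}" and f: "f absolutely_integrable_on {a..b'}"
    using W U by (auto simp: has_weak_derivative_on_def locally_integrable_on_def)
  then have gi: "g integrable_on {a..b'}" and fi: "f integrable_on {a..b'}"
    by (simp_all add: absolutely_integrable_on_def)
  define G where "G t = integral {a..t} g" for t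
  have Gc: "continuous_on {a..b'} G" unfolding G_def by (rule indefinite_integral_continuous_1[OF gi])
  have Gi: "G integrable_on {a..b'}" by (rule integrable_continuous_real[OF Gc])
  have fGi: "(\<lambda>t. f t - G t) integrable_on {a..b'}" by (intro Henstock_Kurzweil_Integration.integrable_diff fi Gi)
  define c where "c = (1 / (b - a)) *\<^sub>R integral {a..b} (\<lambda>t. f t - G t)"
  define P where "P t = integral {a..t} (\<lambda>t. f t - G t) - (t - a) *\<^sub>R c" for t
  have P: "P t = 0" if "t \<in> {a..b}" for t
  proof (rule equal_increments_imp_zero[OF ab(1) _ _ _ _ that])
    show "continuous_on {a..b} P"
      unfolding P_def
      by (intro continuous_intros indefinite_integral_continuous_1 integrable_on_subinterval[OF fGi]) (use ab in auto)
    show "P a = 0" by (simp add: P_def)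
    show "P b = 0" using ab by (simp add: P_def c_def)
    fix e :: real assume e: "e > 0"
    obtain d where d: "d > 0" "\<And>s t h. a \<le> s ==> s \<le> t ==> t \<le> b ==> 0 < h ==> h < d ==>
        norm ((1 / h) *\<^sub>R (integral {t..t+h} f - integral {s..s+h} f) - integral {s..t} g) \<le> e / 3"
      using weak_derivative_averages[OF W U less_imp_le[OF ab(1)] ab(2), of "e / 3"] e
      by (metis divide_pos_pos zero_less_numeral)
    have "uniformly_continuous_on {a..b'} G"
      using Gc by (intro compact_uniformly_continuous) auto
    then obtain d2 where d2: "d2 > 0" "\<And>x y. x \<in> {a..b'} ==> y \<in> {a..b'} ==> dist x y < d2 ==> dist (G x) (G y) < e / 3"
      unfolding uniformly_continuous_on_def using e by (metis divide_pos_pos zero_less_numeral)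
    show "\<exists>d>0. \<forall>s t h. a \<le> s --> s \<le> t --> t + h \<le> b --> 0 < h --> h < d -->
      norm ((P (t + h) - P t) - (P (s + h) - P s)) \<le> e * h"
    proof (intro exI[of _ "min d d2"] conjI allI impI)
      show "0 < min d d2" using d d2 by simp
      fix s t h assume st: "a \<le> s" "s \<le> t" "t + h \<le> b" and h: "0 < h" "h < min d d2"
      have int: "integral {a..r + h} F - integral {a..r} F = integral {r..r+h} F"
        if "F integrable_on {a..b'}" "a \<le> r" "r \<le> t" for r and F :: "real => 'b"
      proof -
        have "integral {a..r} F + integral {r..r+h} F = integral {a..r+h} F"
          by (rule Henstock_Kurzweil_Integration.integral_combine)
            (use that st h ab in \<open>auto intro!: integrable_on_subinterval[OF that(1)]\<close>)
        then show ?thesis by (simp add: algebra_simps)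
      qed
      have nc: "norm (integral {r..r+h} G - h *\<^sub>R G r) \<le> e / 3 * h" if "a \<le> r" "r \<le> t" for r
      proof (rule integral_near_constant)
        show "continuous_on {r..r+h} G" by (rule continuous_on_subset[OF Gc]) (use that st h ab in auto)
        show "norm (G x - G r) \<le> e / 3" if "x \<in> {r..r+h}" for x
          using d2(2)[of x r] that h \<open>a \<le> r\<close> \<open>r \<le> t\<close> st ab by (auto simp: dist_norm)
      qed (rule h)
      have PP: "P (r + h) - P r = integral {r..r+h} f - integral {r..r+h} G - h *\<^sub>R c" if "a \<le> r" "r \<le> t" for r
      proof -
        have "integral {r..r+h} (\<lambda>t. f t - G t) = integral {r..r+h} f - integral {r..r+h} G"
          by (intro Henstock_Kurzweil_Integration.integral_diff integrable_on_subinterval[OF fi] integrable_on_subinterval[OF Gi])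
            (use that st h ab in auto)
        then show ?thesis
          unfolding P_def using int[OF fGi that] by (simp add: algebra_simps)
      qed
      have Gst: "integral {s..t} g = G t - G s"
      proof -
        have "G s + integral {s..t} g = G t" unfolding G_def
          by (rule Henstock_Kurzweil_Integration.integral_combine)
            (use st h ab in \<open>auto intro!: integrable_on_subinterval[OF gi]\<close>)
        then show ?thesis by (simp add: algebra_simps)
      qed
      define Q where "Q = (1 / h) *\<^sub>R (integral {t..t+h} f - integral {s..s+h} f) - integral {s..t} g"
      have hQ: "h *\<^sub>R Q = (integral {t..t+h} f - integral {s..s+h} f) - h *\<^sub>R (G t - G s)"
        using h by (simp add: Q_def Gst scaleR_diff_right)
      have "norm Q \<le> e / 3" unfolding Q_def by (rule d(2)) (use st h in auto)
      then have nQ: "norm (h *\<^sub>R Q) \<le> e / 3 * h" using h by simp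
      have Peq: "(P (t + h) - P t) - (P (s + h) - P s)
          = h *\<^sub>R Q - (integral {t..t+h} G - h *\<^sub>R G t) + (integral {s..s+h} G - h *\<^sub>R G s)"
        unfolding hQ PP[OF order_trans[OF st(1,2)] order_refl] PP[OF st(1,2)] by (simp add: algebra_simps)
      have "norm ((P (t + h) - P t) - (P (s + h) - P s)) \<le> e / 3 * h + e / 3 * h + e / 3 * h"
        unfolding Peq using nQ nc[OF order_trans[OF st(1,2)] order_refl] nc[OF st(1,2)]
          norm_triangle_ineq[of "h *\<^sub>R Q - (integral {t..t+h} G - h *\<^sub>R G t)" "integral {s..s+h} G - h *\<^sub>R G s"]
          norm_triangle_ineq4[of "h *\<^sub>R Q" "integral {t..t+h} G - h *\<^sub>R G t"]
        by linarith
      then show "norm ((P (t + h) - P t) - (P (s + h) - P s)) \<le> e * h" by simp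
    qed
  qed
  have "AE t in lebesgue. t \<in> {a..b} --> f t - G t - c = 0"
  proof (rule integral_initial_segments_zero_imp_AE)
    have Ga: "G absolutely_integrable_on {a..b}"
      by (rule absolutely_integrable_continuous_real, rule continuous_on_subset[OF Gc]) (use ab in auto)
    show "(\<lambda>t. f t - G t - c) absolutely_integrable_on {a..b}"
      by (intro set_integral_diff Ga absolutely_integrable_on_subinterval[OF f] absolutely_integrable_on_const) (use ab in auto)
    fix t assume t: "t \<in> {a..b}"
    have "integral {a..t} (\<lambda>t. f t - G t - c) = integral {a..t} (\<lambda>t. f t - G t) - integral {a..t} (\<lambda>t. c)"
      by (intro Henstock_Kurzweil_Integration.integral_diff integrable_on_subinterval[OF fGi]) (use t ab in auto)
    then show "integral {a..t} (\<lambda>t. f t - G t - c) = 0"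
      using P[OF t] t by (simp add: P_def)
  qed
  then have "AE t in lebesgue. t \<in> {a..b} --> f t = c + integral {a..t} g"
    by eventually_elim (auto simp: G_def algebra_simps)
  then show thesis by (rule that)
qed

text \<open>Integration by parts through the fundamental theorem, which tolerates one point without
  derivative as long as the function is continuous there.\<close>

lemma derivative_imp_weak_derivative:
  fixes f g :: "real => 'b::euclidean_space"
  assumes cont: "continuous_on {a<..<b} f" and g: "g absolutely_integrable_on {a<..<b}"
    and der: "\<And>t. t \<in> {a<..<b} ==> t \<noteq> t0 ==> (f has_vector_derivative g t) (at t)"
  shows "has_weak_derivative_on f g {a<..<b}"
  unfolding has_weak_derivative_on_def
proof (intro conjI allI impI)
  show lf: "locally_integrable_on f {a<..<b}"
    unfolding locally_integrable_on_def
  proof (intro allI impI)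
    fix K assume K: "compact K \<and> K \<subseteq> {a<..<b}"
    then have "set_integrable lborel K f"
      unfolding set_integrable_def by (intro borel_integrable_compact continuous_on_subset[OF cont]) auto
    then show "f absolutely_integrable_on K"
      unfolding set_integrable_def
      by (subst integrable_completion) (auto dest: borel_measurable_integrable)
  qed
  show lg: "locally_integrable_on g {a<..<b}"
    unfolding locally_integrable_on_def using set_integrable_subset[OF g] lmeasurable_compact by blast
  fix \<phi> assume tf: "test_function {a<..<b} \<phi>"
  then obtain K where K: "compact K" "K \<subseteq> {a<..<b}" "\<And>t. t \<notin> K ==> \<phi> t = 0" and sm: "smooth \<phi>"
    by (auto simp: test_function_def)
  \<comment> \<open>A compact interval with the support in its interior, so that the boundary terms
    vanish. An empty support is served by any inner interval.\<close>
  obtain c d where cd: "a < c" "c < d" "d < b" "K \<subseteq> {c<..<d}" if "a < b"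
  proof (cases "K = {} \<or> \<not> a < b")
    case True
    then show ?thesis using that[of "(2*a + b)/3" "(a + 2*b)/3"] by (cases "a < b") auto
  next
    case False
    then obtain x y where "x \<in> K" "y \<in> K" "\<And>z. z \<in> K ==> x \<le> z \<and> z \<le> y"
      using compact_attains_inf[OF K(1)] compact_attains_sup[OF K(1)] by metis
    then show ?thesis using that[of "(a + x) / 2" "(y + b) / 2"] K(2) by fastforce
  qed
  show "(LINT t:{a<..<b}|lebesgue. deriv \<phi> t *\<^sub>R f t) = - (LINT t:{a<..<b}|lebesgue. \<phi> t *\<^sub>R g t)"
  proof (cases "a < b")
    case True
    note cd = cd[OF True]
    have sub: "{c..d} \<subseteq> {a<..<b}" using cd by auto
    have d\<phi>: "(\<phi> has_real_derivative deriv \<phi> t) (at t)" for t using smooth_real_derivative(1)[OF sm] .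
    have \<phi>0: "\<phi> t = 0" "deriv \<phi> t = 0" if "t \<notin> {c..d}" for t
    proof -
      have z: "\<phi> x = 0" if "x \<notin> {c..d}" for x using K(3)[of x] cd(4) that by fastforce
      then show "\<phi> t = 0" using that .
      have "((\<lambda>x. 0) has_real_derivative 0) (at t)" by simp
      then have "(\<phi> has_real_derivative 0) (at t)"
        by (rule has_field_derivative_transform_within_open[where S = "- {c..d}"])
          (use that z in auto)
      then show "deriv \<phi> t = 0" by (rule DERIV_imp_deriv)
    qed
    have fa: "f absolutely_integrable_on {c..d}" and ga: "g absolutely_integrable_on {c..d}"
      using lf lg sub by (auto simp: locally_integrable_on_def)
    have i1: "(\<lambda>t. deriv \<phi> t *\<^sub>R f t) absolutely_integrable_on {c..d}"
      by (rule absolutely_integrable_continuous_scaleR[OF smooth_continuous_on[OF smooth_real_derivative(2)[OF sm]] fa])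
    have i2: "(\<lambda>t. \<phi> t *\<^sub>R g t) absolutely_integrable_on {c..d}"
      by (rule absolutely_integrable_continuous_scaleR[OF smooth_continuous_on[OF sm] ga])
    have "((\<lambda>t. \<phi> t *\<^sub>R g t + deriv \<phi> t *\<^sub>R f t) has_integral (\<phi> d *\<^sub>R f d - \<phi> c *\<^sub>R f c)) {c..d}"
    proof (rule fundamental_theorem_of_calculus_interior_strong[where S = "{t0}"])
      show "continuous_on {c..d} (\<lambda>t. \<phi> t *\<^sub>R f t)"
        by (intro continuous_intros smooth_continuous_on[OF sm] continuous_on_subset[OF cont sub])
      fix x assume "x \<in> {c<..<d} - {t0}"
      then have "(f has_vector_derivative g x) (at x)" using der[of x] cd by auto
      from has_vector_derivative_scaleR[OF d\<phi> this]
      show "((\<lambda>t. \<phi> t *\<^sub>R f t) has_vector_derivative \<phi> x *\<^sub>R g x + deriv \<phi> x *\<^sub>R f x) (at x)" .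
    qed (use cd in auto)
    moreover have "\<phi> c = 0" "\<phi> d = 0" using K(3) cd by fastforce+
    ultimately have "integral {c..d} (\<lambda>t. \<phi> t *\<^sub>R g t + deriv \<phi> t *\<^sub>R f t) = 0"
      by (simp add: integral_unique)
    then have "integral {c..d} (\<lambda>t. \<phi> t *\<^sub>R g t) + integral {c..d} (\<lambda>t. deriv \<phi> t *\<^sub>R f t) = 0"
      using i1 i2 by (subst (asm) Henstock_Kurzweil_Integration.integral_add) (auto simp: absolutely_integrable_on_def)
    moreover have "(LINT t:{a<..<b}|lebesgue. deriv \<phi> t *\<^sub>R f t) = integral {c..d} (\<lambda>t. deriv \<phi> t *\<^sub>R f t)"
      by (rule set_lebesgue_integral_support[OF sub _ i1]) (simp add: \<phi>0)
    moreover have "(LINT t:{a<..<b}|lebesgue. \<phi> t *\<^sub>R g t) = integral {c..d} (\<lambda>t. \<phi> t *\<^sub>R g t)"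
      by (rule set_lebesgue_integral_support[OF sub _ i2]) (simp add: \<phi>0)
    ultimately show ?thesis by (simp add: eq_neg_iff_add_eq_0 add.commute)
  qed (simp add: set_lebesgue_integral_def)
qed

subsection \<open>Coefficients with a logarithmic singularity\<close>

lemma integrable_lebesgue_on_iff:
  fixes f :: "'a::euclidean_space => 'b::euclidean_space"
  assumes "S \<in> sets lebesgue"
  shows "integrable (lebesgue_on S) f \<longleftrightarrow> f absolutely_integrable_on S"
  unfolding set_integrable_def by (rule integrable_restrict_space) (use assms in auto)

lemma AE_lebesgue_onD:
  assumes "AE x in lebesgue_on S. P x" "S \<in> sets lebesgue"
  shows "AE x in lebesgue. x \<in> S --> P x"
  using assms by (subst (asm) AE_restrict_space_iff) auto

lemma AE_lebesgue_negligible: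
  assumes "AE x in lebesgue. P x"
  obtains N where "negligible N" "\<And>x. x \<notin> N ==> P x"
proof -
  obtain N where "{x \<in> space lebesgue. \<not> P x} \<subseteq> N" "emeasure lebesgue N = 0" "N \<in> sets lebesgue"
    using assms by (rule AE_E)
  then show thesis by (intro that[of N]) (auto simp: negligible_iff_null_sets null_sets_def)
qed

lemma powr_young:
  fixes s x p r :: real
  assumes s: "s > 0" and x: "x \<ge> 0" and p: "p \<ge> 0" and r: "r \<ge> 1" and pr: "p + 1 / r \<le> 1"
  shows "s powr (- p) * x \<le> 1 / s + 1 + x powr r"
proof (cases "s \<ge> 1")
  case True
  have "s powr (- p) \<le> s powr 0" using True p by (intro powr_mono) auto
  then have "s powr (- p) * x \<le> 1 * x" using x s by (intro mult_right_mono) auto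
  also have "1 * x \<le> 1 + x powr r"
  proof (cases "x \<ge> 1")
    case True
    then have "x powr 1 \<le> x powr r" using r by (intro powr_mono) auto
    then show ?thesis using True by simp
  qed (use powr_ge_zero[of x r] in linarith)
  finally have "s powr (- p) * x \<le> 1 + x powr r" .
  moreover have "0 \<le> 1 / s" using s by simp
  ultimately show ?thesis by linarith
next
  case False
  have a: "s powr (- p) \<le> s powr (- (1 - 1 / r))"
    using False s pr by (intro powr_mono') auto
  show ?thesis
  proof (cases "x \<le> s powr (- (1 / r))")
    case True
    have "s powr (- p) * x \<le> s powr (- (1 - 1 / r)) * s powr (- (1 / r))"
      using a True x by (intro mult_mono) auto
    also have "\<dots> = s powr (- 1)" by (simp add: powr_add[symmetric])
    also have "\<dots> = 1 / s" using s by (simp add: powr_minus divide_inverse)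
    finally show ?thesis using powr_ge_zero[of x r] by linarith
  next
    case c: False
    then have xp: "x > 0" using powr_ge_zero[of s "- (1 / r)"] by linarith
    have "- (1 - 1 / r) = - (1 / r) * (r - 1)" using r by (simp add: field_simps)
    then have "s powr (- (1 - 1 / r)) = (s powr (- (1 / r))) powr (r - 1)" by (simp only: powr_powr)
    also have "\<dots> \<le> x powr (r - 1)" using c r by (intro powr_mono2) auto
    finally have "s powr (- p) * x \<le> x powr (r - 1) * x"
      using a x by (intro mult_right_mono) auto
    also have "\<dots> = x powr r" using xp by (simp add: powr_diff)
    finally have "s powr (- p) * x \<le> x powr r" .
    moreover have "0 \<le> 1 / s" using s by simp
    ultimately show ?thesis by linarith
  qed
qed

text \<open>This is the only place where the condition \<open>p + 1/q \<le> 1\<close> enters: it puts the weight in the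
  borderline class \<open>1/\<bar>t - t0\<bar>\<close>, whose integral diverges only logarithmically.\<close>

lemma weighted_Lq_bound:
  fixes a' :: "real => real" and q :: ereal
  assumes Lq: "in_Lq q S (\<lambda>t. \<bar>t0 - t\<bar> powr p * a' t)" and S: "S \<in> lmeasurable"
    and q: "1 \<le> q" and p: "p \<ge> 0" and pq: "ereal p + 1 / q \<le> 1"
  obtains c G where "c \<ge> 0" "G absolutely_integrable_on S" "\<And>t. G t \<ge> 0"
    "AE t in lebesgue. t \<in> S --> t \<noteq> t0 --> \<bar>a' t\<bar> \<le> c / \<bar>t - t0\<bar> + G t"
proof (cases "q = \<infinity>")
  case True
  then have p1: "p \<le> 1" using pq by (simp add: one_ereal_def)
  obtain C where "AE t in lebesgue_on S. \<bar>\<bar>t0 - t\<bar> powr p * a' t\<bar> \<le> C"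
    using Lq True by (auto simp: in_Lq_def)
  then have C: "AE t in lebesgue. t \<in> S --> \<bar>\<bar>t0 - t\<bar> powr p * a' t\<bar> \<le> C"
    using S by (intro AE_lebesgue_onD) auto
  define C' where "C' = max C 0"
  show thesis
  proof (rule that[of C' "\<lambda>t. C'"])
    show "(\<lambda>t. C') absolutely_integrable_on S"
      using S by (intro absolutely_integrable_on_const)
    show "AE t in lebesgue. t \<in> S --> t \<noteq> t0 --> \<bar>a' t\<bar> \<le> C' / \<bar>t - t0\<bar> + C'"
      using C
    proof eventually_elim
      fix t assume C: "t \<in> S --> \<bar>\<bar>t0 - t\<bar> powr p * a' t\<bar> \<le> C"
      show "t \<in> S --> t \<noteq> t0 --> \<bar>a' t\<bar> \<le> C' / \<bar>t - t0\<bar> + C'"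
      proof (intro impI)
        assume t: "t \<in> S" "t \<noteq> t0"
        define s where "s = \<bar>t - t0\<bar>"
        have s: "s > 0" using t by (simp add: s_def)
        have "s powr p * \<bar>a' t\<bar> \<le> C'" using C t by (simp add: abs_mult s_def abs_minus_commute C'_def)
        then have "s powr (- p) * (s powr p * \<bar>a' t\<bar>) \<le> s powr (- p) * C'" by (rule mult_left_mono) simp
        also have "s powr (- p) * (s powr p * \<bar>a' t\<bar>) = \<bar>a' t\<bar>"
          using s by (simp add: powr_minus)
        also have "s powr (- p) * C' \<le> (1 / s + 1) * C'"
        proof (rule mult_right_mono)
          show "s powr (- p) \<le> 1 / s + 1"
          proof (cases "s \<ge> 1")
            case True
            have "s powr (- p) \<le> s powr 0" using True p by (intro powr_mono) auto
            then show ?thesis using s by (simp add: add_increasing)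
          next
            case False
            have "s powr (- p) \<le> s powr (- 1)" using False s p1 by (intro powr_mono') auto
            moreover have "s powr (- 1) = 1 / s" using s by (simp add: powr_minus divide_inverse)
            ultimately show ?thesis by linarith
          qed
        qed (simp add: C'_def)
        finally show "\<bar>a' t\<bar> \<le> C' / \<bar>t - t0\<bar> + C'" by (simp add: s_def algebra_simps)
      qed
    qed
  qed (auto simp: C'_def)
next
  case False
  then obtain r where r: "q = ereal r" using q by (cases q) auto
  have r1: "r \<ge> 1" using q r by simp
  have pr: "p + 1 / r \<le> 1"
    using pq r1 unfolding r by (simp add: one_ereal_def)
  define g where "g t = \<bar>\<bar>t0 - t\<bar> powr p * a' t\<bar> powr r" for t
  have g: "g absolutely_integrable_on S"
    using Lq r S by (subst integrable_lebesgue_on_iff[symmetric]) (auto simp: in_Lq_def g_def[abs_def])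
  show thesis
  proof (rule that[of 1 "\<lambda>t. 1 + g t"])
    show "(\<lambda>t. 1 + g t) absolutely_integrable_on S"
      using S g by (intro set_integral_add(1) absolutely_integrable_on_const)
    have "\<bar>a' t\<bar> \<le> 1 / \<bar>t - t0\<bar> + (1 + g t)" if "t \<noteq> t0" for t
    proof -
      define s where "s = \<bar>t - t0\<bar>"
      have s: "s > 0" using that by (simp add: s_def)
      have "\<bar>a' t\<bar> = s powr (- p) * (s powr p * \<bar>a' t\<bar>)" using s by (simp add: powr_minus)
      also have "\<dots> \<le> 1 / s + 1 + (s powr p * \<bar>a' t\<bar>) powr r"
        by (rule powr_young) (use s p r1 pr in auto)
      finally show ?thesis by (simp add: g_def s_def abs_mult abs_minus_commute)
    qed
    then show "AE t in lebesgue. t \<in> S --> t \<noteq> t0 --> \<bar>a' t\<bar> \<le> 1 / \<bar>t - t0\<bar> + (1 + g t)" by simp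
  qed (auto simp: g_def)
qed

lemma has_integral_inverse_dist:
  fixes s t t0 :: real
  assumes "s \<le> t" "t < t0 \<or> t0 < s"
  shows "((\<lambda>r. 1 / \<bar>r - t0\<bar>) has_integral \<bar>ln \<bar>t - t0\<bar> - ln \<bar>s - t0\<bar>\<bar>) {s..t}"
proof (cases "t < t0")
  case True
  have "((\<lambda>r. 1 / \<bar>r - t0\<bar>) has_integral (- ln (t0 - t) - (- ln (t0 - s)))) {s..t}"
    by (rule fundamental_theorem_of_calculus[OF assms(1)])
      (use True in \<open>auto intro!: derivative_eq_intros simp flip: has_real_derivative_iff_has_vector_derivative simp: field_simps\<close>)
  moreover have "ln (t0 - t) \<le> ln (t0 - s)" using True assms by simp
  ultimately show ?thesis using True assms by simp
next
  case False
  then have "t0 < s" using assms by auto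
  have "((\<lambda>r. 1 / \<bar>r - t0\<bar>) has_integral (ln (t - t0) - ln (s - t0))) {s..t}"
    by (rule fundamental_theorem_of_calculus[OF assms(1)])
      (use \<open>t0 < s\<close> in \<open>auto intro!: derivative_eq_intros simp flip: has_real_derivative_iff_has_vector_derivative simp: field_simps\<close>)
  moreover have "ln (s - t0) \<le> ln (t - t0)" using \<open>t0 < s\<close> assms by simp
  ultimately show ?thesis using \<open>t0 < s\<close> assms by simp
qed

lemma AE_interval_nonempty:
  fixes c d :: real
  assumes "AE t in lebesgue. P t" "c < d"
  obtains t where "c < t" "t < d" "P t"
proof -
  obtain N where N: "negligible N" "\<And>x. x \<notin> N ==> P x"
    using AE_lebesgue_negligible[OF assms(1)] by metis
  have "\<not> negligible {c<..<d}"
    using assms(2) negligible_interval(2)[of c d] by simp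
  then have "\<not> {c<..<d} \<subseteq> N" using N(1) negligible_subset by blast
  then obtain x where "x \<in> {c<..<d}" "x \<notin> N" by blast
  then show thesis using N(2)[of x] that[of x] by simp
qed

text \<open>\<open>J\<close> may contain an end point that is missing from \<open>U\<close>: the
  representative extends to it as soon as \<open>g\<close> is integrable up to it. The interval is
  exhausted by compact ones, and their constants of integration agree because any two of them
  overlap.\<close>

lemma weak_derivative_representative:
  fixes f g :: "real => real"
  assumes W: "has_weak_derivative_on f g U" and U: "{l<..<r} \<subseteq> U" and lr: "l < r"
    and J: "{l<..<r} \<subseteq> J" "J \<subseteq> {l..r}"
    and g: "\<And>s t. s \<in> J ==> t \<in> J ==> s \<le> t ==> g absolutely_integrable_on {s..t}"
  obtains F where "\<And>s t. s \<in> J ==> t \<in> J ==> s \<le> t ==> F t - F s = integral {s..t} g"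
    "AE t in lebesgue. t \<in> {l<..<r} --> f t = F t"
proof -
  define m where "m = (l + r) / 2"
  have mJ: "m \<in> J" using J lr by (auto simp: m_def)
  define P where "P t = (if m \<le> t then integral {m..t} g else - integral {t..m} g)" for t
  have gi: "g integrable_on {s..t}" if "s \<in> J" "t \<in> J" "s \<le> t" for s t
    using g[OF that] by (simp add: absolutely_integrable_on_def)
  have P: "P t - P s = integral {s..t} g" if st: "s \<in> J" "t \<in> J" "s \<le> t" for s t
  proof -
    have comb: "integral {x..y} g + integral {y..z} g = integral {x..z} g"
      if "x \<in> J" "z \<in> J" "x \<le> y" "y \<le> z" for x y z
      using Henstock_Kurzweil_Integration.integral_combine[OF that(3,4) gi[OF that(1,2)]] that by simp
    consider "m \<le> s" | "s < m" "m \<le> t" | "t < m" using st(3) by linarith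
    then show ?thesis
      using comb[of m t s] comb[of s t m] comb[of s m t] st mJ by cases (auto simp: P_def)
  qed
  \<comment> \<open>As \<open>\<delta> n \<le> (r - l) / 4\<close>, each interval of the exhaustion
    contains the middle half, where the constants are compared.\<close>
  define \<delta> where "\<delta> n = (r - l) / (4 * real (Suc n))" for n
  have \<delta>: "0 < \<delta> n" "\<delta> n \<le> (r - l) / 4" for n
    using lr mult_right_mono[of l r "real n"] by (auto simp: \<delta>_def field_simps)
  have "\<exists>c. AE t in lebesgue. t \<in> {l + \<delta> n..r - \<delta> n} --> f t = c + P t" for n
  proof -
    have sub: "{l + \<delta> n..r - \<delta> n / 2} \<subseteq> U" using U \<delta>[of n] by auto
    obtain c where c: "AE t in lebesgue. t \<in> {l + \<delta> n..r - \<delta> n} --> f t = c + integral {l + \<delta> n..t} g"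
      by (rule weak_derivative_AE[OF W sub]) (use \<delta>[of n] lr in auto)
    have eq: "integral {l + \<delta> n..t} g = P t - P (l + \<delta> n)" if "t \<in> {l + \<delta> n..r - \<delta> n}" for t
    proof -
      have "l + \<delta> n \<in> {l<..<r}" "t \<in> {l<..<r}" using that \<delta>[of n] lr by auto
      then have "l + \<delta> n \<in> J" "t \<in> J" using J(1) by blast+
      then show ?thesis using P[of "l + \<delta> n" t] that by auto
    qed
    have "AE t in lebesgue. t \<in> {l + \<delta> n..r - \<delta> n} --> f t = (c - P (l + \<delta> n)) + P t"
      using c by eventually_elim (use eq in simp)
    then show ?thesis by blast
  qed
  then obtain c where c: "\<And>n. AE t in lebesgue. t \<in> {l + \<delta> n..r - \<delta> n} --> f t = c n + P t"
    by metis
  have "c n = c 0" for n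
  proof -
    have "AE t in lebesgue. (t \<in> {l + \<delta> n..r - \<delta> n} --> f t = c n + P t) \<and> (t \<in> {l + \<delta> 0..r - \<delta> 0} --> f t = c 0 + P t)"
      using c[of n] c[of 0] by eventually_elim simp
    from AE_interval_nonempty[OF this, of "l + (r - l) / 4" "r - (r - l) / 4"]
    obtain t where t: "l + (r - l) / 4 < t" "t < r - (r - l) / 4"
      "(t \<in> {l + \<delta> n..r - \<delta> n} --> f t = c n + P t) \<and> (t \<in> {l + \<delta> 0..r - \<delta> 0} --> f t = c 0 + P t)"
      using lr by (auto simp: field_simps)
    then show ?thesis using \<delta>[of n] \<delta>[of 0] by auto
  qed
  then have "AE t in lebesgue. \<forall>n. t \<in> {l + \<delta> n..r - \<delta> n} --> f t = c 0 + P t"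
    using c by (subst AE_all_countable) metis
  then have ae: "AE t in lebesgue. t \<in> {l<..<r} --> f t = c 0 + P t"
  proof eventually_elim
    fix t assume a: "\<forall>n. t \<in> {l + \<delta> n..r - \<delta> n} --> f t = c 0 + P t"
    show "t \<in> {l<..<r} --> f t = c 0 + P t"
    proof
      assume t: "t \<in> {l<..<r}"
      have "\<delta> \<longlonglongrightarrow> 0"
        unfolding \<delta>_def using LIMSEQ_Suc[OF lim_const_over_n[of "(r - l) / 4"]] by simp
      then have "\<forall>\<^sub>F n in sequentially. \<delta> n < min (t - l) (r - t)"
        by (rule order_tendstoD) (use t in auto)
      then obtain n where "\<delta> n < min (t - l) (r - t)" by (auto simp: eventually_sequentially)
      then show "f t = c 0 + P t" using a[rule_format, of n] by auto
    qed
  qed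
  show thesis by (rule that[of "\<lambda>t. c 0 + P t"]) (use P ae in auto)
qed

text \<open>The two sides of \<open>t0\<close> are treated separately and joined without any
  relation across \<open>t0\<close>, for the weight may make \<open>a'\<close> non-integrable there.
  On either side the representative reaches the outer end of \<open>{0..T}\<close>, which makes
  initial values at time 0 meaningful.\<close>

lemma singular_representative:
  fixes f a' :: "real => real" and q :: ereal
  assumes T: "T > 0" and t0: "t0 \<in> {0..T}"
    and W: "has_weak_derivative_on f a' ({0<..<T} - {t0})"
    and Lq: "in_Lq q {0<..<T} (\<lambda>t. \<bar>t0 - t\<bar> powr p * a' t)"
    and q: "1 \<le> q" and p: "p \<ge> 0" and pq: "ereal p + 1 / q \<le> 1"
  obtains F c Gam where "c \<ge> 0" "continuous_on {0..T} Gam" "\<And>s t. 0 \<le> s ==> s \<le> t ==> t \<le> T ==> Gam s \<le> Gam t"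
    "\<And>s t. s \<in> {0..T} ==> t \<in> {0..T} ==> s \<le> t ==> t < t0 \<or> t0 < s ==>
       \<bar>F t - F s\<bar> \<le> c * \<bar>ln \<bar>t - t0\<bar> - ln \<bar>s - t0\<bar>\<bar> + (Gam t - Gam s)"
    "AE t in lebesgue. t \<in> {0..T} --> f t = F t"
proof -
  obtain c G where c: "c \<ge> 0" and G: "G absolutely_integrable_on {0<..<T}" and Gp: "\<And>t. G t \<ge> 0"
    and bd: "AE t in lebesgue. t \<in> {0<..<T} --> t \<noteq> t0 --> \<bar>a' t\<bar> \<le> c / \<bar>t - t0\<bar> + G t"
    by (rule weighted_Lq_bound[OF Lq _ q p pq]) auto
  obtain N0 where N0: "negligible N0" "\<And>t. t \<notin> N0 ==> t \<in> {0<..<T} --> t \<noteq> t0 --> \<bar>a' t\<bar> \<le> c / \<bar>t - t0\<bar> + G t"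
    using AE_lebesgue_negligible[OF bd] by metis
  define N where "N = N0 \<union> {t0, 0, T}"
  have N: "negligible N" using N0(1) by (simp add: N_def)
  have GT: "G absolutely_integrable_on {0..T}"
    using G absolutely_integrable_on_open_interval[where f = G and a = 0 and b = T] by simp
  define Gam where "Gam t = integral {0..t} G" for t
  have Gi: "G integrable_on {s..t}" if "0 \<le> s" "t \<le> T" for s t
    using absolutely_integrable_on_subinterval[OF GT, of s t] that by (auto simp: absolutely_integrable_on_def)
  have Gam: "Gam t - Gam s = integral {s..t} G" if "0 \<le> s" "s \<le> t" "t \<le> T" for s t
    using Henstock_Kurzweil_Integration.integral_combine[OF that(1,2) Gi] that unfolding Gam_def by force
  have a1: "a' absolutely_integrable_on {s..t}" and a2: "norm (integral {s..t} a') \<le> c * \<bar>ln \<bar>t - t0\<bar> - ln \<bar>s - t0\<bar>\<bar> + (Gam t - Gam s)"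
    if st: "0 \<le> s" "s \<le> t" "t \<le> T" "t < t0 \<or> t0 < s" for s t
  proof -
    \<comment> \<open>Setting the derivative to 0 on the exceptional null set makes the weight bound
      pointwise.\<close>
    define a1 where "a1 r = (if r \<in> N then 0 else a' r)" for r
    have "((\<lambda>r. c * (1 / \<bar>r - t0\<bar>) + G r) has_integral c * \<bar>ln \<bar>t - t0\<bar> - ln \<bar>s - t0\<bar>\<bar> + (Gam t - Gam s)) {s..t}"
      unfolding Gam[OF st(1-3)]
      by (intro has_integral_add has_integral_mult_right has_integral_inverse_dist st integrable_integral Gi)
    then have hi: "((\<lambda>r. c / \<bar>r - t0\<bar> + G r) has_integral c * \<bar>ln \<bar>t - t0\<bar> - ln \<bar>s - t0\<bar>\<bar> + (Gam t - Gam s)) {s..t}"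
      by simp
    have le: "norm (a1 r) \<le> c / \<bar>r - t0\<bar> + G r" if "r \<in> {s..t}" for r
      using N0(2)[of r] that st Gp[of r] c by (auto simp: a1_def N_def)
    \<comment> \<open>Measurability is read off the weighted function in \<open>in_Lq\<close>; then
      the weight is divided out. The point \<open>t0\<close>, where the weight may vanish, belongs
      to \<open>N\<close>.\<close>
    have m0: "(\<lambda>r. \<bar>t0 - r\<bar> powr p * a' r) \<in> borel_measurable (lebesgue_on {0<..<T})"
      using Lq by (simp add: in_Lq_def)
    have mi: "(\<lambda>r. inverse (\<bar>t0 - r\<bar> powr p)) \<in> borel_measurable (lebesgue_on {0<..<T})"
      by (intro measurable_restrict_space1 measurable_completion) simp
    have m1: "(\<lambda>r. inverse (\<bar>t0 - r\<bar> powr p) * (\<bar>t0 - r\<bar> powr p * a' r)) \<in> borel_measurable (lebesgue_on {s<..<t})"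
      by (rule measurable_restrict_mono[OF borel_measurable_times[OF mi m0]]) (use st in auto)
    have ms: "a1 \<in> borel_measurable (lebesgue_on {s<..<t})"
    proof -
      have "N \<in> sets lebesgue" using N negligible_imp_sets by blast
      then have "(\<lambda>r. if r \<in> N then 0 else inverse (\<bar>t0 - r\<bar> powr p) * (\<bar>t0 - r\<bar> powr p * a' r)) \<in> borel_measurable (lebesgue_on {s<..<t})"
        using m1 by (intro measurable_If_set) (auto simp: sets_restrict_space)
      also have "(\<lambda>r. if r \<in> N then 0 else inverse (\<bar>t0 - r\<bar> powr p) * (\<bar>t0 - r\<bar> powr p * a' r)) = a1"
        by (auto simp: a1_def N_def)
      finally show ?thesis .
    qed
    have "(\<lambda>r. c / \<bar>r - t0\<bar> + G r) integrable_on {s<..<t}"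
      using has_integral_integrable[OF hi] integrable_on_open_interval_real by blast
    then have "a1 absolutely_integrable_on {s<..<t}"
      by (intro measurable_bounded_by_integrable_imp_absolutely_integrable[OF ms]) (use le in auto)
    then have A1: "a1 absolutely_integrable_on {s..t}"
      using absolutely_integrable_on_open_interval[where f = a1 and a = s and b = t] by simp
    have sp: "a' r = a1 r" if "r \<in> {s..t} - N" for r using that by (simp add: a1_def)
    show "a' absolutely_integrable_on {s..t}"
      by (rule absolutely_integrable_spike[OF A1 N sp])
    have "integral {s..t} a' = integral {s..t} a1"
      by (rule integral_spike[OF N]) (simp add: a1_def)
    also have "norm \<dots> \<le> integral {s..t} (\<lambda>r. c / \<bar>r - t0\<bar> + G r)"
      by (rule Henstock_Kurzweil_Integration.integral_norm_bound_integral)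
        (use A1 le has_integral_integrable[OF hi] in \<open>auto simp: absolutely_integrable_on_def\<close>)
    also have "\<dots> = c * \<bar>ln \<bar>t - t0\<bar> - ln \<bar>s - t0\<bar>\<bar> + (Gam t - Gam s)"
      using hi by (rule integral_unique)
    finally show "norm (integral {s..t} a') \<le> c * \<bar>ln \<bar>t - t0\<bar> - ln \<bar>s - t0\<bar>\<bar> + (Gam t - Gam s)" .
  qed
  obtain F1 where F1: "\<And>s t. s \<in> {0..<t0} ==> t \<in> {0..<t0} ==> s \<le> t ==> F1 t - F1 s = integral {s..t} a'"
    "AE t in lebesgue. t \<in> {0<..<t0} --> f t = F1 t"
  proof (cases "0 < t0")
    case True
    show thesis
    proof (rule weak_derivative_representative[OF W, of 0 t0 "{0..<t0}"])
      fix F assume "\<And>s t. s \<in> {0..<t0} ==> t \<in> {0..<t0} ==> s \<le> t ==> F t - F s = integral {s..t} a'"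
        "AE t in lebesgue. t \<in> {0<..<t0} --> f t = F t"
      then show thesis by (rule that)
    qed (use True t0 a1 in auto)
  qed (auto intro: that)
  obtain F2 where F2: "\<And>s t. s \<in> {t0<..T} ==> t \<in> {t0<..T} ==> s \<le> t ==> F2 t - F2 s = integral {s..t} a'"
    "AE t in lebesgue. t \<in> {t0<..<T} --> f t = F2 t"
  proof (cases "t0 < T")
    case True
    show thesis
    proof (rule weak_derivative_representative[OF W, of t0 T "{t0<..T}"])
      fix F assume "\<And>s t. s \<in> {t0<..T} ==> t \<in> {t0<..T} ==> s \<le> t ==> F t - F s = integral {s..t} a'"
        "AE t in lebesgue. t \<in> {t0<..<T} --> f t = F t"
      then show thesis by (rule that)
    qed (use True t0 a1 in auto)
  qed (auto intro: that)
  \<comment> \<open>The value at \<open>t0\<close> is immaterial: the bound compares points on one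
    side, and a single point is a null set.\<close>
  define F where "F t = (if t < t0 then F1 t else F2 t)" for t
  show thesis
  proof (rule that[of c Gam F, OF c])
    show "continuous_on {0..T} Gam" unfolding Gam_def by (rule indefinite_integral_continuous_1[OF Gi]) auto
    show "Gam s \<le> Gam t" if "0 \<le> s" "s \<le> t" "t \<le> T" for s t
      using Gam[OF that] Henstock_Kurzweil_Integration.integral_nonneg[OF Gi[of s t]] that Gp by auto
    show "\<bar>F t - F s\<bar> \<le> c * \<bar>ln \<bar>t - t0\<bar> - ln \<bar>s - t0\<bar>\<bar> + (Gam t - Gam s)"
      if "s \<in> {0..T}" "t \<in> {0..T}" "s \<le> t" "t < t0 \<or> t0 < s" for s t
      using a2[of s t] that F1(1)[of s t] F2(1)[of s t] by (auto simp: F_def)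
    have "AE t in lebesgue. t \<notin> {t0, 0, T}"
      by (rule AE_not_in) (simp add: negligible_iff_null_sets[symmetric])
    then show "AE t in lebesgue. t \<in> {0..T} --> f t = F t"
      using F1(2) F2(2) by eventually_elim (auto simp: F_def)
  qed
qed

text \<open>\<open>Gam\<close> carries the integrable part of the time derivative, the logarithm its
  part of size \<open>1/|t - t0|\<close>. Points on opposite sides of \<open>t0\<close> are not
  compared, and ellipticity is asked off \<open>t0\<close>, because the representative is arbitrary
  at \<open>t0\<close>.\<close>

locale coefficients =
  fixes T t0 lam C :: real and Gam :: "real => real" and b :: "real => real ^ 'n ^ 'n"
  assumes T: "T > 0" and t0: "t0 \<in> {0..T}" and lam: "lam > 0" and C: "C \<ge> 0"
    and b_sym: "\<And>t i j. b t $ i $ j = b t $ j $ i"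
    and elliptic: "\<And>t \<xi>. t \<in> {0..T} ==> t \<noteq> t0 ==> lam * (norm \<xi>)\<^sup>2 \<le> \<xi> \<bullet> (b t *v \<xi>)"
    and b_int: "b absolutely_integrable_on {0..T}"
    and Gam_cont: "continuous_on {0..T} Gam"
    and Gam_mono: "\<And>s t. 0 \<le> s ==> s \<le> t ==> t \<le> T ==> Gam s \<le> Gam t"
    and b_var: "\<And>s t. s \<in> {0..T} ==> t \<in> {0..T} ==> s \<le> t ==> t < t0 \<or> t0 < s ==>
      norm (b t - b s) \<le> C * \<bar>ln \<bar>t - t0\<bar> - ln \<bar>s - t0\<bar>\<bar> + (Gam t - Gam s)"

text \<open>The modulus on the right-hand side is continuous off \<open>t0\<close> and vanishes on
  the diagonal. Points close enough to \<open>t\<close> lie on the same side of \<open>t0\<close>,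
  so the bound applies to them.\<close>

lemma tendsto_within_0_T:
  fixes f :: "real => 'b::real_normed_vector"
  assumes Gam: "continuous_on {0..T} Gam"
    and var: "\<And>s t. s \<in> {0..T} ==> t \<in> {0..T} ==> s \<le> t ==> t < t0 \<or> t0 < s ==>
      norm (f t - f s) \<le> c * \<bar>ln \<bar>t - t0\<bar> - ln \<bar>s - t0\<bar>\<bar> + (Gam t - Gam s)"
  shows "continuous_on ({0..T} - {t0}) f"
  unfolding continuous_on_def
proof
  fix t assume t: "t \<in> {0..T} - {t0}"
  let ?F = "at t within ({0..T} - {t0})"
  let ?g = "\<lambda>s. c * \<bar>ln \<bar>t - t0\<bar> - ln \<bar>s - t0\<bar>\<bar> + \<bar>Gam t - Gam s\<bar>"
  have G: "(Gam \<longlongrightarrow> Gam t) ?F"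
    by (rule tendsto_within_subset[of _ _ _ "{0..T}"]) (use Gam t in \<open>auto simp: continuous_on_def\<close>)
  have "(?g \<longlongrightarrow> c * \<bar>ln \<bar>t - t0\<bar> - ln \<bar>t - t0\<bar>\<bar> + \<bar>Gam t - Gam t\<bar>) ?F"
    by (intro tendsto_intros G) (use t in auto)
  then have lim: "(?g \<longlongrightarrow> 0) ?F" by simp
  have "\<forall>\<^sub>F s in ?F. norm (f s - f t) \<le> ?g s"
  proof -
    have "\<forall>\<^sub>F s in ?F. dist s t < \<bar>t - t0\<bar>"
      using t by (auto simp: eventually_at intro!: exI[of _ "\<bar>t - t0\<bar>"])
    moreover have "\<forall>\<^sub>F s in ?F. s \<in> {0..T} - {t0}" by (simp add: eventually_at_filter)
    ultimately show ?thesis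
    proof eventually_elim
      case (elim s)
      show ?case
      proof (cases "s \<le> t")
        case True
        then have "norm (f t - f s) \<le> c * \<bar>ln \<bar>t - t0\<bar> - ln \<bar>s - t0\<bar>\<bar> + (Gam t - Gam s)"
          by (intro var) (use elim t in \<open>auto simp: dist_real_def\<close>)
        then show ?thesis by (simp add: norm_minus_commute)
      next
        case False
        then have "norm (f s - f t) \<le> c * \<bar>ln \<bar>s - t0\<bar> - ln \<bar>t - t0\<bar>\<bar> + (Gam s - Gam t)"
          by (intro var) (use elim t in \<open>auto simp: dist_real_def\<close>)
        then show ?thesis by (simp add: abs_minus_commute)
      qed
    qed
  qed
  from Lim_null_comparison[OF this lim] have "((\<lambda>s. f s - f t) \<longlongrightarrow> 0) ?F" .
  then show "(f \<longlongrightarrow> f t) ?F" by (rule LIM_zero_cancel)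
qed

text \<open>Ellipticity of the representative is first known for almost every \<open>t\<close>;
  continuity carries it to each \<open>t \<noteq> t0\<close>.\<close>

lemma AE_nonneg_imp_nonneg:
  fixes h :: "real => real"
  assumes T: "T > 0" and cont: "continuous_on ({0..T} - {t0}) h"
    and ae: "AE t in lebesgue. t \<in> {0..T} --> h t \<ge> 0" and t: "t \<in> {0..T}" "t \<noteq> t0"
  shows "h t \<ge> 0"
proof (rule ccontr)
  assume "\<not> h t \<ge> 0"
  then have neg: "h t < 0" by simp
  have "(h \<longlongrightarrow> h t) (at t within {0..T} - {t0})"
    using cont t by (auto simp: continuous_on_def)
  then have "\<forall>\<^sub>F s in at t within {0..T} - {t0}. h s < 0"
    by (rule order_tendstoD) (rule neg)
  then obtain d where d: "d > 0" "\<And>s. s \<in> {0..T} - {t0} ==> s \<noteq> t ==> dist s t < d ==> h s < 0"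
    unfolding eventually_at by blast
  define e where "e = min d \<bar>t - t0\<bar>"
  have e: "e > 0" using d t by (simp add: e_def)
  have "max 0 (t - e) < min T (t + e)" using t T e by auto
  then obtain s where s: "max 0 (t - e) < s" "s < min T (t + e)" "s \<in> {0..T} --> h s \<ge> 0"
    by (rule AE_interval_nonempty[OF ae])
  then have "s \<noteq> t0" "dist s t < d" "s \<in> {0..T}" by (auto simp: e_def dist_real_def)
  then show False using d(2)[of s] s(3) neg by (cases "s = t") auto
qed

lemma symbol_quadratic_form:
  assumes "\<xi> \<noteq> 0"
  shows "(norm \<xi>)\<^sup>2 * symbol A t \<xi> = \<xi> \<bullet> (A t *v \<xi>)"
proof -
  have "symbol A t \<xi> = (\<Sum>i\<in>UNIV. \<Sum>j\<in>UNIV. A t $ i $ j * (\<xi> $ i) * (\<xi> $ j)) / (norm \<xi>)\<^sup>2"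
    by (simp add: symbol_def sum_divide_distrib)
  then have "(norm \<xi>)\<^sup>2 * symbol A t \<xi> = (\<Sum>i\<in>UNIV. \<Sum>j\<in>UNIV. A t $ i $ j * (\<xi> $ i) * (\<xi> $ j))"
    using assms by simp
  then show ?thesis
    by (simp add: inner_vec_def matrix_vector_mult_def sum_distrib_left mult_ac)
qed

text \<open>The hypotheses speak about the quadratic form only. Polarization recovers the entries
  from its values at finitely many vectors.\<close>

lemma matrix_entry_polarization:
  fixes M :: "real ^ 'n ^ 'n"
  assumes "\<And>i j. M $ i $ j = M $ j $ i"
  shows "M $ i $ j = ((axis i 1 + axis j 1) \<bullet> (M *v (axis i 1 + axis j 1)) - axis i 1 \<bullet> (M *v axis i 1) - axis j 1 \<bullet> (M *v axis j 1)) / 2"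
  using assms[of i j]
  by (simp add: matrix_vector_right_distrib inner_add_left inner_add_right matrix_vector_mul_component
      inner_axis' matrix_vector_mult_basis column_def)


lemma norm_matrix_le_entries:
  fixes M :: "real ^ 'n ^ 'm"
  shows "norm M \<le> (\<Sum>i\<in>UNIV. \<Sum>j\<in>UNIV. \<bar>M $ i $ j\<bar>)"
proof -
  have "norm M \<le> (\<Sum>i\<in>UNIV. norm (M $ i))"
    unfolding norm_vec_def by (rule L2_set_le_sum) simp
  also have "\<dots> \<le> (\<Sum>i\<in>UNIV. \<Sum>j\<in>UNIV. \<bar>M $ i $ j\<bar>)"
    by (intro sum_mono norm_le_l1_cart)
  finally show ?thesis .
qed

lemma absolutely_integrable_matrix:
  fixes f :: "real => real ^ 'n ^ 'm"
  assumes "\<And>i j. (\<lambda>t. f t $ i $ j) absolutely_integrable_on S"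
  shows "f absolutely_integrable_on S"
proof (rule absolutely_integrable_componentwise)
  fix e :: "real ^ 'n ^ 'm" assume "e \<in> Basis"
  then obtain i j where "e = axis i (axis j 1)" by (auto simp: Basis_vec_def)
  then have "f t \<bullet> e = f t $ i $ j" for t by (simp add: inner_axis)
  then show "(\<lambda>t. f t \<bullet> e) absolutely_integrable_on S" using assms by simp
qed

text \<open>Each direction comes with its own representative, constant and null set. Assembling the
  matrix from the directions \<open>e i\<close> and \<open>e i + e j\<close> leaves finitely many of
  them, so that one null set and one bound serve all frequencies at once.\<close>

lemma coefficients_exist:
  fixes T t0 p lam0 :: real and q :: ereal and A :: "real => real ^ 'n ^ 'n"
  assumes T: "T > 0" and t0: "t0 \<in> {0..T}"
    and symmetric: "\<And>t i j. t \<in> {0..T} ==> A t $ i $ j = A t $ j $ i"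
    and L1: "\<And>\<xi>. \<xi> \<noteq> 0 ==> (\<lambda>t. symbol A t \<xi>) absolutely_integrable_on {0<..<T}"
    and lam0: "lam0 > 0"
    and hyperbolic: "\<And>t \<xi>. t \<in> {0..T} ==> \<xi> \<noteq> 0 ==> symbol A t \<xi> \<ge> lam0"
    and q: "1 \<le> q" and p: "p \<ge> 0"
    and Lq: "\<And>\<xi>. \<xi> \<noteq> 0 ==>
      \<exists>a'. has_weak_derivative_on (\<lambda>t. symbol A t \<xi>) a' ({0<..<T} - {t0}) \<and>
           in_Lq q {0<..<T} (\<lambda>t. \<bar>t0 - t\<bar> powr p * a' t)"
    and pq: "ereal p + 1 / q \<le> 1"
  obtains C Gam b where "coefficients T t0 lam0 C Gam b" "AE t in lebesgue. t \<in> {0..T} --> A t = b t"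
proof -
  define Pr where "Pr \<xi> F c Gam \<longleftrightarrow> c \<ge> 0 \<and> continuous_on {0..T} Gam \<and> (\<forall>s t. 0 \<le> s --> s \<le> t --> t \<le> T --> Gam s \<le> Gam t) \<and>
    (\<forall>s t. s \<in> {0..T} --> t \<in> {0..T} --> s \<le> t --> t < t0 \<or> t0 < s -->
       \<bar>F t - F s\<bar> \<le> c * \<bar>ln \<bar>t - t0\<bar> - ln \<bar>s - t0\<bar>\<bar> + (Gam t - Gam s)) \<and>
    (AE t in lebesgue. t \<in> {0..T} --> symbol A t \<xi> = F t)" for \<xi> F c and Gam :: "real => real"
  have "\<exists>F c Gam. Pr \<xi> F c Gam" if \<xi>: "\<xi> \<noteq> 0" for \<xi>
  proof -
    obtain a' where a': "has_weak_derivative_on (\<lambda>t. symbol A t \<xi>) a' ({0<..<T} - {t0})"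
      "in_Lq q {0<..<T} (\<lambda>t. \<bar>t0 - t\<bar> powr p * a' t)"
      using Lq[OF \<xi>] by blast
    show ?thesis
    proof (rule singular_representative[OF T t0 a' q p pq])
      fix F c Gam
      assume "c \<ge> 0" "continuous_on {0..T} Gam" "\<And>s t. 0 \<le> s ==> s \<le> t ==> t \<le> T ==> Gam s \<le> Gam t"
        "\<And>s t. s \<in> {0..T} ==> t \<in> {0..T} ==> s \<le> t ==> t < t0 \<or> t0 < s ==>
          \<bar>F t - F s\<bar> \<le> c * \<bar>ln \<bar>t - t0\<bar> - ln \<bar>s - t0\<bar>\<bar> + (Gam t - Gam s)"
        "AE t in lebesgue. t \<in> {0..T} --> symbol A t \<xi> = F t"
      then have "Pr \<xi> F c Gam" unfolding Pr_def by simp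
      then show ?thesis by blast
    qed
  qed
  then obtain F c G where Pr: "\<And>\<xi>. \<xi> \<noteq> 0 ==> Pr \<xi> (F \<xi>) (c \<xi>) (G \<xi>)"
    by metis
  have c: "\<And>\<xi>. \<xi> \<noteq> 0 ==> c \<xi> \<ge> 0" and G: "\<And>\<xi>. \<xi> \<noteq> 0 ==> continuous_on {0..T} (G \<xi>)"
    and Gm: "\<And>\<xi> s t. \<xi> \<noteq> 0 ==> 0 \<le> s ==> s \<le> t ==> t \<le> T ==> G \<xi> s \<le> G \<xi> t"
    and F: "\<And>\<xi> s t. \<xi> \<noteq> 0 ==> s \<in> {0..T} ==> t \<in> {0..T} ==> s \<le> t ==> t < t0 \<or> t0 < s ==>
       \<bar>F \<xi> t - F \<xi> s\<bar> \<le> c \<xi> * \<bar>ln \<bar>t - t0\<bar> - ln \<bar>s - t0\<bar>\<bar> + (G \<xi> t - G \<xi> s)"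
    and AF: "\<And>\<xi>. \<xi> \<noteq> 0 ==> AE t in lebesgue. t \<in> {0..T} --> symbol A t \<xi> = F \<xi> t"
    using Pr[unfolded Pr_def] by blast+
  define z where "z i j = (axis i 1 + axis j 1 :: real ^ 'n)" for i j
  define e where "e i = (axis i 1 :: real ^ 'n)" for i
  have z0: "z i j \<noteq> 0" for i j
  proof
    assume "z i j = 0"
    then have "z i j $ i = 0" by simp
    then show False by (simp add: z_def axis_def split: if_splits)
  qed
  have e0: "e i \<noteq> 0" for i by (simp add: e_def axis_eq_0_iff)
  \<comment> \<open>\<open>symbol\<close> divides by the squared length of the direction, which is
    not 1 for \<open>z i j\<close>.\<close>
  define w where "w i j = (norm (z i j))\<^sup>2" for i j
  have w: "w i j \<ge> 0" for i j by (simp add: w_def)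
  have e1: "norm (e i) = 1" for i by (simp add: e_def)
  define b where "b t = (\<chi> i j. (w i j * F (z i j) t - F (e i) t - F (e j) t) / 2)" for t
  define C where "C = (\<Sum>i\<in>UNIV. \<Sum>j\<in>UNIV. w i j * c (z i j) + c (e i) + c (e j))"
  define Gam where "Gam t = (\<Sum>i\<in>UNIV. \<Sum>j\<in>UNIV. w i j * G (z i j) t + G (e i) t + G (e j) t)" for t
  have bsym: "b t $ i $ j = b t $ j $ i" for t i j
    by (simp add: b_def w_def z_def add.commute)
  have AEall: "AE t in lebesgue. \<forall>i\<in>UNIV. \<forall>j\<in>UNIV. t \<in> {0..T} --> symbol A t (z i j) = F (z i j) t \<and> symbol A t (e i) = F (e i) t"
    using AF[OF z0] AF[OF e0] by (intro AE_finite_allI AE_conjI) (auto simp: eventually_conj_iff imp_conjR)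
  have Apol: "A t $ i $ j = (w i j * symbol A t (z i j) - symbol A t (e i) - symbol A t (e j)) / 2" if "t \<in> {0..T}" for t i j
    using matrix_entry_polarization[of "A t", OF symmetric[OF that], of i j]
      symbol_quadratic_form[OF z0, of i j A t] symbol_quadratic_form[OF e0, of i A t] symbol_quadratic_form[OF e0, of j A t]
    by (simp add: e1 w_def) (simp add: z_def e_def)
  have AB: "AE t in lebesgue. t \<in> {0..T} --> A t = b t"
    using AEall
  proof eventually_elim
    fix t assume "\<forall>i\<in>UNIV. \<forall>j\<in>UNIV. t \<in> {0..T} --> symbol A t (z i j) = F (z i j) t \<and> symbol A t (e i) = F (e i) t"
    then show "t \<in> {0..T} --> A t = b t" using Apol by (simp add: vec_eq_iff b_def)
  qed
  have var: "norm (b t - b s) \<le> C * \<bar>ln \<bar>t - t0\<bar> - ln \<bar>s - t0\<bar>\<bar> + (Gam t - Gam s)"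
    if st: "s \<in> {0..T}" "t \<in> {0..T}" "s \<le> t" "t < t0 \<or> t0 < s" for s t
  proof -
    let ?L = "\<bar>ln \<bar>t - t0\<bar> - ln \<bar>s - t0\<bar>\<bar>"
    have "norm (b t - b s) \<le> (\<Sum>i\<in>UNIV. \<Sum>j\<in>UNIV. \<bar>(b t - b s) $ i $ j\<bar>)"
      by (rule norm_matrix_le_entries)
    also have "\<dots> \<le> (\<Sum>i\<in>UNIV. \<Sum>j\<in>UNIV. (w i j * c (z i j) + c (e i) + c (e j)) * ?L
        + ((w i j * G (z i j) t + G (e i) t + G (e j) t) - (w i j * G (z i j) s + G (e i) s + G (e j) s)))"
    proof (intro sum_mono)
      fix i j
      have "\<bar>(b t - b s) $ i $ j\<bar> = \<bar>w i j * (F (z i j) t - F (z i j) s) - (F (e i) t - F (e i) s) - (F (e j) t - F (e j) s)\<bar> / 2"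
      proof -
        have "(b t - b s) $ i $ j = (w i j * (F (z i j) t - F (z i j) s) - (F (e i) t - F (e i) s) - (F (e j) t - F (e j) s)) / 2"
          by (simp add: b_def field_simps)
        then show ?thesis by (simp only: abs_divide abs_numeral)
      qed
      also have "\<dots> \<le> \<bar>w i j * (F (z i j) t - F (z i j) s) - (F (e i) t - F (e i) s) - (F (e j) t - F (e j) s)\<bar>" by simp
      also have "\<dots> \<le> w i j * \<bar>F (z i j) t - F (z i j) s\<bar> + \<bar>F (e i) t - F (e i) s\<bar> + \<bar>F (e j) t - F (e j) s\<bar>"
        using abs_mult[of "w i j" "F (z i j) t - F (z i j) s"] w[of i j] by linarith
      also have "\<dots> \<le> w i j * (c (z i j) * ?L + (G (z i j) t - G (z i j) s)) + (c (e i) * ?L + (G (e i) t - G (e i) s))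
          + (c (e j) * ?L + (G (e j) t - G (e j) s))"
        by (intro add_mono mult_left_mono F z0 e0 st w)
      also have "\<dots> = (w i j * c (z i j) + c (e i) + c (e j)) * ?L
        + ((w i j * G (z i j) t + G (e i) t + G (e j) t) - (w i j * G (z i j) s + G (e i) s + G (e j) s))"
        by (simp add: algebra_simps)
      finally show "\<bar>(b t - b s) $ i $ j\<bar> \<le> (w i j * c (z i j) + c (e i) + c (e j)) * ?L
        + ((w i j * G (z i j) t + G (e i) t + G (e j) t) - (w i j * G (z i j) s + G (e i) s + G (e j) s))" .
    qed
    also have "\<dots> = C * ?L + (Gam t - Gam s)"
    proof -
      have "C * ?L = (\<Sum>i\<in>UNIV. \<Sum>j\<in>UNIV. (w i j * c (z i j) + c (e i) + c (e j)) * ?L)"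
        by (simp only: C_def sum_distrib_right)
      then show ?thesis by (simp only: Gam_def sum.distrib sum_subtractf)
    qed
    finally show ?thesis .
  qed
  have Gamc: "continuous_on {0..T} Gam"
    unfolding Gam_def by (intro continuous_intros G z0 e0)
  have bc: "continuous_on ({0..T} - {t0}) b"
    by (rule tendsto_within_0_T[OF Gamc var])
  have "coefficients T t0 lam0 C Gam b"
  proof
    show "C \<ge> 0" unfolding C_def by (intro sum_nonneg add_nonneg_nonneg mult_nonneg_nonneg w c z0 e0)
    show "Gam s \<le> Gam t" if "0 \<le> s" "s \<le> t" "t \<le> T" for s t
      unfolding Gam_def by (intro sum_mono add_mono mult_left_mono Gm w z0 e0 that)
    show "lam0 * (norm \<xi>)\<^sup>2 \<le> \<xi> \<bullet> (b t *v \<xi>)" if t: "t \<in> {0..T}" "t \<noteq> t0" for t \<xi>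
    proof -
      have "0 \<le> \<xi> \<bullet> (b t *v \<xi>) - lam0 * (norm \<xi>)\<^sup>2"
      proof (rule AE_nonneg_imp_nonneg[OF T _ _ t])
        show "continuous_on ({0..T} - {t0}) (\<lambda>t. \<xi> \<bullet> (b t *v \<xi>) - lam0 * (norm \<xi>)\<^sup>2)"
          unfolding inner_vec_def matrix_vector_mult_def
          by (auto intro!: continuous_intros bc)
        show "AE t in lebesgue. t \<in> {0..T} --> 0 \<le> \<xi> \<bullet> (b t *v \<xi>) - lam0 * (norm \<xi>)\<^sup>2"
          using AB
        proof eventually_elim
          fix t assume "t \<in> {0..T} --> A t = b t"
          then show "t \<in> {0..T} --> 0 \<le> \<xi> \<bullet> (b t *v \<xi>) - lam0 * (norm \<xi>)\<^sup>2"
            using hyperbolic[of t \<xi>] symbol_quadratic_form[of \<xi> A t]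
              mult_left_mono[of lam0 "symbol A t \<xi>" "(norm \<xi>)\<^sup>2"]
            by (cases "\<xi> = 0") (auto simp: mult.commute)
        qed
      qed
      then show ?thesis by simp
    qed
    show "b absolutely_integrable_on {0..T}"
    proof -
      have sa: "(\<lambda>t. symbol A t \<xi>) absolutely_integrable_on {0..T}" if "\<xi> \<noteq> 0" for \<xi>
        using L1[OF that] absolutely_integrable_on_open_interval[where f = "\<lambda>t. symbol A t \<xi>" and a = 0 and b = T] by simp
      have "A absolutely_integrable_on {0..T}"
      proof (rule absolutely_integrable_matrix)
        fix i j
        have "(\<lambda>t. (1/2) * (w i j * symbol A t (z i j) - symbol A t (e i) - symbol A t (e j))) absolutely_integrable_on {0..T}"
          by (intro set_integrable_mult_right set_integral_diff sa z0 e0)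
        then show "(\<lambda>t. A t $ i $ j) absolutely_integrable_on {0..T}"
          by (rule absolutely_integrable_spike[OF _ negligible_empty]) (simp add: Apol)
      qed
      note A = this
      obtain N where N: "negligible N" "\<And>t. t \<notin> N ==> t \<in> {0..T} --> A t = b t"
        using AE_lebesgue_negligible[OF AB] by metis
      show ?thesis
      proof (rule absolutely_integrable_spike[OF A N(1)])
        fix x assume "x \<in> {0..T} - N"
        then show "b x = A x" using N(2)[of x] by simp
      qed
    qed
  qed (use T t0 lam0 bsym Gamc var in auto)
  with AB show thesis using that by blast
qed

text \<open>Gronwall's inequality in a form that needs no derivative of \<open>E\<close> and \<open>M\<close>, which are merely of
  bounded variation in the applications.\<close>

lemma difference_nonincreasing:
  fixes f M :: "real => real"
  assumes ab: "a \<le> b"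
    and inc: "\<And>e. e > 0 ==> \<exists>d>0. \<forall>s t. a \<le> s --> s \<le> t --> t \<le> b --> t - s < d --> f t - f s \<le> e * (M t - M s)"
  shows "f b \<le> f a"
proof -
  have "f b - f a \<le> e * (M b - M a)" if ep: "e > 0" for e
  proof -
    obtain d where d: "d > 0" "\<And>s t. a \<le> s ==> s \<le> t ==> t \<le> b ==> t - s < d ==> f t - f s \<le> e * (M t - M s)"
      using inc[OF ep] by blast
    obtain n :: nat where n: "(b - a) / d < real n" using reals_Archimedean2 by blast
    then have np: "real n > 0" using ab d(1) by (metis diff_ge_0_iff_ge divide_nonneg_pos le_less_trans)
    define h where "h = (b - a) / n"
    have h: "h \<ge> 0" "h < d" "n * h = b - a" using n np ab d(1) by (auto simp: h_def field_simps)
    define x where "x i = a + real i * h" for i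
    have step: "f (x (Suc i)) - f (x i) \<le> e * (M (x (Suc i)) - M (x i))" if "i < n" for i
    proof (rule d(2))
      have "real (Suc i) * h \<le> real n * h" using that h by (intro mult_right_mono) auto
      then show "x (Suc i) \<le> b" using h by (simp add: x_def)
    qed (use h in \<open>auto simp: x_def algebra_simps\<close>)
    have "(\<Sum>i<n. f (x (Suc i)) - f (x i)) \<le> (\<Sum>i<n. e * (M (x (Suc i)) - M (x i)))"
      by (intro sum_mono step) auto
    then have "f (x n) - f (x 0) \<le> e * (M (x n) - M (x 0))"
      using sum_lessThan_telescope[of "\<lambda>i. f (x i)" n] sum_lessThan_telescope[of "\<lambda>i. M (x i)" n]
      by (simp add: sum_distrib_left[symmetric])
    then show ?thesis using h by (simp add: x_def)
  qed
  note le = this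
  show ?thesis
  proof (rule ccontr)
    assume "\<not> f b \<le> f a"
    then have p: "f b - f a > 0" by simp
    define e where "e = (f b - f a) / (2 * (\<bar>M b - M a\<bar> + 1))"
    have e: "e > 0" unfolding e_def by (intro divide_pos_pos mult_pos_pos p) (simp_all add: add_nonneg_pos)
    have "f b - f a \<le> e * (M b - M a)" using le[OF e] .
    also have "\<dots> \<le> e * (\<bar>M b - M a\<bar> + 1)" using e by (intro mult_left_mono) auto
    also have "\<dots> = (f b - f a) / 2"
    proof -
      have "\<bar>M b - M a\<bar> + 1 \<noteq> 0" by linarith
      then show ?thesis by (simp add: e_def field_simps)
    qed
    finally show False using p by simp
  qed
qed

text \<open>The slack \<open>e\<close> makes \<open>inc\<close> verifiable by uniform continuity,
  since on short intervals the energy may be replaced by its value at the left end. Multiplied by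
  \<open>exp (- M)\<close> the energy is nonincreasing up to \<open>e\<close> times the increments
  of \<open>M\<close>, because \<open>(1 + m) exp (- m) \<le> 1\<close>.\<close>

lemma difference_gronwall:
  fixes E M :: "real => real"
  assumes ab: "a \<le> b" and Ep: "\<And>t. a \<le> t ==> t \<le> b ==> 0 \<le> E t"
    and M: "\<And>s t. a \<le> s ==> s \<le> t ==> t \<le> b ==> M s \<le> M t"
    and inc: "\<And>e. e > 0 ==> \<exists>d>0. \<forall>s t. a \<le> s --> s \<le> t --> t \<le> b --> t - s < d -->
      E t - E s \<le> (M t - M s) * (E s + e)"
  shows "E b \<le> exp (M b - M a) * E a"
proof -
  have "exp (- M b) * E b \<le> exp (- M a) * E a"
  proof (rule difference_nonincreasing[OF ab])
    fix e :: real assume e: "e > 0"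
    \<comment> \<open>The slack is scaled by \<open>exp (M a)\<close> to meet the later factor
      \<open>exp (- M t)\<close>; the product of the two is at most 1.\<close>
    then have e': "e * exp (M a) > 0" by simp
    obtain d where d: "d > 0" "\<And>s t. a \<le> s ==> s \<le> t ==> t \<le> b ==> t - s < d ==>
        E t - E s \<le> (M t - M s) * (E s + e * exp (M a))"
      using inc[OF e'] by blast
    show "\<exists>d>0. \<forall>s t. a \<le> s --> s \<le> t --> t \<le> b --> t - s < d -->
        exp (- M t) * E t - exp (- M s) * E s \<le> e * (M t - M s)"
    proof (intro exI conjI allI impI)
      fix s t assume st: "a \<le> s" "s \<le> t" "t \<le> b" "t - s < d"
      define m where "m = M t - M s"
      have m: "m \<ge> 0" using M[of s t] st by (simp add: m_def)
      have Mt: "exp (- M t) = exp (- M s) * exp (- m)" by (simp add: m_def flip: exp_add)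
      have Es: "E s \<ge> 0" using Ep st by auto
      have "exp (- M t) * E t \<le> exp (- M t) * (E s * (1 + m) + m * (e * exp (M a)))"
        using d(2)[OF st] by (intro mult_left_mono) (auto simp: m_def algebra_simps)
      also have "\<dots> = exp (- M s) * E s * (exp (- m) * (1 + m)) + m * e * (exp (- M t) * exp (M a))"
        by (simp add: Mt algebra_simps)
      also have "\<dots> \<le> exp (- M s) * E s * 1 + m * e * 1"
      proof (intro add_mono mult_left_mono)
        have "exp (- m) * (1 + m) \<le> exp (- m) * exp m"
          using exp_ge_add_one_self[of m] by (intro mult_left_mono) auto
        then show "exp (- m) * (1 + m) \<le> 1" by (simp flip: exp_add)
        show "exp (- M t) * exp (M a) \<le> 1"
          using M[of a t] st by (simp flip: exp_add)
      qed (use Es m e in auto)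
      finally show "exp (- M t) * E t - exp (- M s) * E s \<le> e * (M t - M s)" by (simp add: m_def mult.commute)
    qed (rule d(1))
  qed
  then have "exp (M b) * (exp (- M b) * E b) \<le> exp (M b) * (exp (- M a) * E a)"
    by (intro mult_left_mono) auto
  then show ?thesis by (simp add: exp_diff exp_minus field_simps)
qed

subsection \<open>Linear oscillators with integrable coefficient\<close>

lemma absolutely_integrable_scaleR_continuous:
  fixes y :: "real => 'b::euclidean_space" and \<alpha> :: "real => real"
  assumes "\<alpha> absolutely_integrable_on {a..b}" "continuous_on {a..b} y"
  shows "(\<lambda>r. \<alpha> r *\<^sub>R y r) absolutely_integrable_on {a..b}"
proof (rule absolutely_integrable_bounded_measurable_product[where h = "\<lambda>x c. c *\<^sub>R x"])
  show "bilinear (\<lambda>x c. c *\<^sub>R x :: 'b)"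
    by (simp add: bilinear_conv_bounded_bilinear bounded_bilinear.flip[OF bounded_bilinear_scaleR])
  show "bounded (y ` {a..b})"
    using assms(2) compact_continuous_image compact_imp_bounded by blast
  show "y \<in> borel_measurable (lebesgue_on {a..b})"
    by (rule continuous_imp_measurable_on_sets_lebesgue) (use assms(2) in auto)
qed (use assms in auto)

lemma indefinite_integral_derivative:
  fixes f :: "real => 'b::banach"
  assumes f: "f integrable_on {a..b}" and cont: "continuous_on ({a..b} - {t0}) f"
    and x: "x \<in> {a..b}" "x \<noteq> t0"
  shows "((\<lambda>u. integral {a..u} f) has_vector_derivative f x) (at x within {a..b})"
proof -
  have "((\<lambda>u. integral {a..u} f) has_vector_derivative f x) (at x within ({a..b} - {t0}))"
    by (rule integral_has_vector_derivative_continuous_at[OF f])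
      (use cont x in \<open>auto simp: continuous_on_eq_continuous_within\<close>)
  moreover have "at x within ({a..b} - {t0}) = at x within {a..b}"
    by (rule at_within_nhd[of _ "- {t0}"]) (use x in auto)
  ultimately show ?thesis by simp
qed

text \<open>The source of the factorials in the Picard iteration: \<open>K\<close> is a primitive of
  \<open>k\<close> off \<open>t0\<close> and continuous at \<open>t0\<close>, so
  \<open>k K^m\<close> has the primitive \<open>K^(m+1) / (m+1)\<close>.\<close>

lemma integral_power_primitive_bound:
  fixes k :: "real => real"
  assumes k: "k integrable_on {0..T}" "continuous_on ({0..T} - {t0}) k"
    and t: "t \<in> {0..T}"
  defines "K \<equiv> \<lambda>t. integral {0..t} k"
  shows "((\<lambda>r. k r * K r ^ m) has_integral (K t ^ Suc m / Suc m)) {0..t}"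
proof -
  have "((\<lambda>r. k r * K r ^ m) has_integral (K t ^ Suc m / Suc m - K 0 ^ Suc m / Suc m)) {0..t}"
  proof (rule fundamental_theorem_of_calculus_interior_strong[where S = "{t0}"])
    show "continuous_on {0..t} (\<lambda>t. K t ^ Suc m / Suc m)"
      unfolding K_def using t
      by (intro continuous_intros indefinite_integral_continuous_1 integrable_on_subinterval[OF k(1)]) auto
    fix x assume x: "x \<in> {0<..<t} - {t0}"
    have "(K has_vector_derivative k x) (at x within {0..T})"
      unfolding K_def by (rule indefinite_integral_derivative[OF k]) (use x t in auto)
    moreover have "at x within {0..T} = at x"
      by (rule at_within_interior) (use x t in auto)
    ultimately have d: "(K has_real_derivative k x) (at x)"
      by (simp add: has_real_derivative_iff_has_vector_derivative)
    show "((\<lambda>t. K t ^ Suc m / Suc m) has_vector_derivative k x * K x ^ m) (at x)"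
      unfolding has_real_derivative_iff_has_vector_derivative[symmetric]
      by (rule DERIV_cdivide[OF DERIV_power[OF d], THEN DERIV_cong]) (auto simp: field_simps)
  qed (use t in auto)
  then show ?thesis by (simp add: K_def)
qed

text \<open>Picard iteration for the first-order system of \<open>(y, v)\<close>, whose right-hand
  side has the integrable Lipschitz constant \<open>k = 1 + |\<alpha>|\<close>. The corrections
  decay like \<open>K^m / m!\<close> and converge uniformly up to and across
  \<open>t0\<close>.\<close>

lemma oscillator_solution:
  fixes \<alpha> :: "real => real" and y0 v0 :: complex
  assumes T: "T > 0" and \<alpha>: "\<alpha> absolutely_integrable_on {0..T}" and cont: "continuous_on ({0..T} - {t0}) \<alpha>"
  obtains y v where "continuous_on {0..T} y" "continuous_on {0..T} v" "y 0 = y0" "v 0 = v0"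
    "\<And>t. t \<in> {0..T} ==> (y has_vector_derivative v t) (at t within {0..T})"
    "\<And>t. t \<in> {0..T} ==> t \<noteq> t0 ==> (v has_vector_derivative - (\<alpha> t *\<^sub>R y t)) (at t within {0..T})"
proof -
  define F where "F t z = (snd z, - (\<alpha> t *\<^sub>R fst z))" for t and z :: "complex \<times> complex"
  define k where "k t = 1 + \<bar>\<alpha> t\<bar>" for t
  have ki: "k integrable_on {0..T}"
    unfolding k_def using \<alpha> by (auto simp: absolutely_integrable_on_def intro!: Henstock_Kurzweil_Integration.integrable_add)
  have kc: "continuous_on ({0..T} - {t0}) k" unfolding k_def by (intro continuous_intros cont)
  define K where "K t = integral {0..t} k" for t
  have kp: "k t \<ge> 1" for t by (simp add: k_def)
  have K0: "0 \<le> K t" and KT: "K t \<le> K T" if "t \<in> {0..T}" for t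
  proof -
    show "0 \<le> K t" unfolding K_def
      by (rule Henstock_Kurzweil_Integration.integral_nonneg) (use that order_trans[OF zero_le_one kp] integrable_on_subinterval[OF ki] in auto)
    show "K t \<le> K T" unfolding K_def
      by (rule integral_subset_le) (use that order_trans[OF zero_le_one kp] integrable_on_subinterval[OF ki] in auto)
  qed
  have FN: "norm (F t z) \<le> k t * norm z" for t z
  proof -
    have "norm (F t z) \<le> norm (snd z) + norm (\<alpha> t *\<^sub>R fst z)"
      unfolding F_def using norm_Pair_le[of "snd z" "- (\<alpha> t *\<^sub>R fst z)"] by simp
    also have "\<dots> \<le> norm z + \<bar>\<alpha> t\<bar> * norm z"
      using norm_snd_le[of "snd z" "fst z"] norm_fst_le[of "fst z" "snd z"] by (auto intro!: add_mono mult_left_mono)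
    finally show ?thesis by (simp add: k_def algebra_simps)
  qed
  have Fi: "(\<lambda>r. F r (Z r)) absolutely_integrable_on {0..T}" if Z: "continuous_on {0..T} Z" for Z
  proof -
    have 1: "(\<lambda>r. snd (Z r)) absolutely_integrable_on {0..T}"
      by (intro absolutely_integrable_continuous_real continuous_intros Z)
    have 2: "(\<lambda>r. - (\<alpha> r *\<^sub>R fst (Z r))) absolutely_integrable_on {0..T}"
      using absolutely_integrable_linear[OF absolutely_integrable_scaleR_continuous[OF \<alpha> continuous_on_fst[OF Z]]
          bounded_linear_minus[OF bounded_linear_ident]] by (simp add: o_def)
    have "(\<lambda>r. (snd (Z r), 0) + (0, - (\<alpha> r *\<^sub>R fst (Z r)))) absolutely_integrable_on {0..T}"
      using absolutely_integrable_linear[OF 1 bounded_linear_Pair[OF bounded_linear_ident bounded_linear_zero]]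
        absolutely_integrable_linear[OF 2 bounded_linear_Pair[OF bounded_linear_zero bounded_linear_ident]]
      by (intro set_integral_add(1)) (simp_all add: o_def)
    then show ?thesis by (simp add: F_def)
  qed
  have Fi': "(\<lambda>r. F r (Z r)) integrable_on {0..t}" if "continuous_on {0..T} Z" "t \<in> {0..T}" for Z t
    using integrable_on_subinterval[of "\<lambda>r. F r (Z r)" "{0..T}" 0 t] Fi[OF that(1)] that(2)
    by (auto simp: absolutely_integrable_on_def)
  \<comment> \<open>\<open>Z m\<close> is the difference of successive Picard iterates; the system
    is linear, so the differences can be iterated by themselves.\<close>
  define Z where "Z = rec_nat (\<lambda>t. (y0, v0)) (\<lambda>m Zm t. integral {0..t} (\<lambda>r. F r (Zm r)))"
  have Z0: "Z 0 = (\<lambda>t. (y0, v0))" and ZS: "Z (Suc m) = (\<lambda>t. integral {0..t} (\<lambda>r. F r (Z m r)))" for m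
    by (simp_all add: Z_def)
  have Zc: "continuous_on {0..T} (Z m)" for m
  proof (induction m)
    case (Suc m)
    show ?case unfolding ZS by (rule indefinite_integral_continuous_1[OF Fi']) (use Suc T in auto)
  qed (simp add: Z0)
  define c where "c = norm (y0, v0)"
  have ZN: "norm (Z m t) \<le> c * (K t ^ m / fact m)" if "t \<in> {0..T}" for m t
    using that
  proof (induction m arbitrary: t)
    case (Suc m)
    have hi: "((\<lambda>r. c / fact m * (k r * K r ^ m)) has_integral c / fact m * (K t ^ Suc m / Suc m)) {0..t}"
      unfolding K_def by (intro has_integral_mult_right integral_power_primitive_bound[OF ki kc Suc.prems])
    have "norm (Z (Suc m) t) \<le> integral {0..t} (\<lambda>r. c / fact m * (k r * K r ^ m))"
      unfolding ZS
    proof (rule Henstock_Kurzweil_Integration.integral_norm_bound_integral)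
      fix r assume r: "r \<in> {0..t}"
      have "norm (F r (Z m r)) \<le> k r * (c * (K r ^ m / fact m))"
        using order_trans[OF FN mult_left_mono[OF Suc.IH]] r Suc.prems order_trans[OF zero_le_one kp] by auto
      then show "norm (F r (Z m r)) \<le> c / fact m * (k r * K r ^ m)" by (simp add: algebra_simps)
    qed (use hi Fi'[OF Zc Suc.prems] in \<open>auto simp: has_integral_iff\<close>)
    also have "\<dots> = c * (K t ^ Suc m / fact (Suc m))"
      unfolding integral_unique[OF hi]
      by (simp only: times_divide_times_eq times_divide_eq_right times_divide_eq_left divide_divide_eq_left fact_Suc mult.commute)
    finally show ?case .
  qed (simp add: Z0 c_def)
  have cp: "c \<ge> 0" by (simp add: c_def)
  define B where "B m = c * (K T ^ m / fact m)" for m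
  have ZB: "norm (Z m t) \<le> B m" if "t \<in> {0..T}" for m t
  proof -
    have "c * (K t ^ m / fact m) \<le> B m"
      unfolding B_def using KT[OF that] K0[OF that] cp
      by (intro mult_left_mono divide_right_mono power_mono) auto
    then show ?thesis using ZN[OF that, of m] by linarith
  qed
  have sB: "summable B"
    unfolding B_def using summable_exp[of "K T"] by (intro summable_mult) (simp add: divide_inverse mult.commute)
  define Y where "Y t = (\<Sum>m. Z m t)" for t
  have ul: "uniform_limit {0..T} (\<lambda>n t. \<Sum>m<n. Z m t) Y sequentially"
    unfolding Y_def[abs_def] by (rule Weierstrass_m_test[OF ZB sB])
  have Yc: "continuous_on {0..T} Y"
    by (rule uniform_limit_theorem[OF _ ul]) (auto intro!: always_eventually continuous_intros Zc)
  have Sc: "continuous_on {0..T} (\<lambda>t. \<Sum>m<n. Z m t)" for n by (intro continuous_intros Zc)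
  have Seq: "(\<Sum>m<Suc n. Z m t) = (y0, v0) + integral {0..t} (\<lambda>r. F r (\<Sum>m<n. Z m r))" if t: "t \<in> {0..T}" for n t
  proof -
    have Fsum: "F r (\<Sum>m<n. Z m r) = (\<Sum>m<n. F r (Z m r))" for r
      by (induction n) (auto simp: F_def algebra_simps prod_eq_iff)
    have "(\<Sum>m<Suc n. Z m t) = Z 0 t + (\<Sum>m<n. Z (Suc m) t)"
      by (rule sum.lessThan_Suc_shift)
    also have "(\<Sum>m<n. Z (Suc m) t) = integral {0..t} (\<lambda>r. \<Sum>m<n. F r (Z m r))"
      unfolding ZS by (rule Henstock_Kurzweil_Integration.integral_sum[symmetric]) (use Fi'[OF Zc t] in auto)
    finally show ?thesis by (simp add: Z0 Fsum)
  qed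
  have Yeq: "Y t = (y0, v0) + integral {0..t} (\<lambda>r. F r (Y r))" if t: "t \<in> {0..T}" for t
  proof -
    have pl: "(\<lambda>n. \<Sum>m<n. Z m r) \<longlonglongrightarrow> Y r" if "r \<in> {0..T}" for r
      using tendsto_uniform_limitI[OF ul that] .
    have "(\<lambda>n. integral {0..t} (\<lambda>r. F r (\<Sum>m<n. Z m r))) \<longlonglongrightarrow> integral {0..t} (\<lambda>r. F r (Y r))"
    proof (rule dominated_convergence(2)[where h = "\<lambda>r. suminf B * k r"])
      show "(\<lambda>r. suminf B * k r) integrable_on {0..t}"
        using integrable_on_subinterval[OF ki, of 0 t] t by (intro integrable_on_mult_right) auto
      fix n r assume r: "r \<in> {0..t}"
      then have r': "r \<in> {0..T}" using t by auto
      have "norm (\<Sum>m<n. Z m r) \<le> (\<Sum>m<n. B m)" by (intro sum_norm_le ZB r')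
      also have "\<dots> \<le> suminf B"
        using sB order_trans[OF norm_ge_zero ZB[OF r']] by (intro sum_le_suminf) auto
      finally show "norm (F r (\<Sum>m<n. Z m r)) \<le> suminf B * k r"
        using order_trans[OF FN mult_left_mono] order_trans[OF zero_le_one kp] by (simp add: mult.commute)
      show "(\<lambda>n. F r (\<Sum>m<n. Z m r)) \<longlonglongrightarrow> F r (Y r)"
        unfolding F_def by (intro tendsto_intros pl r')
    qed (use Fi'[OF Sc t] in auto)
    then have "(\<lambda>n. (\<Sum>m<Suc n. Z m t)) \<longlonglongrightarrow> (y0, v0) + integral {0..t} (\<lambda>r. F r (Y r))"
      unfolding Seq[OF t] by (intro tendsto_intros)
    moreover have "(\<lambda>n. (\<Sum>m<Suc n. Z m t)) \<longlonglongrightarrow> Y t"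
      using LIMSEQ_Suc[OF pl[OF t]] .
    ultimately show ?thesis using LIMSEQ_unique by blast
  qed
  have YF: "((\<lambda>t. (y0, v0) + integral {0..t} (\<lambda>r. F r (Y r))) has_vector_derivative F t (Y t)) (at t within {0..T})"
    if t: "t \<in> {0..T}" "t \<noteq> t0" for t
  proof -
    have "continuous_on ({0..T} - {t0}) (\<lambda>r. F r (Y r))"
      unfolding F_def by (intro continuous_intros cont continuous_on_subset[OF Yc]) auto
    from indefinite_integral_derivative[OF Fi'[OF Yc] this t] T show ?thesis
      by (auto intro!: derivative_eq_intros)
  qed
  have Yd: "(Y has_vector_derivative F t (Y t)) (at t within {0..T})" if t: "t \<in> {0..T}" "t \<noteq> t0" for t
    by (rule has_vector_derivative_transform[OF t(1) _ YF[OF t]]) (rule Yeq)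
  define y where "y t = fst (Y t)" for t
  define v where "v t = snd (Y t)" for t
  have yc: "continuous_on {0..T} y" "continuous_on {0..T} v"
    unfolding y_def v_def by (intro continuous_intros Yc)+
  have yd: "(y has_vector_derivative v t) (at t within {0..T})" if t: "t \<in> {0..T}" "t \<noteq> t0" for t
    using bounded_linear.has_vector_derivative[OF bounded_linear_fst Yd[OF t]]
    by (simp add: y_def[abs_def] v_def F_def)
  have vd: "(v has_vector_derivative - (\<alpha> t *\<^sub>R y t)) (at t within {0..T})" if t: "t \<in> {0..T}" "t \<noteq> t0" for t
    using bounded_linear.has_vector_derivative[OF bounded_linear_snd Yd[OF t]]
    by (simp add: y_def v_def[abs_def] F_def)
  \<comment> \<open>The derivative of \<open>Y\<close> is known off \<open>t0\<close> only. Since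
    \<open>v\<close> is continuous, integrating it makes \<open>y\<close> differentiable at
    \<open>t0\<close> as well.\<close>
  have yi: "y t = y0 + integral {0..t} v" if t: "t \<in> {0..T}" for t
  proof -
    have "(v has_integral (y t - y 0)) {0..t}"
    proof (rule fundamental_theorem_of_calculus_interior_strong[where S = "{t0}"])
      fix x assume x: "x \<in> {0<..<t} - {t0}"
      have "at x within {0..T} = at x" by (rule at_within_interior) (use x t in auto)
      then show "(y has_vector_derivative v x) (at x)" using yd[of x] x t by auto
    qed (use t continuous_on_subset[OF yc(1)] in auto)
    moreover have "y 0 = y0" using Yeq[of 0] T by (simp add: y_def)
    ultimately show ?thesis by (simp add: integral_unique)
  qed
  show thesis
  proof (rule that[OF yc])
    show "y 0 = y0" "v 0 = v0" using Yeq[of 0] T by (simp_all add: y_def v_def)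
    fix t assume t: "t \<in> {0..T}"
    have "((\<lambda>t. y0 + integral {0..t} v) has_vector_derivative v t) (at t within {0..T})"
      using integral_has_vector_derivative[OF yc(2) t] by (auto intro!: derivative_eq_intros)
    from has_vector_derivative_transform[OF t _ this] yi
    show "(y has_vector_derivative v t) (at t within {0..T})" by blast
  qed (rule vd)
qed


lemma uniformly_continuous_onD:
  fixes f :: "'a::metric_space => 'b::metric_space"
  assumes "continuous_on S f" "compact S" "e > 0"
  obtains d where "d > 0" "\<And>x y. x \<in> S ==> y \<in> S ==> dist x y < d ==> dist (f x) (f y) < e"
  using compact_uniformly_continuous[OF assms(1,2)] assms(3) unfolding uniformly_continuous_on_def by metis

text \<open>The coefficient \<open>\<beta>\<close> is frozen at the left end of each small interval, so that it need not be
  differentiable.\<close>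

lemma energy_frozen_coefficient:
  fixes F0 F0' V :: "real => real" and F F' \<beta> :: "real => 'a::euclidean_space"
  assumes ad: "a \<le> d" and \<beta>: "continuous_on {a..d} \<beta>" and F': "continuous_on {a..d} F'"
    and d0: "\<And>t. t \<in> {a..d} ==> (F0 has_real_derivative F0' t) (at t within {a..d})"
    and dF: "\<And>t. t \<in> {a..d} ==> (F has_vector_derivative F' t) (at t within {a..d})"
    and dec: "\<And>t. t \<in> {a..d} ==> F0' t + \<beta> t \<bullet> F' t \<le> F0 t + \<beta> t \<bullet> F t"
    and coer: "\<And>t. t \<in> {a..d} ==> norm (F t) \<le> K * (F0 t + \<beta> t \<bullet> F t)" and K: "K > 0"
    and var: "\<And>s t. a \<le> s ==> s \<le> t ==> t \<le> d ==> norm (\<beta> t - \<beta> s) \<le> V t - V s"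
  shows "F0 d + \<beta> d \<bullet> F d \<le> exp ((d + K * V d) - (a + K * V a)) * (F0 a + \<beta> a \<bullet> F a)"
proof -
  define E where "E t = F0 t + \<beta> t \<bullet> F t" for t
  have Ep: "0 \<le> E t" if "t \<in> {a..d}" for t
    using order_trans[OF norm_ge_zero coer[OF that]] K by (simp add: E_def zero_le_mult_iff)
  have Vm: "V s \<le> V t" if "a \<le> s" "s \<le> t" "t \<le> d" for s t
    using order_trans[OF norm_ge_zero var[OF that]] by simp
  have Fc: "continuous_on {a..d} F"
    using dF by (meson continuous_on_eq_continuous_within has_vector_derivative_continuous)
  have Ec: "continuous_on {a..d} E"
    unfolding E_def using d0 by (intro continuous_intros \<beta> Fc DERIV_continuous_on)
  obtain B where B: "B > 0" "\<And>t. t \<in> {a..d} ==> norm (F' t) \<le> B"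
    using compact_imp_bounded[OF compact_continuous_image[OF F' compact_Icc]] by (auto simp: bounded_pos)
  have "E d \<le> exp ((d + K * V d) - (a + K * V a)) * E a"
  proof (rule difference_gronwall[OF ad])
    show "0 \<le> E t" if "a \<le> t" "t \<le> d" for t using Ep that by simp
    show "s + K * V s \<le> t + K * V t" if "a \<le> s" "s \<le> t" "t \<le> d" for s t
      using Vm[OF that] that K by (intro add_mono mult_left_mono) auto
    fix e :: real assume e: "e > 0"
    obtain d1 where d1: "d1 > 0" "\<And>t s. t \<in> {a..d} ==> s \<in> {a..d} ==> dist t s < d1 ==> dist (\<beta> t) (\<beta> s) < e / 2 / B"
      using uniformly_continuous_onD[OF \<beta> compact_Icc divide_pos_pos[OF half_gt_zero[OF e] B(1)], of thesis] by fast
    obtain d2 where d2: "d2 > 0" "\<And>t s. t \<in> {a..d} ==> s \<in> {a..d} ==> dist t s < d2 ==> dist (F t) (F s) < K * e"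
      using uniformly_continuous_onD[OF Fc compact_Icc mult_pos_pos[OF K e], of thesis] by fast
    obtain d3 where d3: "d3 > 0" "\<And>t s. t \<in> {a..d} ==> s \<in> {a..d} ==> dist t s < d3 ==> dist (E t) (E s) < e / 2"
      using uniformly_continuous_onD[OF Ec compact_Icc half_gt_zero[OF e], of thesis] by fast
    have "E t - E s \<le> (t + K * V t - (s + K * V s)) * (E s + e)"
      if st: "a \<le> s" "s \<le> t" "t \<le> d" "t - s < min d1 (min d2 d3)" for s t
    proof -
      have s: "s \<in> {a..d}" and t: "t \<in> {a..d}" using st by auto
      \<comment> \<open>With the coefficient frozen at \<open>s\<close> the energy is
        differentiable. Half of the slack pays for \<open>\<beta> s\<close> in place of
        \<open>\<beta> r\<close> in its derivative, the other half for \<open>E s\<close> in place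
        of \<open>E r\<close>.\<close>
      have "F0 t + \<beta> s \<bullet> F t - (F0 s + \<beta> s \<bullet> F s) \<le> (E s + e) * (t - s)"
      proof -
        define h where "h r = F0 r + \<beta> s \<bullet> F r - (E s + e) * r" for r
        have "h t \<le> h s"
        proof (rule DERIV_nonpos_imp_decreasing_open[OF st(2)])
          have dh: "(h has_real_derivative F0' r + \<beta> s \<bullet> F' r - (E s + e)) (at r within {a..d})" if r: "r \<in> {a..d}" for r
            unfolding h_def using d0[OF r] bounded_linear.has_vector_derivative[OF bounded_linear_inner_right dF[OF r]]
            by (auto intro!: derivative_eq_intros simp: has_real_derivative_iff_has_vector_derivative[symmetric])
          have "continuous_on {a..d} h" using dh by (rule DERIV_continuous_on)
          then show "continuous_on {s..t} h" by (rule continuous_on_subset) (use st in auto)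
          fix r assume r: "s < r" "r < t"
          then have r': "r \<in> {a..d}" using st by auto
          have "DERIV h r :> F0' r + \<beta> s \<bullet> F' r - (E s + e)"
            using dh[OF r'] at_within_Icc_at[of a r d] r st by simp
          moreover have "F0' r + \<beta> s \<bullet> F' r - (E s + e) \<le> 0"
          proof -
            have "dist (\<beta> r) (\<beta> s) < e / 2 / B" "dist (E r) (E s) < e / 2"
              using d1(2)[OF r' s] d3(2)[OF r' s] r st by (auto simp: dist_real_def)
            then have "norm (\<beta> s - \<beta> r) \<le> e / 2 / B" and Er: "E r \<le> E s + e / 2"
              by (simp add: dist_norm norm_minus_commute, unfold dist_real_def, linarith)
            then have "(\<beta> s - \<beta> r) \<bullet> F' r \<le> e / 2 / B * B"
              using B(2)[OF r'] e B(1) by (intro order_trans[OF norm_cauchy_schwarz] mult_mono) auto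
            then show ?thesis using dec[OF r'] B(1) Er by (simp add: inner_diff_left E_def)
          qed
          ultimately show "\<exists>y. DERIV h r :> y \<and> y \<le> 0" by blast
        qed
        then show ?thesis by (simp add: h_def algebra_simps)
      qed
      \<comment> \<open>What freezing leaves out is the change of the coefficient over the step,
        bounded by the increment of \<open>V\<close> and by coercivity.\<close>
      moreover have "(\<beta> t - \<beta> s) \<bullet> F t \<le> (V t - V s) * (K * (E s + e))"
      proof -
        have "dist (F t) (F s) < K * e" using st s t by (intro d2) (auto simp: dist_real_def)
        then have "norm (F t) \<le> norm (F s) + K * e"
          using norm_triangle_ineq2[of "F t" "F s"] by (simp add: dist_norm)
        also have "\<dots> \<le> K * (E s + e)" using coer[OF s] by (simp add: E_def algebra_simps)
        finally show ?thesis
          using var[OF st(1-3)] Vm[OF st(1-3)] by (intro order_trans[OF norm_cauchy_schwarz] mult_mono) auto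
      qed
      ultimately show ?thesis by (simp add: E_def algebra_simps)
    qed
    then show "\<exists>\<delta>>0. \<forall>s t. a \<le> s --> s \<le> t --> t \<le> d --> t - s < \<delta> -->
        E t - E s \<le> (t + K * V t - (s + K * V s)) * (E s + e)"
      using d1(1) d2(1) d3(1) by (intro exI[of _ "min d1 (min d2 d3)"]) auto
  qed
  then show ?thesis by (simp add: E_def)
qed

text \<open>The additional \<open>1\<close> in the energy keeps it coercive for
  \<open>\<kappa> = 0\<close>, that is for frequency 0; its price is the factor
  \<open>exp (b - a)\<close>. The variation of \<open>\<alpha>\<close> is measured relative to the
  lower bound \<open>\<kappa> + 1\<close>, so the factor from \<open>w\<close> does not grow with
  the size of \<open>\<alpha>\<close>.\<close>

lemma oscillator_energy_regular:
  fixes y v :: "real => complex" and \<alpha> w :: "real => real"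
  assumes ab: "a \<le> b" and \<alpha>c: "continuous_on {a..b} \<alpha>" and \<kappa>: "\<kappa> \<ge> 0" "\<And>t. t \<in> {a..b} ==> \<kappa> \<le> \<alpha> t"
    and yd: "\<And>t. t \<in> {a..b} ==> (y has_vector_derivative v t) (at t within {a..b})"
    and vd: "\<And>t. t \<in> {a..b} ==> (v has_vector_derivative - (\<alpha> t *\<^sub>R y t)) (at t within {a..b})"
    and w: "\<And>s t. a \<le> s ==> s \<le> t ==> t \<le> b ==> \<bar>\<alpha> t - \<alpha> s\<bar> \<le> (\<kappa> + 1) * (w t - w s)"
  shows "(norm (v b))\<^sup>2 + (\<alpha> b + 1) * (norm (y b))\<^sup>2 \<le>
    exp ((b - a) + (w b - w a)) * ((norm (v a))\<^sup>2 + (\<alpha> a + 1) * (norm (y a))\<^sup>2)"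
proof -
  let ?G = "\<lambda>t. v t \<bullet> v t + y t \<bullet> y t" and ?F = "\<lambda>t. y t \<bullet> y t"
  have yc: "continuous_on {a..b} y" and vc: "continuous_on {a..b} v"
    using yd vd has_vector_derivative_continuous continuous_on_eq_continuous_within by blast+
  have "?G b + \<alpha> b \<bullet> ?F b \<le> exp ((b + 1 / (\<kappa> + 1) * ((\<kappa> + 1) * w b)) - (a + 1 / (\<kappa> + 1) * ((\<kappa> + 1) * w a)))
      * (?G a + \<alpha> a \<bullet> ?F a)"
  proof (rule energy_frozen_coefficient[OF ab \<alpha>c])
    show "continuous_on {a..b} (\<lambda>t. 2 * (y t \<bullet> v t))" by (intro continuous_intros yc vc)
    show "1 / (\<kappa> + 1) > 0" using \<kappa>(1) by simp
    show "norm (\<alpha> t - \<alpha> s) \<le> (\<kappa> + 1) * w t - (\<kappa> + 1) * w s" if "a \<le> s" "s \<le> t" "t \<le> b" for s t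
      using w[OF that] by (simp add: right_diff_distrib)
    fix t assume t: "t \<in> {a..b}"
    have yy: "((\<lambda>t. y t \<bullet> y t) has_vector_derivative 2 * (y t \<bullet> v t)) (at t within {a..b})"
      using bounded_bilinear.has_vector_derivative[OF bounded_bilinear_inner yd[OF t] yd[OF t]] by (simp add: inner_commute)
    then show "((\<lambda>t. y t \<bullet> y t) has_vector_derivative 2 * (y t \<bullet> v t)) (at t within {a..b})" .
    have vv: "((\<lambda>t. v t \<bullet> v t) has_vector_derivative - (2 * \<alpha> t * (y t \<bullet> v t))) (at t within {a..b})"
      using bounded_bilinear.has_vector_derivative[OF bounded_bilinear_inner vd[OF t] vd[OF t]] by (simp add: inner_commute mult.assoc)
    show "(?G has_real_derivative - (2 * \<alpha> t * (y t \<bullet> v t)) + 2 * (y t \<bullet> v t)) (at t within {a..b})"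
      unfolding has_real_derivative_iff_has_vector_derivative by (rule has_vector_derivative_add[OF vv yy])
    have "2 * (y t \<bullet> v t) \<le> y t \<bullet> y t + v t \<bullet> v t"
      using inner_ge_zero[of "y t - v t"] by (simp add: inner_diff_left inner_diff_right inner_commute)
    moreover have "0 \<le> \<alpha> t * (y t \<bullet> y t)" using \<kappa>(1) \<kappa>(2)[OF t] by (intro mult_nonneg_nonneg) auto
    ultimately show "- (2 * \<alpha> t * (y t \<bullet> v t)) + 2 * (y t \<bullet> v t) + \<alpha> t \<bullet> (2 * (y t \<bullet> v t)) \<le> ?G t + \<alpha> t \<bullet> ?F t"
      by simp
    have "(\<kappa> + 1) * (y t \<bullet> y t) \<le> (\<alpha> t + 1) * (y t \<bullet> y t)" using \<kappa>(2)[OF t] by (intro mult_right_mono) auto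
    then have "(\<kappa> + 1) * (y t \<bullet> y t) \<le> ?G t + \<alpha> t \<bullet> ?F t"
      by (simp add: distrib_right add_increasing)
    then show "norm (?F t) \<le> 1 / (\<kappa> + 1) * (?G t + \<alpha> t \<bullet> ?F t)"
      using \<kappa>(1) by (simp add: pos_le_divide_eq mult.commute)
  qed
  moreover have k: "1 / (\<kappa> + 1) * ((\<kappa> + 1) * x) = x" for x using \<kappa>(1) by simp
  ultimately show ?thesis unfolding k by (simp add: power2_norm_eq_inner algebra_simps)
qed

text \<open>Across the singularity the coefficient is compared with the constant \<open>n\<^sup>2\<close>, so that only its
  integral matters.\<close>

lemma oscillator_energy_singular:
  fixes y v :: "real => complex" and \<alpha> :: "real => real"
  assumes ab: "a \<le> b" and n: "n > 0" and \<alpha>: "\<alpha> absolutely_integrable_on {a..b}"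
    and yc: "continuous_on {a..b} y" and vc: "continuous_on {a..b} v"
    and yd: "\<And>t. t \<in> {a..b} ==> t \<noteq> t0 ==> (y has_vector_derivative v t) (at t within {a..b})"
    and vd: "\<And>t. t \<in> {a..b} ==> t \<noteq> t0 ==> (v has_vector_derivative - (\<alpha> t *\<^sub>R y t)) (at t within {a..b})"
  shows "(norm (v b))\<^sup>2 + n\<^sup>2 * (norm (y b))\<^sup>2 \<le>
    exp (n * (b - a) + integral {a..b} (\<lambda>t. \<bar>\<alpha> t\<bar>) / n) * ((norm (v a))\<^sup>2 + n\<^sup>2 * (norm (y a))\<^sup>2)"
proof -
  define E where "E t = (norm (v t))\<^sup>2 + n\<^sup>2 * (norm (y t))\<^sup>2" for t
  define k where "k t = n + \<bar>\<alpha> t\<bar> / n" for t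
  have ki: "k integrable_on {a..b}"
    unfolding k_def using \<alpha>
    by (auto simp: absolutely_integrable_on_def divide_inverse intro!: Henstock_Kurzweil_Integration.integrable_add integrable_on_mult_left)
  define M where "M t = integral {a..t} k" for t
  have kp: "k t \<ge> 0" for t using n by (simp add: k_def)
  have kis: "k integrable_on {s..t}" if "a \<le> s" "t \<le> b" for s t
    by (rule integrable_on_subinterval[OF ki]) (use that in auto)
  have Mi: "M t - M s = integral {s..t} k" if "a \<le> s" "s \<le> t" "t \<le> b" for s t
    using Henstock_Kurzweil_Integration.integral_combine[OF that(1,2) kis] that unfolding M_def by force
  have Ec: "continuous_on {a..b} E" unfolding E_def by (intro continuous_intros yc vc)
  have "E b \<le> exp (M b - M a) * E a"
  proof (rule difference_gronwall[OF ab])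
    show "0 \<le> E t" for t by (simp add: E_def)
    show "M s \<le> M t" if "a \<le> s" "s \<le> t" "t \<le> b" for s t
      using Mi[OF that] Henstock_Kurzweil_Integration.integral_nonneg[OF kis[of s t]] kp that by auto
    fix e :: real assume e: "e > 0"
    obtain d where d: "d > 0" "\<And>s t. s \<in> {a..b} ==> t \<in> {a..b} ==> dist s t < d ==> dist (E s) (E t) < e"
      using uniformly_continuous_onD[OF Ec _ e] by auto
    show "\<exists>d>0. \<forall>s t. a \<le> s --> s \<le> t --> t \<le> b --> t - s < d --> E t - E s \<le> (M t - M s) * (E s + e)"
    proof (intro exI[of _ d] conjI allI impI)
      fix s t assume st: "a \<le> s" "s \<le> t" "t \<le> b" "t - s < d"
      then have sI: "s \<in> {a..b}" by auto
      define E' where "E' \<tau> = 2 * (v \<tau> \<bullet> (- (\<alpha> \<tau> *\<^sub>R y \<tau>))) + n\<^sup>2 * (2 * (y \<tau> \<bullet> v \<tau>))" for \<tau>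
      have "(E' has_integral (E t - E s)) {s..t}"
      proof (rule fundamental_theorem_of_calculus_interior_strong[where S = "{t0}"])
        show "continuous_on {s..t} E" by (rule continuous_on_subset[OF Ec]) (use st in auto)
        fix \<tau> assume \<tau>: "\<tau> \<in> {s<..<t} - {t0}"
        have w: "at \<tau> within {a..b} = at \<tau>" by (rule at_within_interior) (use \<tau> st in auto)
        have 1: "(y has_vector_derivative v \<tau>) (at \<tau>)"
          using yd[of \<tau>] \<tau> st by (simp add: w)
        have 2: "(v has_vector_derivative - (\<alpha> \<tau> *\<^sub>R y \<tau>)) (at \<tau>)"
          using vd[of \<tau>] \<tau> st by (simp add: w)
        show "(E has_vector_derivative E' \<tau>) (at \<tau>)"
          unfolding E_def[abs_def] E'_def power2_norm_eq_inner
          by (rule derivative_eq_intros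
              has_vector_derivative_mult_right
              bounded_bilinear.has_vector_derivative[OF bounded_bilinear_inner 1 1]
              bounded_bilinear.has_vector_derivative[OF bounded_bilinear_inner 2 2] refl)+
            (simp add: inner_commute algebra_simps)
      qed (use st in auto)
      moreover have "((\<lambda>\<tau>. k \<tau> * (E s + e)) has_integral (M t - M s) * (E s + e)) {s..t}"
        unfolding Mi[OF st(1-3)] by (intro has_integral_mult_left integrable_integral kis) (use st in auto)
      ultimately show "E t - E s \<le> (M t - M s) * (E s + e)"
      proof (rule has_integral_le)
        fix \<tau> assume \<tau>: "\<tau> \<in> {s..t}"
        have "dist (E s) (E \<tau>) < e" by (rule d(2)[OF sI]) (use \<tau> st in \<open>auto simp: dist_real_def\<close>)
        then have Es: "E \<tau> \<le> E s + e" by (simp add: dist_real_def)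
        have c: "2 * n * \<bar>y \<tau> \<bullet> v \<tau>\<bar> \<le> E \<tau>"
        proof -
          have "2 * n * \<bar>y \<tau> \<bullet> v \<tau>\<bar> \<le> 2 * n * (norm (y \<tau>) * norm (v \<tau>))"
            using Cauchy_Schwarz_ineq2[of "y \<tau>" "v \<tau>"] n by (intro mult_left_mono) auto
          also have "\<dots> \<le> E \<tau>"
            using sum_squares_bound[of "norm (v \<tau>)" "n * norm (y \<tau>)"] by (simp add: E_def power_mult_distrib algebra_simps)
          finally show ?thesis .
        qed
        \<comment> \<open>For the constant coefficient \<open>n^2\<close> this energy is conserved,
          so its derivative sees only the deviation \<open>n^2 - \<alpha>\<close>. The remaining
          pairing is absorbed by \<open>2 n |y \<bullet> v| \<le> E\<close>.\<close>
        have "E' \<tau> = ((n\<^sup>2 - \<alpha> \<tau>) / n) * (2 * n * (y \<tau> \<bullet> v \<tau>))"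
          using n by (simp add: E'_def inner_commute field_simps)
        also have "\<dots> \<le> \<bar>(n\<^sup>2 - \<alpha> \<tau>) / n\<bar> * (2 * n * \<bar>y \<tau> \<bullet> v \<tau>\<bar>)"
          using abs_ge_self[of "((n\<^sup>2 - \<alpha> \<tau>) / n) * (2 * n * (y \<tau> \<bullet> v \<tau>))"] n by (simp add: abs_mult)
        also have "\<dots> \<le> k \<tau> * E \<tau>"
        proof (rule mult_mono[OF _ c])
          have "\<bar>n\<^sup>2 - \<alpha> \<tau>\<bar> / n \<le> (n\<^sup>2 + \<bar>\<alpha> \<tau>\<bar>) / n" using n abs_triangle_ineq4[of "n\<^sup>2" "\<alpha> \<tau>"] by (intro divide_right_mono) auto
          then show "\<bar>(n\<^sup>2 - \<alpha> \<tau>) / n\<bar> \<le> k \<tau>"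
            using n by (simp add: k_def add_divide_distrib power2_eq_square)
        qed (use kp n in auto)
        also have "\<dots> \<le> k \<tau> * (E s + e)" using Es kp by (intro mult_left_mono) auto
        finally show "E' \<tau> \<le> k \<tau> * (E s + e)" .
      qed
    qed (rule d(1))
  qed
  moreover have "M b - M a = n * (b - a) + integral {a..b} (\<lambda>t. \<bar>\<alpha> t\<bar>) / n"
  proof -
    have "((\<lambda>t. \<bar>\<alpha> t\<bar>) has_integral integral {a..b} (\<lambda>t. \<bar>\<alpha> t\<bar>)) {a..b}"
      using \<alpha> by (auto simp: absolutely_integrable_on_def)
    from has_integral_add[OF has_integral_const_real[of n a b] has_integral_divide[OF this, of n]]
    have "integral {a..b} k = (b - a) *\<^sub>R n + integral {a..b} (\<lambda>t. \<bar>\<alpha> t\<bar>) / n"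
      unfolding k_def using ab by (intro integral_unique) simp
    then show ?thesis using Mi[of a b] ab by (simp add: mult.commute)
  qed
  ultimately show ?thesis by (simp add: E_def)
qed

subsection \<open>Growth of the modes\<close>

lemma one_le_mult: "1 \<le> a ==> 1 \<le> b ==> 1 \<le> a * b" for a b :: real
  using mult_mono[of 1 a 1 b] by simp

lemma norm_matrix_vector_le:
  fixes M :: "real ^ 'n ^ 'm"
  shows "norm (M *v x) \<le> norm M * norm x"
proof -
  have "norm (M *v x) = L2_set (\<lambda>i. \<bar>M $ i \<bullet> x\<bar>) UNIV"
    by (simp add: norm_vec_def matrix_vector_mul_component)
  also have "\<dots> \<le> L2_set (\<lambda>i. norm (M $ i) * norm x) UNIV"
    by (intro L2_set_mono Cauchy_Schwarz_ineq2) auto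
  also have "\<dots> = norm M * norm x"
    by (simp add: L2_set_left_distrib norm_vec_def)
  finally show ?thesis .
qed

lemma quadratic_form_le:
  fixes M :: "real ^ 'n ^ 'n"
  shows "\<bar>x \<bullet> (M *v x)\<bar> \<le> norm M * (norm x)\<^sup>2"
proof -
  have "\<bar>x \<bullet> (M *v x)\<bar> \<le> norm x * norm (M *v x)" by (rule Cauchy_Schwarz_ineq2)
  also have "\<dots> \<le> norm x * (norm M * norm x)" by (intro mult_left_mono norm_matrix_vector_le) simp
  finally show ?thesis by (simp add: power2_eq_square mult_ac)
qed

lemma x_ln_abs_tendsto_0: "((\<lambda>x::real. x * ln \<bar>x\<bar>) \<longlongrightarrow> 0) (at 0)"
proof (rule Lim_null_comparison[where g = "\<lambda>x. 2 * sqrt \<bar>x\<bar>"])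
  have "norm (x * ln \<bar>x\<bar>) \<le> 2 * sqrt \<bar>x\<bar>" if "x \<noteq> 0" "\<bar>x\<bar> < 1" for x :: real
  proof -
    define r where "r = sqrt \<bar>x\<bar>"
    have r: "r > 0" "r * r = \<bar>x\<bar>" using that by (auto simp: r_def)
    have "ln (1 / r) \<le> 1 / r - 1" using r by (intro ln_le_minus_one) auto
    then have "- ln r \<le> 1 / r" using r by (simp add: ln_div)
    then have "r * r * (- (2 * ln r)) \<le> r * r * (2 * (1 / r))" using r by (intro mult_left_mono) auto
    also have "\<dots> = 2 * r" using r(1) by simp
    finally have "r * r * (- (2 * ln r)) \<le> 2 * r" .
    moreover have "ln \<bar>x\<bar> = 2 * ln r"
      unfolding r(2)[symmetric] using r(1) by (simp add: ln_mult)
    ultimately have "\<bar>x\<bar> * (- ln \<bar>x\<bar>) \<le> 2 * r" using r(2) by simp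
    moreover have "ln \<bar>x\<bar> \<le> 0" using that by simp
    ultimately show ?thesis by (simp add: abs_mult r_def)
  qed
  then show "\<forall>\<^sub>F x::real in at 0. norm (x * ln \<bar>x\<bar>) \<le> 2 * sqrt \<bar>x\<bar>"
    by (auto simp: eventually_at intro!: exI[of _ 1])
  have "((\<lambda>x::real. 2 * sqrt \<bar>x\<bar>) \<longlongrightarrow> 2 * sqrt \<bar>0\<bar>) (at 0)" by (intro tendsto_intros)
  then show "((\<lambda>x::real. 2 * sqrt \<bar>x\<bar>) \<longlongrightarrow> 0) (at 0)" by simp
qed

text \<open>The primitive \<open>2 x - x ln |x|\<close>, with \<open>x = t - t0\<close>, extends
  continuously through 0, so the fundamental theorem applies across the singularity.\<close>

lemma has_integral_log_dist:
  fixes t0 \<epsilon> :: real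
  assumes \<epsilon>: "\<epsilon> > 0"
  shows "((\<lambda>t. 1 - ln \<bar>t - t0\<bar>) has_integral (4 * \<epsilon> - 2 * \<epsilon> * ln \<epsilon>)) {t0 - \<epsilon>..t0 + \<epsilon>}"
proof -
  define P where "P t = 2 * (t - t0) - (t - t0) * ln \<bar>t - t0\<bar>" for t
  have "((\<lambda>t. 1 - ln \<bar>t - t0\<bar>) has_integral (P (t0 + \<epsilon>) - P (t0 - \<epsilon>))) {t0 - \<epsilon>..t0 + \<epsilon>}"
  proof (rule fundamental_theorem_of_calculus_interior_strong[where S = "{t0}"])
    fix x assume x: "x \<in> {t0 - \<epsilon><..<t0 + \<epsilon>} - {t0}"
    have "((\<lambda>t. ln \<bar>t - t0\<bar>) has_real_derivative 1 / (x - t0)) (at x)"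
    proof (cases "x > t0")
      case True
      have "((\<lambda>t. ln (t - t0)) has_real_derivative 1 / (x - t0)) (at x)"
        using True by (auto intro!: derivative_eq_intros)
      then show ?thesis
        by (rule has_field_derivative_transform_within_open[where S = "{t0<..}"]) (use True in auto)
    next
      case False
      have "((\<lambda>t. ln (t0 - t)) has_real_derivative 1 / (x - t0)) (at x)"
        using False x by (auto intro!: derivative_eq_intros simp: divide_simps)
      then show ?thesis
        by (rule has_field_derivative_transform_within_open[where S = "{..<t0}"]) (use False x in auto)
    qed
    note L = this
    have X: "((\<lambda>t. t - t0) has_real_derivative 1) (at x)" by (auto intro!: derivative_eq_intros)
    have "(P has_real_derivative 1 - ln \<bar>x - t0\<bar>) (at x)"
      unfolding P_def[abs_def]
      by (rule DERIV_cong[OF DERIV_diff[OF DERIV_cmult[OF X] DERIV_mult[OF X L]]]) (use x in auto)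
    then show "(P has_vector_derivative 1 - ln \<bar>x - t0\<bar>) (at x)"
      by (simp add: has_real_derivative_iff_has_vector_derivative)
  next
    have "isCont P x" for x
    proof (cases "x = t0")
      case True
      have "((\<lambda>t. (t - t0) * ln \<bar>t - t0\<bar>) \<longlongrightarrow> 0) (at t0)"
        using x_ln_abs_tendsto_0 LIM_offset_zero_iff[of t0 "\<lambda>t. (t - t0) * ln \<bar>t - t0\<bar>" 0] by simp
      then have "(P \<longlongrightarrow> 2 * (t0 - t0) - 0) (at t0)"
        unfolding P_def[abs_def] by (intro tendsto_intros)
      then show ?thesis using True by (simp add: isCont_def P_def)
    next
      case False
      then show ?thesis unfolding P_def[abs_def] by (intro continuous_intros) auto
    qed
    then show "continuous_on {t0 - \<epsilon>..t0 + \<epsilon>} P" by (simp add: continuous_at_imp_continuous_on)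
  qed (use \<epsilon> in auto)
  then show ?thesis using \<epsilon> by (simp add: P_def algebra_simps)
qed

lemma exp_ln_le_power:
  fixes n c :: real
  assumes "n \<ge> 1"
  shows "exp (c * ln n) \<le> n ^ nat \<lceil>c\<rceil>"
proof -
  have "exp (c * ln n) = n powr c" using assms by (simp add: powr_def)
  also have "\<dots> \<le> n powr real (nat \<lceil>c\<rceil>)" using assms by (intro powr_mono) linarith+
  also have "\<dots> = n ^ nat \<lceil>c\<rceil>" using assms by (simp add: powr_realpow)
  finally show ?thesis .
qed

context coefficients
begin

lemma b_cont: "continuous_on ({0..T} - {t0}) b"
  by (rule tendsto_within_0_T[OF Gam_cont b_var])

lemma b_log_bound:
  obtains K where "K \<ge> 0" "\<And>t. t \<in> {0..T} ==> t \<noteq> t0 ==> norm (b t) \<le> K * (1 + \<bar>ln \<bar>t - t0\<bar>\<bar>)"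
proof -
  \<comment> \<open>Each \<open>t\<close> is compared with the end of \<open>{0..T}\<close> on its
    own side of \<open>t0\<close>. The constant collects the terms of both ends, and the factor
    \<open>1 +\<close> ensures \<open>C \<le> K\<close>.\<close>
  define K where "K = norm (b 0) + norm (b T) + C * (1 + \<bar>ln \<bar>0 - t0\<bar>\<bar> + \<bar>ln \<bar>T - t0\<bar>\<bar>) + (Gam T - Gam 0)"
  have G: "Gam 0 \<le> Gam t" "Gam t \<le> Gam T" if "t \<in> {0..T}" for t
    using Gam_mono[of 0 t] Gam_mono[of t T] that by auto
  have G0: "Gam T - Gam 0 \<ge> 0" using G(1)[of T] T by simp
  show thesis
  proof (rule that[of K])
    show "K \<ge> 0" unfolding K_def using C G0 by (intro add_nonneg_nonneg mult_nonneg_nonneg) auto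
    fix t assume t: "t \<in> {0..T}" "t \<noteq> t0"
    let ?l = "\<bar>ln \<bar>t - t0\<bar>\<bar>"
    have "norm (b t) \<le> norm (b 0) + norm (b T) + C * (?l + (\<bar>ln \<bar>0 - t0\<bar>\<bar> + \<bar>ln \<bar>T - t0\<bar>\<bar>)) + (Gam T - Gam 0)"
    proof (cases "t < t0")
      case True
      have "norm (b t - b 0) \<le> C * \<bar>ln \<bar>t - t0\<bar> - ln \<bar>0 - t0\<bar>\<bar> + (Gam t - Gam 0)"
        by (rule b_var) (use t T True in auto)
      also have "C * \<bar>ln \<bar>t - t0\<bar> - ln \<bar>0 - t0\<bar>\<bar> \<le> C * (?l + (\<bar>ln \<bar>0 - t0\<bar>\<bar> + \<bar>ln \<bar>T - t0\<bar>\<bar>))"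
        using C by (intro mult_left_mono) linarith+
      finally have "norm (b t - b 0) \<le> C * (?l + (\<bar>ln \<bar>0 - t0\<bar>\<bar> + \<bar>ln \<bar>T - t0\<bar>\<bar>)) + (Gam T - Gam 0)"
        using G[OF t(1)] by linarith
      then show ?thesis using norm_triangle_sub[of "b t" "b 0"] norm_ge_zero[of "b T"] by linarith
    next
      case False
      have "norm (b T - b t) \<le> C * \<bar>ln \<bar>T - t0\<bar> - ln \<bar>t - t0\<bar>\<bar> + (Gam T - Gam t)"
        by (rule b_var) (use t T False in auto)
      also have "C * \<bar>ln \<bar>T - t0\<bar> - ln \<bar>t - t0\<bar>\<bar> \<le> C * (?l + (\<bar>ln \<bar>0 - t0\<bar>\<bar> + \<bar>ln \<bar>T - t0\<bar>\<bar>))"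
        using C by (intro mult_left_mono) linarith+
      finally have "norm (b T - b t) \<le> C * (?l + (\<bar>ln \<bar>0 - t0\<bar>\<bar> + \<bar>ln \<bar>T - t0\<bar>\<bar>)) + (Gam T - Gam 0)"
        using G[OF t(1)] by linarith
      then show ?thesis using norm_triangle_sub[of "b t" "b T"] norm_ge_zero[of "b 0"]
          norm_minus_commute[of "b t" "b T"] by linarith
    qed
    also have "\<dots> \<le> K + K * ?l"
    proof -
      have "C * ?l \<le> K * ?l"
      proof (rule mult_right_mono)
        have "C \<le> C * (1 + \<bar>ln \<bar>0 - t0\<bar>\<bar> + \<bar>ln \<bar>T - t0\<bar>\<bar>)"
          using mult_left_mono[of 1 "1 + \<bar>ln \<bar>0 - t0\<bar>\<bar> + \<bar>ln \<bar>T - t0\<bar>\<bar>" C] C by simp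
        then show "C \<le> K" unfolding K_def using G0 norm_ge_zero[of "b 0"] norm_ge_zero[of "b T"] by linarith
      qed simp
      moreover have "norm (b 0) + norm (b T) + C * (\<bar>ln \<bar>0 - t0\<bar>\<bar> + \<bar>ln \<bar>T - t0\<bar>\<bar>) + (Gam T - Gam 0) \<le> K"
        unfolding K_def using C by (simp add: algebra_simps)
      ultimately show ?thesis by (simp add: distrib_left)
    qed
    finally show "norm (b t) \<le> K * (1 + ?l)" by (simp add: distrib_left)
  qed
qed

text \<open>Over a zone of width \<open>1/n\<close> around \<open>t0\<close> the integral of
  \<open>norm b\<close> is of order \<open>ln n / n\<close>. Multiplied by \<open>n^2\<close> from
  the frequency and divided by \<open>n\<close> from the energy, this leaves \<open>ln n\<close> in
  the exponent, hence a power of \<open>n\<close>.\<close>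

lemma b_integral_near_singularity:
  assumes K: "\<And>t. t \<in> {0..T} ==> t \<noteq> t0 ==> norm (b t) \<le> K * (1 + \<bar>ln \<bar>t - t0\<bar>\<bar>)" "K \<ge> 0"
    and \<epsilon>: "0 < \<epsilon>" "\<epsilon> \<le> 1" and rs: "r \<le> s" "0 \<le> r" "s \<le> T" "t0 - \<epsilon> \<le> r" "s \<le> t0 + \<epsilon>"
  shows "integral {r..s} (\<lambda>t. norm (b t)) \<le> K * (4 * \<epsilon> - 2 * \<epsilon> * ln \<epsilon>)"
proof -
  define f where "f t = (if t = t0 then 0 else norm (b t))" for t
  define g where "g t = K * (1 - ln \<bar>t - t0\<bar>)" for t
  have g: "(g has_integral K * (4 * \<epsilon> - 2 * \<epsilon> * ln \<epsilon>)) {t0 - \<epsilon>..t0 + \<epsilon>}"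
    unfolding g_def by (intro has_integral_mult_right has_integral_log_dist \<epsilon>)
  have lp: "ln \<bar>t - t0\<bar> \<le> 0" if "t \<in> {t0 - \<epsilon>..t0 + \<epsilon>}" for t
  proof (cases "t = t0")
    case False
    then show ?thesis using that \<epsilon> by (subst ln_le_zero_iff) (auto simp: abs_le_iff)
  qed simp
  have gp: "0 \<le> g t" if "t \<in> {t0 - \<epsilon>..t0 + \<epsilon>}" for t
    using lp[OF that] K(2) by (simp add: g_def)
  have gi: "g integrable_on {t0 - \<epsilon>..t0 + \<epsilon>}" using g by blast
  have gi': "g integrable_on {r..s}" by (rule integrable_on_subinterval[OF gi]) (use rs in auto)
  have bi: "(\<lambda>t. norm (b t)) integrable_on {r..s}"
    using absolutely_integrable_on_subinterval[OF b_int, of r s] rs by (auto simp: absolutely_integrable_on_def)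
  have fi: "f integrable_on {r..s}"
    by (rule integrable_spike[OF bi negligible_sing[of t0]]) (simp add: f_def)
  have "integral {r..s} (\<lambda>t. norm (b t)) = integral {r..s} f"
    by (rule integral_spike[OF negligible_sing[of t0]]) (simp add: f_def)
  also have "\<dots> \<le> integral {r..s} g"
  proof (rule integral_le[OF fi gi'])
    fix t assume t: "t \<in> {r..s}"
    then have "t \<in> {t0 - \<epsilon>..t0 + \<epsilon>}" "t \<in> {0..T}" using rs by auto
    then show "f t \<le> g t" using K(1)[of t] lp[of t] gp[of t] by (auto simp: f_def g_def)
  qed
  also have "\<dots> \<le> integral {t0 - \<epsilon>..t0 + \<epsilon>} g"
    by (rule integral_subset_le) (use rs gi gi' gp in auto)
  also have "\<dots> = K * (4 * \<epsilon> - 2 * \<epsilon> * ln \<epsilon>)" using g by (rule integral_unique)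
  finally show ?thesis .
qed

definition \<alpha> :: "real ^ 'n => real => real" where
  "\<alpha> \<xi> t = \<xi> \<bullet> (b t *v \<xi>)"

lemma \<alpha>_cont: "continuous_on ({0..T} - {t0}) (\<alpha> \<xi>)"
  unfolding \<alpha>_def[abs_def] inner_vec_def matrix_vector_mult_def
  by (auto intro!: continuous_intros b_cont)

lemma \<alpha>_int: "\<alpha> \<xi> absolutely_integrable_on {0..T}"
proof -
  have "linear (\<lambda>M. \<xi> \<bullet> (M *v \<xi>) :: real)"
    by (auto intro!: linearI simp: matrix_vector_mult_add_rdistrib scaleR_matrix_vector_assoc[symmetric] inner_add_right)
  then have "bounded_linear (\<lambda>M. \<xi> \<bullet> (M *v \<xi>) :: real)" by (rule linear_conv_bounded_linear[THEN iffD1])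
  from absolutely_integrable_linear[OF b_int this] show ?thesis
    by (simp add: o_def \<alpha>_def[abs_def])
qed

lemma \<alpha>_le: "\<bar>\<alpha> \<xi> t\<bar> \<le> (norm \<xi>)\<^sup>2 * norm (b t)"
  unfolding \<alpha>_def using quadratic_form_le[of \<xi> "b t"] by (simp add: mult.commute)

lemma \<alpha>_ge: "t \<in> {0..T} ==> t \<noteq> t0 ==> lam * (norm \<xi>)\<^sup>2 \<le> \<alpha> \<xi> t"
  unfolding \<alpha>_def by (rule elliptic)

lemma \<alpha>_var:
  assumes "s \<in> {0..T}" "t \<in> {0..T}" "s \<le> t" "t < t0 \<or> t0 < s"
  shows "\<bar>\<alpha> \<xi> t - \<alpha> \<xi> s\<bar> \<le> (norm \<xi>)\<^sup>2 * (C * \<bar>ln \<bar>t - t0\<bar> - ln \<bar>s - t0\<bar>\<bar> + (Gam t - Gam s))"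
proof -
  have "\<alpha> \<xi> t - \<alpha> \<xi> s = \<xi> \<bullet> ((b t - b s) *v \<xi>)"
    by (simp add: \<alpha>_def matrix_vector_mult_diff_rdistrib inner_diff_right)
  then have "\<bar>\<alpha> \<xi> t - \<alpha> \<xi> s\<bar> \<le> norm (b t - b s) * (norm \<xi>)\<^sup>2"
    using quadratic_form_le[of \<xi> "b t - b s"] by simp
  also have "\<dots> \<le> (C * \<bar>ln \<bar>t - t0\<bar> - ln \<bar>s - t0\<bar>\<bar> + (Gam t - Gam s)) * (norm \<xi>)\<^sup>2"
    by (intro mult_right_mono b_var assms) simp
  finally show ?thesis by (simp add: mult.commute)
qed

definition is_mode :: "real ^ 'n => (real => complex) => (real => complex) => bool" where
  "is_mode \<xi> y v \<longleftrightarrow> continuous_on {0..T} y \<and> continuous_on {0..T} v \<and>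
    (\<forall>t\<in>{0..T}. (y has_vector_derivative v t) (at t within {0..T})) \<and>
    (\<forall>t\<in>{0..T} - {t0}. (v has_vector_derivative - (\<alpha> \<xi> t *\<^sub>R y t)) (at t within {0..T}))"

lemma mode_exists: obtains y v where "is_mode \<xi> y v" "y 0 = y0" "v 0 = v0"
proof (rule oscillator_solution[OF T \<alpha>_int \<alpha>_cont, of y0 v0 \<xi>])
  fix y v
  assume "continuous_on {0..T} y" "continuous_on {0..T} v" "y 0 = y0" "v 0 = v0"
    "\<And>t. t \<in> {0..T} ==> (y has_vector_derivative v t) (at t within {0..T})"
    "\<And>t. t \<in> {0..T} ==> t \<noteq> t0 ==> (v has_vector_derivative - (\<alpha> \<xi> t *\<^sub>R y t)) (at t within {0..T})"
  then show thesis by (intro that[of y v]) (simp_all add: is_mode_def)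
qed

text \<open>At distance at least \<open>1/n\<close> from \<open>t0\<close>, where
  \<open>n = 1 + norm \<xi>\<close>, the logarithm of the distance varies by at most
  \<open>2 (ln n + ln (1 + T))\<close>; ellipticity divides by \<open>lam\<close>, which gives the
  exponent \<open>2 C / lam\<close>. Both sides are stated with the constant weight
  \<open>n^2\<close>, to fit the other phase. Passing to it costs one further power of
  \<open>n\<close>, because \<open>norm (b s)\<close> is only known to be
  \<open>O(ln n)\<close>.\<close>

lemma mode_regular_phase:
  obtains K N where "K \<ge> 1" "\<And>\<xi> y v s t. is_mode \<xi> y v ==> 0 \<le> s ==> s \<le> t ==> t \<le> T ==>
    t \<le> t0 - 1 / (1 + norm \<xi>) \<or> t0 + 1 / (1 + norm \<xi>) \<le> s ==>
    (norm (v t))\<^sup>2 + (1 + norm \<xi>)\<^sup>2 * (norm (y t))\<^sup>2 \<le>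
      K * (1 + norm \<xi>) ^ N * ((norm (v s))\<^sup>2 + (1 + norm \<xi>)\<^sup>2 * (norm (y s))\<^sup>2)"
proof -
  obtain Kb where Kb: "Kb \<ge> 0" "\<And>t. t \<in> {0..T} ==> t \<noteq> t0 ==> norm (b t) \<le> Kb * (1 + \<bar>ln \<bar>t - t0\<bar>\<bar>)"
    using b_log_bound by metis
  \<comment> \<open>Used to return to the weight \<open>n^2\<close>:
    \<open>lam |\<xi>|^2 + 1\<close> is at least \<open>l1 (|\<xi>|^2 + 1)\<close>, hence at least
    \<open>l1 n^2 / 2\<close>.\<close>
  define l1 where "l1 = min lam 1"
  have l1: "l1 > 0" "l1 \<le> lam" "l1 \<le> 1" using lam by (auto simp: l1_def)
  define lT where "lT = ln (1 + T)"
  have lT: "lT \<ge> 0" using T by (simp add: lT_def)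
  define K1 where "K1 = exp (T + (2 * C * lT + (Gam T - Gam 0)) / lam)"
  define K2 where "K2 = 1 + Kb * (2 + lT)"
  define N where "N = nat \<lceil>2 * C / lam\<rceil>"
  have GT: "Gam T - Gam 0 \<ge> 0" using Gam_mono[of 0 T] T by simp
  have K1: "K1 \<ge> 1" unfolding K1_def using T lam C lT GT by simp
  have K2: "K2 \<ge> 1" unfolding K2_def using Kb(1) lT by simp
  show thesis
  proof (rule that[of "2 / l1 * K1 * K2" "Suc N"])
    have "2 / l1 \<ge> 1" using l1 by simp
    then show "2 / l1 * K1 * K2 \<ge> 1" using K1 K2 by (intro one_le_mult)
    fix \<xi> y v s t
    assume m: "is_mode \<xi> y v" and st: "0 \<le> s" "s \<le> t" "t \<le> T"
      and away: "t \<le> t0 - 1 / (1 + norm \<xi>) \<or> t0 + 1 / (1 + norm \<xi>) \<le> s"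
    define n where "n = 1 + norm \<xi>"
    have n: "n \<ge> 1" by (simp add: n_def)
    have "1 / n > 0" using n by simp
    then have side: "t < t0 \<or> t0 < s" using away unfolding n_def[symmetric] by linarith
    \<comment> \<open>The sign makes \<open>\<sigma> * ln |r - t0|\<close> nondecreasing on the side
      of \<open>t0\<close> under consideration, so that \<open>w\<close> is nondecreasing and its
      increments bound the variation of \<open>\<alpha>\<close>.\<close>
    define \<sigma> where "\<sigma> = (if t < t0 then - 1 else 1 :: real)"
    define w where "w r = (\<sigma> * C * ln \<bar>r - t0\<bar> + Gam r) / lam" for r
    have ne: "r \<noteq> t0" if "r \<in> {s..t}" for r using that side by auto
    have lr: "\<bar>ln \<bar>r - t0\<bar>\<bar> \<le> ln n + lT" if r: "r \<in> {s..t}" for r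
    proof -
      have "1 / n \<le> \<bar>r - t0\<bar>" "\<bar>r - t0\<bar> \<le> 1 + T"
        using away r st t0 unfolding n_def[symmetric] atLeastAtMost_iff by linarith+
      then have "ln (1 / n) \<le> ln \<bar>r - t0\<bar>" "ln \<bar>r - t0\<bar> \<le> ln (1 + T)"
        using n ne[OF r] by (auto intro!: ln_mono simp: less_le_trans[OF _ n])
      moreover have "ln n \<ge> 0" using n by simp
      moreover have "ln (1 / n) = - ln n" using n by (simp add: ln_div)
      ultimately show ?thesis using lT unfolding lT_def by linarith
    qed
    have "(norm (v t))\<^sup>2 + (\<alpha> \<xi> t + 1) * (norm (y t))\<^sup>2 \<le>
      exp ((t - s) + (w t - w s)) * ((norm (v s))\<^sup>2 + (\<alpha> \<xi> s + 1) * (norm (y s))\<^sup>2)"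
    proof (rule oscillator_energy_regular[OF st(2)])
      show "continuous_on {s..t} (\<alpha> \<xi>)"
        by (rule continuous_on_subset[OF \<alpha>_cont]) (use ne[of t0] st in auto)
      show "0 \<le> lam * (norm \<xi>)\<^sup>2" using lam by simp
      show "lam * (norm \<xi>)\<^sup>2 \<le> \<alpha> \<xi> r" if "r \<in> {s..t}" for r
        using \<alpha>_ge[of r \<xi>] that ne[OF that] st by auto
      show "(y has_vector_derivative v r) (at r within {s..t})" if "r \<in> {s..t}" for r
        by (rule has_vector_derivative_within_subset[of _ _ _ "{0..T}"]) (use m that st in \<open>auto simp: is_mode_def\<close>)
      show "(v has_vector_derivative - (\<alpha> \<xi> r *\<^sub>R y r)) (at r within {s..t})" if "r \<in> {s..t}" for r
        by (rule has_vector_derivative_within_subset[of _ _ _ "{0..T}"]) (use m that ne[OF that] st in \<open>auto simp: is_mode_def\<close>)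
      fix s' t' assume st': "s \<le> s'" "s' \<le> t'" "t' \<le> t"
      have side': "t' < t0 \<or> t0 < s'" using side st' by auto
      have sg: "\<bar>ln \<bar>t' - t0\<bar> - ln \<bar>s' - t0\<bar>\<bar> = \<sigma> * (ln \<bar>t' - t0\<bar> - ln \<bar>s' - t0\<bar>)"
      proof (cases "t < t0")
        case True
        then have "ln \<bar>t' - t0\<bar> \<le> ln \<bar>s' - t0\<bar>" using st' by (subst ln_le_cancel_iff) auto
        then show ?thesis using True by (simp add: \<sigma>_def)
      next
        case False
        then have "ln \<bar>s' - t0\<bar> \<le> ln \<bar>t' - t0\<bar>" using st' side by (subst ln_le_cancel_iff) auto
        then show ?thesis using False by (simp add: \<sigma>_def)
      qed
      have "\<bar>\<alpha> \<xi> t' - \<alpha> \<xi> s'\<bar> \<le> (norm \<xi>)\<^sup>2 * (C * \<bar>ln \<bar>t' - t0\<bar> - ln \<bar>s' - t0\<bar>\<bar> + (Gam t' - Gam s'))"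
        by (rule \<alpha>_var) (use st st' side' in auto)
      also have "\<dots> = (lam * (norm \<xi>)\<^sup>2) * (w t' - w s')"
        unfolding sg w_def using lam by (simp add: field_simps)
      also have "\<dots> \<le> (lam * (norm \<xi>)\<^sup>2 + 1) * (w t' - w s')"
      proof (rule mult_right_mono)
        have "0 \<le> C * \<bar>ln \<bar>t' - t0\<bar> - ln \<bar>s' - t0\<bar>\<bar> + (Gam t' - Gam s')"
          using C Gam_mono[of s' t'] st st' by (intro add_nonneg_nonneg mult_nonneg_nonneg) auto
        then show "0 \<le> w t' - w s'"
          unfolding sg w_def using lam by (simp add: diff_divide_distrib[symmetric] algebra_simps)
      qed simp
      finally show "\<bar>\<alpha> \<xi> t' - \<alpha> \<xi> s'\<bar> \<le> (lam * (norm \<xi>)\<^sup>2 + 1) * (w t' - w s')" .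
    qed
    also have "\<dots> \<le> (K1 * n ^ N) * (K2 * n * ((norm (v s))\<^sup>2 + n\<^sup>2 * (norm (y s))\<^sup>2))"
    proof (rule mult_mono)
      have "\<sigma> * C * ln \<bar>t - t0\<bar> - \<sigma> * C * ln \<bar>s - t0\<bar> \<le> C * (2 * (ln n + lT))"
      proof -
        have "\<sigma> * (ln \<bar>t - t0\<bar> - ln \<bar>s - t0\<bar>) \<le> 2 * (ln n + lT)"
          using lr[of t] lr[of s] st by (auto simp: \<sigma>_def abs_le_iff)
        from mult_left_mono[OF this C] show ?thesis by (simp add: algebra_simps)
      qed
      moreover have "Gam t - Gam s \<le> Gam T - Gam 0" using Gam_mono[of t T] Gam_mono[of 0 s] st by auto
      ultimately have "(\<sigma> * C * ln \<bar>t - t0\<bar> + Gam t) - (\<sigma> * C * ln \<bar>s - t0\<bar> + Gam s) \<le> 2 * C * lT + (Gam T - Gam 0) + 2 * C * ln n"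
        by (simp add: algebra_simps)
      then have "w t - w s \<le> (2 * C * lT + (Gam T - Gam 0) + 2 * C * ln n) / lam"
        unfolding w_def diff_divide_distrib[symmetric] using lam by (intro divide_right_mono) auto
      then have "(t - s) + (w t - w s) \<le> (T + (2 * C * lT + (Gam T - Gam 0)) / lam) + (2 * C / lam) * ln n"
        using st by (simp add: add_divide_distrib)
      then have "exp ((t - s) + (w t - w s)) \<le> K1 * exp ((2 * C / lam) * ln n)"
        unfolding K1_def by (simp flip: exp_add)
      also have "\<dots> \<le> K1 * n ^ N"
        unfolding N_def using K1 by (intro mult_left_mono exp_ln_le_power n) auto
      finally show "exp ((t - s) + (w t - w s)) \<le> K1 * n ^ N" .
      have bs: "norm (b s) \<le> Kb * (2 + lT) * n"
      proof -
        have "norm (b s) \<le> Kb * (1 + \<bar>ln \<bar>s - t0\<bar>\<bar>)" using Kb(2)[of s] ne[of s] st by auto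
        also have "\<dots> \<le> Kb * (1 + (ln n + lT))" using lr[of s] st Kb(1) by (intro mult_left_mono) auto
        also have "\<dots> \<le> Kb * ((2 + lT) * n)"
        proof (rule mult_left_mono[OF _ Kb(1)])
          have "ln n \<le> n" using n ln_le_minus_one[of n] by linarith
          moreover have "lT * 1 \<le> lT * n" using n lT by (intro mult_left_mono) auto
          ultimately show "1 + (ln n + lT) \<le> (2 + lT) * n" using n by (simp add: algebra_simps)
        qed
        finally show ?thesis by (simp add: mult.assoc)
      qed
      have "\<alpha> \<xi> s + 1 \<le> n\<^sup>2 * (K2 * n)"
      proof -
        have "\<alpha> \<xi> s + 1 \<le> (norm \<xi>)\<^sup>2 * norm (b s) + 1" using \<alpha>_le[of \<xi> s] by linarith
        also have "\<dots> \<le> n\<^sup>2 * (Kb * (2 + lT) * n) + n\<^sup>2 * n"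
        proof (intro add_mono mult_mono bs power_mono)
          show "1 \<le> n\<^sup>2 * n" using n by (simp add: power2_eq_square one_le_mult)
        qed (use n in \<open>auto simp: n_def\<close>)
        finally show ?thesis by (simp add: K2_def algebra_simps)
      qed
      moreover have "1 \<le> K2 * n" using K2 n by (simp add: one_le_mult)
      ultimately have "(norm (v s))\<^sup>2 + (\<alpha> \<xi> s + 1) * (norm (y s))\<^sup>2 \<le> (K2 * n) * (norm (v s))\<^sup>2 + (n\<^sup>2 * (K2 * n)) * (norm (y s))\<^sup>2"
        using mult_right_mono[of 1 "K2 * n" "(norm (v s))\<^sup>2"] by (intro add_mono mult_right_mono) auto
      then show "(norm (v s))\<^sup>2 + (\<alpha> \<xi> s + 1) * (norm (y s))\<^sup>2 \<le> K2 * n * ((norm (v s))\<^sup>2 + n\<^sup>2 * (norm (y s))\<^sup>2)"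
        by (simp add: algebra_simps)
    qed (use K1 n \<alpha>_ge[of s \<xi>] ne[of s] st lam order_trans[OF _ \<alpha>_ge[of s \<xi>]] in \<open>auto intro!: add_nonneg_nonneg mult_nonneg_nonneg\<close>)
    finally have E: "(norm (v t))\<^sup>2 + (\<alpha> \<xi> t + 1) * (norm (y t))\<^sup>2 \<le> (K1 * n ^ N) * (K2 * n * ((norm (v s))\<^sup>2 + n\<^sup>2 * (norm (y s))\<^sup>2))" .
    have "(norm (v t))\<^sup>2 + n\<^sup>2 * (norm (y t))\<^sup>2 \<le> 2 / l1 * ((norm (v t))\<^sup>2 + (\<alpha> \<xi> t + 1) * (norm (y t))\<^sup>2)"
    proof -
      have "l1 * n\<^sup>2 \<le> 2 * (\<alpha> \<xi> t + 1)"
      proof -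
        have "n\<^sup>2 \<le> 2 * ((norm \<xi>)\<^sup>2 + 1)"
          using sum_squares_bound[of 1 "norm \<xi>"] by (simp add: n_def power2_eq_square algebra_simps)
        then have "l1 * n\<^sup>2 \<le> l1 * (2 * ((norm \<xi>)\<^sup>2 + 1))" using l1 by (intro mult_left_mono) auto
        also have "\<dots> = 2 * (l1 * (norm \<xi>)\<^sup>2 + l1)" by (simp add: algebra_simps)
        finally have "l1 * n\<^sup>2 \<le> 2 * (l1 * (norm \<xi>)\<^sup>2 + l1)" .
        also have "\<dots> \<le> 2 * (\<alpha> \<xi> t + 1)"
        proof (intro mult_left_mono add_mono l1(3))
          have "l1 * (norm \<xi>)\<^sup>2 \<le> lam * (norm \<xi>)\<^sup>2" using l1 by (intro mult_right_mono) auto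
          also have "\<dots> \<le> \<alpha> \<xi> t" by (rule \<alpha>_ge) (use st ne[of t] in auto)
          finally show "l1 * (norm \<xi>)\<^sup>2 \<le> \<alpha> \<xi> t" .
        qed simp
        finally show ?thesis .
      qed
      then have "l1 * n\<^sup>2 * (norm (y t))\<^sup>2 \<le> 2 * (\<alpha> \<xi> t + 1) * (norm (y t))\<^sup>2" by (intro mult_right_mono) auto
      moreover have "l1 * (norm (v t))\<^sup>2 \<le> 2 * (norm (v t))\<^sup>2" using l1 by (intro mult_right_mono) auto
      ultimately have "l1 * ((norm (v t))\<^sup>2 + n\<^sup>2 * (norm (y t))\<^sup>2) \<le> 2 * ((norm (v t))\<^sup>2 + (\<alpha> \<xi> t + 1) * (norm (y t))\<^sup>2)"
        by (simp add: algebra_simps)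
      then show ?thesis using l1 by (simp add: field_simps)
    qed
    also have "\<dots> \<le> 2 / l1 * ((K1 * n ^ N) * (K2 * n * ((norm (v s))\<^sup>2 + n\<^sup>2 * (norm (y s))\<^sup>2)))"
      using l1 by (intro mult_left_mono E) auto
    finally show "(norm (v t))\<^sup>2 + (1 + norm \<xi>)\<^sup>2 * (norm (y t))\<^sup>2 \<le>
      2 / l1 * K1 * K2 * (1 + norm \<xi>) ^ Suc N * ((norm (v s))\<^sup>2 + (1 + norm \<xi>)\<^sup>2 * (norm (y s))\<^sup>2)"
      unfolding n_def[symmetric] power_Suc by (simp only: mult.assoc mult.commute mult.left_commute)
  qed
qed

text \<open>With \<open>n = 1 + norm \<xi>\<close> in \<open>oscillator_energy_singular\<close>, the
  length of the zone contributes \<open>n * (2/n) = 2\<close> to the exponent, and the coefficient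
  contributes \<open>4 Kb + 2 Kb ln n\<close>; hence the constant and the power of
  \<open>n\<close>.\<close>

lemma mode_singular_phase:
  obtains K N where "K \<ge> 1" "\<And>\<xi> y v s t. is_mode \<xi> y v ==> 0 \<le> s ==> s \<le> t ==> t \<le> T ==>
    t0 - 1 / (1 + norm \<xi>) \<le> s ==> t \<le> t0 + 1 / (1 + norm \<xi>) ==>
    (norm (v t))\<^sup>2 + (1 + norm \<xi>)\<^sup>2 * (norm (y t))\<^sup>2 \<le>
      K * (1 + norm \<xi>) ^ N * ((norm (v s))\<^sup>2 + (1 + norm \<xi>)\<^sup>2 * (norm (y s))\<^sup>2)"
proof -
  obtain Kb where Kb: "Kb \<ge> 0" "\<And>t. t \<in> {0..T} ==> t \<noteq> t0 ==> norm (b t) \<le> Kb * (1 + \<bar>ln \<bar>t - t0\<bar>\<bar>)"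
    using b_log_bound by metis
  define N where "N = nat \<lceil>2 * Kb\<rceil>"
  show thesis
  proof (rule that[of "exp (2 + 4 * Kb)" N])
    show "exp (2 + 4 * Kb) \<ge> 1" using Kb(1) by simp
    fix \<xi> y v s t
    assume m: "is_mode \<xi> y v" and st: "0 \<le> s" "s \<le> t" "t \<le> T"
      and near: "t0 - 1 / (1 + norm \<xi>) \<le> s" "t \<le> t0 + 1 / (1 + norm \<xi>)"
    define n where "n = 1 + norm \<xi>"
    have n: "n \<ge> 1" by (simp add: n_def)
    have \<alpha>ai: "\<alpha> \<xi> absolutely_integrable_on {s..t}"
      by (rule absolutely_integrable_on_subinterval[OF \<alpha>_int]) (use st in auto)
    have bi: "(\<lambda>t. norm (b t)) integrable_on {s..t}"
      using absolutely_integrable_on_subinterval[OF b_int, of s t] st by (auto simp: absolutely_integrable_on_def)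
    have "(norm (v t))\<^sup>2 + n\<^sup>2 * (norm (y t))\<^sup>2 \<le>
      exp (n * (t - s) + integral {s..t} (\<lambda>r. \<bar>\<alpha> \<xi> r\<bar>) / n) * ((norm (v s))\<^sup>2 + n\<^sup>2 * (norm (y s))\<^sup>2)"
    proof (rule oscillator_energy_singular[OF st(2) _ \<alpha>ai, where ?t0.0 = t0])
      show "continuous_on {s..t} y" "continuous_on {s..t} v"
        using m continuous_on_subset[of "{0..T}" _ "{s..t}"] st by (auto simp: is_mode_def)
      show "(y has_vector_derivative v r) (at r within {s..t})" if "r \<in> {s..t}" for r
        by (rule has_vector_derivative_within_subset[of _ _ _ "{0..T}"]) (use m that st in \<open>auto simp: is_mode_def\<close>)
      show "(v has_vector_derivative - (\<alpha> \<xi> r *\<^sub>R y r)) (at r within {s..t})" if "r \<in> {s..t}" "r \<noteq> t0" for r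
        by (rule has_vector_derivative_within_subset[of _ _ _ "{0..T}"]) (use m that st in \<open>auto simp: is_mode_def\<close>)
    qed (use n in auto)
    also have "\<dots> \<le> (exp (2 + 4 * Kb) * n ^ N) * ((norm (v s))\<^sup>2 + n\<^sup>2 * (norm (y s))\<^sup>2)"
    proof (rule mult_right_mono)
      have "n * (t - s) \<le> n * (2 * (1 / n))"
        using near n unfolding n_def[symmetric] by (intro mult_left_mono) auto
      then have 1: "n * (t - s) \<le> 2" using n by simp
      have "integral {s..t} (\<lambda>r. \<bar>\<alpha> \<xi> r\<bar>) \<le> integral {s..t} (\<lambda>r. (norm \<xi>)\<^sup>2 * norm (b r))"
        using \<alpha>ai bi by (intro integral_le integrable_on_mult_right \<alpha>_le) (auto simp: absolutely_integrable_on_def)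
      also have "\<dots> = (norm \<xi>)\<^sup>2 * integral {s..t} (\<lambda>r. norm (b r))" by simp
      also have "\<dots> \<le> n\<^sup>2 * (Kb * (4 * (1 / n) - 2 * (1 / n) * ln (1 / n)))"
      proof (rule mult_mono)
        show "integral {s..t} (\<lambda>r. norm (b r)) \<le> Kb * (4 * (1 / n) - 2 * (1 / n) * ln (1 / n))"
          by (rule b_integral_near_singularity[OF Kb(2,1)])
            (use n st near in \<open>auto simp: n_def[symmetric]\<close>)
        show "(norm \<xi>)\<^sup>2 \<le> n\<^sup>2" by (intro power_mono) (auto simp: n_def)
      qed (auto intro!: Henstock_Kurzweil_Integration.integral_nonneg bi)
      also have "\<dots> = n * (4 * Kb + 2 * Kb * ln n)"
        using n by (simp add: ln_div power2_eq_square field_simps)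
      finally have "integral {s..t} (\<lambda>r. \<bar>\<alpha> \<xi> r\<bar>) / n \<le> 4 * Kb + 2 * Kb * ln n"
        using n by (simp add: divide_le_eq mult.commute)
      with 1 have "exp (n * (t - s) + integral {s..t} (\<lambda>r. \<bar>\<alpha> \<xi> r\<bar>) / n) \<le> exp ((2 + 4 * Kb) + 2 * Kb * ln n)"
        by simp
      also have "\<dots> = exp (2 + 4 * Kb) * exp (2 * Kb * ln n)" by (rule exp_add)
      also have "\<dots> \<le> exp (2 + 4 * Kb) * n ^ N"
        unfolding N_def by (intro mult_left_mono exp_ln_le_power n) auto
      finally show "exp (n * (t - s) + integral {s..t} (\<lambda>r. \<bar>\<alpha> \<xi> r\<bar>) / n) \<le> exp (2 + 4 * Kb) * n ^ N" .
    qed simp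
    finally show "(norm (v t))\<^sup>2 + (1 + norm \<xi>)\<^sup>2 * (norm (y t))\<^sup>2 \<le>
      exp (2 + 4 * Kb) * (1 + norm \<xi>) ^ N * ((norm (v s))\<^sup>2 + (1 + norm \<xi>)\<^sup>2 * (norm (y s))\<^sup>2)"
      unfolding n_def[symmetric] by simp
  qed
qed

text \<open>This is the finite loss of derivatives. The interval of length \<open>2/(1 + \<bar>\<xi>\<bar>)\<close> around \<open>t0\<close> is
  treated separately.\<close>

lemma mode_bound:
  obtains K N where "K \<ge> 0" "\<And>\<xi> y v t. is_mode \<xi> y v ==> t \<in> {0..T} ==>
    (norm (v t))\<^sup>2 + (norm (y t))\<^sup>2 \<le> K * (1 + norm \<xi>) ^ N * ((norm (v 0))\<^sup>2 + (norm (y 0))\<^sup>2)"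
proof -
  obtain K1 N1 where K1: "K1 \<ge> 1" and R: "\<And>\<xi> y v s t. is_mode \<xi> y v ==> 0 \<le> s ==> s \<le> t ==> t \<le> T ==>
    t \<le> t0 - 1 / (1 + norm \<xi>) \<or> t0 + 1 / (1 + norm \<xi>) \<le> s ==>
    (norm (v t))\<^sup>2 + (1 + norm \<xi>)\<^sup>2 * (norm (y t))\<^sup>2 \<le>
      K1 * (1 + norm \<xi>) ^ N1 * ((norm (v s))\<^sup>2 + (1 + norm \<xi>)\<^sup>2 * (norm (y s))\<^sup>2)"
    using mode_regular_phase by blast
  obtain K2 N2 where K2: "K2 \<ge> 1" and S: "\<And>\<xi> y v s t. is_mode \<xi> y v ==> 0 \<le> s ==> s \<le> t ==> t \<le> T ==>
    t0 - 1 / (1 + norm \<xi>) \<le> s ==> t \<le> t0 + 1 / (1 + norm \<xi>) ==>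
    (norm (v t))\<^sup>2 + (1 + norm \<xi>)\<^sup>2 * (norm (y t))\<^sup>2 \<le>
      K2 * (1 + norm \<xi>) ^ N2 * ((norm (v s))\<^sup>2 + (1 + norm \<xi>)\<^sup>2 * (norm (y s))\<^sup>2)"
    using mode_singular_phase by blast
  define K where "K = max K1 K2"
  define N where "N = max N1 N2"
  show thesis
  \<comment> \<open>Each of the three phases, before, across and after the zone, costs at most
    \<open>K n^N\<close>. The last two powers of \<open>n\<close> remove the weight
    \<open>n^2\<close> from the initial energy.\<close>
  proof (rule that[of "K ^ 3" "3 * N + 2"])
    show "K ^ 3 \<ge> 0" using K1 by (simp add: K_def)
    fix \<xi> y v t assume m: "is_mode \<xi> y v" and t: "t \<in> {0..T}"
    define n where "n = 1 + norm \<xi>"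
    have n: "n \<ge> 1" by (simp add: n_def)
    define F where "F r = (norm (v r))\<^sup>2 + n\<^sup>2 * (norm (y r))\<^sup>2" for r
    have Fp: "F r \<ge> 0" for r by (simp add: F_def)
    define Q where "Q = K * n ^ N"
    have K1': "K \<ge> 1" using K1 by (simp add: K_def)
    have Q: "K1 * n ^ N1 \<le> Q" "K2 * n ^ N2 \<le> Q" "1 \<le> Q"
    proof -
      show "K1 * n ^ N1 \<le> Q" "K2 * n ^ N2 \<le> Q"
        unfolding Q_def using K1 K2 n by (auto simp: K_def N_def intro!: mult_mono power_increasing)
      have "1 \<le> n ^ N" using n by (rule one_le_power)
      then show "1 \<le> Q" unfolding Q_def using K1' by (simp add: one_le_mult)
    qed
    have R': "F s' \<le> Q * F s" if "0 \<le> s" "s \<le> s'" "s' \<le> T" "s' \<le> t0 - 1 / n \<or> t0 + 1 / n \<le> s" for s s'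
    proof -
      have "F s' \<le> K1 * n ^ N1 * F s"
        unfolding F_def n_def by (rule R[OF m]) (use that in \<open>auto simp: n_def\<close>)
      also have "\<dots> \<le> Q * F s" by (intro mult_right_mono Q Fp)
      finally show ?thesis .
    qed
    have S': "F s' \<le> Q * F s" if "0 \<le> s" "s \<le> s'" "s' \<le> T" "t0 - 1 / n \<le> s" "s' \<le> t0 + 1 / n" for s s'
    proof -
      have "F s' \<le> K2 * n ^ N2 * F s"
        unfolding F_def n_def by (rule S[OF m]) (use that in \<open>auto simp: n_def\<close>)
      also have "\<dots> \<le> Q * F s" by (intro mult_right_mono Q Fp)
      finally show ?thesis .
    qed
    have QF: "F s \<le> Q * F s" for s using mult_right_mono[OF Q(3) Fp[of s]] by simp
    have Qm: "Q * x \<le> Q * y" if "x \<le> y" for x y using Q(3) that by (intro mult_left_mono) auto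
    have n0: "1 / n > 0" using n by simp
    \<comment> \<open>The zone may begin before time 0; then the first phase consists of the instant
      0.\<close>
    define t1 where "t1 = max 0 (t0 - 1 / n)"
    have t1: "0 \<le> t1" "t1 \<le> T" "t0 - 1 / n \<le> t1" "t1 \<le> t0"
      using t0 n0 unfolding t1_def atLeastAtMost_iff by linarith+
    have F1: "F s \<le> Q * F 0" if "0 \<le> s" "s \<le> t1" for s
    proof (cases "s \<le> t0 - 1 / n")
      case True
      show ?thesis by (rule R') (use True that t1 in auto)
    next
      case False
      then have "s = 0" using that by (auto simp: t1_def)
      then show ?thesis using QF by simp
    qed
    have F2: "F s \<le> Q * (Q * F 0)" if "0 \<le> s" "s \<le> T" "s \<le> t0 + 1 / n" for s
    proof (cases "s \<le> t1")
      case True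
      then show ?thesis using F1[OF that(1)] QF[of s] Qm[OF F1[OF that(1)]] by linarith
    next
      case False
      have "F s \<le> Q * F t1" by (rule S') (use False that t1 in auto)
      also have "\<dots> \<le> Q * (Q * F 0)" by (intro Qm F1) (use t1 in auto)
      finally show ?thesis .
    qed
    have F3: "F t \<le> Q * (Q * (Q * F 0))"
    proof (cases "t \<le> t0 + 1 / n")
      case True
      then have "F t \<le> Q * (Q * F 0)" using F2 t by auto
      then show ?thesis using QF[of t] Qm[of "F t" "Q * (Q * F 0)"] by linarith
    next
      case False
      have "F t \<le> Q * F (t0 + 1 / n)" by (rule R') (use False t t0 n0 in auto)
      also have "\<dots> \<le> Q * (Q * (Q * F 0))" by (intro Qm F2) (use False t t0 n0 in auto)
      finally show ?thesis .
    qed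
    have n2: "1 \<le> n\<^sup>2" using n by (rule one_le_power)
    have "(norm (v t))\<^sup>2 + (norm (y t))\<^sup>2 \<le> F t"
      using mult_right_mono[OF n2, of "(norm (y t))\<^sup>2"] by (simp add: F_def)
    also note F3
    also have "Q * (Q * (Q * F 0)) \<le> Q * (Q * (Q * (n\<^sup>2 * ((norm (v 0))\<^sup>2 + (norm (y 0))\<^sup>2))))"
      using mult_right_mono[OF n2, of "(norm (v 0))\<^sup>2"] by (intro Qm) (simp add: F_def distrib_left)
    also have "\<dots> = K ^ 3 * n ^ (3 * N + 2) * ((norm (v 0))\<^sup>2 + (norm (y 0))\<^sup>2)"
      by (simp add: Q_def power_add power_mult eval_nat_numeral power_mult_distrib mult_ac)
    finally show "(norm (v t))\<^sup>2 + (norm (y t))\<^sup>2 \<le> K ^ 3 * (1 + norm \<xi>) ^ (3 * N + 2) * ((norm (v 0))\<^sup>2 + (norm (y 0))\<^sup>2)"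
      by (simp add: n_def)
  qed
qed

end

subsection \<open>Integration by parts\<close>

lemma integral_cbox_enlarge:
  fixes g :: "'a::euclidean_space => 'b::banach"
  assumes "cbox a b \<subseteq> cbox c d" "\<And>x. x \<notin> cbox a b ==> g x = 0"
  shows "integral (cbox c d) g = integral (cbox a b) g"
proof -
  have "g = (\<lambda>x. if x \<in> cbox a b then g x else 0)" using assms(2) by auto
  then have "integral (cbox c d) g = integral (cbox c d) (\<lambda>x. if x \<in> cbox a b then g x else 0)" by simp
  also have "\<dots> = integral (cbox a b \<inter> cbox c d) g"
    by (rule Henstock_Kurzweil_Integration.integral_restrict_Int)
  finally show ?thesis using assms(1) by (simp only: Int_absorb2)
qed

text \<open>Translation along \<open>e\<close> does not change the integral of a function supported
  in the box. Differentiation under the integral sign with respect to the shift gives the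
  claim.\<close>

lemma integral_partial_zero:
  fixes g :: "'a::euclidean_space => 'b::euclidean_space"
  assumes diff: "\<And>x. g differentiable (at x)" and cont: "continuous_on UNIV (partial e g)"
    and supp: "\<And>x. x \<notin> cbox a b ==> g x = 0"
  shows "integral (cbox a b) (partial e g) = 0"
proof -
  \<comment> \<open>The box is enlarged by \<open>norm e\<close> on every side, so that it contains
    the supports of all translates with \<open>|h| \<le> 1\<close>.\<close>
  define d where "d = (\<Sum>i\<in>Basis. norm e *\<^sub>R i :: 'a)"
  have dB: "d \<bullet> i = norm e" if "i \<in> Basis" for i
    using that by (simp add: d_def inner_sum_left inner_Basis if_distrib cong: if_cong)
  define A B where "A = a - d" and "B = b + d"
  have sub: "cbox (a - h *\<^sub>R e) (b - h *\<^sub>R e) \<subseteq> cbox A B" if "h \<in> {-1..1}" for h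
  proof (rule subset_box_imp, intro ballI)
    fix i :: 'a assume i: "i \<in> Basis"
    have "\<bar>h * (e \<bullet> i)\<bar> \<le> 1 * norm e"
      unfolding abs_mult using that Basis_le_norm[OF i] by (intro mult_mono) auto
    then show "A \<bullet> i \<le> (a - h *\<^sub>R e) \<bullet> i \<and> (b - h *\<^sub>R e) \<bullet> i \<le> B \<bullet> i"
      using dB[OF i] by (auto simp: A_def B_def inner_diff_left inner_add_left abs_le_iff)
  qed
  have gc: "continuous_on UNIV g"
    using diff by (simp add: continuous_at_imp_continuous_on differentiable_imp_continuous_within)
  have const: "integral (cbox A B) (\<lambda>x. g (x + h *\<^sub>R e)) = integral (cbox a b) g" if h: "h \<in> {-1..1}" for h
  proof -
    have "integral (cbox A B) (\<lambda>x. g (x + h *\<^sub>R e)) = integral (cbox (a - h *\<^sub>R e) (b - h *\<^sub>R e)) (\<lambda>x. g (x + h *\<^sub>R e))"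
    proof (rule integral_cbox_enlarge[OF sub[OF h]])
      fix x assume "x \<notin> cbox (a - h *\<^sub>R e) (b - h *\<^sub>R e)"
      then have "x + h *\<^sub>R e \<notin> cbox a b" by (auto simp: mem_box inner_diff_left inner_add_left algebra_simps)
      then show "g (x + h *\<^sub>R e) = 0" by (rule supp)
    qed
    then show ?thesis by (simp add: integral_shift_cbox)
  qed
  have "((\<lambda>h. integral (cbox A B) (\<lambda>x. g (x + h *\<^sub>R e))) has_vector_derivative
      integral (cbox A B) (\<lambda>x. partial e g (x + 0 *\<^sub>R e))) (at 0 within {-1..1})"
  proof (rule leibniz_rule_vector_derivative)
    fix h x
    have "(g has_derivative (\<lambda>v. frechet_derivative g (at (x + h *\<^sub>R e)) v)) (at (x + h *\<^sub>R e))"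
      using diff frechet_derivative_works by blast
    then have "((\<lambda>h. g (x + h *\<^sub>R e)) has_derivative (\<lambda>k. frechet_derivative g (at (x + h *\<^sub>R e)) (k *\<^sub>R e))) (at h within {-1..1})"
      by (rule has_derivative_compose[rotated]) (auto intro!: derivative_eq_intros)
    moreover have "frechet_derivative g (at (x + h *\<^sub>R e)) (k *\<^sub>R e) = k *\<^sub>R partial e g (x + h *\<^sub>R e)" for k
      using linear_scale[OF linear_frechet_derivative[OF diff]] by (simp add: partial_def)
    ultimately show "((\<lambda>h. g (x + h *\<^sub>R e)) has_vector_derivative partial e g (x + h *\<^sub>R e)) (at h within {-1..1})"
      by (simp add: has_vector_derivative_def)
    show "(\<lambda>x. g (x + h *\<^sub>R e)) integrable_on cbox A B"
      by (intro integrable_continuous continuous_on_compose2[OF gc] continuous_intros) auto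
  next
    show "continuous_on ({-1..1} \<times> cbox A B) (\<lambda>(h, x). partial e g (x + h *\<^sub>R e))"
      unfolding split_beta by (intro continuous_on_compose2[OF cont] continuous_intros) auto
  qed auto
  moreover have "((\<lambda>h. integral (cbox A B) (\<lambda>x. g (x + h *\<^sub>R e))) has_vector_derivative 0) (at 0 within {-1..1})"
    by (rule has_vector_derivative_transform[OF _ _ has_vector_derivative_const[of "integral (cbox a b) g"]])
      (use const in auto)
  ultimately have z: "integral (cbox A B) (partial e g) = 0"
    using vector_derivative_unique_within_closed_interval[of "-1" 1 0] by fastforce
  have "partial e g x = 0" if "x \<notin> cbox a b" for x
  proof -
    have "partial e g x = partial e (\<lambda>x. 0) x"
      using partials_cong_open[of "- cbox a b" g "\<lambda>x. 0" x "[e]"] supp that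
      by (simp add: partials_Cons open_Compl closed_cbox)
    then show ?thesis by (simp add: partial_const)
  qed
  moreover have "cbox a b \<subseteq> cbox A B" using sub[of 0] by simp
  ultimately show ?thesis using integral_cbox_enlarge[of a b A B "partial e g"] z by simp
qed

subsection \<open>Concentrating kernels\<close>

text \<open>Laplace's method. Away from 0 the function stays below some \<open>r < \<rho> 0\<close>,
  so the contribution from there is \<open>O(r^N)\<close>, while the total mass is at least
  \<open>c q^N\<close> for some \<open>q > r\<close>, by integrating over a small box around
  0.\<close>

lemma approximate_identity_powers:
  fixes \<rho> :: "'a::euclidean_space => real" and F :: "'a => 'b::euclidean_space"
  assumes cont: "continuous_on (cbox a b) \<rho>" and nonneg: "\<And>z. z \<in> cbox a b ==> 0 \<le> \<rho> z"
    and max: "\<And>z. z \<in> cbox a b ==> z \<noteq> 0 ==> \<rho> z < \<rho> 0" and z0: "0 \<in> box a b"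
    and F: "continuous_on (cbox a b) F"
  shows "(\<lambda>N. (1 / integral (cbox a b) (\<lambda>z. \<rho> z ^ N)) *\<^sub>R integral (cbox a b) (\<lambda>z. \<rho> z ^ N *\<^sub>R F z)) \<longlonglongrightarrow> F 0"
proof -
  let ?Q = "cbox a b"
  define m where "m N = integral ?Q (\<lambda>z. \<rho> z ^ N)" for N
  have zQ: "0 \<in> ?Q" using z0 box_subset_cbox by blast
  have rpos: "\<rho> 0 > 0"
  proof -
    have "infinite (box a b)" using z0 open_box by (metis finite_imp_not_open empty_iff)
    then have "infinite (box a b - {0})" by simp
    then have "box a b - {0} \<noteq> {}" by (metis finite.emptyI)
    then obtain z where "z \<in> box a b" "z \<noteq> 0" by blast
    then show ?thesis using max[of z] nonneg[of z] box_subset_cbox by fastforce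
  qed
  have ip: "(\<lambda>z. \<rho> z ^ N) integrable_on cbox c d" if "cbox c d \<subseteq> ?Q" for c d N
    by (intro integrable_continuous continuous_intros continuous_on_subset[OF cont that])
  have iF: "(\<lambda>z. \<rho> z ^ N *\<^sub>R (F z - F 0)) integrable_on ?Q" "(\<lambda>z. \<rho> z ^ N *\<^sub>R F z) integrable_on ?Q" for N
    by (intro integrable_continuous continuous_intros cont F)+
  have lower: "\<exists>c q. c > 0 \<and> q > r \<and> q > 0 \<and> (\<forall>N. c * q ^ N \<le> m N)" if r: "r < \<rho> 0" for r
  proof -
    define q where "q = max ((r + \<rho> 0) / 2) (\<rho> 0 / 2)"
    have q: "q > r" "q > 0" "q < \<rho> 0" using r rpos by (auto simp: q_def less_max_iff_disj)
    have "\<rho> \<midarrow>0\<rightarrow> \<rho> 0"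
      using cont z0 by (simp add: continuous_on_interior interior_cbox isCont_def[symmetric])
    then have "\<forall>\<^sub>F z in at 0. q < \<rho> z" using q(3) by (rule order_tendstoD)
    then obtain \<eta> where \<eta>: "\<eta> > 0" "\<And>z. z \<noteq> 0 ==> dist z 0 < \<eta> ==> q < \<rho> z"
      unfolding eventually_at by blast
    have "open (box a b \<inter> ball 0 \<eta>)" "0 \<in> box a b \<inter> ball 0 \<eta>" using z0 \<eta>(1) by auto
    then obtain c d where cd: "0 \<in> box c d" "cbox c d \<subseteq> box a b \<inter> ball 0 \<eta>"
      using open_contains_cbox by (metis)
    have sub: "cbox c d \<subseteq> ?Q" using cd(2) box_subset_cbox by blast
    have cp: "measure lborel (cbox c d) > 0" using cd(1) by (simp add: content_pos_lt_eq mem_box) (meson less_trans)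
    have "measure lborel (cbox c d) * q ^ N \<le> m N" for N
    proof -
      have "measure lborel (cbox c d) * q ^ N = integral (cbox c d) (\<lambda>z. q ^ N)" by simp
      also have "\<dots> \<le> integral (cbox c d) (\<lambda>z. \<rho> z ^ N)"
      proof (rule integral_le[OF _ ip[OF sub]])
        fix z assume z: "z \<in> cbox c d"
        have "q \<le> \<rho> z" using \<eta>(2)[of z] cd(2) z q(3) by (cases "z = 0") (auto simp: dist_commute)
        then show "q ^ N \<le> \<rho> z ^ N" using q(2) by (intro power_mono) auto
      qed auto
      also have "\<dots> \<le> m N" unfolding m_def
        by (rule integral_subset_le[OF sub]) (use ip sub nonneg in auto)
      finally show ?thesis .
    qed
    then show ?thesis using cp q by blast
  qed
  have mp: "m N > 0" for N
  proof -
    obtain c q where "c > 0" "q > 0" "c * q ^ N \<le> m N" using lower[OF rpos] by blast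
    then show ?thesis using less_le_trans[of 0 "c * q ^ N" "m N"] by simp
  qed
  show ?thesis
  proof (rule LIMSEQ_I)
    fix e :: real assume e: "e > 0"
    have "(F \<longlongrightarrow> F 0) (at 0)"
      using F z0 by (simp add: continuous_on_interior interior_cbox isCont_def[symmetric])
    then have "\<forall>\<^sub>F z in at 0. dist (F z) (F 0) < e / 3" using e by (intro tendstoD) auto
    then obtain \<delta> where \<delta>: "\<delta> > 0" "\<And>z. z \<noteq> 0 ==> dist z 0 < \<delta> ==> dist (F z) (F 0) < e / 3"
      unfolding eventually_at by blast
    obtain M where M: "\<And>z. z \<in> ?Q ==> norm (F z) \<le> M" "M > 0"
      using compact_imp_bounded[OF compact_continuous_image[OF F compact_cbox]] by (auto simp: bounded_pos)
    obtain r where r: "0 \<le> r" "r < \<rho> 0" "\<And>z. z \<in> ?Q - ball 0 \<delta> ==> \<rho> z \<le> r"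
    proof (cases "?Q - ball 0 \<delta> = {}")
      case True
      then show ?thesis by (intro that[of 0]) (use rpos in blast)+
    next
      case False
      have "compact (?Q - ball 0 \<delta>)" by (intro compact_diff) auto
      then obtain zm where "zm \<in> ?Q - ball 0 \<delta>" "\<And>z. z \<in> ?Q - ball 0 \<delta> ==> \<rho> z \<le> \<rho> zm"
        using continuous_attains_sup[OF _ False continuous_on_subset[OF cont]] by (metis Diff_subset)
      then show ?thesis using that[of "\<rho> zm"] nonneg[of zm] max[of zm] \<delta>(1) by (cases "zm = 0") auto
    qed
    obtain c q where cq: "c > 0" "q > r" "q > 0" "\<And>N. c * q ^ N \<le> m N" using lower[OF r(2)] by blast
    define V where "V = measure lborel ?Q"
    have "(\<lambda>N. 2 * M * V / c * (r / q) ^ N) \<longlonglongrightarrow> 2 * M * V / c * 0"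
      using cq r(1) by (intro tendsto_intros LIMSEQ_realpow_zero) (auto simp: field_simps)
    then have "\<forall>\<^sub>F N in sequentially. 2 * M * V / c * (r / q) ^ N < e / 3"
      using e by (intro order_tendstoD) auto
    then obtain N0 where N0: "\<And>N. N \<ge> N0 ==> 2 * M * V / c * (r / q) ^ N < e / 3"
      unfolding eventually_sequentially by blast
    show "\<exists>N0. \<forall>N\<ge>N0. norm ((1 / integral ?Q (\<lambda>z. \<rho> z ^ N)) *\<^sub>R integral ?Q (\<lambda>z. \<rho> z ^ N *\<^sub>R F z) - F 0) < e"
    proof (intro exI[of _ N0] allI impI)
      fix N assume N: "N \<ge> N0"
      have eq: "(1 / m N) *\<^sub>R integral ?Q (\<lambda>z. \<rho> z ^ N *\<^sub>R F z) - F 0 = (1 / m N) *\<^sub>R integral ?Q (\<lambda>z. \<rho> z ^ N *\<^sub>R (F z - F 0))"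
      proof -
        have "integral ?Q (\<lambda>z. \<rho> z ^ N *\<^sub>R (F z - F 0)) = integral ?Q (\<lambda>z. \<rho> z ^ N *\<^sub>R F z - \<rho> z ^ N *\<^sub>R F 0)"
          by (simp add: scaleR_diff_right)
        also have "\<dots> = integral ?Q (\<lambda>z. \<rho> z ^ N *\<^sub>R F z) - integral ?Q (\<lambda>z. \<rho> z ^ N *\<^sub>R F 0)"
          by (intro Henstock_Kurzweil_Integration.integral_diff iF(2) integrable_continuous continuous_intros cont)
        also have "integral ?Q (\<lambda>z. \<rho> z ^ N *\<^sub>R F 0) = m N *\<^sub>R F 0"
          unfolding m_def
          by (rule integral_unique, rule has_integral_scaleR_left, rule integrable_integral, rule ip) simp
        finally show ?thesis using mp[of N] by (simp add: scaleR_diff_right)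
      qed
      have "norm (integral ?Q (\<lambda>z. \<rho> z ^ N *\<^sub>R (F z - F 0))) \<le> integral ?Q (\<lambda>z. e / 3 * \<rho> z ^ N + r ^ N * (2 * M))"
      proof (rule Henstock_Kurzweil_Integration.integral_norm_bound_integral[OF iF(1)])
        show "(\<lambda>z. e / 3 * \<rho> z ^ N + r ^ N * (2 * M)) integrable_on ?Q"
          by (intro integrable_continuous continuous_intros cont)
        fix z assume z: "z \<in> ?Q"
        have rz: "\<rho> z ^ N \<ge> 0" using nonneg[OF z] by simp
        show "norm (\<rho> z ^ N *\<^sub>R (F z - F 0)) \<le> e / 3 * \<rho> z ^ N + r ^ N * (2 * M)"
        proof (cases "z \<in> ball 0 \<delta>")
          case True
          then have "norm (F z - F 0) \<le> e / 3" using \<delta>(2)[of z] e by (cases "z = 0") (auto simp: dist_norm)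
          then have "\<rho> z ^ N * norm (F z - F 0) \<le> \<rho> z ^ N * (e / 3)" using rz by (rule mult_left_mono)
          also have "\<dots> = e / 3 * \<rho> z ^ N" by (rule mult.commute)
          finally have "\<rho> z ^ N * norm (F z - F 0) \<le> e / 3 * \<rho> z ^ N" .
          moreover have "0 \<le> r ^ N * (2 * M)" using r(1) M(2) by simp
          ultimately show ?thesis unfolding norm_scaleR real_norm_def abs_of_nonneg[OF rz] by linarith
        next
          case False
          have "norm (F z - F 0) \<le> 2 * M"
            using norm_triangle_ineq4[of "F z" "F 0"] M(1)[OF z] M(1)[OF zQ] by linarith
          then have "\<rho> z ^ N * norm (F z - F 0) \<le> r ^ N * (2 * M)"
            using r z False nonneg[OF z] by (intro mult_mono power_mono) auto
          moreover have "0 \<le> e / 3 * \<rho> z ^ N" using rz e by simp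
          ultimately show ?thesis unfolding norm_scaleR real_norm_def abs_of_nonneg[OF rz] by linarith
        qed
      qed
      also have "\<dots> = e / 3 * m N + V * (r ^ N * (2 * M))"
      proof -
        have "((\<lambda>z. e / 3 * \<rho> z ^ N + r ^ N * (2 * M)) has_integral (e / 3 * m N + V *\<^sub>R (r ^ N * (2 * M)))) ?Q"
          unfolding m_def V_def
          by (intro has_integral_add has_integral_mult_right integrable_integral ip has_integral_const) simp
        then show ?thesis by (simp add: integral_unique)
      qed
      finally have b1: "norm (integral ?Q (\<lambda>z. \<rho> z ^ N *\<^sub>R (F z - F 0))) \<le> e / 3 * m N + V * (r ^ N * (2 * M))" .
      have "V * (r ^ N * (2 * M)) \<le> e / 3 * m N"
      proof -
        have "V * (r ^ N * (2 * M)) = (2 * M * V / c * (r / q) ^ N) * (c * q ^ N)"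
          using cq by (simp add: power_divide field_simps)
        also have "\<dots> \<le> e / 3 * m N"
          using N0[OF N] cq mp[of N] e by (intro mult_mono cq(4)) auto
        finally show ?thesis .
      qed
      with b1 have "norm (integral ?Q (\<lambda>z. \<rho> z ^ N *\<^sub>R (F z - F 0))) \<le> (2 / 3 * e) * m N" by simp
      then have "norm ((1 / m N) *\<^sub>R integral ?Q (\<lambda>z. \<rho> z ^ N *\<^sub>R (F z - F 0))) \<le> 2 / 3 * e"
        using mp[of N] by (simp add: divide_le_eq)
      then show "norm ((1 / integral ?Q (\<lambda>z. \<rho> z ^ N)) *\<^sub>R integral ?Q (\<lambda>z. \<rho> z ^ N *\<^sub>R F z) - F 0) < e"
        unfolding m_def[symmetric] eq using e by linarith
    qed
  qed
qed

subsection \<open>Trigonometric expansions\<close>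

definition freq :: "('n => int) => real ^ 'n" where
  "freq k = (\<chi> j. of_int (k j))"

text \<open>The Fourier coefficients of the de la Vallee Poussin kernel
  \<open>(2 + 2 cos \<theta>)^N\<close>, divided by the central one so that the zeroth coefficient
  is 1.\<close>

definition kernel_coeff :: "nat => int => real" where
  "kernel_coeff N l = (if \<bar>l\<bar> \<le> int N then real (2 * N choose nat (int N + l)) / real (2 * N choose N) else 0)"

lemma kernel_coeff_bounds: "0 \<le> kernel_coeff N l" "kernel_coeff N l \<le> 1" "kernel_coeff N 0 = 1"
proof -
  have p: "2 * N choose N > 0" by (rule zero_less_binomial) simp
  show "0 \<le> kernel_coeff N l" by (simp add: kernel_coeff_def)
  have "2 * N choose nat (int N + l) \<le> 2 * N choose N"
    using binomial_maximum[of "2 * N" "nat (int N + l)"] by simp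
  then show "kernel_coeff N l \<le> 1" using p by (simp add: kernel_coeff_def divide_le_eq)
  show "kernel_coeff N 0 = 1" using p by (simp add: kernel_coeff_def)
qed

text \<open>Since \<open>2 + 2 cos \<theta> = cis (- \<theta>) (1 + cis \<theta>)^2\<close>, the
  kernel is a binomial expansion with its index shifted by \<open>N\<close>.\<close>

lemma kernel_expansion_1:
  "complex_of_real ((2 + 2 * cos \<theta>) ^ N / real (2 * N choose N)) = (\<Sum>l\<in>{- int N..int N}. of_real (kernel_coeff N l) * cis (of_int l * \<theta>))"
proof -
  have "complex_of_real (2 + 2 * cos \<theta>) = cis (- \<theta>) * (1 + cis \<theta>) ^ 2"
  proof -
    have "cos \<theta> * (cos \<theta> * 2) + sin \<theta> * (sin \<theta> * 2) = 2"
      using sin_cos_squared_add[of \<theta>] by algebra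
    then show ?thesis by (simp add: power2_eq_square algebra_simps cis_mult complex_eq_iff)
  qed
  then have "complex_of_real ((2 + 2 * cos \<theta>) ^ N) = cis (- \<theta>) ^ N * (1 + cis \<theta>) ^ (2 * N)"
    by (simp add: power_mult_distrib power_mult del: of_real_add of_real_mult)
  also have "(1 + cis \<theta>) ^ (2 * N) = (\<Sum>i\<le>2 * N. of_nat (2 * N choose i) * cis \<theta> ^ i)"
    using binomial_ring[of "cis \<theta>" 1 "2 * N"] by (simp add: add.commute)
  also have "cis (- \<theta>) ^ N * (\<Sum>i\<le>2 * N. of_nat (2 * N choose i) * cis \<theta> ^ i)
      = (\<Sum>i\<le>2 * N. of_nat (2 * N choose i) * cis ((real i - real N) * \<theta>))"
  proof -
    have "cis (- \<theta>) ^ N * cis \<theta> ^ i = cis ((real i - real N) * \<theta>)" for i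
      by (simp add: Complex.DeMoivre cis_mult algebra_simps)
    then have e2: "cis (- \<theta>) ^ N * (of_nat (2 * N choose i) * cis \<theta> ^ i) = of_nat (2 * N choose i) * cis ((real i - real N) * \<theta>)" for i
      by (metis mult.left_commute)
    show ?thesis by (simp only: sum_distrib_left e2)
  qed
  also have "\<dots> = (\<Sum>l\<in>{- int N..int N}. of_nat (2 * N choose nat (int N + l)) * cis (of_int l * \<theta>))"
    by (rule sum.reindex_bij_witness[of _ "\<lambda>l. nat (int N + l)" "\<lambda>i. int i - int N"]) auto
  finally have "complex_of_real ((2 + 2 * cos \<theta>) ^ N) / of_nat (2 * N choose N)
      = (\<Sum>l\<in>{- int N..int N}. of_nat (2 * N choose nat (int N + l)) / of_nat (2 * N choose N) * cis (of_int l * \<theta>))"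
    by (simp add: sum_divide_distrib)
  also have "\<dots> = (\<Sum>l\<in>{- int N..int N}. of_real (kernel_coeff N l) * cis (of_int l * \<theta>))"
    by (intro sum.cong refl) (auto simp: kernel_coeff_def)
  finally show ?thesis by simp
qed

text \<open>Successive coefficients have the ratio \<open>(N - k) / (N + k + 1)\<close>, which tends
  to 1 for fixed \<open>k\<close>; negative indices follow from the symmetry of the binomial
  coefficients.\<close>

lemma kernel_coeff_tendsto: "(\<lambda>N. kernel_coeff N l) \<longlonglongrightarrow> 1"
proof -
  define r where "r k N = real (2 * N choose (N + k)) / real (2 * N choose N)" for k N
  have p: "2 * N choose N > 0" for N by (rule zero_less_binomial) simp
  have "r k \<longlonglongrightarrow> 1" for k
  proof (induction k)
    case 0
    then show ?case using p by (simp add: r_def)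
  next
    case (Suc k)
    have step: "r (Suc k) N = r k N * ((real N - real k) / (real N + real k + 1))" if "N \<ge> Suc k" for N
    proof -
      have "Suc (N + k) * (2 * N choose Suc (N + k)) = (2 * N - (N + k)) * (2 * N choose (N + k))"
        using binomial_absorb_comp[of "2 * N" "N + k"] Suc_times_binomial_add[of "N + k" "N - Suc k"] that
        by (metis Suc_times_binomial_eq binomial_absorption binomial_absorb_comp mult.commute diff_Suc_1 add_Suc_right)
      then have "real (Suc (N + k) * (2 * N choose Suc (N + k))) = real ((2 * N - (N + k)) * (2 * N choose (N + k)))"
        by (simp only:)
      then have "real (Suc (N + k)) * real (2 * N choose Suc (N + k)) = (real N - real k) * real (2 * N choose (N + k))"
        using that by (simp only: of_nat_mult) (simp add: of_nat_diff)
      then have "real (2 * N choose Suc (N + k)) = real (2 * N choose (N + k)) * ((real N - real k) / (real N + real k + 1))"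
        by (simp add: field_simps)
      then show ?thesis by (simp add: r_def)
    qed
    have "(\<lambda>N. (real N - real k) / (real N + real k + 1)) \<longlonglongrightarrow> 1"
    proof -
      have "(\<lambda>N. 1 - (2 * real k + 1) * inverse (real (N + (k + 1)))) \<longlonglongrightarrow> 1 - (2 * real k + 1) * 0"
        by (intro tendsto_intros LIMSEQ_ignore_initial_segment LIMSEQ_inverse_real_of_nat[THEN LIMSEQ_imp_Suc])
      moreover have "1 - (2 * real k + 1) * inverse (real (N + (k + 1))) = (real N - real k) / (real N + real k + 1)" for N
        by (simp add: field_simps)
      ultimately show ?thesis by simp
    qed
    from tendsto_mult[OF Suc this] have "(\<lambda>N. r k N * ((real N - real k) / (real N + real k + 1))) \<longlonglongrightarrow> 1" by simp
    then show ?case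
      by (rule Lim_transform_eventually) (use step in \<open>auto simp: eventually_sequentially intro!: exI[of _ "Suc k"]\<close>)
  qed
  moreover have "\<forall>\<^sub>F N in sequentially. r (nat \<bar>l\<bar>) N = kernel_coeff N l"
    unfolding eventually_sequentially
  proof (intro exI[of _ "nat \<bar>l\<bar>"] allI impI)
    fix N assume N: "nat \<bar>l\<bar> \<le> N"
    show "r (nat \<bar>l\<bar>) N = kernel_coeff N l"
    proof (cases "l \<ge> 0")
      case True
      then show ?thesis using N by (simp add: r_def kernel_coeff_def nat_add_distrib)
    next
      case False
      then have "2 * N choose nat (int N + l) = 2 * N choose (2 * N - nat (int N + l))"
        using N by (intro binomial_symmetric) auto
      moreover have "2 * N - nat (int N + l) = N + nat \<bar>l\<bar>" using False N by auto
      ultimately show ?thesis using N False by (simp add: r_def kernel_coeff_def)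
    qed
  qed
  ultimately show ?thesis by (blast intro: Lim_transform_eventually)
qed

definition trig_kernel :: "nat => real ^ 'n => real" where
  "trig_kernel N z = (\<Prod>j\<in>UNIV. (2 + 2 * cos (z $ j)) ^ N / real (2 * N choose N))"

definition kernel_coeffs :: "nat => ('n::finite => int) => real" where
  "kernel_coeffs N k = (\<Prod>j\<in>UNIV. kernel_coeff N (k j))"

lemma cis_sum: "finite A ==> cis (\<Sum>j\<in>A. f j) = (\<Prod>j\<in>A. cis (f j))"
  by (induction A rule: finite_induct) (auto simp: cis_mult[symmetric])

lemma kernel_expansion:
  fixes z :: "real ^ 'n"
  shows "complex_of_real (trig_kernel N z) =
    (\<Sum>k\<in>PiE UNIV (\<lambda>_. {- int N..int N}). of_real (kernel_coeffs N k) * cis (freq k \<bullet> z))"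
proof -
  have "complex_of_real (trig_kernel N z) = (\<Prod>j\<in>UNIV. \<Sum>l\<in>{- int N..int N}. of_real (kernel_coeff N l) * cis (of_int l * z $ j))"
    unfolding trig_kernel_def of_real_prod kernel_expansion_1 ..
  also have "\<dots> = (\<Sum>k\<in>PiE UNIV (\<lambda>_. {- int N..int N}). \<Prod>j\<in>UNIV. of_real (kernel_coeff N (k j)) * cis (of_int (k j) * z $ j))"
    by (rule prod_sum_PiE) auto
  also have "\<dots> = (\<Sum>k\<in>PiE UNIV (\<lambda>_. {- int N..int N}). of_real (kernel_coeffs N k) * cis (freq k \<bullet> z))"
    by (simp add: kernel_coeffs_def prod.distrib cis_sum[symmetric] freq_def inner_vec_def)
  finally show ?thesis .
qed

lemma kernel_coeffs_bounds: "0 \<le> kernel_coeffs N k" "kernel_coeffs N k \<le> 1" "kernel_coeffs N (\<lambda>_. 0) = 1"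
  unfolding kernel_coeffs_def using kernel_coeff_bounds by (auto intro!: prod_nonneg prod_le_1)

lemma kernel_coeffs_tendsto: "(\<lambda>N. kernel_coeffs N k) \<longlonglongrightarrow> 1"
  unfolding kernel_coeffs_def using tendsto_prod[of UNIV "\<lambda>j N. kernel_coeff N (k j)" "\<lambda>_. 1"] kernel_coeff_tendsto by simp


subsection \<open>Fourier series\<close>

text \<open>The subtracted \<open>2 / (N + 1)\<close> makes the induction telescope: the two new
  terms are together at most \<open>2 (1 / (N + 1) - 1 / (N + 2))\<close>.\<close>

lemma sum_inverse_squares_int: "(\<Sum>l\<in>{- int N..int N}. 1 / (1 + \<bar>real_of_int l\<bar>)\<^sup>2) \<le> 3 - 2 / (real N + 1)"
proof (induction N)
  case (Suc N)
  have "{- int (Suc N)..int (Suc N)} = insert (int (Suc N)) (insert (- int (Suc N)) {- int N..int N})" by auto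
  then have "(\<Sum>l\<in>{- int (Suc N)..int (Suc N)}. 1 / (1 + \<bar>real_of_int l\<bar>)\<^sup>2)
      = 2 * (1 / (real N + 2)\<^sup>2) + (\<Sum>l\<in>{- int N..int N}. 1 / (1 + \<bar>real_of_int l\<bar>)\<^sup>2)"
    by (simp add: add.commute)
  also have "1 / (real N + 2)\<^sup>2 \<le> 1 / (real N + 1) - 1 / (real N + 2)"
  proof -
    have "1 / (real N + 2)\<^sup>2 \<le> 1 / ((real N + 1) * (real N + 2))"
      unfolding power2_eq_square by (intro divide_left_mono mult_right_mono) auto
    also have "\<dots> = 1 / (real N + 1) - 1 / (real N + 2)" by (simp add: field_simps)
    finally show ?thesis .
  qed
  finally show ?case using Suc by (simp add: add.commute)
qed simp

text \<open>The weight \<open>w\<close> is a product over the coordinates, so its sum over a box of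
  integer vectors factorises and stays below \<open>3 ^ CARD('n)\<close>. Each coordinate is at most
  the Euclidean norm, which gives the exponent \<open>2 * CARD('n)\<close>.\<close>

lemma frequency_enumeration:
  obtains e :: "nat => 'n::finite => int" and p where "bij e"
    "summable (\<lambda>i. 1 / (1 + norm (freq (e i))) ^ p)"
proof -
  have c: "countable (UNIV :: ('n => int) set)" by simp
  have "inj (\<lambda>(m::nat) (j::'n). int m)" by (auto intro!: injI dest: fun_cong)
  then have inf: "infinite (UNIV :: ('n => int) set)"
    using range_inj_infinite infinite_super subset_UNIV by blast
  define e where "e = from_nat_into (UNIV :: ('n => int) set)"
  have bij: "bij e" unfolding e_def using bij_betw_from_nat_into[OF c inf] .
  define w where "w k = (\<Prod>j\<in>UNIV. 1 / (1 + \<bar>real_of_int (k j)\<bar>)\<^sup>2)" for k :: "'n => int"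
  have wp: "w k \<ge> 0" for k unfolding w_def by (intro prod_nonneg) auto
  have "(\<Sum>i<M. w (e i)) \<le> 3 ^ CARD('n)" for M
  proof -
    define N where "N = (\<Sum>i<M. \<Sum>j\<in>UNIV. nat \<bar>e i j\<bar>)"
    have N: "nat \<bar>e i j\<bar> \<le> N" if "i < M" for i j
    proof -
      have "nat \<bar>e i j\<bar> \<le> (\<Sum>j\<in>UNIV. nat \<bar>e i j\<bar>)" by (rule member_le_sum) auto
      also have "\<dots> \<le> N" unfolding N_def by (rule member_le_sum) (use that in auto)
      finally show ?thesis .
    qed
    have "(\<Sum>i<M. w (e i)) = (\<Sum>k\<in>e ` {..<M}. w k)"
      using bij by (subst sum.reindex) (auto simp: bij_def inj_on_def)
    also have "\<dots> \<le> (\<Sum>k\<in>PiE UNIV (\<lambda>_. {- int N..int N}). w k)"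
    proof (rule sum_mono2)
      show "e ` {..<M} \<subseteq> PiE UNIV (\<lambda>_. {- int N..int N})"
      proof
        fix k assume "k \<in> e ` {..<M}"
        then obtain i where i: "i < M" "k = e i" by auto
        have "\<bar>k j\<bar> \<le> int N" for j using N[OF i(1), of j] i(2) by simp
        then show "k \<in> PiE UNIV (\<lambda>_. {- int N..int N})" by (auto simp: PiE_def abs_le_iff) (smt (verit))
      qed
    qed (auto intro!: finite_PiE wp)
    also have "\<dots> = (\<Prod>j\<in>(UNIV :: 'n set). \<Sum>l\<in>{- int N..int N}. 1 / (1 + \<bar>real_of_int l\<bar>)\<^sup>2)"
      unfolding w_def by (rule prod_sum_PiE[symmetric]) auto
    also have "\<dots> \<le> (\<Prod>j\<in>(UNIV :: 'n set). 3)"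
    proof (rule prod_mono)
      show "0 \<le> (\<Sum>l\<in>{- int N..int N}. 1 / (1 + \<bar>real_of_int l\<bar>)\<^sup>2) \<and> (\<Sum>l\<in>{- int N..int N}. 1 / (1 + \<bar>real_of_int l\<bar>)\<^sup>2) \<le> 3" for j :: 'n
        using order_trans[OF sum_inverse_squares_int[of N]] by (auto intro!: sum_nonneg)
    qed
    finally show ?thesis by simp
  qed
  then have sw: "summable (\<lambda>i. w (e i))"
    by (intro summableI_nonneg_bounded wp) auto
  have "summable (\<lambda>i. 1 / (1 + norm (freq (e i))) ^ (2 * CARD('n)))"
  proof (rule summable_comparison_test'[OF sw])
    fix i
    have "1 / (1 + norm (freq (e i))) ^ (2 * CARD('n)) = (\<Prod>j\<in>(UNIV :: 'n set). 1 / (1 + norm (freq (e i)))\<^sup>2)"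
      by (simp add: power_mult power_one_over)
    also have "\<dots> \<le> w (e i)"
      unfolding w_def
    proof (rule prod_mono)
      fix j
      have "\<bar>real_of_int (e i j)\<bar> \<le> norm (freq (e i))"
        using component_le_norm_cart[of "freq (e i)" j] by (simp add: freq_def)
      then show "0 \<le> 1 / (1 + norm (freq (e i)))\<^sup>2 \<and> 1 / (1 + norm (freq (e i)))\<^sup>2 \<le> 1 / (1 + \<bar>real_of_int (e i j)\<bar>)\<^sup>2"
        by (auto intro!: divide_left_mono power_mono mult_pos_pos zero_less_power add_pos_nonneg)
    qed
    finally show "norm (1 / (1 + norm (freq (e i))) ^ (2 * CARD('n))) \<le> w (e i)" by simp
  qed
  with bij show thesis by (rule that)
qed

text \<open>The functions expanded are supported in the cube of side 2, which is shorter than the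
  period \<open>2 pi\<close>; integrating over the cube is therefore enough. The normalising
  constant is left out and reappears as \<open>\<gamma>\<close> in
  \<open>fourier_inversion\<close>.\<close>

definition fcoeff :: "(real ^ 'n => complex) => ('n => int) => complex" where
  "fcoeff f k = integral (cbox (- 1) 1) (\<lambda>x. cis (- (freq k \<bullet> x)) * f x)"

lemma cis_inner_has_derivative:
  "((\<lambda>x. cis (\<xi> \<bullet> x)) has_derivative (\<lambda>v. \<i> * complex_of_real (\<xi> \<bullet> v) * cis (\<xi> \<bullet> x))) (at x)"
proof -
  have "((\<lambda>x. \<xi> \<bullet> x) has_derivative (\<lambda>v. \<xi> \<bullet> v)) (at x)"
    by (auto intro!: derivative_eq_intros)
  from has_derivative_cis[OF this] show ?thesis
    by (rule has_derivative_eq_rhs) (simp add: fun_eq_iff scaleR_conv_of_real mult_ac)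
qed

lemma continuous_on_cis_inner: "continuous_on S (\<lambda>x. cis (\<xi> \<bullet> x))"
  by (intro continuous_at_imp_continuous_on ballI) (rule has_derivative_continuous[OF cis_inner_has_derivative])

lemma continuous_on_cis_minus_inner: "continuous_on S (\<lambda>x. cis (- (\<xi> \<bullet> x)))"
  using continuous_on_cis_inner[of S "- \<xi>"] by simp

lemma partial_supported:
  assumes "\<And>x. x \<notin> K ==> f x = 0" "closed K" "x \<notin> K"
  shows "partial e f x = 0"
  using partials_cong_open[of "- K" f "\<lambda>x. 0" x "[e]"] assms by (simp add: partials_Cons partial_const open_Compl)

lemma fcoeff_partial:
  fixes f :: "real ^ 'n => complex"
  assumes f: "smooth f" and supp: "\<And>x. x \<notin> cbox (- 1) 1 ==> f x = 0"
  shows "fcoeff (partial (axis j 1) f) k = \<i> * of_int (k j) * fcoeff f k"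
proof -
  define g where "g x = cis (- (freq k \<bullet> x)) * f x" for x
  have fd: "(f has_derivative frechet_derivative f (at x)) (at x)" for x
    using smooth_differentiable[OF f] frechet_derivative_works by blast
  have d: "(g has_derivative (\<lambda>v. cis (- (freq k \<bullet> x)) * frechet_derivative f (at x) v
      + (\<i> * complex_of_real (- freq k \<bullet> v) * cis (- (freq k \<bullet> x))) * f x)) (at x)" for x
    unfolding g_def[abs_def]
    using has_derivative_mult[OF cis_inner_has_derivative[of "- freq k" x] fd] by simp
  have pg: "partial (axis j 1) g = (\<lambda>x. cis (- (freq k \<bullet> x)) * partial (axis j 1) f x - \<i> * of_int (k j) * g x)"
    using has_derivative_partial[OF d, of "axis j 1"]
    by (auto simp: g_def partial_def inner_axis freq_def algebra_simps)
  have gc: "continuous_on UNIV g" "continuous_on UNIV (\<lambda>x. cis (- (freq k \<bullet> x)) * partial (axis j 1) f x)"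
    unfolding g_def
    by (intro continuous_on_mult continuous_on_cis_minus_inner smooth_continuous_on f smooth_partial[OF f] axis_in_Basis_iff[THEN iffD2]; simp)+
  have "integral (cbox (- 1) 1) (partial (axis j 1) g) = 0"
  proof (rule integral_partial_zero)
    show "g differentiable (at x)" for x using d by (auto simp: differentiable_def)
    show "continuous_on UNIV (partial (axis j 1) g)"
      unfolding pg by (intro continuous_on_diff continuous_on_mult continuous_on_const gc)
  qed (use supp in \<open>simp add: g_def\<close>)
  then have "integral (cbox (- 1) 1) (\<lambda>x. cis (- (freq k \<bullet> x)) * partial (axis j 1) f x)
     - integral (cbox (- 1) 1) (\<lambda>x. \<i> * of_int (k j) * g x) = 0"
    unfolding pg
    by (subst (asm) Henstock_Kurzweil_Integration.integral_diff)
      (intro integrable_continuous continuous_on_mult continuous_on_const continuous_on_subset[OF gc(1)] continuous_on_subset[OF gc(2)] subset_UNIV)+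
  then show ?thesis
    by (simp add: fcoeff_def g_def)
qed

lemma fcoeff_bounded:
  fixes f :: "real ^ 'n => complex"
  assumes f: "continuous_on (cbox (- 1) 1) f"
  obtains B where "B \<ge> 0" "\<And>k. norm (fcoeff f k) \<le> B"
proof -
  let ?P = "cbox (- 1) (1 :: real ^ 'n)"
  have nf: "(\<lambda>x. norm (f x)) integrable_on ?P" by (intro integrable_continuous continuous_intros f)
  show thesis
  proof (rule that[of "integral ?P (\<lambda>x. norm (f x))"])
    show "0 \<le> integral ?P (\<lambda>x. norm (f x))" by (rule Henstock_Kurzweil_Integration.integral_nonneg[OF nf]) simp
    show "norm (fcoeff f k) \<le> integral ?P (\<lambda>x. norm (f x))" for k
      unfolding fcoeff_def
      by (rule Henstock_Kurzweil_Integration.integral_norm_bound_integral[OF _ nf])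
        (auto simp: norm_mult intro!: integrable_continuous continuous_intros f continuous_on_cis_minus_inner)
  qed
qed

text \<open>An \<open>m\<close>-fold derivative in direction \<open>j\<close> multiplies the
  coefficient by the \<open>m\<close>-th power of \<open>k j\<close> up to a unit; boundedness of
  the coefficients of that derivative gives decay in \<open>k j\<close>, and the largest coordinate
  controls the norm of the frequency.\<close>

lemma fcoeff_decay:
  fixes f :: "real ^ 'n => complex"
  assumes f: "smooth f" and supp: "\<And>x. x \<notin> cbox (- 1) 1 ==> f x = 0"
  obtains B where "\<And>k. norm (fcoeff f k) * (1 + norm (freq k)) ^ m \<le> B"
proof -
  have pw: "\<exists>B\<ge>0. \<forall>k. \<bar>real_of_int (k j)\<bar> ^ m * norm (fcoeff f k) \<le> B" for j
    using f supp
  proof (induction m arbitrary: f)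
    case 0
    then show ?case using fcoeff_bounded[OF smooth_continuous_on[OF 0(1)]] by (metis mult_1 power_0)
  next
    case (Suc m)
    have "smooth (partial (axis j 1) f)" by (rule smooth_partial[OF Suc.prems(1)]) simp
    moreover have "partial (axis j 1) f x = 0" if "x \<notin> cbox (- 1) 1" for x
      by (rule partial_supported[OF Suc.prems(2) closed_cbox that])
    ultimately obtain B where "B \<ge> 0" "\<And>k. \<bar>real_of_int (k j)\<bar> ^ m * norm (fcoeff (partial (axis j 1) f) k) \<le> B"
      using Suc.IH by blast
    then show ?case
      by (intro exI[of _ B]) (auto simp: fcoeff_partial[OF Suc.prems] norm_mult mult_ac)
  qed
  then obtain B where B: "\<And>j. B j \<ge> 0" "\<And>j k. \<bar>real_of_int (k j)\<bar> ^ m * norm (fcoeff f k) \<le> B j" by metis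
  obtain B0 where B0: "B0 \<ge> 0" "\<And>k. norm (fcoeff f k) \<le> B0"
    using fcoeff_bounded[OF smooth_continuous_on[OF f]] by metis
  define n where "n = real (CARD('n)) + 1"
  show thesis
  proof (rule that[of "n ^ m * (B0 + (\<Sum>j\<in>UNIV. B j))"])
    fix k :: "'n => int"
    define M where "M = Max (insert 1 (range (\<lambda>j. \<bar>real_of_int (k j)\<bar>)))"
    have M: "1 \<le> M" "\<And>j. \<bar>real_of_int (k j)\<bar> \<le> M" unfolding M_def by (rule Max_ge; simp)+
    have "M \<in> insert 1 (range (\<lambda>j. \<bar>real_of_int (k j)\<bar>))" unfolding M_def by (rule Max_in) auto
    then have Mm: "M ^ m \<le> 1 + (\<Sum>j\<in>UNIV. \<bar>real_of_int (k j)\<bar> ^ m)"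
    proof
      assume "M = 1"
      then show ?thesis by (simp add: sum_nonneg)
    next
      assume "M \<in> range (\<lambda>j. \<bar>real_of_int (k j)\<bar>)"
      then obtain j where j: "M = \<bar>real_of_int (k j)\<bar>" by auto
      have "\<bar>real_of_int (k j)\<bar> ^ m \<le> (\<Sum>j\<in>UNIV. \<bar>real_of_int (k j)\<bar> ^ m)"
        by (rule member_le_sum[of j UNIV "\<lambda>j. \<bar>real_of_int (k j)\<bar> ^ m"]) auto
      then show ?thesis by (simp add: j)
    qed
    have "norm (freq k) \<le> (\<Sum>j\<in>UNIV. \<bar>real_of_int (k j)\<bar>)"
      using norm_le_l1_cart[of "freq k"] by (simp add: freq_def)
    also have "\<dots> \<le> (\<Sum>j\<in>(UNIV :: 'n set). M)" by (intro sum_mono M)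
    finally have "1 + norm (freq k) \<le> n * M" using M(1) by (simp add: n_def algebra_simps)
    then have "(1 + norm (freq k)) ^ m \<le> (n * M) ^ m" by (intro power_mono) auto
    also have "\<dots> \<le> n ^ m * (1 + (\<Sum>j\<in>UNIV. \<bar>real_of_int (k j)\<bar> ^ m))"
      unfolding power_mult_distrib by (intro mult_left_mono Mm) (simp add: n_def)
    finally have "norm (fcoeff f k) * (1 + norm (freq k)) ^ m \<le> norm (fcoeff f k) * (n ^ m * (1 + (\<Sum>j\<in>UNIV. \<bar>real_of_int (k j)\<bar> ^ m)))"
      by (intro mult_left_mono) auto
    also have "\<dots> = n ^ m * (norm (fcoeff f k) + (\<Sum>j\<in>UNIV. \<bar>real_of_int (k j)\<bar> ^ m * norm (fcoeff f k)))"
      by (simp add: algebra_simps sum_distrib_left)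
    also have "\<dots> \<le> n ^ m * (B0 + (\<Sum>j\<in>UNIV. B j))"
      by (intro mult_left_mono add_mono sum_mono B B0) (simp add: n_def)
    finally show "norm (fcoeff f k) * (1 + norm (freq k)) ^ m \<le> n ^ m * (B0 + (\<Sum>j\<in>UNIV. B j))" .
  qed
qed


section \<open>Inversion of the Fourier series on the unit cube\<close>

lemma integral_reflect_shift:
  fixes h :: "'a::euclidean_space => 'b::euclidean_space"
  shows "integral (cbox (- c) c) (\<lambda>y. h (x - y)) = integral (cbox (x - c) (x + c)) h"
proof -
  have "integral (cbox (- c) (- (- c))) (\<lambda>y. h (- y + x)) = integral (cbox (- c) c) (\<lambda>y. h (y + x))"
    using integral_reflect[of c "- c" "\<lambda>y. h (y + x)"] by simp
  also have "\<dots> = integral (cbox (x - c) (x + c)) h"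
    using integral_shift_cbox[of "x - c" x "x + c" h] by simp
  finally show ?thesis by simp
qed

text \<open>On the cube of half side 2 all coordinates satisfy \<open>|z $ j| < pi\<close>, so each
  cosine equals 1 only at 0 and the maximum at 0 is strict. Half side 2 is what differences of
  points of the unit cube require.\<close>

lemma prod_cos_lt:
  fixes z :: "real ^ 'n"
  assumes z: "z \<in> cbox (- vec 2) (vec 2)" "z \<noteq> 0"
  shows "(\<Prod>j\<in>UNIV. 2 + 2 * cos (z $ j)) < 4 ^ CARD('n)"
proof -
  obtain j where j: "z $ j \<noteq> 0" using z(2) by (auto simp: vec_eq_iff)
  have "\<bar>z $ j\<bar> \<le> 2" using z(1) by (auto simp: mem_box_cart abs_le_iff) (metis minus_le_iff)
  then have "\<bar>z $ j\<bar> < pi" using pi_gt3 by linarith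
  then have "cos \<bar>z $ j\<bar> < cos 0" using j by (intro cos_monotone_0_pi) auto
  then have c: "cos (z $ j) < 1" by simp
  have "(\<Prod>j\<in>UNIV. 2 + 2 * cos (z $ j)) = (2 + 2 * cos (z $ j)) * (\<Prod>i\<in>UNIV - {j}. 2 + 2 * cos (z $ i))"
    by (rule prod.remove) auto
  also have "\<dots> \<le> (2 + 2 * cos (z $ j)) * (\<Prod>i\<in>UNIV - {j}. 4)"
  proof (intro mult_left_mono prod_mono)
    show "0 \<le> 2 + 2 * cos (z $ i) \<and> 2 + 2 * cos (z $ i) \<le> 4" for i
      using cos_ge_minus_one[of "z $ i"] cos_le_one[of "z $ i"] by linarith
    show "0 \<le> 2 + 2 * cos (z $ j)" using cos_ge_minus_one[of "z $ j"] by linarith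
  qed
  also have "\<dots> < 4 * (\<Prod>i\<in>UNIV - {j}. 4)" using c by (intro mult_strict_right_mono) (auto intro!: prod_pos)
  also have "\<dots> = (\<Prod>i\<in>(UNIV :: 'n set). 4)" by (rule prod.remove[symmetric]) auto
  finally show ?thesis by simp
qed

lemma trig_kernel_power:
  fixes z :: "real ^ 'n"
  shows "trig_kernel N z = (\<Prod>j\<in>UNIV. 2 + 2 * cos (z $ j)) ^ N / real (2 * N choose N) ^ CARD('n)"
  by (simp add: trig_kernel_def prod_dividef prod_power_distrib)

lemma trig_kernel_nonneg: "0 \<le> trig_kernel N z"
proof -
  have "0 \<le> 2 + 2 * cos t" for t :: real using cos_ge_minus_one[of t] by linarith
  then show ?thesis unfolding trig_kernel_def by (intro prod_nonneg) auto
qed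

lemma continuous_on_trig_kernel: "continuous_on S (trig_kernel N)"
  unfolding trig_kernel_def[abs_def]
  by (intro continuous_on_prod continuous_on_divide continuous_intros) auto

text \<open>The integral runs over the cube of differences, less than a full period, so it has no
  simple closed form; a lower bound is all that gets proved about it. The type argument carries the
  dimension.\<close>

definition trig_mass :: "'n::finite itself => nat => real" where
  "trig_mass _ N = integral (cbox (- vec 2) (vec 2 :: real ^ 'n)) (trig_kernel N)"

lemma trig_approximate_identity:
  fixes F :: "real ^ 'n => complex"
  assumes F: "continuous_on (cbox (- vec 2) (vec 2)) F"
  shows "(\<lambda>N. (1 / trig_mass TYPE('n) N) *\<^sub>R integral (cbox (- vec 2) (vec 2)) (\<lambda>z. trig_kernel N z *\<^sub>R F z)) \<longlonglongrightarrow> F 0"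
proof -
  let ?Q = "cbox (- vec 2) (vec 2 :: real ^ 'n)"
  define \<rho> where "\<rho> z = (\<Prod>j\<in>UNIV. 2 + 2 * cos (z $ j))" for z :: "real ^ 'n"
  have \<rho>0: "\<rho> 0 = 4 ^ CARD('n)" by (simp add: \<rho>_def)
  have c: "continuous_on ?Q \<rho>" unfolding \<rho>_def by (intro continuous_on_prod continuous_intros)
  have lim: "(\<lambda>N. (1 / integral ?Q (\<lambda>z. \<rho> z ^ N)) *\<^sub>R integral ?Q (\<lambda>z. \<rho> z ^ N *\<^sub>R F z)) \<longlonglongrightarrow> F 0"
  proof (rule approximate_identity_powers[OF c])
    have "0 \<le> 2 + 2 * cos t" for t :: real using cos_ge_minus_one[of t] by linarith
    then show "0 \<le> \<rho> z" for z unfolding \<rho>_def by (intro prod_nonneg) auto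
    show "\<rho> z < \<rho> 0" if "z \<in> ?Q" "z \<noteq> 0" for z unfolding \<rho>0 unfolding \<rho>_def by (rule prod_cos_lt[OF that])
  qed (use F in \<open>auto simp: mem_box_cart\<close>)
  define D where "D N = real (2 * N choose N) ^ CARD('n)" for N
  have D: "D N > 0" for N unfolding D_def by (intro zero_less_power) (simp add: zero_less_binomial)
  have K: "trig_kernel N z = (1 / D N) * \<rho> z ^ N" for N and z :: "real ^ 'n"
    by (simp add: trig_kernel_power \<rho>_def D_def)
  have "(1 / trig_mass TYPE('n) N) *\<^sub>R integral ?Q (\<lambda>z. trig_kernel N z *\<^sub>R F z)
      = (1 / integral ?Q (\<lambda>z. \<rho> z ^ N)) *\<^sub>R integral ?Q (\<lambda>z. \<rho> z ^ N *\<^sub>R F z)" for N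
  proof -
    have "integral ?Q (\<lambda>z. trig_kernel N z *\<^sub>R F z) = integral ?Q (\<lambda>z. (1 / D N) *\<^sub>R (\<rho> z ^ N *\<^sub>R F z))"
      by (simp add: K)
    also have "\<dots> = (1 / D N) *\<^sub>R integral ?Q (\<lambda>z. \<rho> z ^ N *\<^sub>R F z)" by (rule integral_cmul)
    finally have 1: "integral ?Q (\<lambda>z. trig_kernel N z *\<^sub>R F z) = (1 / D N) *\<^sub>R integral ?Q (\<lambda>z. \<rho> z ^ N *\<^sub>R F z)" .
    have "trig_mass TYPE('n) N = (1 / D N) * integral ?Q (\<lambda>z. \<rho> z ^ N)"
      unfolding trig_mass_def K[abs_def] by (rule integral_mult_right)
    then show ?thesis unfolding 1 using D[of N] by simp
  qed
  then show ?thesis using lim by simp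
qed

lemma trig_kernel_convolution:
  fixes g :: "real ^ 'n => complex"
  assumes g: "continuous_on (cbox (- 1) 1) g"
  shows "integral (cbox (- 1) 1) (\<lambda>y. complex_of_real (trig_kernel N (x - y)) * g y)
    = (\<Sum>k\<in>PiE UNIV (\<lambda>_. {- int N..int N}). of_real (kernel_coeffs N k) * fcoeff g k * cis (freq k \<bullet> x))"
proof -
  let ?B = "PiE (UNIV :: 'n set) (\<lambda>_. {- int N..int N})"
  have e: "complex_of_real (trig_kernel N (x - y)) * g y
      = (\<Sum>k\<in>?B. (of_real (kernel_coeffs N k) * cis (freq k \<bullet> x)) * (cis (- (freq k \<bullet> y)) * g y))" for y
    unfolding kernel_expansion sum_distrib_right
  proof (intro sum.cong refl)
    fix k :: "'n => int"
    have "cis (freq k \<bullet> (x - y)) = cis (freq k \<bullet> x) * cis (- (freq k \<bullet> y))"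
      by (simp add: cis_mult inner_diff_right)
    then show "of_real (kernel_coeffs N k) * cis (freq k \<bullet> (x - y)) * g y
      = (of_real (kernel_coeffs N k) * cis (freq k \<bullet> x)) * (cis (- (freq k \<bullet> y)) * g y)"
      by (simp only: mult_ac)
  qed
  have "integral (cbox (- 1) 1) (\<lambda>y. complex_of_real (trig_kernel N (x - y)) * g y)
    = (\<Sum>k\<in>?B. integral (cbox (- 1) 1) (\<lambda>y. (of_real (kernel_coeffs N k) * cis (freq k \<bullet> x)) * (cis (- (freq k \<bullet> y)) * g y)))"
    unfolding e
    by (rule Henstock_Kurzweil_Integration.integral_sum)
      (auto intro!: finite_PiE integrable_continuous continuous_on_mult continuous_on_const continuous_on_cis_minus_inner g)
  also have "\<dots> = (\<Sum>k\<in>?B. of_real (kernel_coeffs N k) * fcoeff g k * cis (freq k \<bullet> x))"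
    by (intro sum.cong refl) (subst integral_mult_right, simp add: fcoeff_def mult_ac)
  finally show ?thesis .
qed

text \<open>The kernel is positive definite and its zeroth coefficient is \<open>1\<close>, which bounds its mass from
  below.\<close>

lemma trig_mass_ge: "trig_mass TYPE('n::finite) N \<ge> measure lborel (cbox (- 1) (1 :: real ^ 'n))"
  and content_unit_cbox_pos: "measure lborel (cbox (- 1) (1 :: real ^ 'n)) > 0"
proof -
  let ?P = "cbox (- 1) (1 :: real ^ 'n)"
  let ?Q = "cbox (- vec 2) (vec 2 :: real ^ 'n)"
  let ?B = "PiE (UNIV :: 'n set) (\<lambda>_. {- int N..int N})"
  define V where "V = measure lborel ?P"
  show Vp: "measure lborel ?P > 0"
  proof -
    have "0 \<in> box (- 1) (1 :: real ^ 'n)" by (simp add: mem_box_cart)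
    then have "box (- 1) (1 :: real ^ 'n) \<noteq> {}" by blast
    then show ?thesis by (simp add: content_pos_lt_eq box_ne_empty)
  qed
  define c where "c k = fcoeff (\<lambda>_. 1 :: complex) k" for k :: "'n => int"
  have cnjc: "integral ?P (\<lambda>x. cis (freq k \<bullet> x)) = cnj (c k)" for k
  proof -
    have "(\<lambda>x. cis (- (freq k \<bullet> x))) integrable_on ?P"
      by (intro integrable_continuous continuous_on_cis_minus_inner)
    from integral_linear[OF this bounded_linear_cnj] show ?thesis
      by (simp add: c_def fcoeff_def o_def cis_cnj)
  qed
  define G where "G x = integral ?P (\<lambda>y. trig_kernel N (x - y))" for x :: "real ^ 'n"
  have tc: "continuous_on S (\<lambda>y. trig_kernel N (x - y))" for x :: "real ^ 'n" and S
    by (intro continuous_on_compose2[OF continuous_on_trig_kernel[of UNIV]] continuous_intros) auto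
  have bl: "bounded_linear complex_of_real" by (rule bounded_linear_of_real)
  have G: "complex_of_real (G x) = (\<Sum>k\<in>?B. of_real (kernel_coeffs N k) * c k * cis (freq k \<bullet> x))" for x
  proof -
    have "(\<lambda>y. trig_kernel N (x - y)) integrable_on ?P" by (intro integrable_continuous tc)
    from integral_linear[OF this bl]
    have "complex_of_real (G x) = integral ?P (\<lambda>y. complex_of_real (trig_kernel N (x - y)))"
      by (simp add: G_def o_def)
    also have "\<dots> = integral ?P (\<lambda>y. complex_of_real (trig_kernel N (x - y)) * 1)" by simp
    also have "\<dots> = (\<Sum>k\<in>?B. of_real (kernel_coeffs N k) * c k * cis (freq k \<bullet> x))"
      unfolding c_def by (rule trig_kernel_convolution) simp
    finally show ?thesis .
  qed
  have Gi: "G integrable_on ?P"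
  proof -
    have "continuous_on ?P (\<lambda>x. Re (\<Sum>k\<in>?B. of_real (kernel_coeffs N k) * c k * cis (freq k \<bullet> x)))"
      by (intro continuous_on_Re continuous_on_sum continuous_on_mult continuous_on_const continuous_on_cis_inner)
    then have "continuous_on ?P G" unfolding G[symmetric] by simp
    then show ?thesis by (rule integrable_continuous)
  qed
  have "complex_of_real (integral ?P G) = integral ?P (\<lambda>x. complex_of_real (G x))"
    using integral_linear[OF Gi bl, symmetric] by (simp add: o_def)
  also have "\<dots> = (\<Sum>k\<in>?B. integral ?P (\<lambda>x. of_real (kernel_coeffs N k) * c k * cis (freq k \<bullet> x)))"
    unfolding G
    by (rule Henstock_Kurzweil_Integration.integral_sum)
      (auto intro!: finite_PiE integrable_continuous continuous_on_mult continuous_on_const continuous_on_cis_inner)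
  also have "\<dots> = (\<Sum>k\<in>?B. of_real (kernel_coeffs N k * (norm (c k))\<^sup>2))"
    by (intro sum.cong refl) (simp add: cnjc mult.assoc complex_norm_square[symmetric])
  also have "\<dots> = complex_of_real (\<Sum>k\<in>?B. kernel_coeffs N k * (norm (c k))\<^sup>2)" by simp
  finally have I: "integral ?P G = (\<Sum>k\<in>?B. kernel_coeffs N k * (norm (c k))\<^sup>2)"
    using of_real_eq_iff by blast
  have c0: "c (\<lambda>_. 0) = of_real V"
  proof -
    have "freq (\<lambda>_::'n. 0) = 0" by (simp add: freq_def vec_eq_iff)
    then show ?thesis by (simp add: c_def fcoeff_def V_def scaleR_conv_of_real)
  qed
  \<comment> \<open>The kernel integrated over pairs of points of the cube equals the sum of
    \<open>kernel_coeffs N k * (norm (c k))^2\<close>, whose term for \<open>k = 0\<close> alone is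
    \<open>V^2\<close>. Integrating in one variable first gives at most \<open>trig_mass\<close> for
    each point, hence the upper bound \<open>V * trig_mass\<close>.\<close>
  have "V\<^sup>2 = kernel_coeffs N (\<lambda>_::'n. 0) * (norm (c (\<lambda>_. 0)))\<^sup>2"
    by (simp add: c0 kernel_coeffs_bounds)
  also have "\<dots> \<le> (\<Sum>k\<in>?B. kernel_coeffs N k * (norm (c k))\<^sup>2)"
    by (rule member_le_sum[of "\<lambda>_. 0" ?B "\<lambda>k. kernel_coeffs N k * (norm (c k))\<^sup>2"])
      (auto simp: kernel_coeffs_bounds intro!: finite_PiE)
  also have "\<dots> = integral ?P G" using I by simp
  also have "\<dots> \<le> integral ?P (\<lambda>x. trig_mass TYPE('n) N)"
  proof (rule integral_le[OF Gi])
    fix x assume x: "x \<in> ?P"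
    have sub: "cbox (x - 1) (x + 1) \<subseteq> ?Q"
    proof
      fix z assume z: "z \<in> cbox (x - 1) (x + 1)"
      have "- 2 \<le> z $ i \<and> z $ i \<le> 2" for i
      proof -
        have "- 1 \<le> x $ i" "x $ i \<le> 1" "x $ i - 1 \<le> z $ i" "z $ i \<le> x $ i + 1"
          using x z by (auto simp: mem_box_cart)
        then show ?thesis by linarith
      qed
      then show "z \<in> ?Q" by (simp add: mem_box_cart)
    qed
    have "G x = integral (cbox (x - 1) (x + 1)) (trig_kernel N)"
      unfolding G_def using integral_reflect_shift[of 1 "trig_kernel N" x] by simp
    also have "\<dots> \<le> trig_mass TYPE('n) N"
      unfolding trig_mass_def
      by (rule integral_subset_le[OF sub])
        (auto intro!: integrable_continuous continuous_on_trig_kernel trig_kernel_nonneg)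
    finally show "G x \<le> trig_mass TYPE('n) N" .
  qed auto
  also have "\<dots> = V * trig_mass TYPE('n) N" by (simp add: V_def)
  finally show "trig_mass TYPE('n) N \<ge> measure lborel ?P"
    using Vp by (simp add: power2_eq_square V_def)
qed

text \<open>The constant \<open>\<gamma>\<close> is a limit of reciprocal masses along a
  subsequence, which exists by compactness because the masses are bounded below; it is independent
  of \<open>f\<close> and never evaluated. Smoothing by the kernel multiplies the terms by
  coefficients tending to 1 under a summable majorant, so Tannery's theorem identifies the limit
  with the series, while the approximate identity identifies it with \<open>f x\<close>.\<close>

lemma fourier_inversion:
  fixes e :: "nat => 'n::finite => int"
  assumes e: "bij e" and p: "summable (\<lambda>i. 1 / (1 + norm (freq (e i))) ^ p)"
  shows "\<exists>\<gamma> :: real. \<forall>(f :: real ^ 'n => complex) x. smooth f --> (\<forall>x. x \<notin> cbox (- 1) 1 --> f x = 0) -->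
    x \<in> cbox (- 1) 1 --> (\<lambda>i. of_real \<gamma> * fcoeff f (e i) * cis (freq (e i) \<bullet> x)) sums f x"
proof -
  let ?P = "cbox (- 1) (1 :: real ^ 'n)"
  let ?Q = "cbox (- vec 2) (vec 2 :: real ^ 'n)"
  define V where "V = measure lborel ?P"
  define m where "m = trig_mass TYPE('n)"
  have V: "V > 0" unfolding V_def by (rule content_unit_cbox_pos)
  have mV: "m N \<ge> V" for N unfolding m_def V_def by (rule trig_mass_ge)
  have mp: "m N > 0" for N using V mV less_le_trans by blast
  have "1 / m N \<in> {0..1 / V}" for N using mV[of N] mp[of N] V by (simp add: divide_left_mono)
  then obtain \<gamma> r where r: "strict_mono r" "((\<lambda>N. 1 / m N) \<circ> r) \<longlonglongrightarrow> \<gamma>"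
    using compact_Icc[of 0 "1 / V"] unfolding compact_def by metis
  show ?thesis
  proof (intro exI[of _ \<gamma>] allI impI)
    fix f :: "real ^ 'n => complex" and x
    assume f: "smooth f" and supp': "\<forall>x. x \<notin> ?P --> f x = 0" and x: "x \<in> ?P"
    from supp' have supp: "\<And>x. x \<notin> ?P ==> f x = 0" by blast
    obtain B where B: "\<And>k. norm (fcoeff f k) * (1 + norm (freq k)) ^ p \<le> B"
      using fcoeff_decay[OF f supp] by metis
    have n0: "0 < 1 + norm (freq k)" for k :: "'n => int" by (simp add: add_pos_nonneg)
    have fB: "norm (fcoeff f k) \<le> B * (1 / (1 + norm (freq k)) ^ p)" for k
      using B[of k] n0[of k] by (simp add: pos_le_divide_eq)
    define a where "a i N = of_real (kernel_coeffs (r N) (e i) / m (r N)) * fcoeff f (e i) * cis (freq (e i) \<bullet> x)" for i N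
    define b where "b i = of_real \<gamma> * fcoeff f (e i) * cis (freq (e i) \<bullet> x)" for i
    have alim: "a i \<longlonglongrightarrow> b i" for i
    proof -
      have "(\<lambda>N. kernel_coeffs (r N) (e i)) \<longlonglongrightarrow> 1"
        using LIMSEQ_subseq_LIMSEQ[OF kernel_coeffs_tendsto r(1)] by (simp add: o_def)
      from tendsto_mult[OF this r(2)] have "(\<lambda>N. kernel_coeffs (r N) (e i) / m (r N)) \<longlonglongrightarrow> \<gamma>"
        by (simp add: o_def)
      then show ?thesis unfolding a_def b_def by (intro tendsto_intros)
    qed
    have abd: "norm (a i N) \<le> 1 / V * (B * (1 / (1 + norm (freq (e i))) ^ p))" for i N
    proof -
      have "kernel_coeffs (r N) (e i) / m (r N) \<le> 1 / V"
        using kernel_coeffs_bounds(1,2)[of "r N" "e i"] mV[of "r N"] V by (intro frac_le) auto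
      then have "\<bar>kernel_coeffs (r N) (e i) / m (r N)\<bar> \<le> 1 / V"
        using kernel_coeffs_bounds(1)[of "r N" "e i"] mp[of "r N"] by (subst abs_of_nonneg) auto
      then show ?thesis
        unfolding a_def norm_mult norm_of_real using fB[of "e i"] V
        by (simp only: norm_cis mult_1_right) (intro mult_mono, auto)
    qed
    have sumM: "summable (\<lambda>i. 1 / V * (B * (1 / (1 + norm (freq (e i))) ^ p)))"
      by (intro summable_mult p)
    have tan: "eventually (\<lambda>n. summable (\<lambda>k. norm (a k n))) sequentially \<and> summable (\<lambda>n. norm (b n)) \<and>
           (\<lambda>N. suminf (\<lambda>i. a i N)) \<longlonglongrightarrow> suminf b"
      by (rule tannerys_theorem[OF alim _ sumM]) (intro always_eventually allI, simp only: split_beta abd, rule sequentially_bot)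
    have "suminf (\<lambda>i. a i N) = (1 / m (r N)) *\<^sub>R integral ?Q (\<lambda>z. trig_kernel (r N) z *\<^sub>R f (x - z))" for N
    proof -
      let ?B = "PiE (UNIV :: 'n set) (\<lambda>_. {- int (r N)..int (r N)})"
      have fin: "finite ?B" by (intro finite_PiE) auto
      have inv: "e (inv e k) = k" for k using e by (simp add: bij_is_surj surj_f_inv_f)
      have "a i N = 0" if "i \<notin> inv e ` ?B" for i
      proof -
        have "e i \<notin> ?B" using that e by (metis bij_inv_eq_iff image_eqI)
        then obtain j where "e i j \<notin> {- int (r N)..int (r N)}" by (auto simp: PiE_iff)
        then have "kernel_coeff (r N) (e i j) = 0" by (auto simp: kernel_coeff_def)
        then have "kernel_coeffs (r N) (e i) = 0" unfolding kernel_coeffs_def by (meson UNIV_I finite prod_zero)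
        then show ?thesis by (simp add: a_def)
      qed
      then have "suminf (\<lambda>i. a i N) = (\<Sum>i\<in>inv e ` ?B. a i N)" by (intro suminf_finite) (use fin in auto)
      also have "\<dots> = (\<Sum>k\<in>?B. a (inv e k) N)"
        using inv by (subst sum.reindex) (metis inj_onI, simp)
      also have "\<dots> = (1 / m (r N)) *\<^sub>R (\<Sum>k\<in>?B. of_real (kernel_coeffs (r N) k) * fcoeff f k * cis (freq k \<bullet> x))"
        by (simp add: a_def inv scaleR_conv_of_real mult_ac sum_divide_distrib)
      also have "(\<Sum>k\<in>?B. of_real (kernel_coeffs (r N) k) * fcoeff f k * cis (freq k \<bullet> x))
        = integral ?P (\<lambda>y. complex_of_real (trig_kernel (r N) (x - y)) * f y)"
        by (rule trig_kernel_convolution[symmetric]) (rule smooth_continuous_on[OF f])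
      also have "\<dots> = integral ?P (\<lambda>y. (\<lambda>z. trig_kernel (r N) z *\<^sub>R f (x - z)) (x - y))"
        by (simp add: scaleR_conv_of_real)
      also have "\<dots> = integral (cbox (x - 1) (x + 1)) (\<lambda>z. trig_kernel (r N) z *\<^sub>R f (x - z))"
        by (rule integral_reflect_shift)
      also have "\<dots> = integral ?Q (\<lambda>z. trig_kernel (r N) z *\<^sub>R f (x - z))"
      proof (rule integral_cbox_enlarge[symmetric])
        show "cbox (x - 1) (x + 1) \<subseteq> ?Q"
        proof
          fix z assume z: "z \<in> cbox (x - 1) (x + 1)"
          have "- 2 \<le> z $ i \<and> z $ i \<le> 2" for i
          proof -
            have "- 1 \<le> x $ i" "x $ i \<le> 1" "x $ i - 1 \<le> z $ i" "z $ i \<le> x $ i + 1"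
              using x z by (auto simp: mem_box_cart)
            then show ?thesis by linarith
          qed
          then show "z \<in> ?Q" by (simp add: mem_box_cart)
        qed
        fix z assume "z \<notin> cbox (x - 1) (x + 1)"
        then have "x - z \<notin> ?P" by (auto simp: mem_box_cart algebra_simps)
        then show "trig_kernel (r N) z *\<^sub>R f (x - z) = 0" using supp by simp
      qed
      finally show ?thesis .
    qed
    moreover have "(\<lambda>N. (1 / m (r N)) *\<^sub>R integral ?Q (\<lambda>z. trig_kernel (r N) z *\<^sub>R f (x - z))) \<longlonglongrightarrow> f (x - 0)"
    proof -
      have "continuous_on ?Q (\<lambda>z. f (x - z))"
        by (intro continuous_on_compose2[OF smooth_continuous_on[OF f, of UNIV]] continuous_intros) auto
      from LIMSEQ_subseq_LIMSEQ[OF trig_approximate_identity[OF this] r(1)] show ?thesis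
        by (simp add: o_def m_def)
    qed
    ultimately have "(\<lambda>N. suminf (\<lambda>i. a i N)) \<longlonglongrightarrow> f x" by simp
    then have "suminf b = f x" using tan LIMSEQ_unique by blast
    then show "(\<lambda>i. of_real \<gamma> * fcoeff f (e i) * cis (freq (e i) \<bullet> x)) sums f x"
      unfolding b_def[symmetric, abs_def] using tan by (metis summable_norm_cancel summable_sums)
  qed
qed

text \<open>Scaling by \<open>2 R\<close> takes the ball of radius \<open>R\<close> into the ball of
  radius \<open>1/2\<close>, where the cut-off is 1. The frequencies are chosen before
  \<open>f\<close>, so that both initial data are expanded in the same plane waves.\<close>

lemma plane_wave_expansion:
  fixes R :: real
  assumes R: "R > 0"
  shows "\<exists>\<xi> :: nat => real ^ 'n. \<forall>f :: real ^ 'n => complex. smooth f -->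
    (\<exists>c. (\<forall>m. summable (\<lambda>i. norm (c i) * (1 + norm (\<xi> i)) ^ m)) \<and>
      (\<forall>x. norm x \<le> R --> (\<lambda>i. c i * cis (\<xi> i \<bullet> x)) sums f x))"
proof -
  obtain e :: "nat => 'n => int" and p where e: "bij e" and p: "summable (\<lambda>i. 1 / (1 + norm (freq (e i))) ^ p)"
    by (rule frequency_enumeration)
  from fourier_inversion[OF e p]
  obtain \<gamma> :: real where \<gamma>: "\<forall>(f :: real ^ 'n => complex) x. smooth f --> (\<forall>x. x \<notin> cbox (- 1) 1 --> f x = 0) -->
    x \<in> cbox (- 1) 1 --> (\<lambda>i. of_real \<gamma> * fcoeff f (e i) * cis (freq (e i) \<bullet> x)) sums f x"
    by (elim exE) (rule that)
  obtain H :: "real => real" where H: "smooth H" "\<And>x. x \<le> 0 ==> H x = 0" "\<And>x. x \<ge> 1 ==> H x = 1"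
    using smooth_step_exists by metis
  \<comment> \<open>Equal to 1 for \<open>|t| \<le> 1/2\<close> and to 0 for
    \<open>|t| \<ge> 1\<close>.\<close>
  define h1 where "h1 t = H (2 * t + 2) * H (- 2 * t + 2)" for t
  have sm1: "smooth h1"
    unfolding h1_def
    by (intro smooth_mult smooth_affine[OF _ H(1)]) (rule bounded_linear_mult_right)+
  define h where "h y = (\<Prod>j\<in>UNIV. h1 (y $ j))" for y :: "real ^ 'n"
  have "smooth (\<lambda>y :: real ^ 'n. h1 (y $ j + 0))" for j
    by (rule smooth_affine[OF bounded_linear_vec_nth sm1])
  then have smh: "smooth h" unfolding h_def by (intro smooth_prod) simp
  have h_one: "h y = 1" if "norm y \<le> 1 / 2" for y
  proof -
    have "h1 (y $ j) = 1" for j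
    proof -
      have "\<bar>y $ j\<bar> \<le> 1 / 2" using component_le_norm_cart[of y j] that by linarith
      then show ?thesis by (simp add: h1_def H(3) abs_le_iff)
    qed
    then show ?thesis by (simp add: h_def)
  qed
  have h_zero: "h y = 0" if y: "y \<notin> cbox (- 1) 1" for y
  proof -
    obtain j where "\<not> (- 1 \<le> y $ j \<and> y $ j \<le> 1)" using y unfolding mem_box_cart by auto
    then have "h1 (y $ j) = 0" by (auto simp: h1_def H(2))
    then show ?thesis unfolding h_def by (meson UNIV_I finite prod_zero)
  qed
  show ?thesis
  proof (intro exI[of _ "\<lambda>i. (1 / (2 * R)) *\<^sub>R freq (e i)"] allI impI)
    fix f :: "real ^ 'n => complex" assume f: "smooth f"
    define g where "g y = h y *\<^sub>R f ((2 * R) *\<^sub>R y)" for y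
    have smg: "smooth g"
      unfolding g_def using smooth_scaleR[OF smh smooth_affine[OF bounded_linear_scaleR_right[of "2 * R"] f, of 0]] by simp
    have g0: "g y = 0" if "y \<notin> cbox (- 1) 1" for y using h_zero[OF that] by (simp add: g_def)
    define c where "c i = of_real \<gamma> * fcoeff g (e i)" for i
    define \<xi> where "\<xi> i = (1 / (2 * R)) *\<^sub>R freq (e i)" for i
    have "summable (\<lambda>i. norm (c i) * (1 + norm (\<xi> i)) ^ m)" for m
    proof -
      obtain B where B: "\<And>k. norm (fcoeff g k) * (1 + norm (freq k)) ^ (m + p) \<le> B"
        using fcoeff_decay[OF smg g0] by metis
      define K where "K = 1 + 1 / (2 * R)"
      have K: "K \<ge> 1" using R by (simp add: K_def)
      show ?thesis
      proof (rule summable_comparison_test'[OF summable_mult[OF p, of "\<bar>\<gamma>\<bar> * K ^ m * B"]])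
        fix i
        define n where "n = 1 + norm (freq (e i))"
        have n: "n \<ge> 1" by (simp add: n_def)
        have "1 + norm (\<xi> i) \<le> K * n"
          using R by (simp add: \<xi>_def K_def n_def algebra_simps add_divide_distrib)
        then have "(1 + norm (\<xi> i)) ^ m \<le> (K * n) ^ m" by (intro power_mono) auto
        then have "norm (c i) * (1 + norm (\<xi> i)) ^ m \<le> norm (c i) * (K ^ m * n ^ m)"
          by (intro mult_left_mono) (auto simp: power_mult_distrib)
        also have "\<dots> = \<bar>\<gamma>\<bar> * K ^ m * (norm (fcoeff g (e i)) * n ^ m)" by (simp add: c_def norm_mult mult_ac)
        also have "norm (fcoeff g (e i)) * n ^ m \<le> B * (1 / n ^ p)"
          using B[of "e i"] n unfolding n_def[symmetric] by (simp add: power_add pos_le_divide_eq mult_ac)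
        finally have "norm (c i) * (1 + norm (\<xi> i)) ^ m \<le> \<bar>\<gamma>\<bar> * K ^ m * (B * (1 / n ^ p))"
          using K by (simp add: mult_left_mono)
        then show "norm (norm (c i) * (1 + norm (\<xi> i)) ^ m) \<le> \<bar>\<gamma>\<bar> * K ^ m * B * (1 / (1 + norm (freq (e i))) ^ p)"
          by (simp add: n_def mult_ac)
      qed
    qed
    moreover have "(\<lambda>i. c i * cis (\<xi> i \<bullet> x)) sums f x" if "norm x \<le> R" for x
    proof -
      define y where "y = (1 / (2 * R)) *\<^sub>R x"
      have ny: "norm y \<le> 1 / 2" using that R by (simp add: y_def field_simps)
      have "y \<in> cbox (- 1) 1"
      proof -
        have "\<bar>y $ j\<bar> \<le> 1" for j using component_le_norm_cart[of y j] ny by linarith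
        then show ?thesis by (auto simp: mem_box_cart abs_le_iff)
      qed
      from \<gamma> smg g0 this have "(\<lambda>i. c i * cis (freq (e i) \<bullet> y)) sums g y" unfolding c_def by blast
      moreover have "g y = f x" using R unfolding g_def h_one[OF ny] by (simp add: y_def)
      moreover have "freq (e i) \<bullet> y = \<xi> i \<bullet> x" for i by (simp add: y_def \<xi>_def)
      ultimately show ?thesis by simp
    qed
    ultimately show "\<exists>c. (\<forall>m. summable (\<lambda>i. norm (c i) * (1 + norm ((1 / (2 * R)) *\<^sub>R freq (e i))) ^ m)) \<and>
      (\<forall>x. norm x \<le> R --> (\<lambda>i. c i * cis ((1 / (2 * R)) *\<^sub>R freq (e i) \<bullet> x)) sums f x)"
      unfolding \<xi>_def by blast
  qed
qed

subsection \<open>Energy estimates in a cone of dependence\<close>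

lemma positive_part_squared_derivative:
  "((\<lambda>s::real. (max 0 s)\<^sup>2) has_real_derivative 2 * max 0 s) (at s)"
proof -
  consider "s > 0" | "s < 0" | "s = 0" by linarith
  then show ?thesis
  proof cases
    case 1
    have "((\<lambda>s. s\<^sup>2) has_real_derivative 2 * max 0 s) (at s)"
      using 1 by (auto intro!: derivative_eq_intros)
    then show ?thesis by (rule has_field_derivative_transform_within_open[of _ _ _ "{0<..}"]) (use 1 in auto)
  next
    case 2
    have "((\<lambda>s. 0) has_real_derivative 2 * max 0 s) (at s)"
      using 2 by (auto intro!: derivative_eq_intros)
    then show ?thesis by (rule has_field_derivative_transform_within_open[of _ _ _ "{..<0}"]) (use 2 in auto)
  next
    case 3
    have "((\<lambda>h. (max 0 h)\<^sup>2 / h) \<longlongrightarrow> 0) (at (0::real))"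
    proof (rule Lim_null_comparison[where g = "\<lambda>h. \<bar>h\<bar>"])
      show "\<forall>\<^sub>F h in at (0::real). norm ((max 0 h)\<^sup>2 / h) \<le> \<bar>h\<bar>"
        by (intro always_eventually) (auto simp: max_def power2_eq_square)
      show "((\<lambda>h. \<bar>h\<bar>) \<longlongrightarrow> 0) (at (0::real))" by (auto intro!: tendsto_eq_intros)
    qed
    then show ?thesis using 3 by (simp add: DERIV_def)
  qed
qed

text \<open>Each component of \<open>M *v x\<close> is at most \<open>norm M * norm x\<close>. The
  factor \<open>CARD('n)\<close> appears since \<open>w\<close> is paired with every
  \<open>z i\<close>; it is the origin of the same number in \<open>front\<close>.\<close>

lemma flux_bound:
  fixes M :: "real ^ 'n ^ 'n" and z :: "'n => 'b::real_inner"
  shows "\<bar>\<Sum>i\<in>UNIV. \<Sum>j\<in>UNIV. M $ i $ j * (x $ j * (z i \<bullet> w))\<bar>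
    \<le> norm M * norm x * (((\<Sum>i\<in>UNIV. (norm (z i))\<^sup>2) + real CARD('n) * (norm w)\<^sup>2) / 2)"
proof -
  have "(\<Sum>i\<in>UNIV. \<Sum>j\<in>UNIV. M $ i $ j * (x $ j * (z i \<bullet> w))) = (\<Sum>i\<in>UNIV. (M *v x) $ i * (z i \<bullet> w))"
    by (simp add: matrix_vector_mult_def sum_distrib_right mult.assoc)
  also have "\<bar>\<dots>\<bar> \<le> (\<Sum>i\<in>UNIV. norm M * norm x * (((norm (z i))\<^sup>2 + (norm w)\<^sup>2) / 2))"
  proof (intro order_trans[OF sum_abs] sum_mono)
    fix i
    have "\<bar>(M *v x) $ i\<bar> \<le> norm M * norm x"
      using component_le_norm_cart norm_matrix_vector_le order_trans by blast
    moreover have "\<bar>z i \<bullet> w\<bar> \<le> ((norm (z i))\<^sup>2 + (norm w)\<^sup>2) / 2"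
      using Cauchy_Schwarz_ineq2[of "z i" w] sum_squares_bound[of "norm (z i)" "norm w"] by simp
    ultimately show "\<bar>(M *v x) $ i * (z i \<bullet> w)\<bar> \<le> norm M * norm x * (((norm (z i))\<^sup>2 + (norm w)\<^sup>2) / 2)"
      unfolding abs_mult by (intro mult_mono) auto
  qed
  also have "\<dots> = norm M * norm x * (((\<Sum>i\<in>UNIV. (norm (z i))\<^sup>2) + real CARD('n) * (norm w)\<^sup>2) / 2)"
    by (simp add: sum_distrib_left[symmetric] sum_divide_distrib[symmetric] sum.distrib)
  finally show ?thesis .
qed

definition second_order :: "real ^ 'n ^ 'n => (real ^ 'n => complex) => real ^ 'n => complex" where
  "second_order M f x = (\<Sum>i\<in>UNIV. \<Sum>j\<in>UNIV. M $ i $ j *\<^sub>R partial (axis j 1) (partial (axis i 1) f) x)"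

lemma smooth_second_partials: "smooth f ==> smooth (partial (axis j 1) (partial (axis i 1) f))"
  for f :: "real ^ 'n => complex"
  by (intro smooth_partial) auto

lemma smooth_second_order: "smooth f ==> smooth (second_order M f)"
  unfolding second_order_def[abs_def] by (intro smooth_sum smooth_cscaleR smooth_second_partials)

lemma partials_second_order:
  fixes f :: "real ^ 'n => complex"
  assumes f: "smooth f" and bs: "bs \<in> lists Basis"
  shows "partials bs (second_order M f) x =
    (\<Sum>i\<in>UNIV. \<Sum>j\<in>UNIV. M $ i $ j *\<^sub>R partials (bs @ [axis j 1, axis i 1]) f x)"
proof -
  note s = smooth_sum smooth_cscaleR smooth_second_partials f
  have "partials bs (second_order M f) x
      = (\<Sum>i\<in>UNIV. partials bs (\<lambda>x. \<Sum>j\<in>UNIV. M $ i $ j *\<^sub>R partial (axis j 1) (partial (axis i 1) f) x) x)"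
    unfolding second_order_def[abs_def] by (rule partials_sum[OF _ bs]) (intro s)
  also have "\<dots> = (\<Sum>i\<in>UNIV. \<Sum>j\<in>UNIV. partials bs (\<lambda>x. M $ i $ j *\<^sub>R partial (axis j 1) (partial (axis i 1) f) x) x)"
    by (intro sum.cong refl partials_sum[OF _ bs] s)
  also have "\<dots> = (\<Sum>i\<in>UNIV. \<Sum>j\<in>UNIV. M $ i $ j *\<^sub>R partials (bs @ [axis j 1, axis i 1]) f x)"
    by (intro sum.cong refl) (simp add: partials_cscaleR[OF smooth_second_partials[OF f] bs] partials_append partials_Cons partials_Nil)
  finally show ?thesis .
qed


context coefficients
begin

text \<open>The inner product of complex numbers is the real one, so the form splits into its values
  on the real and on the imaginary parts.\<close>

lemma elliptic_complex:
  fixes z :: "'n => complex"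
  assumes "t \<in> {0..T}" "t \<noteq> t0"
  shows "lam * (\<Sum>i\<in>UNIV. (norm (z i))\<^sup>2) \<le> (\<Sum>i\<in>UNIV. \<Sum>j\<in>UNIV. b t $ i $ j * (z i \<bullet> z j))"
proof -
  have q: "lam * (\<Sum>i\<in>UNIV. (f i)\<^sup>2) \<le> (\<Sum>i\<in>UNIV. \<Sum>j\<in>UNIV. b t $ i $ j * (f i * f j))" for f :: "'n => real"
  proof -
    have "(norm (vec_lambda f))\<^sup>2 = (\<Sum>i\<in>UNIV. (f i)\<^sup>2)"
      by (simp only: power2_norm_eq_inner) (simp add: inner_vec_def power2_eq_square)
    moreover have "vec_lambda f \<bullet> (b t *v vec_lambda f) = (\<Sum>i\<in>UNIV. \<Sum>j\<in>UNIV. b t $ i $ j * (f i * f j))"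
      by (simp add: inner_vec_def matrix_vector_mult_def sum_distrib_left mult_ac)
    ultimately show ?thesis using elliptic[OF assms, of "vec_lambda f"] by simp
  qed
  have "lam * (\<Sum>i\<in>UNIV. (norm (z i))\<^sup>2) = lam * (\<Sum>i\<in>UNIV. (Re (z i))\<^sup>2) + lam * (\<Sum>i\<in>UNIV. (Im (z i))\<^sup>2)"
    by (simp add: cmod_power2 sum.distrib distrib_left)
  also have "\<dots> \<le> (\<Sum>i\<in>UNIV. \<Sum>j\<in>UNIV. b t $ i $ j * (Re (z i) * Re (z j)))
      + (\<Sum>i\<in>UNIV. \<Sum>j\<in>UNIV. b t $ i $ j * (Im (z i) * Im (z j)))"
    by (intro add_mono q)
  also have "\<dots> = (\<Sum>i\<in>UNIV. \<Sum>j\<in>UNIV. b t $ i $ j * (z i \<bullet> z j))"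
    by (simp add: inner_complex_def sum.distrib distrib_left)
  finally show ?thesis .
qed

abbreviation wave_operator :: "real => (real ^ 'n => complex) => real ^ 'n => complex" where
  "wave_operator t \<equiv> second_order (b t)"

text \<open>The common ground of sums of plane waves and solutions in the Sobolev sense. The time
  derivative is carried along as \<open>v\<close>, since it is continuous at \<open>t0\<close>
  although the second time derivative may not exist there. Asking for every multi-index makes the
  class stable under the spatial derivatives that the equation costs.\<close>

definition classical_solution ::
  "(real => real ^ 'n => complex) => (real => real ^ 'n => complex) => bool" where
  "classical_solution u v \<longleftrightarrow>
    (\<forall>t\<in>{0..T}. smooth (u t) \<and> smooth (v t)) \<and>
    (\<forall>bs\<in>lists Basis. continuous_on ({0..T} \<times> UNIV) (\<lambda>p. partials bs (u (fst p)) (snd p)) \<and>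
       continuous_on ({0..T} \<times> UNIV) (\<lambda>p. partials bs (v (fst p)) (snd p))) \<and>
    (\<forall>bs\<in>lists Basis. \<forall>x. \<forall>t\<in>{0..T}.
       ((\<lambda>t. partials bs (u t) x) has_vector_derivative partials bs (v t) x) (at t within {0..T}) \<and>
       (t \<noteq> t0 -->
          ((\<lambda>t. partials bs (v t) x) has_vector_derivative partials bs (wave_operator t (u t)) x) (at t within {0..T})))"

lemma
  assumes cs: "classical_solution u v"
  shows classical_smooth: "t \<in> {0..T} ==> smooth (u t)" "t \<in> {0..T} ==> smooth (v t)"
    and classical_continuous: "bs \<in> lists Basis ==> S \<subseteq> {0..T} \<times> UNIV ==> continuous_on S (\<lambda>p. partials bs (u (fst p)) (snd p))"
      "bs \<in> lists Basis ==> S \<subseteq> {0..T} \<times> UNIV ==> continuous_on S (\<lambda>p. partials bs (v (fst p)) (snd p))"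
    and classical_derivative: "bs \<in> lists Basis ==> t \<in> {0..T} ==>
        ((\<lambda>t. partials bs (u t) x) has_vector_derivative partials bs (v t) x) (at t within {0..T})"
      "bs \<in> lists Basis ==> t \<in> {0..T} ==> t \<noteq> t0 ==>
        ((\<lambda>t. partials bs (v t) x) has_vector_derivative partials bs (wave_operator t (u t)) x) (at t within {0..T})"
  using cs unfolding classical_solution_def by (blast intro: continuous_on_subset)+

lemma norm_b_int: "(\<lambda>r. norm (b r)) absolutely_integrable_on {0..T}"
  using absolutely_integrable_norm[OF b_int] by (simp add: o_def)

text \<open>The factor is chosen so that the loss through the lateral boundary of the cone dominates the flux
  term of the energy identity.\<close>

definition front :: "real => real" where
  "front t = (real CARD('n) + 1 / lam) * integral {0..t} (\<lambda>r. norm (b r))"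

lemma front_0: "front 0 = 0"
  by (simp add: front_def)

lemma front_coefficient: "real CARD('n) + 1 / lam > 0"
  using lam by (simp add: add_pos_pos)

lemma front_mono: "0 \<le> s ==> s \<le> t ==> t \<le> T ==> front s \<le> front t"
  unfolding front_def using front_coefficient
  by (intro mult_left_mono integral_subset_le)
    (auto intro!: integrable_on_subinterval[OF set_lebesgue_integral_eq_integral(1)[OF norm_b_int]])

lemma front_continuous: "continuous_on {0..T} front"
  unfolding front_def
  by (intro continuous_intros indefinite_integral_continuous_1 set_lebesgue_integral_eq_integral(1)[OF norm_b_int])

lemma front_derivative:
  assumes "t \<in> {0..T}" "t \<noteq> t0"
  shows "(front has_real_derivative (real CARD('n) + 1 / lam) * norm (b t)) (at t within {0..T})"
proof -
  have "((\<lambda>u. integral {0..u} (\<lambda>r. norm (b r))) has_vector_derivative norm (b t)) (at t within {0..T})"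
    by (rule indefinite_integral_derivative[OF set_lebesgue_integral_eq_integral(1)[OF norm_b_int] _ assms])
      (intro continuous_intros b_cont)
  then show ?thesis unfolding front_def[abs_def]
    by (intro DERIV_cmult) (simp add: has_real_derivative_iff_has_vector_derivative)
qed

text \<open>The square of the positive part is continuously differentiable across the boundary of
  the cone. Integrals over the shrinking sections thus become integrals over one fixed box, without
  boundary terms.\<close>

definition cone_weight :: "real => real => real ^ 'n => real" where
  "cone_weight R t x = (max 0 ((R - front t)\<^sup>2 - x \<bullet> x))\<^sup>2"

definition energy_density ::
  "(real => real ^ 'n => complex) => (real => real ^ 'n => complex) => real => real ^ 'n => real" where
  "energy_density u v t x = (norm (v t x))\<^sup>2 +
    (\<Sum>i\<in>UNIV. \<Sum>j\<in>UNIV. b t $ i $ j * (partial (axis i 1) (u t) x \<bullet> partial (axis j 1) (u t) x))"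

definition cone_energy ::
  "real => (real => real ^ 'n => complex) => (real => real ^ 'n => complex) => real => real" where
  "cone_energy R u v t = integral (cbox (- vec R) (vec R)) (\<lambda>x. cone_weight R t x * energy_density u v t x)"

lemma cone_weight_zero:
  assumes "0 \<le> R" "0 \<le> front t" "front t \<le> R" "x \<notin> cbox (- vec R) (vec R)"
  shows "cone_weight R t x = 0"
proof -
  obtain j where "\<not> (- R \<le> x $ j \<and> x $ j \<le> R)" using assms(4) unfolding mem_box_cart by auto
  then have "R < norm x" using component_le_norm_cart[of x j] by linarith
  then have "(R - front t)\<^sup>2 \<le> (norm x)\<^sup>2" using assms by (intro power_mono) auto
  then show ?thesis by (simp add: cone_weight_def power2_norm_eq_inner)
qed

text \<open>Integration by parts in \<open>x\<close> leaves the flux through the gradient of the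
  weight, and the time derivative of the weight outweighs it. The variation of the coefficients is
  left to \<open>energy_frozen_coefficient\<close>, with \<open>\<beta> = b\<close> and the
  Frobenius inner product of matrices.\<close>

lemma cone_energy_estimate:
  assumes cs: "classical_solution u v" and R: "R > 0" and ad: "0 \<le> a" "a \<le> d" "d \<le> T"
    and t0ad: "t0 \<notin> {a..d}" and fd: "front d \<le> R"
    and var: "\<And>s t. a \<le> s ==> s \<le> t ==> t \<le> d ==> norm (b t - b s) \<le> V t - V s"
  shows "cone_energy R u v d \<le>
    exp ((d + real CARD('n) / lam * V d) - (a + real CARD('n) / lam * V a)) * cone_energy R u v a"
proof -
  let ?Q = "cbox (- vec R) (vec R :: real ^ 'n)"
  let ?n = "real CARD('n)"
  define \<kappa> where "\<kappa> = ?n + 1 / lam"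
  have I: "t \<in> {0..T}" "t \<noteq> t0" if "t \<in> {a..d}" for t using that ad t0ad by auto
  have Isub: "{a..d} \<times> UNIV \<subseteq> {0..T} \<times> UNIV" "{a..d} \<subseteq> {0..T}" "{a..d} \<subseteq> {0..T} - {t0}" using ad t0ad by auto
  have fr: "0 \<le> front t" "front t \<le> R" if "t \<in> {a..d}" for t
    using front_mono[of 0 t] front_mono[of t d] that ad fd front_0 by auto
  define g where "g i t x = partial (axis i 1) (u t) x" for i t and x :: "real ^ 'n"
  define gt where "gt i t x = partial (axis i 1) (v t) x" for i t and x :: "real ^ 'n"
  define h where "h i j t x = partial (axis j 1) (g i t) x" for i j t and x :: "real ^ 'n"
  define vt where "vt t x = wave_operator t (u t) x" for t x
  define E where "E i j = (axis i (axis j 1) :: real ^ 'n ^ 'n)" for i j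
  define \<phi> where "\<phi> t x = (R - front t)\<^sup>2 - x \<bullet> x" for t and x :: "real ^ 'n"
  define w where "w t x = (max 0 (\<phi> t x))\<^sup>2" for t x
  define wt where "wt t x = 2 * max 0 (\<phi> t x) * (- (2 * (R - front t) * (\<kappa> * norm (b t))))" for t x
  \<comment> \<open>\<open>P\<close> is the Gram matrix of the gradient, with the matrix units
    \<open>E i j\<close> as basis; the quadratic form in the energy becomes
    \<open>b t \<bullet> P t x\<close>, linear in the coefficients.\<close>
  define P where "P t x = (\<Sum>i\<in>UNIV. \<Sum>j\<in>UNIV. (g i t x \<bullet> g j t x) *\<^sub>R E i j)" for t x
  define P' where "P' t x = (\<Sum>i\<in>UNIV. \<Sum>j\<in>UNIV. (g i t x \<bullet> gt j t x + gt i t x \<bullet> g j t x) *\<^sub>R E i j)" for t x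
  define f0 where "f0 t x = w t x * (v t x \<bullet> v t x)" for t x
  define f0' where "f0' t x = w t x * (2 * (v t x \<bullet> vt t x)) + wt t x * (v t x \<bullet> v t x)" for t x
  define f where "f t x = w t x *\<^sub>R P t x" for t x
  define f' where "f' t x = w t x *\<^sub>R P' t x + wt t x *\<^sub>R P t x" for t x
  have bE: "M \<bullet> E i j = M $ i $ j" for M :: "real ^ 'n ^ 'n" and i j
    by (simp add: E_def inner_axis)
  have nE: "norm (E i j) = 1" for i j by (simp add: E_def)
  have ww: "cone_weight R = w" by (simp add: cone_weight_def[abs_def] w_def[abs_def] \<phi>_def fun_eq_iff)
  have wp: "w t x \<ge> 0" for t x by (simp add: w_def)
  have bP: "b t \<bullet> P t x = (\<Sum>i\<in>UNIV. \<Sum>j\<in>UNIV. b t $ i $ j * (g i t x \<bullet> g j t x))" for t x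
    by (simp add: P_def inner_sum_right bE mult.commute)
  have ed: "energy_density u v t x = v t x \<bullet> v t x + b t \<bullet> P t x" for t x
    by (simp add: energy_density_def bP g_def power2_norm_eq_inner)
  have contb: "continuous_on {a..d} b" by (rule continuous_on_subset[OF b_cont Isub(3)])
  have contf: "continuous_on {a..d} front" by (rule continuous_on_subset[OF front_continuous Isub(2)])
  have cv: "continuous_on ({a..d} \<times> UNIV) (\<lambda>p. v (fst p) (snd p))"
    using classical_continuous(2)[OF cs _ Isub(1), of "[]"] by (simp add: partials_Nil)
  have cg: "continuous_on ({a..d} \<times> UNIV) (\<lambda>p. g i (fst p) (snd p))" for i
    using classical_continuous(1)[OF cs _ Isub(1), of "[axis i 1]"] by (simp add: partials_Nil partials_Cons g_def)
  have cgt: "continuous_on ({a..d} \<times> UNIV) (\<lambda>p. gt i (fst p) (snd p))" for i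
    using classical_continuous(2)[OF cs _ Isub(1), of "[axis i 1]"] by (simp add: partials_Nil partials_Cons gt_def)
  have ch: "continuous_on ({a..d} \<times> UNIV) (\<lambda>p. h i j (fst p) (snd p))" for i j
    using classical_continuous(1)[OF cs _ Isub(1), of "[axis j 1, axis i 1]"]
    by (simp add: partials_Nil partials_Cons h_def g_def[abs_def])
  have cb: "continuous_on ({a..d} \<times> (UNIV :: (real ^ 'n) set)) (\<lambda>p. b (fst p))"
    by (intro continuous_on_compose2[OF contb] continuous_intros) auto
  have cf: "continuous_on ({a..d} \<times> (UNIV :: (real ^ 'n) set)) (\<lambda>p. front (fst p))"
    by (intro continuous_on_compose2[OF contf] continuous_intros) auto
  have vth: "vt t x = (\<Sum>i\<in>UNIV. \<Sum>j\<in>UNIV. b t $ i $ j *\<^sub>R h i j t x)" for t x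
    by (simp add: vt_def second_order_def h_def g_def[abs_def])
  have cvt: "continuous_on ({a..d} \<times> UNIV) (\<lambda>p. vt (fst p) (snd p))"
    unfolding vth by (intro continuous_intros cb ch)
  have c\<phi>: "continuous_on ({a..d} \<times> (UNIV :: (real ^ 'n) set)) (\<lambda>p. \<phi> (fst p) (snd p))"
    unfolding \<phi>_def by (intro continuous_intros cf)
  have cw: "continuous_on ({a..d} \<times> UNIV) (\<lambda>p. w (fst p) (snd p))"
    unfolding w_def by (intro continuous_intros c\<phi>)
  have cwt: "continuous_on ({a..d} \<times> UNIV) (\<lambda>p. wt (fst p) (snd p))"
    unfolding wt_def by (intro continuous_intros c\<phi> cf cb)
  have cP: "continuous_on ({a..d} \<times> UNIV) (\<lambda>p. P (fst p) (snd p))"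
    unfolding P_def by (intro continuous_intros cg)
  have cP': "continuous_on ({a..d} \<times> UNIV) (\<lambda>p. P' (fst p) (snd p))"
    unfolding P'_def by (intro continuous_intros cg cgt)
  have cf0: "continuous_on ({a..d} \<times> UNIV) (\<lambda>p. f0 (fst p) (snd p))"
    unfolding f0_def by (intro continuous_intros cw cv)
  have cf0': "continuous_on ({a..d} \<times> UNIV) (\<lambda>p. f0' (fst p) (snd p))"
    unfolding f0'_def by (intro continuous_intros cw cv cvt cwt)
  have cff: "continuous_on ({a..d} \<times> UNIV) (\<lambda>p. f (fst p) (snd p))"
    unfolding f_def by (intro continuous_intros cw cP)
  have cff': "continuous_on ({a..d} \<times> UNIV) (\<lambda>p. f' (fst p) (snd p))"
    unfolding f'_def by (intro continuous_intros cw cP cP' cwt)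
  have sec: "continuous_on S (F t)" if "continuous_on ({a..d} \<times> UNIV) (\<lambda>p. F (fst p) (snd p))" "t \<in> {a..d}"
    for F :: "real => real ^ 'n => 'c::topological_space" and t S
  proof -
    have "continuous_on S (\<lambda>x. (\<lambda>p. F (fst p) (snd p)) (t, x))"
      by (rule continuous_on_compose2[OF that(1)]) (use that(2) in \<open>auto intro!: continuous_intros\<close>)
    then show ?thesis by simp
  qed
  have int: "F t integrable_on ?Q" if "continuous_on ({a..d} \<times> UNIV) (\<lambda>p. F (fst p) (snd p))" "t \<in> {a..d}"
    for F :: "real => real ^ 'n => 'c::banach" and t
    by (intro integrable_continuous sec that)
  have par: "continuous_on ({a..d} \<times> ?Q) (\<lambda>(t, x). F t x)" if "continuous_on ({a..d} \<times> UNIV) (\<lambda>p. F (fst p) (snd p))"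
    for F :: "real => real ^ 'n => 'c::banach"
    unfolding split_beta by (rule continuous_on_subset[OF that]) auto
  have dv: "((\<lambda>t. v t x) has_vector_derivative vt t x) (at t within {a..d})" if "t \<in> {a..d}" for t x
    using classical_derivative(2)[OF cs _ I(1)[OF that] I(2)[OF that], of "[]" x]
    by (auto simp: partials_Nil vt_def intro: has_vector_derivative_within_subset[OF _ Isub(2)])
  have dg: "((\<lambda>t. g i t x) has_vector_derivative gt i t x) (at t within {a..d})" if "t \<in> {a..d}" for i t x
    using classical_derivative(1)[OF cs _ I(1)[OF that], of "[axis i 1]" x]
    by (auto simp: partials_Nil partials_Cons g_def gt_def intro: has_vector_derivative_within_subset[OF _ Isub(2)])
  have dw: "((\<lambda>t. w t x) has_real_derivative wt t x) (at t within {a..d})" if "t \<in> {a..d}" for t x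
  proof -
    have "(front has_real_derivative \<kappa> * norm (b t)) (at t within {a..d})"
      using has_field_derivative_subset[OF front_derivative[OF I[OF that]] Isub(2)] by (simp add: \<kappa>_def)
    then have "((\<lambda>t. \<phi> t x) has_real_derivative - (2 * (R - front t) * (\<kappa> * norm (b t)))) (at t within {a..d})"
      unfolding \<phi>_def by (auto intro!: derivative_eq_intros)
    from DERIV_chain2[OF positive_part_squared_derivative this] show ?thesis by (simp add: w_def wt_def)
  qed
  define F0 where "F0 t = integral ?Q (f0 t)" for t
  define F where "F t = integral ?Q (f t)" for t
  have dF0: "(F0 has_real_derivative integral ?Q (f0' t)) (at t within {a..d})" if t: "t \<in> {a..d}" for t
    unfolding F0_def[abs_def] has_real_derivative_iff_has_vector_derivative
  proof (rule leibniz_rule_vector_derivative[OF _ int[OF cf0] par[OF cf0'] t])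
    fix r and x :: "real ^ 'n" assume r: "r \<in> {a..d}"
    have "((\<lambda>t. w t x *\<^sub>R (v t x \<bullet> v t x)) has_vector_derivative
        w r x *\<^sub>R (v r x \<bullet> vt r x + vt r x \<bullet> v r x) + wt r x *\<^sub>R (v r x \<bullet> v r x)) (at r within {a..d})"
      by (intro has_vector_derivative_scaleR dw[OF r] dv[OF r] bounded_bilinear.has_vector_derivative[OF bounded_bilinear_inner])
    then show "((\<lambda>t. f0 t x) has_vector_derivative f0' r x) (at r within {a..d})"
      by (simp add: f0_def f0'_def inner_commute)
  qed auto
  have dF: "(F has_vector_derivative integral ?Q (f' t)) (at t within {a..d})" if t: "t \<in> {a..d}" for t
    unfolding F_def[abs_def]
  proof (rule leibniz_rule_vector_derivative[OF _ int[OF cff] par[OF cff'] t])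
    fix r and x :: "real ^ 'n" assume r: "r \<in> {a..d}"
    have "((\<lambda>t. (g i t x \<bullet> g j t x) *\<^sub>R E i j) has_vector_derivative
        (g i r x \<bullet> gt j r x + gt i r x \<bullet> g j r x) *\<^sub>R E i j) (at r within {a..d})" for i j
    proof -
      have "((\<lambda>t. g i t x \<bullet> g j t x) has_vector_derivative (g i r x \<bullet> gt j r x + gt i r x \<bullet> g j r x)) (at r within {a..d})"
        by (intro dg[OF r] bounded_bilinear.has_vector_derivative[OF bounded_bilinear_inner])
      then show ?thesis
        by (auto intro!: derivative_eq_intros has_vector_derivative_scaleR simp: has_real_derivative_iff_has_vector_derivative)
    qed
    then have "((\<lambda>t. P t x) has_vector_derivative P' r x) (at r within {a..d})"
      unfolding P_def P'_def by (intro has_vector_derivative_sum)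
    from has_vector_derivative_scaleR[OF dw[OF r] this]
    show "((\<lambda>t. f t x) has_vector_derivative f' r x) (at r within {a..d})"
      by (simp add: f_def f'_def)
  qed auto
  have F'c: "continuous_on {a..d} (\<lambda>t. integral ?Q (f' t))"
    by (rule integral_continuous_on_param[OF par[OF cff']])
  have bint: "b t \<bullet> integral ?Q (G t) = integral ?Q (\<lambda>x. b t \<bullet> G t x)"
    and bintg: "(\<lambda>x. b t \<bullet> G t x) integrable_on ?Q"
    if "continuous_on ({a..d} \<times> UNIV) (\<lambda>p. G (fst p) (snd p))" "t \<in> {a..d}" for G :: "real => real ^ 'n => real ^ 'n ^ 'n" and t
    using integral_linear[OF int[OF that] bounded_linear_inner_right[of "b t"]]
      integrable_linear[OF int[OF that] bounded_linear_inner_right[of "b t"]] by (simp_all add: o_def)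
  have en: "cone_energy R u v t = F0 t + b t \<bullet> F t" if t: "t \<in> {a..d}" for t
  proof -
    have "F0 t + b t \<bullet> F t = integral ?Q (\<lambda>x. f0 t x + b t \<bullet> f t x)"
      unfolding F0_def F_def bint[OF cff t]
      by (rule Henstock_Kurzweil_Integration.integral_add[OF int[OF cf0 t] bintg[OF cff t], symmetric])
    also have "(\<lambda>x. f0 t x + b t \<bullet> f t x) = (\<lambda>x. cone_weight R t x * energy_density u v t x)"
      by (simp add: f0_def f_def ww ed distrib_left fun_eq_iff)
    finally show ?thesis by (simp add: cone_energy_def)
  qed
  have ell: "lam * (\<Sum>i\<in>UNIV. (norm (g i t x))\<^sup>2) \<le> b t \<bullet> P t x" if "t \<in> {a..d}" for t x
    unfolding bP by (rule elliptic_complex[OF I[OF that]])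
  have coer: "norm (F t) \<le> ?n / lam * (F0 t + b t \<bullet> F t)" if t: "t \<in> {a..d}" for t
  proof -
    have "norm (F t) \<le> integral ?Q (\<lambda>x. ?n / lam * (f0 t x + b t \<bullet> f t x))"
      unfolding F_def
    proof (rule Henstock_Kurzweil_Integration.integral_norm_bound_integral[OF int[OF cff t]])
      show "(\<lambda>x. ?n / lam * (f0 t x + b t \<bullet> f t x)) integrable_on ?Q"
        by (intro integrable_on_mult_right Henstock_Kurzweil_Integration.integrable_add int[OF cf0 t] bintg[OF cff t])
      fix x :: "real ^ 'n"
      have "norm (P t x) \<le> (\<Sum>i\<in>UNIV. \<Sum>j\<in>UNIV. ((norm (g i t x))\<^sup>2 + (norm (g j t x))\<^sup>2) / 2)"
        unfolding P_def
      proof (intro order_trans[OF norm_sum] sum_mono)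
        fix i j
        show "norm ((g i t x \<bullet> g j t x) *\<^sub>R E i j) \<le> ((norm (g i t x))\<^sup>2 + (norm (g j t x))\<^sup>2) / 2"
          using Cauchy_Schwarz_ineq2[of "g i t x" "g j t x"] sum_squares_bound[of "norm (g i t x)" "norm (g j t x)"]
          by (simp add: nE)
      qed
      also have "\<dots> = ?n * (\<Sum>i\<in>UNIV. (norm (g i t x))\<^sup>2)"
        by (simp add: sum_divide_distrib[symmetric] sum.distrib sum_distrib_left[symmetric])
      also have "\<dots> \<le> ?n * ((b t \<bullet> P t x) / lam)"
        using ell[OF t, of x] lam by (intro mult_left_mono) (auto simp: pos_le_divide_eq mult.commute)
      also have "\<dots> \<le> ?n / lam * (v t x \<bullet> v t x + b t \<bullet> P t x)"
        using lam by (simp add: field_simps)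
      finally have "w t x * norm (P t x) \<le> w t x * (?n / lam * (v t x \<bullet> v t x + b t \<bullet> P t x))"
        using wp by (rule mult_left_mono)
      then show "norm (f t x) \<le> ?n / lam * (f0 t x + b t \<bullet> f t x)"
        using wp[of t x] by (simp add: f_def f0_def distrib_left mult_ac)
    qed
    also have "\<dots> = ?n / lam * (F0 t + b t \<bullet> F t)"
      unfolding F0_def F_def bint[OF cff t]
      by (simp add: Henstock_Kurzweil_Integration.integral_add[OF int[OF cf0 t] bintg[OF cff t]])
    finally show ?thesis .
  qed
  have dec: "integral ?Q (f0' t) + b t \<bullet> integral ?Q (f' t) \<le> 0" if t: "t \<in> {a..d}" for t
  proof -
    define \<rho> where "\<rho> = R - front t"
    have \<rho>: "\<rho> \<ge> 0" using fr[OF t] by (simp add: \<rho>_def)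
    define D where "D i j = partial (axis j 1) (\<lambda>x. w t x * (g i t x \<bullet> v t x))" for i j
    have sm: "smooth (g i t)" "smooth (v t)" for i
      using classical_smooth[OF cs I(1)[OF t]] smooth_partial[of "u t" "axis i 1"] by (auto simp: g_def[abs_def])
    have hd: "((\<lambda>x. w t x * (g i t x \<bullet> v t x)) has_derivative
        (\<lambda>k. w t x * (g i t x \<bullet> frechet_derivative (v t) (at x) k + frechet_derivative (g i t) (at x) k \<bullet> v t x)
          + 2 * max 0 (\<phi> t x) * (- (2 * (x \<bullet> k))) * (g i t x \<bullet> v t x))) (at x)" for i x
    proof -
      have "((\<lambda>x. \<phi> t x) has_derivative (\<lambda>k. - (2 * (x \<bullet> k)))) (at x)"
        unfolding \<phi>_def by (auto intro!: derivative_eq_intros simp: inner_commute)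
      from has_derivative_compose[OF this has_field_derivative_imp_has_derivative[OF positive_part_squared_derivative]]
      have "((\<lambda>x. w t x) has_derivative (\<lambda>k. 2 * max 0 (\<phi> t x) * (- (2 * (x \<bullet> k))))) (at x)"
        by (simp add: w_def)
      moreover have "((\<lambda>x. g i t x \<bullet> v t x) has_derivative
          (\<lambda>k. g i t x \<bullet> frechet_derivative (v t) (at x) k + frechet_derivative (g i t) (at x) k \<bullet> v t x)) (at x)"
        using smooth_differentiable[OF sm(1)] smooth_differentiable[OF sm(2)]
        by (intro has_derivative_inner) (simp_all add: frechet_derivative_works)
      ultimately show ?thesis by (rule has_derivative_mult)
    qed
    have Deq: "D i j x = w t x * (g i t x \<bullet> gt j t x + h i j t x \<bullet> v t x)
        - 4 * max 0 (\<phi> t x) * (x $ j * (g i t x \<bullet> v t x))" for i j x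
      unfolding D_def has_derivative_partial[OF hd]
      by (simp add: gt_def h_def partial_def inner_axis)
    have cD: "continuous_on UNIV (D i j)" for i j
      unfolding Deq[abs_def]
      by (intro continuous_intros sec[OF cw t] sec[OF cg t] sec[OF cgt t] sec[OF ch t] sec[OF cv t] sec[OF c\<phi> t])
    have D0: "integral ?Q (D i j) = 0" for i j
      unfolding D_def
    proof (rule integral_partial_zero)
      show "(\<lambda>x. w t x * (g i t x \<bullet> v t x)) differentiable (at x)" for x
        using hd[of i x] unfolding differentiable_def by blast
      show "continuous_on UNIV (partial (axis j 1) (\<lambda>x. w t x * (g i t x \<bullet> v t x)))"
        using cD[of i j] by (simp add: D_def)
      fix x assume "x \<notin> ?Q"
      then have "w t x = 0" using cone_weight_zero[of R t x] R fr[OF t] by (simp add: ww)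
      then show "w t x * (g i t x \<bullet> v t x) = 0" by simp
    qed
    \<comment> \<open>The divergence of the weighted flux, with zero integral over the box. It
      dominates the time derivative of the energy density with frozen coefficients.\<close>
    define S where "S x = (\<Sum>i\<in>UNIV. \<Sum>j\<in>UNIV. 2 * b t $ i $ j * D i j x)" for x
    have iD: "D i j integrable_on ?Q" for i j
      by (intro integrable_continuous continuous_on_subset[OF cD]) auto
    have iS: "S integrable_on ?Q"
      unfolding S_def by (intro integrable_sum integrable_on_mult_right iD) auto
    have S0: "integral ?Q S = 0"
      unfolding S_def
      by (simp add: Henstock_Kurzweil_Integration.integral_sum integrable_sum integrable_on_mult_right iD D0)
    have "f0' t x + b t \<bullet> f' t x \<le> S x" for x
    proof -
      define m where "m = max 0 (\<phi> t x)"
      have m: "m \<ge> 0" by (simp add: m_def)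
      define X where "X = (\<Sum>i\<in>UNIV. \<Sum>j\<in>UNIV. b t $ i $ j * (x $ j * (g i t x \<bullet> v t x)))"
      define Y where "Y = (\<Sum>i\<in>UNIV. \<Sum>j\<in>UNIV. b t $ i $ j * (g i t x \<bullet> gt j t x))"
      have vv: "v t x \<bullet> vt t x = (\<Sum>i\<in>UNIV. \<Sum>j\<in>UNIV. b t $ i $ j * (h i j t x \<bullet> v t x))"
        by (simp add: vth inner_sum_right inner_commute)
      have Y2: "(\<Sum>i\<in>UNIV. \<Sum>j\<in>UNIV. b t $ i $ j * (gt i t x \<bullet> g j t x)) = Y"
        unfolding Y_def
        by (subst sum.swap) (simp add: b_sym[of t] inner_commute)
      have bP': "b t \<bullet> P' t x = 2 * Y"
        using Y2 by (simp add: P'_def inner_sum_right bE Y_def[symmetric] distrib_left sum.distrib mult.commute)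
      have Sx: "S x = 2 * w t x * Y + 2 * w t x * (v t x \<bullet> vt t x) - 8 * m * X"
        unfolding S_def Deq m_def[symmetric] X_def Y_def vv
        by (simp add: algebra_simps sum.distrib sum_subtractf sum_distrib_left)
      \<comment> \<open>Here the coefficient \<open>\<kappa>\<close> of \<open>front\<close> is
        spent: on the support of the weight \<open>norm x \<le> R - front t\<close>, the summand
        \<open>CARD('n)\<close> of \<open>\<kappa>\<close> covers the part of the flux in
        \<open>v\<close>, and \<open>1 / lam\<close> the part in the gradient.\<close>
      have Xb: "8 * m * X \<le> - (wt t x * (v t x \<bullet> v t x + b t \<bullet> P t x))"
      proof (cases "m = 0")
        case True
        then show ?thesis by (simp add: wt_def m_def[symmetric])
      next
        case False
        then have "\<phi> t x > 0" by (simp add: m_def max_def split: if_splits)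
        then have "(norm x)\<^sup>2 < \<rho>\<^sup>2" by (simp add: \<phi>_def \<rho>_def power2_norm_eq_inner)
        then have nx: "norm x \<le> \<rho>" using \<rho> power2_less_imp_less[of "norm x" \<rho>] by simp
        define A where "A = (\<Sum>i\<in>UNIV. (norm (g i t x))\<^sup>2) + ?n * (norm (v t x))\<^sup>2"
        have A: "A \<ge> 0" unfolding A_def by (intro add_nonneg_nonneg sum_nonneg) auto
        have "X \<le> norm (b t) * norm x * (A / 2)"
          using flux_bound[of "b t" x "\<lambda>i. g i t x" "v t x"] unfolding X_def A_def by linarith
        also have "\<dots> \<le> norm (b t) * \<rho> * (A / 2)"
          using nx A by (intro mult_right_mono mult_left_mono) auto
        also have "\<dots> \<le> norm (b t) * \<rho> * (\<kappa> * (v t x \<bullet> v t x + b t \<bullet> P t x) / 2)"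
        proof -
          have bP0: "0 \<le> b t \<bullet> P t x" using ell[OF t, of x] lam by (meson mult_nonneg_nonneg less_imp_le order_trans sum_nonneg zero_le_power2)
          then have "0 \<le> ?n * (b t \<bullet> P t x)" by simp
          moreover have "(\<Sum>i\<in>UNIV. (norm (g i t x))\<^sup>2) \<le> 1 / lam * (b t \<bullet> P t x)"
            using ell[OF t, of x] lam by (simp add: pos_le_divide_eq mult.commute)
          moreover have "0 \<le> 1 / lam * (norm (v t x))\<^sup>2" using lam by simp
          ultimately have "A \<le> \<kappa> * (v t x \<bullet> v t x + b t \<bullet> P t x)"
            unfolding A_def \<kappa>_def power2_norm_eq_inner[symmetric] by (simp add: algebra_simps)
          then show ?thesis using \<rho> by (intro mult_left_mono) auto
        qed
        finally have Xle: "X \<le> norm (b t) * \<rho> * (\<kappa> * (v t x \<bullet> v t x + b t \<bullet> P t x) / 2)" .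
        have "8 * m * X \<le> 8 * m * (norm (b t) * \<rho> * (\<kappa> * (v t x \<bullet> v t x + b t \<bullet> P t x) / 2))"
          using m by (intro mult_left_mono Xle) auto
        also have "\<dots> = - (wt t x * (v t x \<bullet> v t x + b t \<bullet> P t x))"
          unfolding wt_def m_def[symmetric] \<rho>_def[symmetric] by (simp add: field_simps)
        finally show ?thesis .
      qed
      have "f0' t x + b t \<bullet> f' t x
          = 2 * w t x * (v t x \<bullet> vt t x) + 2 * w t x * Y + wt t x * (v t x \<bullet> v t x + b t \<bullet> P t x)"
        by (simp add: f0'_def f'_def inner_add_right bP' algebra_simps)
      then show ?thesis using Sx Xb by linarith
    qed
    then have "integral ?Q (\<lambda>x. f0' t x + b t \<bullet> f' t x) \<le> integral ?Q S"
      by (intro integral_le iS Henstock_Kurzweil_Integration.integrable_add int[OF cf0' t] bintg[OF cff' t])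
    then show ?thesis
      unfolding bint[OF cff' t] S0
      by (simp add: Henstock_Kurzweil_Integration.integral_add[OF int[OF cf0' t] bintg[OF cff' t]])
  qed
  have "F0 d + b d \<bullet> F d \<le> exp ((d + ?n / lam * V d) - (a + ?n / lam * V a)) * (F0 a + b a \<bullet> F a)"
  proof (rule energy_frozen_coefficient[OF ad(2) contb F'c dF0 dF _ coer _ var])
    show np: "?n / lam > 0" using lam by simp
    show "integral ?Q (f0' t) + b t \<bullet> integral ?Q (f' t) \<le> F0 t + b t \<bullet> F t" if "t \<in> {a..d}" for t
    proof -
      have "0 \<le> X" if "0 \<le> c * X" "c > 0" for c X :: real using that by (simp add: zero_le_mult_iff)
      from order_trans[OF dec[OF that] this[OF order_trans[OF norm_ge_zero coer[OF that]] np]] show ?thesis .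
    qed
  qed
  then show ?thesis using en[of a] en[of d] ad by simp
qed

subsection \<open>Finite speed of propagation and local uniqueness\<close>

lemma classical_time_continuous:
  assumes cs: "classical_solution u v" and bs: "bs \<in> lists Basis"
  shows "continuous_on {0..T} (\<lambda>t. partials bs (u t) x)" "continuous_on {0..T} (\<lambda>t. partials bs (v t) x)"
proof -
  have "continuous_on {0..T} (\<lambda>t. (\<lambda>p. partials bs (u (fst p)) (snd p)) (t, x))"
    by (rule continuous_on_compose2[OF classical_continuous(1)[OF cs bs order_refl]]) (auto intro!: continuous_intros)
  then show "continuous_on {0..T} (\<lambda>t. partials bs (u t) x)" by simp
  have "continuous_on {0..T} (\<lambda>t. (\<lambda>p. partials bs (v (fst p)) (snd p)) (t, x))"
    by (rule continuous_on_compose2[OF classical_continuous(2)[OF cs bs order_refl]]) (auto intro!: continuous_intros)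
  then show "continuous_on {0..T} (\<lambda>t. partials bs (v t) x)" by simp
qed

lemma energy_density_ge:
  assumes "t \<in> {0..T}" "t \<noteq> t0"
  shows "(norm (v t x))\<^sup>2 \<le> energy_density u v t x"
proof -
  have "0 \<le> lam * (\<Sum>i\<in>UNIV. (norm (partial (axis i 1) (u t) x))\<^sup>2)"
    using lam by (intro mult_nonneg_nonneg sum_nonneg) auto
  then show ?thesis
    using elliptic_complex[OF assms, of "\<lambda>i. partial (axis i 1) (u t) x"]
    unfolding energy_density_def by linarith
qed

lemma energy_density_continuous:
  assumes cs: "classical_solution u v" and t: "t \<in> {0..T}"
  shows "continuous_on S (energy_density u v t)"
  unfolding energy_density_def[abs_def]
  using classical_smooth[OF cs t] by (intro continuous_intros smooth_continuous_on smooth_partial) auto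

lemma cone_weight_continuous: "continuous_on S (cone_weight R t)"
  unfolding cone_weight_def[abs_def] by (intro continuous_intros)

text \<open>A continuous nonnegative integrand with zero integral vanishes, and inside the section
  the weight is positive. Only \<open>v\<close> is extracted; \<open>u\<close> follows by
  integrating \<open>v\<close> in time, as the sections grow when followed backwards.\<close>

lemma cone_energy_nonpos_imp_zero:
  assumes cs: "classical_solution u v" and R: "R > 0" and t: "t \<in> {0..T}" "t \<noteq> t0" and ft: "front t \<le> R"
    and E: "cone_energy R u v t \<le> 0" and x: "norm x < R - front t"
  shows "v t x = 0"
proof -
  let ?Q = "cbox (- vec R) (vec R :: real ^ 'n)"
  let ?h = "\<lambda>x. cone_weight R t x * energy_density u v t x"
  have hc: "continuous_on ?Q ?h"
    by (intro continuous_intros cone_weight_continuous energy_density_continuous[OF cs t(1)])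
  have h0: "0 \<le> ?h x" for x
    using order_trans[OF zero_le_power2 energy_density_ge[OF t]] by (simp add: cone_weight_def)
  have "integral ?Q ?h \<ge> 0" by (intro Henstock_Kurzweil_Integration.integral_nonneg integrable_continuous hc h0)
  then have "integral ?Q ?h = 0" using E by (simp add: cone_energy_def)
  then have hi: "(?h has_integral 0) ?Q" using integrable_integral[OF integrable_continuous[OF hc]] by simp
  have f0: "0 \<le> front t" using front_mono[of 0 t] front_0 t by simp
  have "0 \<in> box (- vec R) (vec R :: real ^ 'n)" using R by (simp add: mem_box_cart)
  then have ne: "box (- vec R) (vec R :: real ^ 'n) \<noteq> {}" by blast
  have xQ: "x \<in> ?Q"
  proof -
    have "\<bar>x $ j\<bar> \<le> R" for j using component_le_norm_cart[of x j] x f0 by linarith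
    then have "- R \<le> x $ j \<and> x $ j \<le> R" for j by (metis abs_le_iff minus_le_iff)
    then show ?thesis by (simp add: mem_box_cart)
  qed
  have "?h x = 0" by (rule has_integral_0_cbox_imp_0[OF hc h0 hi ne xQ])
  moreover have "(norm x)\<^sup>2 < (R - front t)\<^sup>2" using x by (intro power_strict_mono) auto
  then have "cone_weight R t x > 0" by (simp add: cone_weight_def power2_norm_eq_inner)
  ultimately have "energy_density u v t x = 0" by simp
  then show ?thesis using energy_density_ge[OF t, of v x u] by simp
qed

lemma stationary_imp_zero:
  assumes cs: "classical_solution u v" and ad: "0 \<le> a" "a \<le> d" "d \<le> T"
    and v: "\<And>r. r \<in> {a..d} ==> v r x = 0" and u: "u a x = 0"
  shows "u d x = 0"
proof -
  have "((\<lambda>t. u t x) has_vector_derivative 0) (at r within {a..d})" if "r \<in> {a..d}" for r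
    using has_vector_derivative_within_subset[OF classical_derivative(1)[OF cs, of "[]" r x], of "{a..d}"] v[OF that] that ad
    by (auto simp: partials_Nil)
  then have "((\<lambda>t. 0) has_integral (u d x - u a x)) {a..d}"
    by (intro fundamental_theorem_of_calculus ad)
  then show ?thesis using u by (simp add: has_integral_0_eq)
qed

lemma zero_on_ball_imp_partials_zero:
  assumes "\<And>y. norm y < r ==> f y = 0" "norm x < r"
  shows "partials bs f x = 0"
  using partials_cong_open[of "ball 0 r" f "\<lambda>y. 0" x bs] assms by (simp add: partials_const_zero)

text \<open>The data vanish wherever the weight at time \<open>a\<close> is positive, so the energy
  is 0 there and stays 0. A point of the section at time \<open>d\<close> lies in all earlier
  sections because \<open>front\<close> is nondecreasing, which gives \<open>u\<close> along with
  \<open>v\<close>.\<close>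

lemma regular_phase_uniqueness:
  assumes cs: "classical_solution u v" and R: "R > 0" and ad: "0 \<le> a" "a \<le> d" "d \<le> T"
    and t0ad: "t0 \<notin> {a..d}" and fd: "front d \<le> R"
    and data: "\<And>x. norm x < R - front a ==> u a x = 0 \<and> v a x = 0" and x: "norm x < R - front d"
  shows "u d x = 0 \<and> v d x = 0"
proof -
  \<comment> \<open>The logarithm of the distance to \<open>t0\<close> decreases before
    \<open>t0\<close> and increases after it; hence the sign of its term in
    \<open>V\<close>.\<close>
  obtain V where V: "\<And>s t. a \<le> s ==> s \<le> t ==> t \<le> d ==> norm (b t - b s) \<le> V t - V s"
  proof (cases "d < t0")
    case True
    show thesis
    proof (rule that[of "\<lambda>t. - C * ln \<bar>t - t0\<bar> + Gam t"])
      fix s t assume st: "a \<le> s" "s \<le> t" "t \<le> d"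
      have "ln \<bar>t - t0\<bar> \<le> ln \<bar>s - t0\<bar>" using st True by (subst ln_le_cancel_iff) auto
      then show "norm (b t - b s) \<le> - C * ln \<bar>t - t0\<bar> + Gam t - (- C * ln \<bar>s - t0\<bar> + Gam s)"
        using b_var[of s t] st ad True by (simp add: algebra_simps)
    qed
  next
    case False
    then have a: "t0 < a" using t0ad ad by auto
    show thesis
    proof (rule that[of "\<lambda>t. C * ln \<bar>t - t0\<bar> + Gam t"])
      fix s t assume st: "a \<le> s" "s \<le> t" "t \<le> d"
      have "ln \<bar>s - t0\<bar> \<le> ln \<bar>t - t0\<bar>" using st a by (subst ln_le_cancel_iff) auto
      then show "norm (b t - b s) \<le> C * ln \<bar>t - t0\<bar> + Gam t - (C * ln \<bar>s - t0\<bar> + Gam s)"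
        using b_var[of s t] st ad a by (simp add: algebra_simps)
    qed
  qed
  have "energy_density u v a y = 0" if "norm y < R - front a" for y
    using zero_on_ball_imp_partials_zero[of "R - front a" "u a" y "[axis i 1]" for i] data that
    by (simp add: energy_density_def partials_Cons partials_Nil)
  moreover have "cone_weight R a y = 0" if "\<not> norm y < R - front a" for y
  proof -
    have "0 \<le> R - front a" using front_mono[of a d] ad fd by simp
    then have "(R - front a)\<^sup>2 \<le> (norm y)\<^sup>2" using that by (intro power_mono) auto
    then show ?thesis by (simp add: cone_weight_def power2_norm_eq_inner)
  qed
  ultimately have "(\<lambda>y. cone_weight R a y * energy_density u v a y) = (\<lambda>y. 0)" by fastforce
  then have Ea: "cone_energy R u v a = 0" by (simp add: cone_energy_def)
  have v0: "v r y = 0" if r: "r \<in> {a..d}" and y: "norm y < R - front r" for r y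
  proof (rule cone_energy_nonpos_imp_zero[OF cs R _ _ _ _ y])
    show fr: "front r \<le> R" using front_mono[of r d] r ad fd by simp
    have "cone_energy R u v r \<le> exp ((r + real CARD('n) / lam * V r) - (a + real CARD('n) / lam * V a)) * cone_energy R u v a"
      by (rule cone_energy_estimate[OF cs R]) (use r ad t0ad fr V in auto)
    then show "cone_energy R u v r \<le> 0" using Ea by simp
  qed (use r ad t0ad in auto)
  have fr: "norm x < R - front r" if "r \<in> {a..d}" for r using front_mono[of r d] that ad x by simp
  have "u d x = 0"
    by (rule stationary_imp_zero[OF cs ad]) (use v0 fr data ad in auto)
  then show ?thesis using v0[of d x] x ad by simp
qed

text \<open>One integration of the equation carries order \<open>m\<close> from \<open>u\<close> to
  \<open>v\<close>; the coefficient is merely integrable, so no power is gained. The second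
  integration, of \<open>v\<close>, gains one. The equation costs two derivatives, hence the
  hypothesis for all multi-indices at once.\<close>

lemma vanishing_order_step:
  assumes cs: "classical_solution u v" and d: "t0 < d" "d \<le> T"
    and data: "\<And>x. norm x < \<rho> ==> u t0 x = 0 \<and> v t0 x = 0"
    and B: "\<And>bs. bs \<in> lists Basis ==> \<exists>B\<ge>0. \<forall>t\<in>{t0..d}. \<forall>x. norm x < \<rho> --> norm (partials bs (u t) x) \<le> B * (t - t0) ^ m"
    and bs: "bs \<in> lists Basis"
  shows "\<exists>B\<ge>0. \<forall>t\<in>{t0..d}. \<forall>x. norm x < \<rho> --> norm (partials bs (v t) x) \<le> B * (t - t0) ^ m"
    and "\<exists>B\<ge>0. \<forall>t\<in>{t0..d}. \<forall>x. norm x < \<rho> --> norm (partials bs (u t) x) \<le> B * (t - t0) ^ Suc m"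
proof -
  let ?P = "\<lambda>i j B. B \<ge> 0 \<and> (\<forall>t\<in>{t0..d}. \<forall>x. norm x < \<rho> --> norm (partials (bs @ [axis j 1, axis i 1]) (u t) x) \<le> B * (t - t0) ^ m)"
  define c where "c i j = (SOME B. ?P i j B)" for i j
  have "?P i j (c i j)" for i j
    unfolding c_def by (rule someI_ex[OF B]) (use bs in auto)
  then have c: "\<And>i j. c i j \<ge> 0"
      "\<And>i j t x. t \<in> {t0..d} ==> norm x < \<rho> ==> norm (partials (bs @ [axis j 1, axis i 1]) (u t) x) \<le> c i j * (t - t0) ^ m"
    by blast+
  define S where "S = (\<Sum>i\<in>UNIV. \<Sum>j\<in>UNIV. c i j)"
  have S: "S \<ge> 0" unfolding S_def by (intro sum_nonneg c)
  have t00: "0 \<le> t0" using t0 by simp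
  have nbi: "(\<lambda>r. norm (b r)) integrable_on {r..s}" if "0 \<le> r" "s \<le> T" for r s
    by (rule integrable_on_subinterval[OF set_lebesgue_integral_eq_integral(1)[OF norm_b_int]]) (use that in auto)
  define J where "J = integral {t0..d} (\<lambda>r. norm (b r))"
  have J: "J \<ge> 0" unfolding J_def by (intro Henstock_Kurzweil_Integration.integral_nonneg nbi) (use d t00 in auto)
  have vb: "norm (partials bs (v t) x) \<le> (S * J) * (t - t0) ^ m" if t: "t \<in> {t0..d}" and x: "norm x < \<rho>" for t x
  proof -
    have tT: "{t0..t} \<subseteq> {0..T}" using t d t00 by auto
    have "((\<lambda>r. partials bs (wave_operator r (u r)) x) has_integral partials bs (v t) x - partials bs (v t0) x) {t0..t}"
    proof (rule fundamental_theorem_of_calculus_interior_strong[of "{}"])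
      show "continuous_on {t0..t} (\<lambda>a. partials bs (v a) x)"
        by (rule continuous_on_subset[OF classical_time_continuous(2)[OF cs bs] tT])
      fix r assume r: "r \<in> {t0<..<t} - {}"
      then have "0 < r" "r < T" using t d t00 by auto
      then show "((\<lambda>a. partials bs (v a) x) has_vector_derivative partials bs (wave_operator r (u r)) x) (at r)"
        using classical_derivative(2)[OF cs bs, of r x] r at_within_Icc_at[of 0 r T] by auto
    qed (use t in auto)
    moreover have "partials bs (v t0) x = 0"
      using zero_on_ball_imp_partials_zero[of \<rho> "v t0" x bs] data x by simp
    ultimately have hi: "((\<lambda>r. partials bs (wave_operator r (u r)) x) has_integral partials bs (v t) x) {t0..t}" by simp
    have "norm (integral {t0..t} (\<lambda>r. partials bs (wave_operator r (u r)) x)) \<le> integral {t0..t} (\<lambda>r. S * (t - t0) ^ m * norm (b r))"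
    proof (rule Henstock_Kurzweil_Integration.integral_norm_bound_integral)
      show "(\<lambda>r. partials bs (wave_operator r (u r)) x) integrable_on {t0..t}" using hi by blast
      show "(\<lambda>r. S * (t - t0) ^ m * norm (b r)) integrable_on {t0..t}"
        by (intro integrable_on_mult_right nbi) (use t d t00 in auto)
      fix r assume r: "r \<in> {t0..t}"
      then have r': "r \<in> {t0..d}" "r \<in> {0..T}" using t tT by auto
      have "norm (partials bs (wave_operator r (u r)) x) \<le> (\<Sum>i\<in>UNIV. \<Sum>j\<in>UNIV. norm (b r) * (c i j * (t - t0) ^ m))"
        unfolding partials_second_order[OF classical_smooth(1)[OF cs r'(2)] bs]
      proof (intro order_trans[OF norm_sum] sum_mono)
        fix i j
        have "\<bar>b r $ i $ j\<bar> \<le> norm (b r)"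
          using component_le_norm_cart[of "b r $ i" j] Finite_Cartesian_Product.norm_nth_le[of "b r" i] by linarith
        moreover have "norm (partials (bs @ [axis j 1, axis i 1]) (u r) x) \<le> c i j * (t - t0) ^ m"
          using c(2)[OF r'(1) x, of j i] c(1)[of i j] r
          by (meson atLeastAtMost_iff diff_ge_0_iff_ge diff_right_mono mult_left_mono order_trans power_mono)
        ultimately show "norm (b r $ i $ j *\<^sub>R partials (bs @ [axis j 1, axis i 1]) (u r) x) \<le> norm (b r) * (c i j * (t - t0) ^ m)"
          unfolding norm_scaleR by (intro mult_mono) auto
      qed
      also have "\<dots> = S * (t - t0) ^ m * norm (b r)"
        by (simp add: S_def sum_distrib_left sum_distrib_right mult_ac)
      finally show "norm (partials bs (wave_operator r (u r)) x) \<le> S * (t - t0) ^ m * norm (b r)" .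
    qed
    also have "\<dots> = S * (t - t0) ^ m * integral {t0..t} (\<lambda>r. norm (b r))" by simp
    also have "\<dots> \<le> S * (t - t0) ^ m * J"
      unfolding J_def
      by (intro mult_left_mono integral_subset_le nbi) (use t d t00 S in auto)
    finally show ?thesis using hi by (simp add: integral_unique mult_ac)
  qed
  then show "\<exists>B\<ge>0. \<forall>t\<in>{t0..d}. \<forall>x. norm x < \<rho> --> norm (partials bs (v t) x) \<le> B * (t - t0) ^ m"
    using S J by (intro exI[of _ "S * J"]) auto
  have "norm (partials bs (u t) x) \<le> (S * J) * (t - t0) ^ Suc m" if t: "t \<in> {t0..d}" and x: "norm x < \<rho>" for t x
  proof -
    have "((\<lambda>r. partials bs (v r) x) has_integral partials bs (u t) x - partials bs (u t0) x) {t0..t}"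
    proof (rule fundamental_theorem_of_calculus)
      fix r assume r: "r \<in> {t0..t}"
      then show "((\<lambda>a. partials bs (u a) x) has_vector_derivative partials bs (v r) x) (at r within {t0..t})"
        using has_vector_derivative_within_subset[OF classical_derivative(1)[OF cs bs, of r x], of "{t0..t}"] t d t00 by auto
    qed (use t in auto)
    moreover have "partials bs (u t0) x = 0"
      using zero_on_ball_imp_partials_zero[of \<rho> "u t0" x bs] data x by simp
    ultimately have "((\<lambda>r. partials bs (v r) x) has_integral partials bs (u t) x) (cbox t0 t)" by simp
    moreover have "norm (partials bs (v r) x) \<le> (S * J) * (t - t0) ^ m" if r: "r \<in> cbox t0 t" for r
    proof -
      have "norm (partials bs (v r) x) \<le> (S * J) * (r - t0) ^ m" using vb r t x by auto
      also have "\<dots> \<le> (S * J) * (t - t0) ^ m" using r S J by (intro mult_left_mono power_mono) auto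
      finally show ?thesis .
    qed
    ultimately have "norm (partials bs (u t) x) \<le> (S * J) * (t - t0) ^ m * measure lborel (cbox t0 t)"
      by (intro has_integral_bound) (use S J t in auto)
    then show ?thesis using t by (simp add: mult_ac)
  qed
  then show "\<exists>B\<ge>0. \<forall>t\<in>{t0..d}. \<forall>x. norm x < \<rho> --> norm (partials bs (u t) x) \<le> B * (t - t0) ^ Suc m"
    using S J by (intro exI[of _ "S * J"]) auto
qed

lemma vanishing_infinite_order:
  assumes cs: "classical_solution u v" and d: "t0 < d" "d \<le> T"
    and data: "\<And>x. norm x < \<rho> ==> u t0 x = 0 \<and> v t0 x = 0"
    and bs: "bs \<in> lists Basis"
  shows "\<exists>B\<ge>0. \<forall>t\<in>{t0..d}. \<forall>x. norm x < \<rho> --> norm (partials bs (u t) x) \<le> B * (t - t0) ^ m"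
  using bs
proof (induction m arbitrary: bs)
  case 0
  have "continuous_on ({t0..d} \<times> cball 0 \<rho>) (\<lambda>p. partials bs (u (fst p)) (snd p))"
    by (rule classical_continuous(1)[OF cs 0]) (use d t0 in auto)
  from compact_imp_bounded[OF compact_continuous_image[OF this]]
  obtain B where B: "B > 0" "\<And>p. p \<in> {t0..d} \<times> cball 0 \<rho> ==> norm (partials bs (u (fst p)) (snd p)) \<le> B"
    by (auto simp: bounded_pos compact_Times)
  then show ?case by (intro exI[of _ B]) force
next
  case (Suc m)
  show ?case by (rule vanishing_order_step(2)[OF cs d data Suc.IH Suc.prems])
qed


lemma exp_neg_ln_le:
  fixes c \<delta> :: real
  assumes "0 < \<delta>" "\<delta> \<le> 1"
  shows "exp (- c * ln \<delta>) \<le> (1 / \<delta>) ^ nat \<lceil>c\<rceil>"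
  using exp_ln_le_power[of "1 / \<delta>" c] assms by (simp add: ln_div)

text \<open>Crossing the singularity costs only a fixed power of the distance to it in the energy estimate,
  which vanishing to infinite order compensates.\<close>

lemma singular_phase_uniqueness:
  assumes cs: "classical_solution u v" and R: "R > 0" and d: "t0 < d" "d \<le> T" and fd: "front d \<le> R"
    and data: "\<And>x. norm x < R - front t0 ==> u t0 x = 0 \<and> v t0 x = 0" and x: "norm x < R - front d"
  shows "v d x = 0"
proof (rule cone_energy_nonpos_imp_zero[OF cs R _ _ fd _ x])
  let ?Q = "cbox (- vec R) (vec R :: real ^ 'n)"
  define \<rho> where "\<rho> = R - front t0"
  have t00: "0 \<le> t0" using t0 by simp
  have ft: "front t0 \<le> front r" if "r \<in> {t0..d}" for r using front_mono[of t0 r] that t00 d by simp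
  have ft0: "0 \<le> front t0" using front_mono[of 0 t0] front_0 t00 d by simp
  have \<rho>: "0 \<le> \<rho>" "\<rho> \<le> R" using ft[of d] ft0 d fd by (auto simp: \<rho>_def)
  have data': "\<And>x. norm x < \<rho> ==> u t0 x = 0 \<and> v t0 x = 0" using data by (simp add: \<rho>_def)
  obtain Kb where Kb: "Kb \<ge> 0" "\<And>t. t \<in> {0..T} ==> t \<noteq> t0 ==> norm (b t) \<le> Kb * (1 + \<bar>ln \<bar>t - t0\<bar>\<bar>)"
    using b_log_bound by metis
  define \<gamma> where "\<gamma> = real CARD('n) / lam"
  have \<gamma>: "\<gamma> \<ge> 0" using lam by (simp add: \<gamma>_def)
  \<comment> \<open>\<open>N\<close> is the exponent lost by an estimate that starts at distance
    \<open>\<delta>\<close> from \<open>t0\<close>. The energy at the start is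
    \<open>O(\<delta>^(2m) / \<delta>)\<close>, the division coming from the crude bound of the
    logarithm in \<open>norm (b s)\<close> by \<open>1/\<delta>\<close>. With
    \<open>m = N + 1\<close> the balance \<open>2 m - 1 - N\<close> equals \<open>m\<close>.\<close>
  define N where "N = nat \<lceil>\<gamma> * C\<rceil>"
  define m where "m = N + 1"
  have vio: "\<And>bs. bs \<in> lists Basis ==> \<exists>B\<ge>0. \<forall>t\<in>{t0..d}. \<forall>x. norm x < \<rho> --> norm (partials bs (u t) x) \<le> B * (t - t0) ^ m"
    by (rule vanishing_infinite_order[OF cs d data'])
  obtain Bv where Bv: "Bv \<ge> 0" "\<And>t x. t \<in> {t0..d} ==> norm x < \<rho> ==> norm (v t x) \<le> Bv * (t - t0) ^ m"
    using vanishing_order_step(1)[OF cs d data' vio, of "[]"] by (auto simp: partials_Nil)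
  let ?P = "\<lambda>i B. B \<ge> 0 \<and> (\<forall>t\<in>{t0..d}. \<forall>x. norm x < \<rho> --> norm (partials [axis i 1] (u t) x) \<le> B * (t - t0) ^ m)"
  define c where "c i = (SOME B. ?P i B)" for i
  have cP: "?P i (c i)" for i
    unfolding c_def by (rule someI_ex[OF vio]) auto
  have c: "c i \<ge> 0" for i using cP by blast
  have cu: "norm (partial (axis i 1) (u t) x) \<le> c i * (t - t0) ^ m" if "t \<in> {t0..d}" "norm x < \<rho>" for i t x
    using cP[of i] that by (simp add: partials_Cons partials_Nil)
  define S where "S = (\<Sum>i\<in>UNIV. \<Sum>j\<in>UNIV. c i * c j)"
  have S: "S \<ge> 0" unfolding S_def by (intro sum_nonneg mult_nonneg_nonneg c)
  define Vq where "Vq = measure lborel ?Q"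
  define X where "X = exp (d + \<gamma> * (C * ln (d - t0) + Gam d) - \<gamma> * Gam 0)"
  define Y where "Y = Vq * (R ^ 4 * (Bv\<^sup>2 + 2 * Kb * S))"
  have main: "cone_energy R u v d \<le> X * Y * \<delta>" if \<delta>: "0 < \<delta>" "\<delta> < 1" "\<delta> < d - t0" for \<delta>
  proof -
    define s where "s = t0 + \<delta>"
    have s: "t0 < s" "s < d" "s - t0 = \<delta>" "s \<in> {t0..d}" "s \<in> {0..T}" using \<delta> d t00 by (auto simp: s_def)
    have bs: "norm (b s) \<le> 2 * Kb / \<delta>"
    proof -
      have "- ln \<delta> \<le> 1 / \<delta> - 1" using ln_le_minus_one[of "1 / \<delta>"] \<delta> by (simp add: ln_div)
      moreover have "ln \<delta> \<le> 0" using \<delta> by simp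
      ultimately have "1 + \<bar>ln \<delta>\<bar> \<le> 2 / \<delta>" using \<delta> by (simp add: field_simps)
      then have "Kb * (1 + \<bar>ln \<delta>\<bar>) \<le> Kb * (2 / \<delta>)" using Kb(1) by (rule mult_left_mono)
      moreover have "norm (b s) \<le> Kb * (1 + \<bar>ln \<delta>\<bar>)" using Kb(2)[of s] s \<delta> by simp
      ultimately show ?thesis by (simp only: times_divide_eq_right mult.commute[of 2])
    qed
    have dens: "energy_density u v s y \<le> (Bv\<^sup>2 + 2 * Kb * S) * (\<delta> ^ (2 * m) / \<delta>)" if y: "norm y < \<rho>" for y
    proof -
      have "(norm (v s y))\<^sup>2 \<le> (Bv * \<delta> ^ m)\<^sup>2" using Bv(2)[OF s(4) y] s(3) by (intro power_mono) auto
      also have "\<dots> = Bv\<^sup>2 * \<delta> ^ (2 * m) * 1" by (simp add: power_mult_distrib power_mult[symmetric] mult.commute)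
      also have "\<dots> \<le> Bv\<^sup>2 * \<delta> ^ (2 * m) * (1 / \<delta>)" using \<delta> by (intro mult_left_mono) auto
      finally have 1: "(norm (v s y))\<^sup>2 \<le> Bv\<^sup>2 * (\<delta> ^ (2 * m) / \<delta>)" by simp
      have "(\<Sum>i\<in>UNIV. \<Sum>j\<in>UNIV. b s $ i $ j * (partial (axis i 1) (u s) y \<bullet> partial (axis j 1) (u s) y))
          \<le> (\<Sum>i\<in>UNIV. \<Sum>j\<in>UNIV. 2 * Kb / \<delta> * ((c i * \<delta> ^ m) * (c j * \<delta> ^ m)))"
      proof (intro sum_mono)
        fix i j
        have "\<bar>b s $ i $ j\<bar> \<le> norm (b s)"
          using component_le_norm_cart[of "b s $ i" j] Finite_Cartesian_Product.norm_nth_le[of "b s" i] by linarith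
        then have "\<bar>b s $ i $ j\<bar> \<le> 2 * Kb / \<delta>" using bs by linarith
        moreover have "\<bar>partial (axis i 1) (u s) y \<bullet> partial (axis j 1) (u s) y\<bar> \<le> (c i * \<delta> ^ m) * (c j * \<delta> ^ m)"
          using cu[OF s(4) y, of i] cu[OF s(4) y, of j] c[of i] \<delta> unfolding s(3)
          by (intro order_trans[OF Cauchy_Schwarz_ineq2] mult_mono) auto
        ultimately have "\<bar>b s $ i $ j * (partial (axis i 1) (u s) y \<bullet> partial (axis j 1) (u s) y)\<bar>
            \<le> 2 * Kb / \<delta> * ((c i * \<delta> ^ m) * (c j * \<delta> ^ m))"
          unfolding abs_mult using Kb(1) \<delta> by (intro mult_mono) auto
        then show "b s $ i $ j * (partial (axis i 1) (u s) y \<bullet> partial (axis j 1) (u s) y)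
            \<le> 2 * Kb / \<delta> * ((c i * \<delta> ^ m) * (c j * \<delta> ^ m))" by linarith
      qed
      also have "\<dots> = 2 * Kb * S * (\<delta> ^ (2 * m) / \<delta>)"
      proof -
        have sq: "(\<Sum>i\<in>UNIV. \<Sum>j\<in>UNIV. k * ((c i * e) * (c j * e))) = k * S * (e * e)" for k e
          unfolding S_def by (simp only: sum_distrib_left sum_distrib_right mult_ac)
        have dd: "\<delta> ^ (2 * m) = \<delta> ^ m * \<delta> ^ m" by (simp add: mult_2 power_add)
        show ?thesis unfolding sq dd by simp
      qed
      finally have 2: "(\<Sum>i\<in>UNIV. \<Sum>j\<in>UNIV. b s $ i $ j * (partial (axis i 1) (u s) y \<bullet> partial (axis j 1) (u s) y))
          \<le> 2 * Kb * S * (\<delta> ^ (2 * m) / \<delta>)" .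
      show ?thesis unfolding energy_density_def distrib_right by (rule add_mono[OF 1 2])
    qed
    have "cone_energy R u v s \<le> integral ?Q (\<lambda>y. R ^ 4 * ((Bv\<^sup>2 + 2 * Kb * S) * (\<delta> ^ (2 * m) / \<delta>)))"
      unfolding cone_energy_def
    proof (rule integral_le)
      show "(\<lambda>y. cone_weight R s y * energy_density u v s y) integrable_on ?Q"
        by (intro integrable_continuous continuous_intros cone_weight_continuous energy_density_continuous[OF cs s(5)])
      fix y :: "real ^ 'n"
      have pos: "0 \<le> (Bv\<^sup>2 + 2 * Kb * S) * (\<delta> ^ (2 * m) / \<delta>)" using Kb(1) S \<delta> by simp
      have fs: "front t0 \<le> front s" "front s \<le> R" using ft[OF s(4)] front_mono[of s d] s d fd by auto
      show "cone_weight R s y * energy_density u v s y \<le> R ^ 4 * ((Bv\<^sup>2 + 2 * Kb * S) * (\<delta> ^ (2 * m) / \<delta>))"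
      proof (cases "norm y < R - front s")
        case True
        then have y: "norm y < \<rho>" using fs by (simp add: \<rho>_def)
        have "(R - front s)\<^sup>2 \<le> R\<^sup>2" using fs ft0 by (intro power_mono) auto
        then have "(R - front s)\<^sup>2 - y \<bullet> y \<le> R\<^sup>2" using inner_ge_zero[of y] by linarith
        then have "cone_weight R s y \<le> (R\<^sup>2)\<^sup>2" unfolding cone_weight_def by (intro power_mono) auto
        then have w: "cone_weight R s y \<le> R ^ 4" by simp
        have "0 \<le> energy_density u v s y"
          using order_trans[OF zero_le_power2 energy_density_ge] s by auto
        then show ?thesis using w dens[OF y] by (intro mult_mono) auto
      next
        case False
        then have "(R - front s)\<^sup>2 \<le> (norm y)\<^sup>2" using fs by (intro power_mono) auto
        then have "cone_weight R s y = 0" by (simp add: cone_weight_def power2_norm_eq_inner)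
        then show ?thesis using mult_nonneg_nonneg[OF _ pos, of "R ^ 4"] R by simp
      qed
    qed auto
    also have "\<dots> = Y * (\<delta> ^ (2 * m) / \<delta>)" by (simp add: Y_def Vq_def mult_ac)
    finally have Es: "cone_energy R u v s \<le> Y * (\<delta> ^ (2 * m) / \<delta>)" .
    have Yp: "0 \<le> Y" unfolding Y_def Vq_def using Kb(1) S by simp
    have "cone_energy R u v d \<le> exp ((d + real CARD('n) / lam * (C * ln (d - t0) + Gam d))
        - (s + real CARD('n) / lam * (C * ln (s - t0) + Gam s))) * cone_energy R u v s"
    proof (rule cone_energy_estimate[OF cs R, where V = "\<lambda>t. C * ln (t - t0) + Gam t"])
      fix r t assume rt: "s \<le> r" "r \<le> t" "t \<le> d"
      have "ln (r - t0) \<le> ln (t - t0)" using rt s by (subst ln_le_cancel_iff) auto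
      then show "norm (b t - b r) \<le> C * ln (t - t0) + Gam t - (C * ln (r - t0) + Gam r)"
        using b_var[of r t] rt s d t00 by (simp add: algebra_simps)
    qed (use s d fd t00 in auto)
    also have "\<dots> \<le> exp ((d + real CARD('n) / lam * (C * ln (d - t0) + Gam d))
        - (s + real CARD('n) / lam * (C * ln (s - t0) + Gam s))) * (Y * (\<delta> ^ (2 * m) / \<delta>))"
      using Es by (intro mult_left_mono) auto
    also have "\<dots> \<le> X * (1 / \<delta>) ^ N * (Y * (\<delta> ^ (2 * m) / \<delta>))"
    proof (rule mult_right_mono)
      have "\<gamma> * Gam 0 \<le> \<gamma> * Gam s" using Gam_mono[of 0 s] s \<gamma> by (intro mult_left_mono) auto
      then have "exp ((d + \<gamma> * (C * ln (d - t0) + Gam d)) - (s + \<gamma> * (C * ln (s - t0) + Gam s)))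
          \<le> exp ((d + \<gamma> * (C * ln (d - t0) + Gam d) - \<gamma> * Gam 0) + (- (\<gamma> * C) * ln \<delta>))"
        using s by (simp add: algebra_simps)
      also have "\<dots> = X * exp (- (\<gamma> * C) * ln \<delta>)" unfolding X_def exp_add[symmetric] by simp
      also have "\<dots> \<le> X * (1 / \<delta>) ^ N"
        unfolding N_def using \<delta> by (intro mult_left_mono exp_neg_ln_le) (auto simp: X_def)
      finally show "exp ((d + real CARD('n) / lam * (C * ln (d - t0) + Gam d))
        - (s + real CARD('n) / lam * (C * ln (s - t0) + Gam s))) \<le> X * (1 / \<delta>) ^ N" by (simp add: \<gamma>_def)
      show "0 \<le> Y * (\<delta> ^ (2 * m) / \<delta>)" using Yp \<delta> by simp
    qed
    also have "\<dots> = X * Y * ((1 / \<delta>) ^ N * (\<delta> ^ (2 * m) / \<delta>))" by simp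
    also have "(1 / \<delta>) ^ N * (\<delta> ^ (2 * m) / \<delta>) = \<delta> ^ m"
      using \<delta> by (simp add: m_def mult_2 power_add power_one_over field_simps, simp add: power_mult power2_eq_square)
    also have "\<delta> ^ m \<le> \<delta>" using \<delta> power_decreasing[of 1 m \<delta>] by (simp add: m_def)
    finally show ?thesis using Yp by (simp add: X_def mult_left_mono)
  qed
  show "cone_energy R u v d \<le> 0"
  proof (rule tendsto_lowerbound[of "\<lambda>\<delta>. X * Y * \<delta>" 0 "at_right 0"])
    show "((\<lambda>\<delta>. X * Y * \<delta>) \<longlongrightarrow> 0) (at_right 0)" by (auto intro!: tendsto_eq_intros)
    show "\<forall>\<^sub>F \<delta> in at_right 0. cone_energy R u v d \<le> X * Y * \<delta>"
      using eventually_at_right_less[of 0] eventually_at_right_real[of 0 "min 1 (d - t0)"] d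
      by (auto elim!: eventually_mono intro!: main)
  qed simp
qed (use d t0 in auto)

text \<open>Before \<open>t0\<close> the estimate is used on closed intervals that avoid
  \<open>t0\<close>. Its constants may blow up as they approach \<open>t0\<close>, but they multiply
  an energy that is 0, so continuity settles the instant \<open>t0\<close>. Only later times need
  \<open>singular_phase_uniqueness\<close>.\<close>

lemma local_uniqueness:
  assumes cs: "classical_solution u v" and R: "R > 0"
    and data: "\<And>x. norm x < R ==> u 0 x = 0 \<and> v 0 x = 0"
    and t: "t \<in> {0..T}" and x: "norm x < R - front t"
  shows "u t x = 0"
proof -
  have before: "u r y = 0 \<and> v r y = 0" if "0 \<le> r" "r < t0" "norm y < R - front r" for r y
  proof (rule regular_phase_uniqueness[OF cs R])
    show "norm y < R - front r" by (rule that(3))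
    show "front r \<le> R" using that(3) norm_ge_zero[of y] by linarith
  qed (use that t0 data front_0 in auto)
  have at_t0: "u t0 y = 0 \<and> v t0 y = 0" if y: "norm y < R - front t0" for y
  proof (cases "t0 = 0")
    case True
    then show ?thesis using data y front_0 by simp
  next
    case False
    then have t0p: "0 < t0" using t0 by simp
    have z: "f t0 = 0" if f: "continuous_on {0..T} f" and f0: "\<And>r. 0 \<le> r ==> r < t0 ==> f r = 0" for f :: "real => complex"
    proof -
      have "(f \<longlongrightarrow> f t0) (at t0 within {0..t0})"
        using f t0 unfolding continuous_on_def by (metis (no_types, lifting) atLeastatMost_subset_iff tendsto_within_subset order_refl atLeastAtMost_iff)
      then have "(f \<longlongrightarrow> f t0) (at_left t0)" using t0p by (simp add: at_within_Icc_at_left)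
      moreover have "(f \<longlongrightarrow> 0) (at_left t0)"
      proof (rule tendsto_eventually)
        show "\<forall>\<^sub>F r in at_left t0. f r = 0"
          using eventually_at_left_real[OF t0p] by (rule eventually_mono) (auto intro: f0)
      qed
      ultimately show ?thesis by (rule tendsto_unique[rotated]) simp
    qed
    have fr: "norm y < R - front r" if "0 \<le> r" "r < t0" for r
      using front_mono[of r t0] that t0 y by simp
    show ?thesis
      using z[OF classical_time_continuous(1)[OF cs, of "[]" y]] z[OF classical_time_continuous(2)[OF cs, of "[]" y]]
        before fr by (simp add: partials_Nil)
  qed
  consider "t < t0" | "t = t0" | "t0 < t" by linarith
  then show ?thesis
  proof cases
    case 1
    then show ?thesis using before t x by simp
  next
    case 2
    then show ?thesis using at_t0 x by simp
  next
    case 3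
    have fx: "norm x < R - front r" if "r \<in> {t0..t}" for r
      using front_mono[of r t] that t t0 x by simp
    show ?thesis
    proof (rule stationary_imp_zero[OF cs _ _ _ _ conjunct1[OF at_t0[OF fx]]])
      fix r assume r: "r \<in> {t0..t}"
      show "v r x = 0"
      proof (cases "r = t0")
        case True
        then show ?thesis using at_t0 fx 3 by simp
      next
        case False
        have "front r \<le> R" using fx[OF r] norm_ge_zero[of x] by linarith
        then show ?thesis
          using r False t by (intro singular_phase_uniqueness[OF cs R _ _ _ at_t0 fx]) auto
      qed
    qed (use 3 t t0 in auto)
  qed
qed

lemma wave_operator_diff:
  assumes "smooth f" "smooth g"
  shows "wave_operator t (\<lambda>x. f x - g x) = (\<lambda>x. wave_operator t f x - wave_operator t g x)"
proof
  fix x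
  have "partials [axis j 1, axis i 1] (\<lambda>x. f x - g x) x
      = partials [axis j 1, axis i 1] f x - partials [axis j 1, axis i 1] g x" for i j
    by (rule partials_diff[OF assms]) auto
  then have "partial (axis j 1) (partial (axis i 1) (\<lambda>x. f x - g x)) x
      = partial (axis j 1) (partial (axis i 1) f) x - partial (axis j 1) (partial (axis i 1) g) x" for i j
    by (simp add: partials_Cons partials_Nil)
  then show "wave_operator t (\<lambda>x. f x - g x) x = wave_operator t f x - wave_operator t g x"
    by (simp add: second_order_def scaleR_diff_right sum_subtractf)
qed

lemma classical_solution_diff:
  assumes cs: "classical_solution u v" and cs': "classical_solution u' v'"
  shows "classical_solution (\<lambda>t x. u t x - u' t x) (\<lambda>t x. v t x - v' t x)"
proof -
  note s = classical_smooth[OF cs] classical_smooth[OF cs']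
  have pu: "partials bs (\<lambda>x. u t x - u' t x) x = partials bs (u t) x - partials bs (u' t) x"
    and pv: "partials bs (\<lambda>x. v t x - v' t x) x = partials bs (v t) x - partials bs (v' t) x"
    if "bs \<in> lists Basis" "t \<in> {0..T}" for bs t x
    using that s by (auto intro!: partials_diff)
  have pw: "partials bs (wave_operator t (\<lambda>x. u t x - u' t x)) x
      = partials bs (wave_operator t (u t)) x - partials bs (wave_operator t (u' t)) x"
    if "bs \<in> lists Basis" "t \<in> {0..T}" for bs t x
    using that s by (simp add: wave_operator_diff partials_diff smooth_second_order)
  show ?thesis
    unfolding classical_solution_def
  proof (intro conjI ballI allI impI)
    fix t assume t: "t \<in> {0..T}"
    show "smooth (\<lambda>x. u t x - u' t x)" "smooth (\<lambda>x. v t x - v' t x)" using s t by (auto intro: smooth_diff)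
  next
    fix bs :: "(real ^ 'n) list" assume bs: "bs \<in> lists Basis"
    show "continuous_on ({0..T} \<times> UNIV) (\<lambda>p. partials bs (\<lambda>x. u (fst p) x - u' (fst p) x) (snd p))"
      by (rule continuous_on_eq[OF continuous_on_diff[OF classical_continuous(1)[OF cs bs order_refl] classical_continuous(1)[OF cs' bs order_refl]]])
        (auto simp: pu[OF bs])
    show "continuous_on ({0..T} \<times> UNIV) (\<lambda>p. partials bs (\<lambda>x. v (fst p) x - v' (fst p) x) (snd p))"
      by (rule continuous_on_eq[OF continuous_on_diff[OF classical_continuous(2)[OF cs bs order_refl] classical_continuous(2)[OF cs' bs order_refl]]])
        (auto simp: pv[OF bs])
    fix x t assume t: "t \<in> {0..T}"
    show "((\<lambda>t. partials bs (\<lambda>x. u t x - u' t x) x) has_vector_derivative partials bs (\<lambda>x. v t x - v' t x) x) (at t within {0..T})"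
      unfolding pv[OF bs t]
      by (rule has_vector_derivative_transform[OF t _ has_vector_derivative_diff[OF classical_derivative(1)[OF cs bs t] classical_derivative(1)[OF cs' bs t]]])
        (simp add: pu[OF bs])
    assume "t \<noteq> t0"
    show "((\<lambda>t. partials bs (\<lambda>x. v t x - v' t x) x) has_vector_derivative
        partials bs (wave_operator t (\<lambda>x. u t x - u' t x)) x) (at t within {0..T})"
      unfolding pw[OF bs t]
      by (rule has_vector_derivative_transform[OF t _ has_vector_derivative_diff[OF classical_derivative(2)[OF cs bs t \<open>t \<noteq> t0\<close>] classical_derivative(2)[OF cs' bs t \<open>t \<noteq> t0\<close>]]])
        (simp add: pv[OF bs])
  qed
qed

end

subsection \<open>Superpositions of plane waves\<close>

text \<open>The tails of \<open>M\<close> bound the tails of the series of derivatives uniformly on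
  \<open>S\<close>, which is what termwise differentiation asks for.\<close>

lemma has_derivative_suminf_dominated:
  fixes f :: "nat => 'a::real_normed_vector => 'b::banach"
  assumes S: "convex S" and d: "\<And>n x. x \<in> S ==> (f n has_derivative f' n x) (at x within S)"
    and bd: "\<And>n x h. x \<in> S ==> norm (f' n x h) \<le> M n * norm h" and M: "summable M"
    and s: "\<And>x. x \<in> S ==> summable (\<lambda>n. f n x)" and x: "x \<in> S"
  shows "((\<lambda>x. \<Sum>n. f n x) has_derivative (\<lambda>h. \<Sum>n. f' n x h)) (at x within S)"
proof -
  have sM: "summable (\<lambda>n. M n * norm h)" for h :: 'a by (rule summable_mult2[OF M])
  have sf: "summable (\<lambda>n. norm (f' n x h))" if "x \<in> S" for x h
    by (rule summable_comparison_test'[OF sM[of h], of 0]) (use bd that in auto)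
  have "\<exists>g. \<forall>x\<in>S. (\<lambda>n. f n x) sums g x \<and> (g has_derivative (\<lambda>h. \<Sum>n. f' n x h)) (at x within S)"
  proof (rule has_derivative_series[OF S d _ x summable_sums[OF s[OF x]]])
    fix e :: real assume e: "e > 0"
    obtain N where N: "\<And>n. n \<ge> N ==> norm (\<Sum>i. M (i + n)) < e"
      using suminf_exist_split[OF e M] by blast
    have "norm (sum (\<lambda>i. f' i x h) {..<n} - (\<Sum>i. f' i x h)) \<le> e * norm h"
      if n: "n \<ge> N" and x: "x \<in> S" for n x h
    proof -
      have sfn: "summable (\<lambda>i. norm (f' (i + n) x h))" using sf[OF x] by (subst summable_iff_shift)
      have sMn: "summable (\<lambda>i. M (i + n))" using M by (subst summable_iff_shift)
      have "(\<Sum>i. f' i x h) = (\<Sum>i. f' (i + n) x h) + sum (\<lambda>i. f' i x h) {..<n}"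
        by (rule suminf_split_initial_segment) (rule summable_norm_cancel[OF sf[OF x]])
      then have "norm (sum (\<lambda>i. f' i x h) {..<n} - (\<Sum>i. f' i x h)) = norm (\<Sum>i. f' (i + n) x h)" by simp
      also have "\<dots> \<le> (\<Sum>i. norm (f' (i + n) x h))" by (rule summable_norm[OF sfn])
      also have "\<dots> \<le> (\<Sum>i. M (i + n) * norm h)"
        by (rule suminf_le[OF _ sfn summable_mult2[OF sMn]]) (use bd x in auto)
      also have "\<dots> = (\<Sum>i. M (i + n)) * norm h" by (rule suminf_mult2[OF sMn, symmetric])
      also have "\<dots> \<le> e * norm h" using N[OF n] by (intro mult_right_mono) auto
      finally show ?thesis .
    qed
    then show "\<forall>\<^sub>F n in sequentially. \<forall>x\<in>S. \<forall>h. norm (sum (\<lambda>i. f' i x h) {..<n} - (\<Sum>n. f' n x h)) \<le> e * norm h"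
      unfolding eventually_sequentially by blast
  qed
  then obtain g where g: "\<forall>x\<in>S. (\<lambda>n. f n x) sums g x \<and> (g has_derivative (\<lambda>h. \<Sum>n. f' n x h)) (at x within S)"
    by blast
  show ?thesis
    by (rule has_derivative_transform[OF x _ conjunct2[OF bspec[OF g x]]]) (use g sums_unique in force)
qed

lemma has_vector_derivative_suminf_dominated:
  fixes f :: "nat => real => 'b::banach"
  assumes "convex S" "\<And>n t. t \<in> S ==> (f n has_vector_derivative f' n t) (at t within S)"
    and bd: "\<And>n t. t \<in> S ==> norm (f' n t) \<le> M n" and M: "summable M"
    and "\<And>t. t \<in> S ==> summable (\<lambda>n. f n t)" and t: "t \<in> S"
  shows "((\<lambda>t. \<Sum>n. f n t) has_vector_derivative (\<Sum>n. f' n t)) (at t within S)"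
proof -
  have "((\<lambda>t. \<Sum>n. f n t) has_derivative (\<lambda>h. \<Sum>n. h *\<^sub>R f' n t)) (at t within S)"
    by (rule has_derivative_suminf_dominated[where M = M])
      (use assms in \<open>auto simp: has_vector_derivative_def mult.commute intro!: mult_left_mono\<close>)
  moreover have "(\<Sum>n. h *\<^sub>R f' n t) = h *\<^sub>R (\<Sum>n. f' n t)" for h
    by (rule suminf_scaleR_right[symmetric], rule summable_comparison_test'[OF M]) (use bd t in auto)
  ultimately show ?thesis by (simp add: has_vector_derivative_def)
qed

lemma continuous_on_suminf_dominated:
  fixes f :: "nat => 'a::topological_space => 'b::banach"
  assumes "\<And>n. continuous_on S (f n)" "\<And>n x. x \<in> S ==> norm (f n x) \<le> M n" "summable M"
  shows "continuous_on S (\<lambda>x. \<Sum>n. f n x)"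
  by (rule uniform_limit_theorem[OF _ Weierstrass_m_test[OF assms(2,3)]])
    (auto intro!: always_eventually continuous_intros assms(1))

text \<open>The Fourier multiplier of \<open>partials bs\<close>: the factor that these derivatives
  produce on the plane wave \<open>cis (\<xi> \<bullet> x)\<close>.\<close>

definition monomial :: "(real ^ 'n) list => real ^ 'n => complex" where
  "monomial bs \<xi> = prod_list (map (\<lambda>e. \<i> * of_real (\<xi> \<bullet> e)) bs)"

lemma monomial_simps: "monomial [] \<xi> = 1" "monomial (e # bs) \<xi> = \<i> * of_real (\<xi> \<bullet> e) * monomial bs \<xi>"
  by (simp_all add: monomial_def)

lemma monomial_append: "monomial (as @ bs) \<xi> = monomial as \<xi> * monomial bs \<xi>"
  by (simp add: monomial_def)

lemma norm_monomial_le: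
  assumes "bs \<in> lists Basis"
  shows "norm (monomial bs \<xi>) \<le> (1 + norm \<xi>) ^ length bs"
  using assms
proof (induction bs)
  case (Cons e bs)
  have "\<bar>\<xi> \<bullet> e\<bar> \<le> 1 + norm \<xi>" using Basis_le_norm[of e \<xi>] Cons.hyps by simp
  then show ?case using Cons.IH by (auto simp: monomial_simps norm_mult intro!: mult_mono)
qed (simp add: monomial_simps)

definition wave_sum :: "(nat => real ^ 'n) => (nat => complex) => real ^ 'n => complex" where
  "wave_sum \<xi> a x = (\<Sum>i. a i * cis (\<xi> i \<bullet> x))"

definition rapidly_decreasing :: "(nat => real ^ 'n) => (nat => complex) => bool" where
  "rapidly_decreasing \<xi> a \<longleftrightarrow> (\<forall>m. summable (\<lambda>i. norm (a i) * (1 + norm (\<xi> i)) ^ m))"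

lemma rapidly_decreasingD:
  assumes "rapidly_decreasing \<xi> a"
  shows "summable (\<lambda>i. norm (a i) * (1 + norm (\<xi> i)) ^ m)" "summable (\<lambda>i. norm (a i))"
proof -
  show "summable (\<lambda>i. norm (a i) * (1 + norm (\<xi> i)) ^ m)" for m
    using assms unfolding rapidly_decreasing_def by blast
  from this[of 0] show "summable (\<lambda>i. norm (a i))" by simp
qed

lemma rapidly_decreasing_monomial:
  assumes a: "rapidly_decreasing \<xi> a" and bs: "bs \<in> lists Basis"
  shows "rapidly_decreasing \<xi> (\<lambda>i. a i * monomial bs (\<xi> i))"
  unfolding rapidly_decreasing_def
proof
  fix m
  show "summable (\<lambda>i. norm (a i * monomial bs (\<xi> i)) * (1 + norm (\<xi> i)) ^ m)"
  proof (rule summable_comparison_test'[OF rapidly_decreasingD(1)[OF a, of "length bs + m"], of 0])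
    fix i
    have "norm (a i) * norm (monomial bs (\<xi> i)) * (1 + norm (\<xi> i)) ^ m
        \<le> norm (a i) * (1 + norm (\<xi> i)) ^ length bs * (1 + norm (\<xi> i)) ^ m"
      by (intro mult_right_mono mult_left_mono norm_monomial_le bs) auto
    then show "norm (norm (a i * monomial bs (\<xi> i)) * (1 + norm (\<xi> i)) ^ m) \<le> norm (a i) * (1 + norm (\<xi> i)) ^ (length bs + m)"
      by (simp add: norm_mult power_add mult.assoc)
  qed
qed

lemma wave_sum_has_derivative:
  assumes a: "rapidly_decreasing \<xi> a"
  shows "(wave_sum \<xi> a has_derivative (\<lambda>h. \<Sum>i. a i * (\<i> * of_real (\<xi> i \<bullet> h)) * cis (\<xi> i \<bullet> x))) (at x)"
  unfolding wave_sum_def[abs_def]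
proof (rule has_derivative_suminf_dominated[of UNIV])
  fix n x h
  show "((\<lambda>x. a n * cis (\<xi> n \<bullet> x)) has_derivative (\<lambda>h. a n * (\<i> * of_real (\<xi> n \<bullet> h)) * cis (\<xi> n \<bullet> x))) (at x)"
    using has_derivative_mult_right[OF cis_inner_has_derivative, of "a n" "\<xi> n" x] by (simp only: mult.assoc)
  have "norm (a n * (\<i> * of_real (\<xi> n \<bullet> h)) * cis (\<xi> n \<bullet> x)) = norm (a n) * \<bar>\<xi> n \<bullet> h\<bar>"
    by (simp add: norm_mult)
  also have "\<dots> \<le> norm (a n) * (norm (\<xi> n) * norm h)" by (intro mult_left_mono Cauchy_Schwarz_ineq2) auto
  also have "\<dots> \<le> norm (a n) * ((1 + norm (\<xi> n)) ^ 1 * norm h)" by (intro mult_left_mono mult_right_mono) auto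
  finally show "norm (a n * (\<i> * of_real (\<xi> n \<bullet> h)) * cis (\<xi> n \<bullet> x)) \<le> norm (a n) * (1 + norm (\<xi> n)) ^ 1 * norm h"
    by (simp only: mult.assoc)
  show "summable (\<lambda>n. a n * cis (\<xi> n \<bullet> x))"
    by (rule summable_comparison_test'[OF rapidly_decreasingD(2)[OF a], of 0]) (simp add: norm_mult)
qed (use rapidly_decreasingD(1)[OF a, of 1] in auto)

lemma partial_wave_sum:
  assumes "rapidly_decreasing \<xi> a"
  shows "partial e (wave_sum \<xi> a) = wave_sum \<xi> (\<lambda>i. a i * monomial [e] (\<xi> i))"
  by (rule ext) (simp add: has_derivative_partial[OF wave_sum_has_derivative[OF assms]] wave_sum_def monomial_simps)

lemma smooth_wave_sum:
  assumes "rapidly_decreasing \<xi> a"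
  shows "smooth (wave_sum \<xi> a)"
proof (rule smooth_coinduct[of "\<lambda>f. \<exists>a. rapidly_decreasing \<xi> a \<and> f = wave_sum \<xi> a"])
  fix f assume "\<exists>a. rapidly_decreasing \<xi> a \<and> f = wave_sum \<xi> a"
  then obtain a where a: "rapidly_decreasing \<xi> a" and f: "f = wave_sum \<xi> a" by blast
  have "f differentiable (at x)" for x
    using wave_sum_has_derivative[OF a] unfolding f differentiable_def by blast
  moreover have "sum_closure (\<lambda>f. \<exists>a. rapidly_decreasing \<xi> a \<and> f = wave_sum \<xi> a) (partial e f)" if "e \<in> Basis" for e
    unfolding f partial_wave_sum[OF a]
    using rapidly_decreasing_monomial[OF a, of "[e]"] that by (intro sum_closure.base) auto
  ultimately show "(\<forall>x. f differentiable (at x)) \<and> (\<forall>b\<in>Basis. sum_closure (\<lambda>f. \<exists>a. rapidly_decreasing \<xi> a \<and> f = wave_sum \<xi> a) (partial b f))"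
    by blast
qed (use assms in blast)

lemma partials_wave_sum:
  assumes "rapidly_decreasing \<xi> a" "bs \<in> lists Basis"
  shows "partials bs (wave_sum \<xi> a) = wave_sum \<xi> (\<lambda>i. a i * monomial bs (\<xi> i))"
  using assms(2)
proof (induction bs)
  case (Cons e bs)
  have "partials (e # bs) (wave_sum \<xi> a) = partial e (wave_sum \<xi> (\<lambda>i. a i * monomial bs (\<xi> i)))"
    by (simp add: partials_Cons Cons.IH)
  also have "\<dots> = wave_sum \<xi> (\<lambda>i. a i * monomial bs (\<xi> i) * monomial [e] (\<xi> i))"
    by (rule partial_wave_sum[OF rapidly_decreasing_monomial[OF assms(1) Cons.hyps(2)]])
  finally show ?case by (simp add: monomial_simps mult_ac)
qed (simp add: partials_Nil monomial_simps)

context coefficients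
begin

text \<open>The polynomial growth of the modes in \<open>\<xi>\<close> is absorbed by the rapid
  decrease of the data, which yields one majorant for all times. Termwise differentiation in time is
  then justified for every spatial derivative.\<close>

lemma mode_superposition:
  assumes c: "rapidly_decreasing \<xi> c" and d: "rapidly_decreasing \<xi> d"
    and mode: "\<And>i. is_mode (\<xi> i) (y i) (v i)" and y0: "\<And>i. y i 0 = c i" and v0: "\<And>i. v i 0 = d i"
  shows "classical_solution (\<lambda>t. wave_sum \<xi> (\<lambda>i. y i t)) (\<lambda>t. wave_sum \<xi> (\<lambda>i. v i t))"
proof -
  obtain K N where K: "K \<ge> 0" and KN: "\<And>\<xi> y v t. is_mode \<xi> y v ==> t \<in> {0..T} ==>
    (norm (v t))\<^sup>2 + (norm (y t))\<^sup>2 \<le> K * (1 + norm \<xi>) ^ N * ((norm (v 0))\<^sup>2 + (norm (y 0))\<^sup>2)"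
    by (rule mode_bound, rule that, assumption, blast)
  \<comment> \<open>A majorant of \<open>norm (y i t)\<close> and \<open>norm (v i t)\<close> on
    \<open>{0..T}\<close>. The generous \<open>1 + K\<close> and the full exponent \<open>N\<close>
    avoid the square roots that \<open>mode_bound\<close> would suggest.\<close>
  define A where "A i = (1 + K) * (1 + norm (\<xi> i)) ^ N * (norm (c i) + norm (d i))" for i
  have A0: "A i \<ge> 0" for i using K by (simp add: A_def)
  have ineq: "(norm (v i t))\<^sup>2 + (norm (y i t))\<^sup>2 \<le> (A i)\<^sup>2" if t: "t \<in> {0..T}" for i t
  proof -
    define n where "n = (1 + norm (\<xi> i)) ^ N"
    have n: "n \<ge> 1" by (simp add: n_def)
    have "(norm (d i))\<^sup>2 + (norm (c i))\<^sup>2 \<le> (norm (c i) + norm (d i))\<^sup>2" by (simp add: power2_sum)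
    moreover have "K * n \<le> ((1 + K) * n)\<^sup>2"
    proof -
      have "K * n \<le> (1 + K) * n" using n by (intro mult_right_mono) auto
      also have "\<dots> \<le> ((1 + K) * n)\<^sup>2" using one_le_mult[of "1 + K" n] K n by (intro self_le_power) auto
      finally show ?thesis .
    qed
    ultimately have "K * n * ((norm (d i))\<^sup>2 + (norm (c i))\<^sup>2) \<le> ((1 + K) * n)\<^sup>2 * (norm (c i) + norm (d i))\<^sup>2"
      using K n by (intro mult_mono) auto
    then show ?thesis using KN[OF mode t, of i] by (simp add: A_def n_def y0 v0 power_mult_distrib)
  qed
  have yA: "norm (y i t) \<le> A i" if "t \<in> {0..T}" for i t
    by (rule power2_le_imp_le[OF order_trans[OF _ ineq[OF that]] A0]) simp
  have vA: "norm (v i t) \<le> A i" if "t \<in> {0..T}" for i t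
    by (rule power2_le_imp_le[OF order_trans[OF _ ineq[OF that]] A0]) simp
  have sA: "summable (\<lambda>i. A i * (1 + norm (\<xi> i)) ^ m)" for m
  proof -
    have "summable (\<lambda>i. (1 + K) * (norm (c i) * (1 + norm (\<xi> i)) ^ (N + m) + norm (d i) * (1 + norm (\<xi> i)) ^ (N + m)))"
      by (intro summable_mult summable_add rapidly_decreasingD c d)
    then show ?thesis by (simp add: A_def power_add algebra_simps)
  qed
  have rd: "rapidly_decreasing \<xi> a" if "\<And>i. norm (a i) \<le> A i" for a
    unfolding rapidly_decreasing_def
  proof
    fix m
    show "summable (\<lambda>i. norm (a i) * (1 + norm (\<xi> i)) ^ m)"
      by (rule summable_comparison_test'[OF sA[of m], of 0]) (use that in \<open>auto intro!: mult_right_mono\<close>)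
  qed
  have ry: "rapidly_decreasing \<xi> (\<lambda>i. y i t)" and rv: "rapidly_decreasing \<xi> (\<lambda>i. v i t)" if "t \<in> {0..T}" for t
    using yA[OF that] vA[OF that] by (auto intro: rd)
  have trm: "norm (z * monomial bs (\<xi> i) * cis r) \<le> A i * (1 + norm (\<xi> i)) ^ length bs"
    if "bs \<in> lists Basis" "norm z \<le> A i" for z bs i r
    using mult_mono[OF that(2) norm_monomial_le[OF that(1)], of "\<xi> i"] A0 by (simp add: norm_mult)
  have yc: "continuous_on {0..T} (y i)" and vc: "continuous_on {0..T} (v i)"
    and dy: "t \<in> {0..T} ==> (y i has_vector_derivative v i t) (at t within {0..T})"
    and dv: "t \<in> {0..T} ==> t \<noteq> t0 ==> (v i has_vector_derivative - (\<alpha> (\<xi> i) t *\<^sub>R y i t)) (at t within {0..T})" for i t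
    using mode[of i] by (auto simp: is_mode_def)
  have sm: "summable (\<lambda>i. a i * monomial bs (\<xi> i) * cis (\<xi> i \<bullet> x))"
    if "bs \<in> lists Basis" "\<And>i. norm (a i) \<le> A i" for a bs x
    by (rule summable_comparison_test'[OF sA[of "length bs"], of 0]) (use trm that in auto)
  show ?thesis
    unfolding classical_solution_def
  proof (intro conjI ballI allI impI)
    fix t assume t: "t \<in> {0..T}"
    show "smooth (wave_sum \<xi> (\<lambda>i. y i t))" "smooth (wave_sum \<xi> (\<lambda>i. v i t))"
      by (intro smooth_wave_sum ry rv t)+
  next
    fix bs :: "(real ^ 'n) list" assume bs: "bs \<in> lists Basis"
    have jc: "continuous_on ({0..T} \<times> UNIV) (\<lambda>p. partials bs (wave_sum \<xi> (\<lambda>i. z i (fst p))) (snd p))"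
      if z: "\<And>i. continuous_on {0..T} (z i)" "\<And>i t. t \<in> {0..T} ==> norm (z i t) \<le> A i" for z
    proof (rule continuous_on_eq)
      show "continuous_on ({0..T} \<times> UNIV) (\<lambda>p. \<Sum>i. z i (fst p) * monomial bs (\<xi> i) * cis (\<xi> i \<bullet> snd p))"
      proof (rule continuous_on_suminf_dominated[OF _ _ sA[of "length bs"]])
        show "continuous_on ({0..T} \<times> UNIV) (\<lambda>p. z i (fst p) * monomial bs (\<xi> i) * cis (\<xi> i \<bullet> snd p))" for i
          by (intro continuous_intros continuous_on_compose2[OF z(1)] continuous_on_compose2[OF continuous_on_cis_inner[of UNIV]]) auto
      qed (use trm[OF bs z(2)] in auto)
      fix p :: "real \<times> (real ^ 'n)" assume "p \<in> {0..T} \<times> UNIV"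
      then have "rapidly_decreasing \<xi> (\<lambda>i. z i (fst p))" by (intro rd z(2)) auto
      then show "(\<Sum>i. z i (fst p) * monomial bs (\<xi> i) * cis (\<xi> i \<bullet> snd p)) = partials bs (wave_sum \<xi> (\<lambda>i. z i (fst p))) (snd p)"
        by (simp add: partials_wave_sum[OF _ bs] wave_sum_def)
    qed
    show "continuous_on ({0..T} \<times> UNIV) (\<lambda>p. partials bs (wave_sum \<xi> (\<lambda>i. y i (fst p))) (snd p))"
      "continuous_on ({0..T} \<times> UNIV) (\<lambda>p. partials bs (wave_sum \<xi> (\<lambda>i. v i (fst p))) (snd p))"
      by (intro jc yc vc yA vA; assumption)+
    fix x t assume t: "t \<in> {0..T}"
    have pe: "partials bs (wave_sum \<xi> a) x = (\<Sum>i. a i * monomial bs (\<xi> i) * cis (\<xi> i \<bullet> x))"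
      if "rapidly_decreasing \<xi> a" for a
      by (simp add: partials_wave_sum[OF that bs] wave_sum_def)
    have "((\<lambda>t. \<Sum>i. y i t * monomial bs (\<xi> i) * cis (\<xi> i \<bullet> x)) has_vector_derivative
        (\<Sum>i. v i t * monomial bs (\<xi> i) * cis (\<xi> i \<bullet> x))) (at t within {0..T})"
    proof (rule has_vector_derivative_suminf_dominated[OF _ _ _ sA[of "length bs"] _ t])
      show "((\<lambda>t. y i t * monomial bs (\<xi> i) * cis (\<xi> i \<bullet> x)) has_vector_derivative
          v i r * monomial bs (\<xi> i) * cis (\<xi> i \<bullet> x)) (at r within {0..T})" if "r \<in> {0..T}" for i r
        using has_vector_derivative_mult_left[OF dy[OF that, of i], of "monomial bs (\<xi> i) * cis (\<xi> i \<bullet> x)"]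
        by (simp only: mult.assoc)
    qed (use trm[OF bs] sm[OF bs] yA vA in auto)
    then show "((\<lambda>t. partials bs (wave_sum \<xi> (\<lambda>i. y i t)) x) has_vector_derivative
        partials bs (wave_sum \<xi> (\<lambda>i. v i t)) x) (at t within {0..T})"
      unfolding pe[OF rv[OF t]]
      by (rule has_vector_derivative_transform[OF t, rotated]) (simp add: pe[OF ry])
    assume tn: "t \<noteq> t0"
    \<comment> \<open>The coefficients may be unbounded at \<open>t0\<close>, so the series of
      second time derivatives is dominated only on a compact neighbourhood of \<open>t\<close> that
      avoids \<open>t0\<close>.\<close>
    define e where "e = \<bar>t - t0\<bar> / 2"
    have e: "e > 0" using tn by (simp add: e_def)
    define S where "S = {0..T} \<inter> {t - e..t + e}"
    have S: "S \<subseteq> {0..T}" "t \<in> S" "convex S" "compact S"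
      using t e by (auto simp: S_def compact_Int_closed intro!: convex_Int)
    have "\<bar>t - t0\<bar> \<le> e" if "t0 \<in> S" using that by (auto simp: S_def abs_le_iff)
    then have t0S: "t0 \<notin> S" using e by (auto simp: e_def)
    have atS: "at t within S = at t within {0..T}"
      unfolding S_def by (rule at_within_nhd[of _ "{t - e<..<t + e}"]) (use e in auto)
    have "continuous_on S b" by (rule continuous_on_subset[OF b_cont]) (use S t0S in auto)
    from compact_imp_bounded[OF compact_continuous_image[OF this S(4)]]
    obtain B where B: "B > 0" "\<And>r. r \<in> S ==> norm (b r) \<le> B" by (auto simp: bounded_pos)
    have "((\<lambda>t. \<Sum>i. v i t * monomial bs (\<xi> i) * cis (\<xi> i \<bullet> x)) has_vector_derivative
        (\<Sum>i. - (\<alpha> (\<xi> i) t *\<^sub>R y i t) * monomial bs (\<xi> i) * cis (\<xi> i \<bullet> x))) (at t within S)"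
    proof (rule has_vector_derivative_suminf_dominated[OF S(3) _ _ summable_mult[OF sA[of "2 + length bs"], of B] _ S(2)])
      fix i r assume r: "r \<in> S"
      then have r': "r \<in> {0..T}" "r \<noteq> t0" using S t0S by auto
      have "(v i has_vector_derivative - (\<alpha> (\<xi> i) r *\<^sub>R y i r)) (at r within S)"
        by (rule has_vector_derivative_within_subset[OF dv[OF r'] S(1)])
      from has_vector_derivative_mult_left[OF this, of "monomial bs (\<xi> i) * cis (\<xi> i \<bullet> x)"]
      show "((\<lambda>t. v i t * monomial bs (\<xi> i) * cis (\<xi> i \<bullet> x)) has_vector_derivative
          - (\<alpha> (\<xi> i) r *\<^sub>R y i r) * monomial bs (\<xi> i) * cis (\<xi> i \<bullet> x)) (at r within S)"
        by (simp only: mult.assoc)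
      have "\<bar>\<alpha> (\<xi> i) r\<bar> \<le> (1 + norm (\<xi> i))\<^sup>2 * B"
        using \<alpha>_le[of "\<xi> i" r] B(2)[OF r]
        by (rule_tac order_trans[OF \<alpha>_le mult_mono]) (auto intro!: power_mono)
      moreover have "norm (y i r * monomial bs (\<xi> i) * cis (\<xi> i \<bullet> x)) \<le> A i * (1 + norm (\<xi> i)) ^ length bs"
        by (rule trm[OF bs yA[OF r'(1)]])
      ultimately have "\<bar>\<alpha> (\<xi> i) r\<bar> * norm (y i r * monomial bs (\<xi> i) * cis (\<xi> i \<bullet> x))
          \<le> (1 + norm (\<xi> i))\<^sup>2 * B * (A i * (1 + norm (\<xi> i)) ^ length bs)"
        using B(1) by (intro mult_mono) auto
      then show "norm (- (\<alpha> (\<xi> i) r *\<^sub>R y i r) * monomial bs (\<xi> i) * cis (\<xi> i \<bullet> x)) \<le> B * (A i * (1 + norm (\<xi> i)) ^ (2 + length bs))"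
        by (simp add: norm_mult power_add power2_eq_square mult_ac)
    next
      fix r assume "r \<in> S"
      then show "summable (\<lambda>i. v i r * monomial bs (\<xi> i) * cis (\<xi> i \<bullet> x))" using S vA by (intro sm[OF bs]) auto
    qed
    moreover have "(\<Sum>i. - (\<alpha> (\<xi> i) t *\<^sub>R y i t) * monomial bs (\<xi> i) * cis (\<xi> i \<bullet> x))
        = partials bs (wave_operator t (wave_sum \<xi> (\<lambda>i. y i t))) x"
    proof -
      have "partials bs (wave_operator t (wave_sum \<xi> (\<lambda>i. y i t))) x = (\<Sum>j\<in>UNIV. \<Sum>k\<in>UNIV. b t $ j $ k *\<^sub>R
          (\<Sum>i. y i t * monomial (bs @ [axis k 1, axis j 1]) (\<xi> i) * cis (\<xi> i \<bullet> x)))"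
        unfolding partials_second_order[OF smooth_wave_sum[OF ry[OF t]] bs]
        by (intro sum.cong refl) (use bs in \<open>simp add: partials_wave_sum[OF ry[OF t]] wave_sum_def\<close>)
      also have "\<dots> = (\<Sum>j\<in>UNIV. \<Sum>k\<in>UNIV. \<Sum>i. b t $ j $ k *\<^sub>R
          (y i t * monomial (bs @ [axis k 1, axis j 1]) (\<xi> i) * cis (\<xi> i \<bullet> x)))"
        by (intro sum.cong refl suminf_scaleR_right sm) (use bs yA t in auto)
      also have "\<dots> = (\<Sum>i. \<Sum>j\<in>UNIV. \<Sum>k\<in>UNIV. b t $ j $ k *\<^sub>R
          (y i t * monomial (bs @ [axis k 1, axis j 1]) (\<xi> i) * cis (\<xi> i \<bullet> x)))"
      proof -
        have G: "summable (\<lambda>i. b t $ j $ k *\<^sub>R (y i t * monomial (bs @ [axis k 1, axis j 1]) (\<xi> i) * cis (\<xi> i \<bullet> x)))" for j k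
          by (intro summable_scaleR_right sm) (use bs yA t in auto)
        show ?thesis
          by (simp only: suminf_sum[OF summable_sum[OF G]] suminf_sum[OF G])
      qed
      also have "\<dots> = (\<Sum>i. - (\<alpha> (\<xi> i) t *\<^sub>R y i t) * monomial bs (\<xi> i) * cis (\<xi> i \<bullet> x))"
      proof (rule suminf_cong)
        fix i
        have m2: "monomial (bs @ [axis k 1, axis j 1]) (\<xi> i) = - of_real (\<xi> i $ j * \<xi> i $ k) * monomial bs (\<xi> i)" for j k
          by (simp add: monomial_append monomial_simps inner_axis mult_ac)
        have \<alpha>e: "\<alpha> (\<xi> i) t = (\<Sum>j\<in>UNIV. \<Sum>k\<in>UNIV. b t $ j $ k * (\<xi> i $ j * \<xi> i $ k))"
          by (simp add: \<alpha>_def inner_vec_def matrix_vector_mult_def sum_distrib_left mult_ac)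
        have "(\<Sum>j\<in>UNIV. \<Sum>k\<in>UNIV. b t $ j $ k *\<^sub>R (y i t * monomial (bs @ [axis k 1, axis j 1]) (\<xi> i) * cis (\<xi> i \<bullet> x)))
            = (\<Sum>j\<in>UNIV. \<Sum>k\<in>UNIV. (b t $ j $ k * (\<xi> i $ j * \<xi> i $ k)) *\<^sub>R (- (y i t * monomial bs (\<xi> i) * cis (\<xi> i \<bullet> x))))"
          unfolding m2 by (intro sum.cong refl) (simp add: scaleR_conv_of_real mult_ac)
        also have "\<dots> = - (\<alpha> (\<xi> i) t *\<^sub>R y i t) * monomial bs (\<xi> i) * cis (\<xi> i \<bullet> x)"
        proof -
          have neg: "- (s *\<^sub>R y i t) * monomial bs (\<xi> i) * cis (\<xi> i \<bullet> x) = s *\<^sub>R (- (y i t * monomial bs (\<xi> i) * cis (\<xi> i \<bullet> x)))" for s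
            by simp
          show ?thesis unfolding neg \<alpha>e by (simp only: scaleR_sum_left)
        qed
        finally show "(\<Sum>j\<in>UNIV. \<Sum>k\<in>UNIV. b t $ j $ k *\<^sub>R (y i t * monomial (bs @ [axis k 1, axis j 1]) (\<xi> i) * cis (\<xi> i \<bullet> x)))
            = - (\<alpha> (\<xi> i) t *\<^sub>R y i t) * monomial bs (\<xi> i) * cis (\<xi> i \<bullet> x)" .
      qed
      finally show ?thesis ..
    qed
    ultimately have D: "((\<lambda>t. \<Sum>i. v i t * monomial bs (\<xi> i) * cis (\<xi> i \<bullet> x)) has_vector_derivative
        partials bs (wave_operator t (wave_sum \<xi> (\<lambda>i. y i t))) x) (at t within {0..T})"
      by (simp only: atS)
    show "((\<lambda>t. partials bs (wave_sum \<xi> (\<lambda>i. v i t)) x) has_vector_derivative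
        partials bs (wave_operator t (wave_sum \<xi> (\<lambda>i. y i t))) x) (at t within {0..T})"
      by (rule has_vector_derivative_transform[OF t _ D]) (rule pe[OF rv])
  qed
qed

text \<open>Both data use the same frequencies, so each frequency carries a single mode, with the
  two expansion coefficients as its initial values.\<close>

lemma ball_solution:
  assumes u0: "smooth u0" and u1: "smooth u1" and R: "R > 0"
  shows "\<exists>u v. classical_solution u v \<and> (\<forall>x. norm x \<le> R --> u 0 x = u0 x \<and> v 0 x = u1 x)"
proof -
  from plane_wave_expansion[OF R]
  obtain \<xi> :: "nat => real ^ 'n" where \<xi>: "\<And>f :: real ^ 'n => complex. smooth f ==>
    \<exists>c. (\<forall>m. summable (\<lambda>i. norm (c i) * (1 + norm (\<xi> i)) ^ m)) \<and>
      (\<forall>x. norm x \<le> R --> (\<lambda>i. c i * cis (\<xi> i \<bullet> x)) sums f x)"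
    by blast
  have ex: "\<exists>c. rapidly_decreasing \<xi> c \<and> (\<forall>x. norm x \<le> R --> wave_sum \<xi> c x = f x)" if f: "smooth f" for f
  proof -
    obtain c where "\<forall>m. summable (\<lambda>i. norm (c i) * (1 + norm (\<xi> i)) ^ m)"
      and s: "\<forall>x. norm x \<le> R --> (\<lambda>i. c i * cis (\<xi> i \<bullet> x)) sums f x"
      using \<xi>[OF f] by blast
    then have "rapidly_decreasing \<xi> c" by (simp add: rapidly_decreasing_def)
    moreover have "wave_sum \<xi> c x = f x" if "norm x \<le> R" for x
      unfolding wave_sum_def by (rule sums_unique[symmetric]) (use s that in auto)
    ultimately show ?thesis by blast
  qed
  obtain c where c: "rapidly_decreasing \<xi> c" "\<forall>x. norm x \<le> R --> wave_sum \<xi> c x = u0 x" using ex[OF u0] by blast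
  obtain d where d: "rapidly_decreasing \<xi> d" "\<forall>x. norm x \<le> R --> wave_sum \<xi> d x = u1 x" using ex[OF u1] by blast
  have "\<exists>z. is_mode (\<xi> i) (fst z) (snd z) \<and> fst z 0 = c i \<and> snd z 0 = d i" for i
  proof (rule mode_exists[of "\<xi> i" "c i" "d i"])
    fix y v assume "is_mode (\<xi> i) y v" "y 0 = c i" "v 0 = d i"
    then show ?thesis by (intro exI[of _ "(y, v)"]) simp
  qed
  then have "\<exists>z. \<forall>i. is_mode (\<xi> i) (fst (z i)) (snd (z i)) \<and> fst (z i) 0 = c i \<and> snd (z i) 0 = d i"
    by (intro choice allI)
  then obtain z where z: "\<And>i. is_mode (\<xi> i) (fst (z i)) (snd (z i))" "\<And>i. fst (z i) 0 = c i" "\<And>i. snd (z i) 0 = d i"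
    by blast
  show ?thesis
    using mode_superposition[OF c(1) d(1) z] c(2) d(2)
    by (intro exI[of _ "\<lambda>t. wave_sum \<xi> (\<lambda>i. fst (z i) t)"] exI[of _ "\<lambda>t. wave_sum \<xi> (\<lambda>i. snd (z i) t)"])
      (simp add: z)
qed

subsection \<open>Global classical solutions\<close>

text \<open>\<open>front T\<close> is the largest value of \<open>front\<close>, so the ball of
  radius \<open>R - front T\<close> lies in every section of the cone. Equality of \<open>v\<close>
  comes from uniqueness of the time derivative on the closed interval, end points included.\<close>

lemma local_agreement:
  assumes cs: "classical_solution u v" and cs': "classical_solution u' v'" and R: "R > 0"
    and data: "\<And>x. norm x < R ==> u 0 x = u' 0 x \<and> v 0 x = v' 0 x"
    and t: "t \<in> {0..T}" and x: "norm x < R - front T"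
  shows "u t x = u' t x \<and> v t x = v' t x"
proof -
  note cd = classical_solution_diff[OF cs cs']
  have eq: "u s x - u' s x = 0" if s: "s \<in> {0..T}" for s
    using local_uniqueness[OF cd R _ s, of x] data front_mono[of s T] s x by simp
  have "((\<lambda>s. u s x - u' s x) has_vector_derivative v t x - v' t x) (at t within {0..T})"
    using classical_derivative(1)[OF cd _ t, of "[]" x] by (simp add: partials_Nil)
  moreover have "((\<lambda>s. u s x - u' s x) has_vector_derivative 0) (at t within {0..T})"
    by (rule has_vector_derivative_transform[OF t _ has_vector_derivative_const[of 0]]) (simp add: eq)
  ultimately have "v t x - v' t x = 0"
    using vector_derivative_unique_within_closed_interval[of 0 T t] T t by fastforce
  then show ?thesis using eq[OF t] by simp
qed

text \<open>Every clause of \<open>classical_solution\<close> is local in \<open>x\<close> and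
  concerns all times at once, so agreement with some solution on each ball suffices.\<close>

lemma classical_solution_local:
  assumes loc: "\<And>r. r > 0 ==> \<exists>u' v'. classical_solution u' v' \<and>
    (\<forall>t\<in>{0..T}. \<forall>x. norm x < r --> u t x = u' t x \<and> v t x = v' t x)"
  shows "classical_solution u v"
proof -
  have loc': "\<exists>r u' v'. norm x < r \<and> classical_solution u' v' \<and>
    (\<forall>t\<in>{0..T}. \<forall>y. norm y < r --> (\<forall>bs. partials bs (u t) y = partials bs (u' t) y \<and> partials bs (v t) y = partials bs (v' t) y))" for x :: "real ^ 'n"
  proof -
    have r: "norm x + 1 > 0" by (simp add: add_nonneg_pos)
    obtain u' v' where c: "classical_solution u' v'"
      and e: "\<And>t y. t \<in> {0..T} ==> norm y < norm x + 1 ==> u t y = u' t y \<and> v t y = v' t y"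
      using loc[OF r] by blast
    have "partials bs (u t) y = partials bs (u' t) y \<and> partials bs (v t) y = partials bs (v' t) y"
      if "t \<in> {0..T}" "norm y < norm x + 1" for t y bs
      using partials_cong_open[of "ball 0 (norm x + 1)" "u t" "u' t" y bs]
        partials_cong_open[of "ball 0 (norm x + 1)" "v t" "v' t" y bs] e that by simp
    then show ?thesis using c by (intro exI[of _ "norm x + 1"] exI[of _ u'] exI[of _ v']) auto
  qed
  have diff: "partials bs (u t) differentiable (at x)" "partials bs (v t) differentiable (at x)"
    if bs: "bs \<in> lists Basis" and t: "t \<in> {0..T}" for bs t x
  proof -
    obtain r u' v' where r: "norm x < r" and c: "classical_solution u' v'"
      and e: "\<And>y bs. norm y < r ==> partials bs (u t) y = partials bs (u' t) y \<and> partials bs (v t) y = partials bs (v' t) y"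
      using loc'[of x] t by blast
    have d: "partials bs (u' t) differentiable (at x)" "partials bs (v' t) differentiable (at x)"
      using classical_smooth[OF c t] bs by (auto simp: smooth_altdef)
    have "g differentiable (at x)" if fd: "f differentiable (at x)" and fg: "\<And>y. norm y < r ==> f y = g y" for f g :: "real ^ 'n => complex"
    proof -
      obtain D where "(f has_derivative D) (at x)" using fd unfolding differentiable_def by blast
      then have "(g has_derivative D) (at x)"
        by (rule has_derivative_transform_within_open[of _ _ _ _ "ball 0 r"]) (use r fg in auto)
      then show ?thesis unfolding differentiable_def by blast
    qed
    then show "partials bs (u t) differentiable (at x)" "partials bs (v t) differentiable (at x)"
      using d e by metis+
  qed
  show ?thesis
    unfolding classical_solution_def
  proof (intro conjI ballI allI impI)
    fix t assume "t \<in> {0..T}"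
    then show "smooth (u t)" "smooth (v t)" using diff unfolding smooth_altdef by blast+
  next
    fix bs :: "(real ^ 'n) list" assume bs: "bs \<in> lists Basis"
    have cont: "continuous_on ({0..T} \<times> UNIV) (\<lambda>p. partials bs (w (fst p)) (snd p))"
      if w: "\<And>x :: real ^ 'n. \<exists>r w'. norm x < r \<and> continuous_on ({0..T} \<times> UNIV) (\<lambda>p. partials bs (w' (fst p)) (snd p)) \<and>
        (\<forall>t\<in>{0..T}. \<forall>y. norm y < r --> partials bs (w t) y = partials bs (w' t) y)" for w :: "real => real ^ 'n => complex"
      unfolding continuous_on_def
    proof
      fix p :: "real \<times> (real ^ 'n)" assume p: "p \<in> {0..T} \<times> UNIV"
      let ?F = "at p within ({0..T} \<times> UNIV)"
      obtain r w' where r: "norm (snd p) < r" and w': "continuous_on ({0..T} \<times> UNIV) (\<lambda>p. partials bs (w' (fst p)) (snd p))"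
        and e: "\<And>t y. t \<in> {0..T} ==> norm y < r ==> partials bs (w t) y = partials bs (w' t) y"
        using w[of "snd p"] by blast
      have "((\<lambda>q. partials bs (w' (fst q)) (snd q)) \<longlongrightarrow> partials bs (w' (fst p)) (snd p)) ?F"
        using w' p unfolding continuous_on_def by blast
      moreover have "\<forall>\<^sub>F q in ?F. partials bs (w' (fst q)) (snd q) = partials bs (w (fst q)) (snd q)"
      proof -
        have "\<forall>\<^sub>F q in ?F. q \<in> UNIV \<times> ball 0 r"
          by (rule topological_tendstoD[OF tendsto_ident_at]) (use r in \<open>auto intro!: open_Times simp: mem_Times_iff\<close>)
        moreover have "\<forall>\<^sub>F q in ?F. q \<in> {0..T} \<times> UNIV" by (auto simp: eventually_at_filter)
        ultimately show ?thesis by eventually_elim (auto simp: e)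
      qed
      moreover have "partials bs (w' (fst p)) (snd p) = partials bs (w (fst p)) (snd p)" using e p r by auto
      ultimately show "((\<lambda>q. partials bs (w (fst q)) (snd q)) \<longlongrightarrow> partials bs (w (fst p)) (snd p)) ?F"
        by (simp only: Lim_transform_eventually)
    qed
    show "continuous_on ({0..T} \<times> UNIV) (\<lambda>p. partials bs (u (fst p)) (snd p))"
      by (rule cont) (use loc' classical_continuous(1)[OF _ bs order_refl] in blast)
    show "continuous_on ({0..T} \<times> UNIV) (\<lambda>p. partials bs (v (fst p)) (snd p))"
      by (rule cont) (use loc' classical_continuous(2)[OF _ bs order_refl] in blast)
    fix x :: "real ^ 'n" and t assume t: "t \<in> {0..T}"
    obtain r u' v' where r: "norm x < r" and c: "classical_solution u' v'"
      and e: "\<And>t y bs. t \<in> {0..T} ==> norm y < r ==> partials bs (u t) y = partials bs (u' t) y"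
        "\<And>t y bs. t \<in> {0..T} ==> norm y < r ==> partials bs (v t) y = partials bs (v' t) y"
      using loc'[of x] by blast
    show "((\<lambda>t. partials bs (u t) x) has_vector_derivative partials bs (v t) x) (at t within {0..T})"
      unfolding e(2)[OF t r]
      by (rule has_vector_derivative_transform[OF t _ classical_derivative(1)[OF c bs t]]) (simp add: e(1) r)
    assume tn: "t \<noteq> t0"
    have "wave_operator t (u t) y = wave_operator t (u' t) y" if "norm y < r" for y
      using e(1)[OF t that, of "[axis j 1, axis i 1]" for i j]
      by (simp add: second_order_def partials_Cons partials_Nil)
    then have w: "partials bs (wave_operator t (u t)) x = partials bs (wave_operator t (u' t)) x"
      using partials_cong_open[of "ball 0 r" "wave_operator t (u t)" "wave_operator t (u' t)" x bs] r by simp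
    show "((\<lambda>t. partials bs (v t) x) has_vector_derivative partials bs (wave_operator t (u t)) x) (at t within {0..T})"
      unfolding w
      by (rule has_vector_derivative_transform[OF t _ classical_derivative(2)[OF c bs t tn]]) (simp add: e(2) r)
  qed
qed

text \<open>The solution of index \<open>k\<close> has the right data on the ball of radius
  \<open>k + 1\<close>, and solutions of larger index agree with it wherever only these data matter.
  The value at \<open>x\<close> is taken from an index beyond which it no longer changes.\<close>

lemma classical_solution_exists:
  assumes u0: "smooth u0" and u1: "smooth u1"
  shows "\<exists>u v. classical_solution u v \<and> (\<forall>x. u 0 x = u0 x \<and> v 0 x = u1 x)"
proof -
  have "\<exists>z. classical_solution (fst z) (snd z) \<and> (\<forall>x. norm x \<le> real k + 1 --> fst z 0 x = u0 x \<and> snd z 0 x = u1 x)" for k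
  proof -
    have "real k + 1 > 0" by simp
    from ball_solution[OF u0 u1 this] obtain u v where
      "classical_solution u v \<and> (\<forall>x. norm x \<le> real k + 1 --> u 0 x = u0 x \<and> v 0 x = u1 x)" by blast
    then show ?thesis by (intro exI[of _ "(u, v)"]) simp
  qed
  then have "\<exists>z. \<forall>k. classical_solution (fst (z k)) (snd (z k)) \<and>
      (\<forall>x. norm x \<le> real k + 1 --> fst (z k) 0 x = u0 x \<and> snd (z k) 0 x = u1 x)"
    by (intro choice allI)
  then obtain z where z: "\<And>k. classical_solution (fst (z k)) (snd (z k))"
    and z0: "\<And>k x. norm x \<le> real k + 1 ==> fst (z k) 0 x = u0 x \<and> snd (z k) 0 x = u1 x" by blast
  have L: "0 \<le> front T" using front_mono[of 0 T] front_0 T by simp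
  have agree: "fst (z k) t x = fst (z m) t x \<and> snd (z k) t x = snd (z m) t x"
    if "k \<le> m" "t \<in> {0..T}" "norm x < real k + 1 - front T" for k m t x
    by (rule local_agreement[OF z z _ _ that(2,3)]) (use z0 that(1) in auto)
  \<comment> \<open>Chosen so that \<open>r < \<kappa> r + 1 - front T\<close>: the ball of radius
    \<open>r\<close> depends only on data that the solution of this index already has right.\<close>
  define \<kappa> where "\<kappa> r = nat \<lceil>r + front T\<rceil>" for r
  have \<kappa>: "r < real (\<kappa> r) + 1 - front T" for r unfolding \<kappa>_def by linarith
  have \<kappa>_mono: "\<kappa> r \<le> \<kappa> s" if "r \<le> s" for r s unfolding \<kappa>_def using that by (intro nat_mono ceiling_mono) simp
  define u where "u t x = fst (z (\<kappa> (norm x))) t x" for t x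
  define v where "v t x = snd (z (\<kappa> (norm x))) t x" for t x
  have "classical_solution u v"
  proof (rule classical_solution_local)
    fix r :: real assume "r > 0"
    have "u t x = fst (z (\<kappa> r)) t x \<and> v t x = snd (z (\<kappa> r)) t x" if "t \<in> {0..T}" "norm x < r" for t x
      unfolding u_def v_def by (rule agree[OF \<kappa>_mono]) (use that \<kappa>[of "norm x"] in auto)
    then show "\<exists>u' v'. classical_solution u' v' \<and>
      (\<forall>t\<in>{0..T}. \<forall>x. norm x < r --> u t x = u' t x \<and> v t x = v' t x)"
      using z by blast
  qed
  moreover have "u 0 x = u0 x \<and> v 0 x = u1 x" for x
    unfolding u_def v_def by (rule z0) (use \<kappa>[of "norm x"] L in linarith)
  ultimately show ?thesis by blast
qed

lemma classical_solution_unique: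
  assumes cs: "classical_solution u v" and cs': "classical_solution u' v'"
    and data: "\<And>x. u 0 x = u' 0 x \<and> v 0 x = v' 0 x" and t: "t \<in> {0..T}"
  shows "u t x = u' t x"
proof -
  have "0 \<le> front T" using front_mono[of 0 T] front_0 T by simp
  then have "norm x + 1 + front T > 0" using norm_ge_zero[of x] by linarith
  from local_agreement[OF cs cs' this data t] show ?thesis by simp
qed

end

subsection \<open>Sobolev regularity in time\<close>

lemma Ck_norm_le:
  assumes "\<And>bs x. bs \<in> multi_indices k ==> x \<in> K ==> norm (partials bs f x) \<le> e"
  shows "Ck_norm k K f \<le> ennreal e"
  unfolding Ck_norm_def using assms by (intro SUP_least ennreal_leI)

lemma norm_partials_le_Ck_norm:
  assumes "bs \<in> multi_indices k" "x \<in> K"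
  shows "ennreal (norm (partials bs f x)) \<le> Ck_norm k K f"
  unfolding Ck_norm_def by (rule SUP_upper2[OF assms(1) SUP_upper[OF assms(2)]])

lemma multi_indices_lists: "bs \<in> multi_indices k ==> bs \<in> lists Basis"
  by (simp add: multi_indices_def)

lemma finite_multi_indices: "finite (multi_indices k :: 'a::euclidean_space list set)"
proof -
  have "multi_indices k = {bs :: 'a list. set bs \<subseteq> Basis \<and> length bs \<le> k}"
    by (auto simp: multi_indices_def)
  then show ?thesis using finite_lists_length_le[OF finite_Basis, of k] by simp
qed

lemma smooth_Ck: "smooth f ==> Ck k f"
  by (simp add: smooth_def)

text \<open>There are finitely many multi-indices of bounded order; the filter at 0 from the right
  merges their moduli of continuity into one.\<close>

lemma partials_uniform_modulus:
  fixes F :: "real => 'a::euclidean_space => 'b::real_normed_vector"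
  assumes cont: "\<And>bs. bs \<in> lists Basis ==> continuous_on ({a..d} \<times> UNIV) (\<lambda>p. partials bs (F (fst p)) (snd p))"
    and K: "compact K" and e: "e > 0"
  obtains \<delta> where "\<delta> > 0" "\<And>s t bs x. s \<in> {a..d} ==> t \<in> {a..d} ==> \<bar>s - t\<bar> < \<delta> ==> bs \<in> multi_indices k ==> x \<in> K ==>
    norm (partials bs (F s) x - partials bs (F t) x) < e"
proof -
  let ?P = "\<lambda>bs \<delta>. \<forall>s\<in>{a..d}. \<forall>t\<in>{a..d}. \<bar>s - t\<bar> < \<delta> --> (\<forall>x\<in>K. norm (partials bs (F s) x - partials bs (F t) x) < e)"
  have "\<forall>bs\<in>multi_indices k. \<forall>\<^sub>F \<delta> in at_right 0. ?P bs \<delta>"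
  proof
    fix bs :: "'a list" assume bs: "bs \<in> multi_indices k"
    have c: "continuous_on ({a..d} \<times> K) (\<lambda>p. partials bs (F (fst p)) (snd p))"
      by (rule continuous_on_subset[OF cont[OF multi_indices_lists[OF bs]]]) auto
    have "uniformly_continuous_on ({a..d} \<times> K) (\<lambda>p. partials bs (F (fst p)) (snd p))"
      by (rule compact_uniformly_continuous[OF c]) (intro compact_Times compact_Icc K)
    then obtain \<delta> where \<delta>: "\<delta> > 0" "\<forall>p\<in>{a..d} \<times> K. \<forall>q\<in>{a..d} \<times> K. dist q p < \<delta> -->
        dist (partials bs (F (fst q)) (snd q)) (partials bs (F (fst p)) (snd p)) < e"
      using e unfolding uniformly_continuous_on_def by blast
    have P: "?P bs \<eta>" if \<eta>: "\<eta> < \<delta>" for \<eta>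
    proof (intro ballI impI)
      fix s t x assume st: "s \<in> {a..d}" "t \<in> {a..d}" "\<bar>s - t\<bar> < \<eta>" "x \<in> K"
      have "dist (s, x) (t, x) < \<delta>" using st \<eta> by (simp add: dist_Pair_Pair dist_real_def)
      then show "norm (partials bs (F s) x - partials bs (F t) x) < e"
        using \<delta>(2)[rule_format, of "(t, x)" "(s, x)"] st by (simp add: dist_norm)
    qed
    show "\<forall>\<^sub>F \<delta> in at_right 0. ?P bs \<delta>"
      using eventually_at_right_real[OF \<delta>(1)] by (rule eventually_mono) (use P in auto)
  qed
  then have "\<forall>\<^sub>F \<delta> in at_right 0. \<forall>bs\<in>multi_indices k. ?P bs \<delta>"
    by (rule eventually_ball_finite[OF finite_multi_indices])
  then have "\<forall>\<^sub>F \<delta> in at_right 0. 0 < \<delta> \<and> (\<forall>bs\<in>multi_indices k. ?P bs \<delta>)"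
    using eventually_at_right_less[of 0] by eventually_elim blast
  then obtain \<delta> where "0 < \<delta>" "\<forall>bs\<in>multi_indices k. ?P bs \<delta>"
    using eventually_happens'[OF trivial_limit_at_right_real] by blast
  then show thesis by (intro that[of \<delta>]) auto
qed

lemma partials_uniform_bound:
  fixes F :: "real => 'a::euclidean_space => 'b::real_normed_vector"
  assumes cont: "\<And>bs. bs \<in> lists Basis ==> continuous_on ({a..d} \<times> UNIV) (\<lambda>p. partials bs (F (fst p)) (snd p))"
    and K: "compact K"
  obtains B where "B \<ge> 0" "\<And>t bs x. t \<in> {a..d} ==> bs \<in> multi_indices k ==> x \<in> K ==> norm (partials bs (F t) x) \<le> B"
proof -
  let ?P = "\<lambda>bs B. \<forall>t\<in>{a..d}. \<forall>x\<in>K. norm (partials bs (F t) x) \<le> B"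
  have "\<forall>bs\<in>multi_indices k. \<forall>\<^sub>F B in at_top. ?P bs B"
  proof
    fix bs :: "'a list" assume bs: "bs \<in> multi_indices k"
    have c: "continuous_on ({a..d} \<times> K) (\<lambda>p. partials bs (F (fst p)) (snd p))"
      by (rule continuous_on_subset[OF cont[OF multi_indices_lists[OF bs]]]) auto
    from compact_imp_bounded[OF compact_continuous_image[OF c compact_Times[OF compact_Icc K]]]
    obtain B where B: "\<forall>y\<in>(\<lambda>p. partials bs (F (fst p)) (snd p)) ` ({a..d} \<times> K). norm y \<le> B"
      unfolding bounded_iff by blast
    have "norm (partials bs (F t) x) \<le> B" if "t \<in> {a..d}" "x \<in> K" for t x
      using bspec[OF B imageI[of "(t, x)"]] that by simp
    then have "?P bs B'" if "B \<le> B'" for B'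
      using order_trans[OF _ that] by blast
    then show "\<forall>\<^sub>F B in at_top. ?P bs B" unfolding eventually_at_top_linorder by blast
  qed
  then have "\<forall>\<^sub>F B in at_top. \<forall>bs\<in>multi_indices k. ?P bs B"
    by (rule eventually_ball_finite[OF finite_multi_indices])
  then have "\<forall>\<^sub>F B in at_top. 0 \<le> B \<and> (\<forall>bs\<in>multi_indices k. ?P bs B)"
    using eventually_ge_at_top[of 0] by eventually_elim blast
  then obtain B where "0 \<le> B" "\<forall>bs\<in>multi_indices k. ?P bs B"
    using eventually_happens'[OF trivial_limit_at_top_linorder] by blast
  then show thesis by (intro that[of B]) auto
qed

lemma continuous_on_Ck_jointly_continuous:
  fixes F :: "real => 'a::euclidean_space => 'b::real_normed_vector"
  assumes sm: "\<And>t. t \<in> {a..d} ==> smooth (F t)"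
    and cont: "\<And>bs. bs \<in> lists Basis ==> continuous_on ({a..d} \<times> UNIV) (\<lambda>p. partials bs (F (fst p)) (snd p))"
    and K: "compact K"
  shows "continuous_on_Ck k K {a..d} F"
  unfolding continuous_on_Ck_def
proof (intro ballI tendsto_zero_ennreal)
  fix t and r :: real assume t: "t \<in> {a..d}" and r: "0 < r"
  obtain \<delta> where \<delta>: "\<delta> > 0" "\<And>s t bs x. s \<in> {a..d} ==> t \<in> {a..d} ==> \<bar>s - t\<bar> < \<delta> ==> bs \<in> multi_indices k ==> x \<in> K ==>
    norm (partials bs (F s) x - partials bs (F t) x) < r / 2"
    using partials_uniform_modulus[OF cont K half_gt_zero[OF r], of k thesis] by blast
  have "Ck_norm k K (\<lambda>x. F s x - F t x) < ennreal r" if "s \<in> {a..d}" "\<bar>s - t\<bar> < \<delta>" for s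
  proof -
    have "Ck_norm k K (\<lambda>x. F s x - F t x) \<le> ennreal (r / 2)"
      using \<delta>(2)[OF that(1) t that(2)] that(1) t
      by (intro Ck_norm_le) (simp add: partials_diff sm multi_indices_lists less_imp_le)
    also have "\<dots> < ennreal r" using r by (simp add: ennreal_less_iff)
    finally show ?thesis .
  qed
  then show "\<forall>\<^sub>F s in at t within {a..d}. Ck_norm k K (\<lambda>x. F s x - F t x) < ennreal r"
    unfolding eventually_at using \<delta>(1) by (intro exI[of _ \<delta>]) (auto simp: dist_real_def)
qed

text \<open>Convergence in the \<open>Ck\<close> norm over a closed ball around \<open>x\<close> is
  uniform in the space variable near \<open>x\<close>. Together with continuity of the partials at
  the fixed time \<open>t\<close> this gives joint continuity.\<close>

lemma jointly_continuous_of_Ck: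
  fixes F :: "real => 'a::euclidean_space => 'b::real_normed_vector"
  assumes sm: "\<And>t. t \<in> {a..d} ==> smooth (F t)"
    and ck: "\<And>k K. compact K ==> continuous_on_Ck k K {a..d} F" and bs: "bs \<in> lists Basis"
  shows "continuous_on ({a..d} \<times> UNIV) (\<lambda>p. partials bs (F (fst p)) (snd p))"
  unfolding continuous_on_iff
proof (intro ballI allI impI)
  fix p :: "real \<times> 'a" and e :: real assume p: "p \<in> {a..d} \<times> UNIV" and e: "e > 0"
  obtain t x where tx: "p = (t, x)" by (cases p)
  have t: "t \<in> {a..d}" using p tx by simp
  let ?k = "length bs"
  have "((\<lambda>s. Ck_norm ?k (cball x 1) (\<lambda>y. F s y - F t y)) \<longlongrightarrow> 0) (at t within {a..d})"
    using ck[OF compact_cball] t unfolding continuous_on_Ck_def by blast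
  then have "\<forall>\<^sub>F s in at t within {a..d}. Ck_norm ?k (cball x 1) (\<lambda>y. F s y - F t y) < ennreal (e / 2)"
    by (rule order_tendstoD) (use e in simp)
  then obtain d1 where d1: "d1 > 0" "\<And>s. s \<in> {a..d} ==> s \<noteq> t ==> dist s t < d1 ==>
      Ck_norm ?k (cball x 1) (\<lambda>y. F s y - F t y) < ennreal (e / 2)"
    unfolding eventually_at by blast
  have "isCont (partials bs (F t)) x"
    using sm[OF t] bs unfolding smooth_altdef by (blast intro: differentiable_imp_continuous_within)
  then obtain d2 where d2: "d2 > 0" "\<And>y. dist y x < d2 ==> dist (partials bs (F t) y) (partials bs (F t) x) < e / 2"
    unfolding continuous_at_eps_delta using half_gt_zero[OF e] by blast
  have "dist (partials bs (F s) y) (partials bs (F t) x) < e"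
    if s: "s \<in> {a..d}" and dst: "dist s t < d1" and dy: "dist y x < d2" "dist y x < 1" for s y
  proof -
    have "norm (partials bs (F s) y - partials bs (F t) y) < e / 2"
    proof (cases "s = t")
      case True
      then show ?thesis using e by simp
    next
      case False
      have "ennreal (norm (partials bs (\<lambda>y. F s y - F t y) y)) \<le> Ck_norm ?k (cball x 1) (\<lambda>y. F s y - F t y)"
        by (rule norm_partials_le_Ck_norm) (use bs dy in \<open>auto simp: multi_indices_def dist_commute\<close>)
      also have "\<dots> < ennreal (e / 2)" by (rule d1(2)[OF s False dst])
      finally show ?thesis by (simp add: ennreal_less_iff partials_diff[OF sm[OF s] sm[OF t] bs])
    qed
    then have "dist (partials bs (F s) y) (partials bs (F t) y) < e / 2" by (simp add: dist_norm)
    then show ?thesis using d2(2)[OF dy(1)] dist_triangle_half_l[of "partials bs (F s) y" "partials bs (F t) y" e "partials bs (F t) x"]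
      by (simp add: dist_commute)
  qed
  moreover have "dist s t \<le> dist (s, y) (t, x)" "dist y x \<le> dist (s, y) (t, x)" for s y
    using dist_fst_le[of "(s, y)" "(t, x)"] dist_snd_le[of "(s, y)" "(t, x)"] by simp_all
  ultimately have "dist (partials bs (F s) y) (partials bs (F t) x) < e"
    if "s \<in> {a..d}" "dist (s, y) (t, x) < min d1 (min d2 1)" for s y
    using that by (meson le_less_trans min_less_iff_conj)
  then show "\<exists>\<delta>>0. \<forall>q\<in>{a..d} \<times> UNIV. dist q p < \<delta> -->
      dist (partials bs (F (fst q)) (snd q)) (partials bs (F (fst p)) (snd p)) < e"
    using d1(1) d2(1) unfolding tx by (intro exI[of _ "min d1 (min d2 1)"]) auto
qed

text \<open>Sampling times for the simple functions that approximate a function of time with values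
  in \<open>Ck\<close>. Rounding down keeps them in \<open>{0..T}\<close>, where smoothness is
  known.\<close>

definition time_grid :: "nat => real => real" where
  "time_grid i t = of_int \<lfloor>t * real (Suc i)\<rfloor> / real (Suc i)"

lemma time_grid_bounds:
  assumes "0 \<le> t"
  shows "0 \<le> time_grid i t" "time_grid i t \<le> t" "\<bar>time_grid i t - t\<bar> \<le> 1 / real (Suc i)"
proof -
  let ?m = "real (Suc i)"
  have fl: "of_int \<lfloor>t * ?m\<rfloor> \<le> t * ?m" "t * ?m \<le> of_int \<lfloor>t * ?m\<rfloor> + 1" by linarith+
  show "0 \<le> time_grid i t" using assms by (simp add: time_grid_def)
  show le: "time_grid i t \<le> t" using fl(1) by (simp add: time_grid_def pos_divide_le_eq)
  have "t \<le> time_grid i t + 1 / ?m"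
    using fl(2) by (simp add: time_grid_def add_divide_distrib[symmetric] pos_le_divide_eq)
  then show "\<bar>time_grid i t - t\<bar> \<le> 1 / ?m" using le by simp
qed

lemma simple_function_time_grid: "simple_function (lebesgue_on {0<..<T}) (time_grid i)"
proof (rule simple_function_borel_measurable)
  have "time_grid i \<in> borel_measurable borel" unfolding time_grid_def[abs_def] by measurable
  then have "time_grid i \<in> borel_measurable lebesgue" by (simp add: measurable_completion)
  then show "time_grid i \<in> borel_measurable (lebesgue_on {0<..<T})" by (rule measurable_restrict_space1)
  have "time_grid i ` {0<..<T} \<subseteq> (\<lambda>k. of_int k / real (Suc i)) ` {0..\<lfloor>T * real (Suc i)\<rfloor>}"
  proof (intro image_subsetI)
    fix t assume t: "t \<in> {0<..<T}"
    have "\<lfloor>t * real (Suc i)\<rfloor> \<in> {0..\<lfloor>T * real (Suc i)\<rfloor>}"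
      using t by (auto intro!: floor_mono mult_right_mono)
    then show "time_grid i t \<in> (\<lambda>k. of_int k / real (Suc i)) ` {0..\<lfloor>T * real (Suc i)\<rfloor>}"
      unfolding time_grid_def by blast
  qed
  then show "finite (time_grid i ` space (lebesgue_on {0<..<T}))"
    by (simp add: finite_subset)
qed

lemma eventually_time_grid_close:
  assumes "\<delta> > 0" "0 \<le> t"
  shows "\<forall>\<^sub>F i in sequentially. \<bar>time_grid i t - t\<bar> < \<delta>"
proof -
  have "\<forall>\<^sub>F i in sequentially. 1 / real (Suc i) < \<delta>"
    using order_tendstoD(2)[OF LIMSEQ_inverse_real_of_nat assms(1)] by (simp add: inverse_eq_divide)
  then show ?thesis by (rule eventually_mono) (rule le_less_trans[OF time_grid_bounds(3)[OF assms(2)]])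
qed

lemma in_L1_Ck_jointly_continuous:
  fixes F :: "real => 'a::euclidean_space => 'b::real_normed_vector"
  assumes sm: "\<And>t. t \<in> {0..T} ==> smooth (F t)"
    and cont: "\<And>bs. bs \<in> lists Basis ==> continuous_on ({0..T} \<times> UNIV) (\<lambda>p. partials bs (F (fst p)) (snd p))"
    and K: "compact K"
  shows "in_L1_Ck k K {0<..<T} F"
  unfolding in_L1_Ck_def
proof (intro conjI ballI)
  show "Ck k (F t)" if "t \<in> {0<..<T}" for t using that by (intro smooth_Ck sm) auto
  have grid: "time_grid i t \<in> {0..T}" if "t \<in> {0<..<T}" for i t
    using time_grid_bounds[of t i] that by auto
  have lim: "(\<lambda>i. Ck_norm k K (\<lambda>x. F (time_grid i t) x - F t x)) \<longlonglongrightarrow> 0" if t: "t \<in> {0<..<T}" for t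
  proof (rule tendsto_zero_ennreal)
    fix r :: real assume r: "0 < r"
    obtain \<delta> where \<delta>: "\<delta> > 0" "\<And>s t bs x. s \<in> {0..T} ==> t \<in> {0..T} ==> \<bar>s - t\<bar> < \<delta> ==> bs \<in> multi_indices k ==> x \<in> K ==>
      norm (partials bs (F s) x - partials bs (F t) x) < r / 2"
      using partials_uniform_modulus[OF cont K half_gt_zero[OF r], of k thesis] by blast
    have t': "t \<in> {0..T}" "0 \<le> t" using t by auto
    show "\<forall>\<^sub>F i in sequentially. Ck_norm k K (\<lambda>x. F (time_grid i t) x - F t x) < ennreal r"
      using eventually_time_grid_close[OF \<delta>(1) t'(2)]
    proof (rule eventually_mono)
      fix i assume i: "\<bar>time_grid i t - t\<bar> < \<delta>"
      have "Ck_norm k K (\<lambda>x. F (time_grid i t) x - F t x) \<le> ennreal (r / 2)"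
        using \<delta>(2)[OF grid[OF t] t'(1) i] grid[OF t] t'(1)
        by (intro Ck_norm_le) (simp add: partials_diff sm multi_indices_lists less_imp_le)
      also have "\<dots> < ennreal r" using r by (simp add: ennreal_less_iff)
      finally show "Ck_norm k K (\<lambda>x. F (time_grid i t) x - F t x) < ennreal r" .
    qed
  qed
  show "strongly_measurable_Ck k K {0<..<T} F"
    unfolding strongly_measurable_Ck_def
  proof (intro exI[of _ "\<lambda>i t. F (time_grid i t)"] conjI allI ballI)
    show "simple_function (lebesgue_on {0<..<T}) (\<lambda>t. F (time_grid i t))" for i
      by (rule simple_function_compose1[OF simple_function_time_grid])
    show "Ck k (F (time_grid i t))" if "t \<in> {0<..<T}" for i t
      by (intro smooth_Ck sm grid that)
    show "AE t in lebesgue_on {0<..<T}. (\<lambda>i. Ck_norm k K (\<lambda>x. F (time_grid i t) x - F t x)) \<longlonglongrightarrow> 0"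
      by (rule AE_I2) (simp add: lim)
  qed
  obtain B where B: "B \<ge> 0" "\<And>t bs x. t \<in> {0..T} ==> bs \<in> multi_indices k ==> x \<in> K ==> norm (partials bs (F t) x) \<le> B"
    using partials_uniform_bound[OF cont K, of k thesis] by blast
  have "(\<integral>\<^sup>+ t. Ck_norm k K (F t) \<partial>lebesgue_on {0<..<T}) \<le> (\<integral>\<^sup>+ t. ennreal B \<partial>lebesgue_on {0<..<T})"
    by (intro nn_integral_mono Ck_norm_le B(2)) auto
  also have "\<dots> < \<infinity>"
    using emeasure_lborel_box_finite[of 0 T] by (simp add: emeasure_restrict_space ennreal_mult_less_top)
  finally show "(\<integral>\<^sup>+ t. Ck_norm k K (F t) \<partial>lebesgue_on {0<..<T}) < \<infinity>" .
qed

lemma norm_matrix_component_le: "\<bar>M $ i $ j\<bar> \<le> norm M" for M :: "real ^ 'n ^ 'm"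
  using component_le_norm_cart[of "M $ i" j] Finite_Cartesian_Product.norm_nth_le[of M i] by linarith

lemma partials_second_order_le:
  fixes f :: "real ^ 'n => complex"
  assumes f: "smooth f" and bs: "bs \<in> multi_indices k"
    and B: "\<And>cs. cs \<in> multi_indices (k + 2) ==> norm (partials cs f x) \<le> B"
  shows "norm (partials bs (second_order M f) x) \<le> (real CARD('n))\<^sup>2 * (norm M * B)"
proof -
  have "norm (partials bs (second_order M f) x) \<le> (\<Sum>i\<in>(UNIV :: 'n set). \<Sum>j\<in>(UNIV :: 'n set). norm M * B)"
    unfolding partials_second_order[OF f multi_indices_lists[OF bs]]
  proof (intro order_trans[OF norm_sum] sum_mono)
    fix i j
    have "norm (partials (bs @ [axis j 1, axis i 1]) f x) \<le> B"
      by (rule B) (use bs in \<open>auto simp: multi_indices_def\<close>)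
    then show "norm (M $ i $ j *\<^sub>R partials (bs @ [axis j 1, axis i 1]) f x) \<le> norm M * B"
      unfolding norm_scaleR by (intro mult_mono norm_matrix_component_le) auto
  qed
  then show ?thesis by (simp add: power2_eq_square)
qed

text \<open>The difference splits into the operator \<open>M - N\<close> applied to \<open>f\<close>
  and the operator \<open>N\<close> applied to \<open>f - g\<close>; the square of the dimension
  counts the pairs of indices.\<close>

lemma partials_second_order_diff_le:
  fixes f g :: "real ^ 'n => complex"
  assumes f: "smooth f" and g: "smooth g" and bs: "bs \<in> multi_indices k"
    and B: "\<And>cs. cs \<in> multi_indices (k + 2) ==> norm (partials cs f x) \<le> B"
    and e: "\<And>cs. cs \<in> multi_indices (k + 2) ==> norm (partials cs f x - partials cs g x) \<le> e"
  shows "norm (partials bs (\<lambda>x. second_order M f x - second_order N g x) x)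
    \<le> (real CARD('n))\<^sup>2 * (norm (M - N) * B + norm N * e)"
proof -
  note bl = multi_indices_lists[OF bs]
  have "partials bs (\<lambda>x. second_order M f x - second_order N g x) x
      = partials bs (second_order (M - N) f) x + partials bs (second_order N (\<lambda>x. f x - g x)) x"
  proof -
    have "second_order M f x - second_order N g x = second_order (M - N) f x + second_order N (\<lambda>x. f x - g x) x" for x
    proof -
      have "partials [axis j 1, axis i 1] (\<lambda>x. f x - g x) x = partials [axis j 1, axis i 1] f x - partials [axis j 1, axis i 1] g x" for i j
        by (rule partials_diff[OF f g]) auto
      then have pd: "partial (axis j 1) (partial (axis i 1) (\<lambda>x. f x - g x)) x
          = partial (axis j 1) (partial (axis i 1) f) x - partial (axis j 1) (partial (axis i 1) g) x" for i j
        by (simp add: partials_Cons partials_Nil)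
      show ?thesis
        unfolding second_order_def pd
        by (simp add: sum_subtractf[symmetric] sum.distrib[symmetric] scaleR_diff_left scaleR_diff_right)
    qed
    then have "(\<lambda>x. second_order M f x - second_order N g x) = (\<lambda>x. second_order (M - N) f x + second_order N (\<lambda>x. f x - g x) x)"
      by (rule ext)
    then show ?thesis
      using partials_add[OF smooth_second_order[OF f] smooth_second_order[OF smooth_diff[OF f g]] bl] by simp
  qed
  moreover have "norm (partials bs (second_order (M - N) f) x) \<le> (real CARD('n))\<^sup>2 * (norm (M - N) * B)"
    by (rule partials_second_order_le[OF f bs B])
  moreover have "norm (partials bs (second_order N (\<lambda>x. f x - g x)) x) \<le> (real CARD('n))\<^sup>2 * (norm N * e)"
    by (rule partials_second_order_le[OF smooth_diff[OF f g] bs]) (simp add: partials_diff f g multi_indices_lists e)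
  ultimately show ?thesis
    using norm_triangle_ineq[of "partials bs (second_order (M - N) f) x" "partials bs (second_order N (\<lambda>x. f x - g x)) x"]
    by (simp add: distrib_left)
qed

text \<open>Test functions see only the open interval, so the identity comes for interior times. The
  difference of \<open>f\<close> and the primitive of \<open>g\<close> is constant inside and, by
  continuity, up to both ends; off \<open>t0\<close> the primitive is differentiable.\<close>

lemma interior_integral_identity_imp_derivative:
  fixes f g :: "real => 'b::euclidean_space"
  assumes f: "continuous_on {0..T} f" and g: "g integrable_on {0..T}" and gc: "continuous_on ({0..T} - {t0}) g"
    and id: "\<And>s t. 0 < s ==> s \<le> t ==> t < T ==> f t - f s = integral {s..t} g"
    and t: "t \<in> {0..T}" "t \<noteq> t0" and T: "T > 0"
  shows "(f has_vector_derivative g t) (at t within {0..T})"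
proof -
  define h where "h t = f t - integral {0..t} g" for t
  have hc: "continuous_on {0..T} h"
    unfolding h_def by (intro continuous_intros f indefinite_integral_continuous_1 g)
  have hrs: "h r = h s" if "0 < s" "s \<le> r" "r < T" for r s
  proof -
    have "integral {0..s} g + integral {s..r} g = integral {0..r} g"
      by (rule Henstock_Kurzweil_Integration.integral_combine)
        (use that in \<open>auto intro: integrable_on_subinterval[OF g]\<close>)
    then show ?thesis using id[OF that] by (simp add: h_def algebra_simps)
  qed
  have hh: "h r = h (T / 2)" if "r \<in> {0<..<T}" for r
  proof (cases "r \<le> T / 2")
    case True
    then show ?thesis using hrs[of r "T / 2"] that T by simp
  next
    case False
    then show ?thesis using hrs[of "T / 2" r] that T by simp
  qed
  have cl: "closure {0<..<T} = {0..T}" using T by simp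
  have const: "h r = h (T / 2)" if "r \<in> {0..T}" for r
  proof (rule continuous_constant_on_closure[of "{0<..<T}" h "h (T / 2)" r])
    show "continuous_on (closure {0<..<T}) h" unfolding cl by (rule hc)
    show "r \<in> closure {0<..<T}" unfolding cl by (rule that)
  qed (rule hh)
  have "((\<lambda>u. h (T / 2) + integral {0..u} g) has_vector_derivative 0 + g t) (at t within {0..T})"
    by (intro has_vector_derivative_add has_vector_derivative_const indefinite_integral_derivative[OF g gc t])
  then have "((\<lambda>u. h (T / 2) + integral {0..u} g) has_vector_derivative g t) (at t within {0..T})" by simp
  then show ?thesis
  proof (rule has_vector_derivative_transform[OF t(1), rotated])
    fix r assume "r \<in> {0..T}"
    then show "f r = h (T / 2) + integral {0..r} g" using const[of r] by (metis diff_add_cancel h_def)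
  qed
qed

section \<open>Equivalence of the pointwise and the Sobolev formulation\<close>

context coefficients
begin

lemma b_measurable: "b \<in> borel_measurable (lebesgue_on {0<..<T})"
  and norm_b_integrable: "integrable (lebesgue_on {0<..<T}) (\<lambda>t. norm (b t))"
proof -
  have "b absolutely_integrable_on {0<..<T}"
    by (rule set_integrable_subset[OF b_int]) auto
  then show "b \<in> borel_measurable (lebesgue_on {0<..<T})" "integrable (lebesgue_on {0<..<T}) (\<lambda>t. norm (b t))"
    by (simp_all add: absolutely_integrable_measurable o_def)
qed

text \<open>The coefficients are merely integrable in time, so the approximants combine simple
  functions tending pointwise to \<open>b\<close> with samples of \<open>u\<close> on the time grid.
  The norm is integrable because it is at most a constant times \<open>norm (b t)\<close>.\<close>

lemma wave_operator_in_L1_Ck: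
  assumes cs: "classical_solution u v" and K: "compact K"
  shows "in_L1_Ck k K {0<..<T} (\<lambda>t. wave_operator t (u t))"
  unfolding in_L1_Ck_def
proof (intro conjI ballI)
  note sm = classical_smooth(1)[OF cs]
  note cont = classical_continuous(1)[OF cs _ order_refl]
  let ?n = "(real CARD('n))\<^sup>2"
  have n: "?n > 0" by simp
  show "Ck k (wave_operator t (u t))" if "t \<in> {0<..<T}" for t
    using that by (intro smooth_Ck smooth_second_order sm) auto
  have grid: "time_grid i t \<in> {0..T}" if "t \<in> {0<..<T}" for i t
    using time_grid_bounds[of t i] that by auto
  obtain B where B: "B \<ge> 0" "\<And>t bs x. t \<in> {0..T} ==> bs \<in> multi_indices (k + 2) ==> x \<in> K ==> norm (partials bs (u t) x) \<le> B"
    using partials_uniform_bound[OF cont K, of "k + 2" thesis] by blast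
  obtain \<beta> where \<beta>': "\<forall>i. simple_function (lebesgue_on {0<..<T}) (\<beta> i)"
      "\<forall>t\<in>space (lebesgue_on {0<..<T}). (\<lambda>i. \<beta> i t) \<longlonglongrightarrow> b t"
    using borel_measurable_implies_sequence_metric[OF b_measurable, of 0] by blast
  then have \<beta>: "\<And>i. simple_function (lebesgue_on {0<..<T}) (\<beta> i)"
      "\<And>t. t \<in> {0<..<T} ==> (\<lambda>i. \<beta> i t) \<longlonglongrightarrow> b t"
    by auto
  have lim: "(\<lambda>i. Ck_norm k K (\<lambda>x. second_order (\<beta> i t) (u (time_grid i t)) x - wave_operator t (u t) x)) \<longlonglongrightarrow> 0"
    if t: "t \<in> {0<..<T}" for t
  proof (rule tendsto_zero_ennreal)
    fix r :: real assume r: "0 < r"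
    \<comment> \<open>\<open>e\<close> and the later \<open>\<eta>\<close> let the error in
      \<open>u\<close> and the error in \<open>b\<close> each contribute at most
      \<open>r / 4\<close>.\<close>
    define e where "e = r / (4 * ?n * (norm (b t) + 1))"
    have b1: "norm (b t) + 1 > 0" by (simp add: add_nonneg_pos)
    have e: "e > 0" using r n b1 by (simp add: e_def)
    obtain \<delta> where \<delta>: "\<delta> > 0" "\<And>s t bs x. s \<in> {0..T} ==> t \<in> {0..T} ==> \<bar>s - t\<bar> < \<delta> ==> bs \<in> multi_indices (k + 2) ==> x \<in> K ==>
      norm (partials bs (u s) x - partials bs (u t) x) < e"
      using partials_uniform_modulus[OF cont K e, of "k + 2" thesis] by blast
    have t': "t \<in> {0..T}" "0 \<le> t" using t by auto
    define \<eta> where "\<eta> = r / (4 * ?n * (B + 1))"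
    have \<eta>: "\<eta> > 0" using r n B(1) by (simp add: \<eta>_def)
    have "\<forall>\<^sub>F i in sequentially. dist (\<beta> i t) (b t) < \<eta>" by (rule tendstoD[OF \<beta>(2)[OF t] \<eta>])
    with eventually_time_grid_close[OF \<delta>(1) t'(2)]
    show "\<forall>\<^sub>F i in sequentially. Ck_norm k K (\<lambda>x. second_order (\<beta> i t) (u (time_grid i t)) x - wave_operator t (u t) x) < ennreal r"
    proof eventually_elim
      case (elim i)
      have "Ck_norm k K (\<lambda>x. second_order (\<beta> i t) (u (time_grid i t)) x - wave_operator t (u t) x)
          \<le> ennreal (?n * (norm (\<beta> i t - b t) * B + norm (b t) * e))"
        by (intro Ck_norm_le partials_second_order_diff_le sm grid t t'(1) B(2) less_imp_le[OF \<delta>(2)] elim(1))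
      also have "\<dots> < ennreal r"
      proof -
        have "norm (\<beta> i t - b t) * B \<le> \<eta> * (B + 1)"
          using elim(2) B(1) \<eta> by (intro mult_mono) (auto simp: dist_norm)
        moreover have "norm (b t) * e \<le> (norm (b t) + 1) * e" using e by (intro mult_right_mono) auto
        ultimately have "?n * (norm (\<beta> i t - b t) * B + norm (b t) * e) \<le> ?n * (\<eta> * (B + 1) + (norm (b t) + 1) * e)"
          by (intro mult_left_mono add_mono) auto
        also have "\<dots> = r / 2"
        proof -
          have "?n * (\<eta> * (B + 1)) = r / 4" using n B(1) by (simp add: \<eta>_def nonzero_divide_eq_eq add_nonneg_eq_0_iff)
          moreover have "?n * ((norm (b t) + 1) * e) = r / 4" using n b1 by (simp add: e_def)
          ultimately show ?thesis by (simp add: distrib_left)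
        qed
        also have "\<dots> < r" using r by simp
        finally show ?thesis using r by (simp add: ennreal_lessI)
      qed
      finally show ?case .
    qed
  qed
  show "strongly_measurable_Ck k K {0<..<T} (\<lambda>t. wave_operator t (u t))"
    unfolding strongly_measurable_Ck_def
  proof (intro exI[of _ "\<lambda>i t. second_order (\<beta> i t) (u (time_grid i t))"] conjI allI ballI)
    show "simple_function (lebesgue_on {0<..<T}) (\<lambda>t. second_order (\<beta> i t) (u (time_grid i t)))" for i
      by (rule simple_function_compose2[OF \<beta>(1) simple_function_time_grid, of "\<lambda>M s. second_order M (u s)"])
    show "Ck k (second_order (\<beta> i t) (u (time_grid i t)))" if "t \<in> {0<..<T}" for i t
      by (intro smooth_Ck smooth_second_order sm grid that)
    show "AE t in lebesgue_on {0<..<T}.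
        (\<lambda>i. Ck_norm k K (\<lambda>x. second_order (\<beta> i t) (u (time_grid i t)) x - wave_operator t (u t) x)) \<longlonglongrightarrow> 0"
      by (rule AE_I2) (simp add: lim)
  qed
  have "(\<integral>\<^sup>+ t. Ck_norm k K (wave_operator t (u t)) \<partial>lebesgue_on {0<..<T})
      \<le> (\<integral>\<^sup>+ t. ennreal (?n * B * norm (b t)) \<partial>lebesgue_on {0<..<T})"
  proof (rule nn_integral_mono)
    fix t assume "t \<in> space (lebesgue_on {0<..<T})"
    then have t: "t \<in> {0..T}" by auto
    have "Ck_norm k K (wave_operator t (u t)) \<le> ennreal (?n * (norm (b t) * B))"
      by (intro Ck_norm_le partials_second_order_le sm t B(2))
    then show "Ck_norm k K (wave_operator t (u t)) \<le> ennreal (?n * B * norm (b t))" by (simp add: mult_ac)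
  qed
  also have "\<dots> < \<infinity>"
  proof -
    have "integrable (lebesgue_on {0<..<T}) (\<lambda>t. ?n * B * norm (b t))" by (intro integrable_mult_right norm_b_integrable)
    from nn_integral_eq_integral[OF this] show ?thesis using B(1) by simp
  qed
  finally show "(\<integral>\<^sup>+ t. Ck_norm k K (wave_operator t (u t)) \<partial>lebesgue_on {0<..<T}) < \<infinity>" .
qed

lemma wave_operator_absolutely_integrable:
  assumes sm: "\<And>t. t \<in> {0..T} ==> smooth (u t)"
    and cont: "\<And>bs. bs \<in> lists Basis ==> continuous_on ({0..T} \<times> UNIV) (\<lambda>p. partials bs (u (fst p)) (snd p))"
    and bs: "bs \<in> lists Basis"
  shows "(\<lambda>t. partials bs (wave_operator t (u t)) x) absolutely_integrable_on {0..T}"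
    and "continuous_on ({0..T} - {t0}) (\<lambda>t. partials bs (wave_operator t (u t)) x)"
proof -
  let ?g = "\<lambda>t. \<Sum>i\<in>UNIV. \<Sum>j\<in>UNIV. b t $ i $ j *\<^sub>R partials (bs @ [axis j 1, axis i 1]) (u t) x"
  have eq: "?g t = partials bs (wave_operator t (u t)) x" if "t \<in> {0..T}" for t
    using partials_second_order[OF sm[OF that] bs] by simp
  have c: "continuous_on {0..T} (\<lambda>t. partials (bs @ [axis j 1, axis i 1]) (u t) x)" for i j
  proof -
    have "continuous_on {0..T} (\<lambda>t. (\<lambda>p. partials (bs @ [axis j 1, axis i 1]) (u (fst p)) (snd p)) (t, x))"
      by (rule continuous_on_compose2[OF cont]) (use bs in \<open>auto intro!: continuous_intros\<close>)
    then show ?thesis by simp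
  qed
  have "(\<lambda>t. b t $ i $ j) absolutely_integrable_on {0..T}" for i j
    using absolutely_integrable_linear[OF b_int bounded_linear_compose[OF bounded_linear_vec_nth bounded_linear_vec_nth]]
    by (simp add: o_def)
  then have "?g absolutely_integrable_on {0..T}"
    by (intro absolutely_integrable_sum absolutely_integrable_scaleR_continuous c) auto
  then show "(\<lambda>t. partials bs (wave_operator t (u t)) x) absolutely_integrable_on {0..T}"
    by (rule set_integrable_cong[THEN iffD1, rotated 3]) (auto simp: eq)
  have "continuous_on ({0..T} - {t0}) ?g"
    by (intro continuous_intros b_cont continuous_on_subset[OF c]) auto
  then show "continuous_on ({0..T} - {t0}) (\<lambda>t. partials bs (wave_operator t (u t)) x)"
    by (rule continuous_on_eq) (auto simp: eq)
qed

lemma classical_imp_W21_smooth: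
  assumes cs: "classical_solution u v"
  shows "W21_smooth T u v (\<lambda>t. wave_operator t (u t))"
  unfolding W21_smooth_def W21_Ck_def
proof (intro conjI ballI allI impI)
  note sm = classical_smooth[OF cs]
  note cont = classical_continuous[OF cs _ order_refl]
  show "smooth (u t)" "smooth (v t)" "smooth (wave_operator t (u t))" if "t \<in> {0..T}" for t
    using sm[OF that] by (auto intro: smooth_second_order)
  have int: "at t within {0..T} = at t" if "t \<in> {0<..<T}" for t
    using that by (intro at_within_Icc_at) auto
  fix k and K :: "(real ^ 'n) set" assume K: "compact K"
  show "in_L1_Ck k K {0<..<T} u" "in_L1_Ck k K {0<..<T} v"
    by (rule in_L1_Ck_jointly_continuous[OF sm(1) cont(1) K] in_L1_Ck_jointly_continuous[OF sm(2) cont(2) K]; assumption)+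
  show "in_L1_Ck k K {0<..<T} (\<lambda>t. wave_operator t (u t))" by (rule wave_operator_in_L1_Ck[OF cs K])
  show "continuous_on_Ck k K {0..T} u" "continuous_on_Ck k K {0..T} v"
    by (rule continuous_on_Ck_jointly_continuous[OF sm(1) cont(1) K] continuous_on_Ck_jointly_continuous[OF sm(2) cont(2) K]; assumption)+
  show "has_weak_derivative_Ck k K {0<..<T} u v"
    unfolding has_weak_derivative_Ck_def
  proof (intro ballI)
    fix bs :: "(real ^ 'n) list" and x :: "real ^ 'n" assume "bs \<in> multi_indices k"
    then have bs: "bs \<in> lists Basis" by (rule multi_indices_lists)
    have "(\<lambda>t. partials bs (v t) x) absolutely_integrable_on {0..T}"
      by (intro absolutely_integrable_continuous_real classical_time_continuous[OF cs bs])
    then have "(\<lambda>t. partials bs (v t) x) absolutely_integrable_on {0<..<T}"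
      by (rule set_integrable_subset) auto
    moreover have "((\<lambda>t. partials bs (u t) x) has_vector_derivative partials bs (v t) x) (at t)" if "t \<in> {0<..<T}" for t
      using classical_derivative(1)[OF cs bs, of t x] int[OF that] that by simp
    ultimately show "has_weak_derivative_on (\<lambda>t. partials bs (u t) x) (\<lambda>t. partials bs (v t) x) {0<..<T}"
      by (intro derivative_imp_weak_derivative[where ?t0.0 = t0] continuous_on_subset[OF classical_time_continuous(1)[OF cs bs]]) auto
  qed
  show "has_weak_derivative_Ck k K {0<..<T} v (\<lambda>t. wave_operator t (u t))"
    unfolding has_weak_derivative_Ck_def
  proof (intro ballI)
    fix bs :: "(real ^ 'n) list" and x :: "real ^ 'n" assume "bs \<in> multi_indices k"
    then have bs: "bs \<in> lists Basis" by (rule multi_indices_lists)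
    have "(\<lambda>t. partials bs (wave_operator t (u t)) x) absolutely_integrable_on {0..T}"
      by (rule wave_operator_absolutely_integrable(1)[OF sm(1) cont(1) bs])
    then have "(\<lambda>t. partials bs (wave_operator t (u t)) x) absolutely_integrable_on {0<..<T}"
      by (rule set_integrable_subset) auto
    moreover have "((\<lambda>t. partials bs (v t) x) has_vector_derivative partials bs (wave_operator t (u t)) x) (at t)"
      if "t \<in> {0<..<T}" "t \<noteq> t0" for t
      using classical_derivative(2)[OF cs bs, of t x] int[OF that(1)] that by simp
    ultimately show "has_weak_derivative_on (\<lambda>t. partials bs (v t) x) (\<lambda>t. partials bs (wave_operator t (u t)) x) {0<..<T}"
      by (intro derivative_imp_weak_derivative[where ?t0.0 = t0] continuous_on_subset[OF classical_time_continuous(2)[OF cs bs]]) auto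
  qed
qed

lemma classical_imp_solution:
  assumes cs: "classical_solution u v" and Ab: "AE t in lebesgue. t \<in> {0..T} --> A t = b t"
    and data: "\<And>x. u 0 x = u0 x \<and> v 0 x = u1 x"
  shows "is_solution T A u0 u1 u"
  unfolding is_solution_def
proof (intro exI conjI allI)
  show "W21_smooth T u v (\<lambda>t. wave_operator t (u t))" by (rule classical_imp_W21_smooth[OF cs])
  have "AE t in lebesgue_on {0..T}. A t = b t" using Ab by (simp add: AE_restrict_space_iff)
  then show "AE t in lebesgue_on {0..T}. \<forall>x. wave_operator t (u t) x -
      (\<Sum>i\<in>UNIV. \<Sum>j\<in>UNIV. (A t $ i $ j) *\<^sub>R partial (axis j 1) (partial (axis i 1) (u t)) x) = 0"
    by eventually_elim (simp add: second_order_def)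
qed (use data in auto)

text \<open>The continuous representatives turn weak derivatives into integral identities. The
  equation replaces \<open>w\<close> by the operator inside the integral, and since that integrand
  is continuous off \<open>t0\<close>, the identity can be differentiated at every
  \<open>t \<noteq> t0\<close>.\<close>

lemma solution_imp_classical:
  assumes sol: "is_solution T A u0 u1 u" and Ab: "AE t in lebesgue. t \<in> {0..T} --> A t = b t"
  shows "\<exists>v. classical_solution u v \<and> (\<forall>x. u 0 x = u0 x \<and> v 0 x = u1 x)"
proof -
  obtain v w where W: "W21_smooth T u v w"
    and pde: "AE t in lebesgue_on {0..T}. \<forall>x. w t x -
      (\<Sum>i\<in>UNIV. \<Sum>j\<in>UNIV. (A t $ i $ j) *\<^sub>R partial (axis j 1) (partial (axis i 1) (u t)) x) = 0"
    and data: "\<And>x. u 0 x = u0 x" "\<And>x. v 0 x = u1 x"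
    using sol unfolding is_solution_def by blast
  have sm: "smooth (u t)" "smooth (v t)" if "t \<in> {0..T}" for t using W that unfolding W21_smooth_def by blast+
  have ck: "continuous_on_Ck k K {0..T} u" "continuous_on_Ck k K {0..T} v" if "compact K" for k K
    using W that unfolding W21_smooth_def W21_Ck_def by blast+
  have weak: "has_weak_derivative_on (\<lambda>t. partials bs (u t) x) (\<lambda>t. partials bs (v t) x) {0<..<T}"
    "has_weak_derivative_on (\<lambda>t. partials bs (v t) x) (\<lambda>t. partials bs (w t) x) {0<..<T}"
    if "bs \<in> lists Basis" for bs x
  proof -
    have "bs \<in> multi_indices (length bs)" using that by (simp add: multi_indices_def)
    moreover have "W21_Ck (length bs) {x} T u v w" using W unfolding W21_smooth_def by simp
    ultimately show "has_weak_derivative_on (\<lambda>t. partials bs (u t) x) (\<lambda>t. partials bs (v t) x) {0<..<T}"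
      "has_weak_derivative_on (\<lambda>t. partials bs (v t) x) (\<lambda>t. partials bs (w t) x) {0<..<T}"
      unfolding W21_Ck_def has_weak_derivative_Ck_def by blast+
  qed
  have cont: "continuous_on ({0..T} \<times> UNIV) (\<lambda>p. partials bs (u (fst p)) (snd p))"
    "continuous_on ({0..T} \<times> UNIV) (\<lambda>p. partials bs (v (fst p)) (snd p))" if "bs \<in> lists Basis" for bs
    by (rule jointly_continuous_of_Ck[OF sm(1) ck(1) that] jointly_continuous_of_Ck[OF sm(2) ck(2) that]; assumption)+
  have tc: "continuous_on {0..T} (\<lambda>t. partials bs (u t) x)" "continuous_on {0..T} (\<lambda>t. partials bs (v t) x)"
    if "bs \<in> lists Basis" for bs x
  proof -
    have "continuous_on {0..T} (\<lambda>t. (\<lambda>p. partials bs (u (fst p)) (snd p)) (t, x))"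
      by (rule continuous_on_compose2[OF cont(1)[OF that]]) (auto intro!: continuous_intros)
    then show "continuous_on {0..T} (\<lambda>t. partials bs (u t) x)" by simp
    have "continuous_on {0..T} (\<lambda>t. (\<lambda>p. partials bs (v (fst p)) (snd p)) (t, x))"
      by (rule continuous_on_compose2[OF cont(2)[OF that]]) (auto intro!: continuous_intros)
    then show "continuous_on {0..T} (\<lambda>t. partials bs (v t) x)" by simp
  qed
  have id: "f t - f s = integral {s..t} g"
    if "has_weak_derivative_on f g {0<..<T}" "continuous_on {0..T} f" "0 < s" "s \<le> t" "t < T" for f g :: "real => complex" and s t
    by (rule weak_derivative_continuous[OF that(1), of s "(t + T) / 2"])
      (use that in \<open>auto intro: continuous_on_subset[OF that(2)]\<close>)
  have T_sets: "{0..T} \<in> sets lebesgue" by simp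
  \<comment> \<open>The exceptional set of times does not depend on \<open>x\<close>: at all other
    times the two sides coincide as functions, hence with all their spatial derivatives.\<close>
  have "AE t in lebesgue. t \<in> {0..T} --> w t = wave_operator t (u t)"
    using AE_lebesgue_onD[OF pde T_sets] Ab by eventually_elim (auto simp: second_order_def fun_eq_iff)
  then obtain N where N: "negligible N" "\<And>t. t \<notin> N ==> t \<in> {0..T} --> w t = wave_operator t (u t)"
    by (rule AE_lebesgue_negligible) blast
  have "classical_solution u v"
    unfolding classical_solution_def
  proof (intro conjI ballI allI impI)
    show "smooth (u t)" "smooth (v t)" if "t \<in> {0..T}" for t by (rule sm[OF that])+
    fix bs :: "(real ^ 'n) list" assume bs: "bs \<in> lists Basis"
    show "continuous_on ({0..T} \<times> UNIV) (\<lambda>p. partials bs (u (fst p)) (snd p))"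
      "continuous_on ({0..T} \<times> UNIV) (\<lambda>p. partials bs (v (fst p)) (snd p))" by (rule cont[OF bs])+
    fix x t assume t: "t \<in> {0..T}"
    show "((\<lambda>t. partials bs (u t) x) has_vector_derivative partials bs (v t) x) (at t within {0..T})"
    \<comment> \<open>The integrand \<open>v\<close> is continuous on all of \<open>{0..T}\<close>;
      the exceptional point is placed outside at \<open>-1\<close>, so that \<open>t0\<close> is
      included.\<close>
    proof (rule interior_integral_identity_imp_derivative[OF tc(1)[OF bs] _ _ _ t, where ?t0.0 = "-1"])
      show "(\<lambda>t. partials bs (v t) x) integrable_on {0..T}" by (intro integrable_continuous_real tc bs)
      show "continuous_on ({0..T} - {-1}) (\<lambda>t. partials bs (v t) x)"
        by (rule continuous_on_subset[OF tc(2)[OF bs]]) auto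
      show "partials bs (u r) x - partials bs (u s) x = integral {s..r} (\<lambda>t. partials bs (v t) x)"
        if "0 < s" "s \<le> r" "r < T" for s r
        by (rule id[OF weak(1)[OF bs] tc(1)[OF bs] that])
    qed (use t T in auto)
    assume tn: "t \<noteq> t0"
    show "((\<lambda>t. partials bs (v t) x) has_vector_derivative partials bs (wave_operator t (u t)) x) (at t within {0..T})"
    proof (rule interior_integral_identity_imp_derivative[OF tc(2)[OF bs] _ _ _ t tn T])
      show "(\<lambda>t. partials bs (wave_operator t (u t)) x) integrable_on {0..T}"
        by (rule set_lebesgue_integral_eq_integral(1)[OF wave_operator_absolutely_integrable(1)[OF sm(1) cont(1) bs]])
      show "continuous_on ({0..T} - {t0}) (\<lambda>t. partials bs (wave_operator t (u t)) x)"
        by (rule wave_operator_absolutely_integrable(2)[OF sm(1) cont(1) bs])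
      show "partials bs (v r) x - partials bs (v s) x = integral {s..r} (\<lambda>t. partials bs (wave_operator t (u t)) x)"
        if "0 < s" "s \<le> r" "r < T" for s r
      proof -
        have "partials bs (v r) x - partials bs (v s) x = integral {s..r} (\<lambda>t. partials bs (w t) x)"
          by (rule id[OF weak(2)[OF bs] tc(2)[OF bs] that])
        also have "\<dots> = integral {s..r} (\<lambda>t. partials bs (wave_operator t (u t)) x)"
          by (rule integral_spike[OF N(1)]) (use N(2) that in auto)
        finally show ?thesis .
      qed
    qed
  qed
  then show ?thesis using data by blast
qed

lemma well_posed:
  assumes Ab: "AE t in lebesgue. t \<in> {0..T} --> A t = b t"
  shows "Cinfinity_well_posed T A"
  unfolding Cinfinity_well_posed_def
proof (intro allI impI conjI ballI)
  fix u0 u1 :: "real ^ 'n => complex" assume "smooth u0 \<and> smooth u1"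
  then obtain u v where "classical_solution u v" "\<And>x. u 0 x = u0 x \<and> v 0 x = u1 x"
    using classical_solution_exists[of u0 u1] by blast
  then show "\<exists>u. is_solution T A u0 u1 u" using classical_imp_solution[OF _ Ab] by blast
next
  fix u0 u1 u u' t x
  assume "is_solution T A u0 u1 u \<and> is_solution T A u0 u1 u'" and t: "t \<in> {0..T}"
  then obtain v v' where "classical_solution u v" "\<forall>x. u 0 x = u0 x \<and> v 0 x = u1 x"
    "classical_solution u' v'" "\<forall>x. u' 0 x = u0 x \<and> v' 0 x = u1 x"
    using solution_imp_classical[OF _ Ab] by meson
  then show "u t x = u' t x" using classical_solution_unique[of u v u' v' t x] t by simp
qed

end

theorem theorem4:
  fixes T t0 p lam0 :: real and q :: ereal
    and A :: "real \<Rightarrow> real ^ 'n ^ 'n"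
  assumes "T > 0" and "t0 \<in> {0..T}"
    and symmetric: "\<And>t i j. t \<in> {0..T} \<Longrightarrow> A t $ i $ j = A t $ j $ i"
    and L1: "\<And>\<xi>. \<xi> \<noteq> 0 \<Longrightarrow> (\<lambda>t. symbol A t \<xi>) absolutely_integrable_on {0<..<T}"
    and "lam0 > 0"
    and hyperbolic: "\<And>t \<xi>. t \<in> {0..T} \<Longrightarrow> \<xi> \<noteq> 0 \<Longrightarrow> symbol A t \<xi> \<ge> lam0"
    and "1 \<le> q" and "p \<ge> 0"
    and W11: "\<And>\<xi> \<epsilon>. \<xi> \<noteq> 0 \<Longrightarrow> \<epsilon> > 0 \<Longrightarrow>
      in_W11 ({0<..<t0 - \<epsilon>} \<union> {t0 + \<epsilon><..<T}) (\<lambda>t. symbol A t \<xi>)"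
    and Lq: "\<And>\<xi>. \<xi> \<noteq> 0 \<Longrightarrow>
      \<exists>a'. has_weak_derivative_on (\<lambda>t. symbol A t \<xi>) a' ({0<..<T} - {t0}) \<and>
           in_Lq q {0<..<T} (\<lambda>t. \<bar>t0 - t\<bar> powr p * a' t)"
    and "ereal p + 1 / q \<le> 1"
  shows "Cinfinity_well_posed T A"
proof (rule coefficients_exist[OF assms(1-8) Lq assms(11)])
  fix C Gam b
  assume "coefficients T t0 lam0 C Gam b" "AE t in lebesgue. t \<in> {0..T} \<longrightarrow> A t = b t"
  then show "Cinfinity_well_posed T A" by (rule coefficients.well_posed)
qed

end
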